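(* The assignment $T\mapsto\mathsf{Com}^T$, sending an operad $T$ to the symmetric strict monoidal category $\mathsf{Com}^T$, is the effect on objects of a left 2-adjoint to the 2-functor $\mathcal U_{\mathrm s}$ from the 2-category of symmetric strict monoidal categories, symmetric strict monoidal functors and monoidal natural transformations to the 2-category $\mathbf{Opd}$ of operads; and it is also the effect on objects of a left biadjoint to the 2-functor $\mathcal U_{\mathrm{ps}}$ from the 2-category of symmetric monoidal categories, symmetric strong monoidal functors and monoidal natural transformations to $\mathbf{Opd}$.
   Context: **Operads.** "Operad" means coloured symmetric operad in $\mathbf{Set}$ (symmetric multicategory), with $\alpha\rho:(i_{\rho k})_k\to i$ for $\alpha:(i_k)_{1\le k\le n}\to i$ and $\rho\in\Sigma_n$. $\mathbf{Opd}$ is the 2-category of operads, operad morphisms, and natural transformations: a 2-cell $\phi:F\to G$ between $F,G:S\to T$ is a family of unary operations $\phi_i:Fi\to Gi$ of $T$ with $\phi_i(F\alpha)=G\alpha(\phi_{i_k})_k$ for all $\alpha:(i_k)_k\to i$ in $S$. **$\mathcal U$.** For a symmetric monoidal category $\mathcal V$, $\mathcal U\mathcal V$ is the operad whose colours are the objects of $\mathcal V$ and whose operations $(A_1,\dots,A_n)\to B$ are morphisms $A_1\otimes\dots\otimes A_n\to B$ in $\mathcal V$. The object assignment $\mathcal V\mapsto\mathcal U\mathcal V$ extends to 2-functors $\mathcal U_{\mathrm s}$ (on symmetric strict monoidal categories and symmetric strict monoidal functors) and $\mathcal U_{\mathrm{ps}}$ (on symmetric monoidal categories and symmetric strong monoidal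 functors). **$\mathsf{Com}^T$.** For an operad $T$ with set of colours $I$, $\mathsf{Com}^T$ is the internal $T$-algebra classifier relative to the unique operad morphism $T\to\mathsf{Com}$ into the terminal operad, i.e. the free symmetric strict monoidal category containing a $T$-algebra. Explicitly: objects are finite sequences $(i_1,\dots,i_n)$ of elements of $I$; a morphism $(i_1,\dots,i_m)\to(j_1,\dots,j_n)$ is $(f,(\alpha_k)_{1\le k\le n})$ with $f:\{1,\dots,m\}\to\{1,\dots,n\}$ a function and $\alpha_k:(i_l)_{fl=k}\to j_k$ operations of $T$. The composite of $(f,(\alpha_k)_k)$ followed by $(g,(\beta_r)_r)$ has function $gf$ and $r$-th operation $\beta_r(\alpha_k)_{gk=r}$ with its inputs put in increasing order by the symmetric group action. The tensor product is concatenation of sequences on objects, and ordinal sum of functions with concatenation of operations on morphisms; symmetries are block permutations labelled by identity operations. *)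

theory Defs
  imports "HOL-Library.FuncSet" "HOL-Combinatorics.Permutations"
begin

section \<open>Categories\<close>

record ('a, 'm) category =
  Ob :: "'a set"
  Ar :: "'m set"
  Dom :: "'m \<Rightarrow> 'a"
  Cod :: "'m \<Rightarrow> 'a"
  Id :: "'a \<Rightarrow> 'm"
  Comp :: "'m \<Rightarrow> 'm \<Rightarrow> 'm"  (infixl \<open>\<cdot>\<index>\<close> 60)

definition Hom :: "('a, 'm, 'z) category_scheme \<Rightarrow> 'a \<Rightarrow> 'a \<Rightarrow> 'm set" where
  "Hom C A B = {f \<in> Ar C. Dom C f = A \<and> Cod C f = B}"

locale category =
  fixes C (structure)
  assumes Dom_in: "f \<in> Ar C \<Longrightarrow> Dom C f \<in> Ob C"
    and Cod_in: "f \<in> Ar C \<Longrightarrow> Cod C f \<in> Ob C"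
    and Id_in: "A \<in> Ob C \<Longrightarrow> Id C A \<in> Hom C A A"
    and Comp_in: "\<lbrakk>f \<in> Hom C A B; g \<in> Hom C B D\<rbrakk> \<Longrightarrow> g \<cdot> f \<in> Hom C A D"
    and Comp_Id: "f \<in> Hom C A B \<Longrightarrow> f \<cdot> Id C A = f"
    and Id_Comp: "f \<in> Hom C A B \<Longrightarrow> Id C B \<cdot> f = f"
    and Comp_assoc: "\<lbrakk>f \<in> Hom C A B; g \<in> Hom C B D; h \<in> Hom C D E\<rbrakk>
      \<Longrightarrow> (h \<cdot> g) \<cdot> f = h \<cdot> (g \<cdot> f)"

definition inverse_arrows :: "('a, 'm, 'z) category_scheme \<Rightarrow> 'm \<Rightarrow> 'm \<Rightarrow> bool" where
  "inverse_arrows C f g \<longleftrightarrow> f \<in> Ar C \<and> g \<in> Hom C (Cod C f) (Dom C f) \<and>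
     g \<cdot>\<^bsub>C\<^esub> f = Id C (Dom C f) \<and> f \<cdot>\<^bsub>C\<^esub> g = Id C (Cod C f)"

definition Iso :: "('a, 'm, 'z) category_scheme \<Rightarrow> 'a \<Rightarrow> 'a \<Rightarrow> 'm set" where
  "Iso C A B = {f \<in> Hom C A B. \<exists>g. inverse_arrows C f g}"

definition Inv :: "('a, 'm, 'z) category_scheme \<Rightarrow> 'm \<Rightarrow> 'm" where
  "Inv C f = (THE g. inverse_arrows C f g)"

locale cat_functor = C: category C + D: category D for C (structure) and D (structure) +
  fixes F0 :: "'a \<Rightarrow> 'b" and F1 :: "'m \<Rightarrow> 'n"
  assumes F0_in: "A \<in> Ob C \<Longrightarrow> F0 A \<in> Ob D"
    and F1_in: "f \<in> Hom C A B \<Longrightarrow> F1 f \<in> Hom D (F0 A) (F0 B)"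
    and F1_Id: "A \<in> Ob C \<Longrightarrow> F1 (Id C A) = Id D (F0 A)"
    and F1_Comp: "\<lbrakk>f \<in> Hom C A B; g \<in> Hom C B E\<rbrakk>
      \<Longrightarrow> F1 (g \<cdot>\<^bsub>C\<^esub> f) = F1 g \<cdot>\<^bsub>D\<^esub> F1 f"

definition naturally_isomorphic where
  "naturally_isomorphic C D F0 F1 G0 G1 \<longleftrightarrow>
     (\<exists>t. (\<forall>A \<in> Ob C. t A \<in> Iso D (F0 A) (G0 A)) \<and>
          (\<forall>A B. \<forall>f \<in> Hom C A B. t B \<cdot>\<^bsub>D\<^esub> F1 f = G1 f \<cdot>\<^bsub>D\<^esub> t A))"

definition isomorphism_of_categories where
  "isomorphism_of_categories C D F0 F1 \<longleftrightarrow> cat_functor C D F0 F1 \<and>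
     (\<exists>G0 G1. cat_functor D C G0 G1 \<and>
        (\<forall>A \<in> Ob C. G0 (F0 A) = A) \<and> (\<forall>f \<in> Ar C. G1 (F1 f) = f) \<and>
        (\<forall>A \<in> Ob D. F0 (G0 A) = A) \<and> (\<forall>f \<in> Ar D. F1 (G1 f) = f))"

definition equivalence_of_categories where
  "equivalence_of_categories C D F0 F1 \<longleftrightarrow> cat_functor C D F0 F1 \<and>
     (\<exists>G0 G1. cat_functor D C G0 G1 \<and>
        naturally_isomorphic C C (G0 \<circ> F0) (G1 \<circ> F1) id id \<and>
        naturally_isomorphic D D (F0 \<circ> G0) (F1 \<circ> G1) id id)"


section \<open>2-categories, 2-adjunctions and biadjunctions\<close>

record ('o, 'c, 't) twocat =
  Obj :: "'o set"
  Cell1 :: "'c set"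
  dom1 :: "'c \<Rightarrow> 'o"
  cod1 :: "'c \<Rightarrow> 'o"
  id1 :: "'o \<Rightarrow> 'c"
  comp1 :: "'c \<Rightarrow> 'c \<Rightarrow> 'c"  (infixl \<open>\<odot>\<index>\<close> 70)
  Cell2 :: "'t set"
  dom2 :: "'t \<Rightarrow> 'c"
  cod2 :: "'t \<Rightarrow> 'c"
  id2 :: "'c \<Rightarrow> 't"
  vcomp :: "'t \<Rightarrow> 't \<Rightarrow> 't"  (infixl \<open>\<bullet>\<index>\<close> 60)
  hcomp :: "'t \<Rightarrow> 't \<Rightarrow> 't"  (infixl \<open>\<star>\<index>\<close> 70)

definition hom_cat :: "('o, 'c, 't) twocat \<Rightarrow> 'o \<Rightarrow> 'o \<Rightarrow> ('c, 't) category" where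
  "hom_cat A X Y =
    (let H = {f \<in> Cell1 A. dom1 A f = X \<and> cod1 A f = Y} in
     \<lparr>Ob = H, Ar = {a \<in> Cell2 A. dom2 A a \<in> H}, Dom = dom2 A, Cod = cod2 A,
      Id = id2 A, Comp = vcomp A\<rparr>)"

locale two_category =
  fixes A :: "('o, 'c, 't) twocat" (structure)
  assumes dom1_in: "f \<in> Cell1 A \<Longrightarrow> dom1 A f \<in> Obj A"
    and cod1_in: "f \<in> Cell1 A \<Longrightarrow> cod1 A f \<in> Obj A"
    and id1_in: "X \<in> Obj A \<Longrightarrow> id1 A X \<in> Ob (hom_cat A X X)"
    and comp1_in: "\<lbrakk>f \<in> Ob (hom_cat A X Y); g \<in> Ob (hom_cat A Y Z)\<rbrakk>
      \<Longrightarrow> g \<odot> f \<in> Ob (hom_cat A X Z)"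
    and comp1_id1: "f \<in> Ob (hom_cat A X Y) \<Longrightarrow> f \<odot> id1 A X = f"
    and id1_comp1: "f \<in> Ob (hom_cat A X Y) \<Longrightarrow> id1 A Y \<odot> f = f"
    and comp1_assoc: "\<lbrakk>f \<in> Ob (hom_cat A X Y); g \<in> Ob (hom_cat A Y Z); h \<in> Ob (hom_cat A Z W)\<rbrakk>
      \<Longrightarrow> (h \<odot> g) \<odot> f = h \<odot> (g \<odot> f)"
    and dom2_in: "a \<in> Cell2 A \<Longrightarrow> dom2 A a \<in> Cell1 A"
    and hom_category: "\<lbrakk>X \<in> Obj A; Y \<in> Obj A\<rbrakk> \<Longrightarrow> category (hom_cat A X Y)"
    and hcomp_in: "\<lbrakk>a \<in> Hom (hom_cat A X Y) f f'; b \<in> Hom (hom_cat A Y Z) g g'\<rbrakk>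
      \<Longrightarrow> b \<star> a \<in> Hom (hom_cat A X Z) (g \<odot> f) (g' \<odot> f')"
    and hcomp_id: "a \<in> Ar (hom_cat A X Y) \<Longrightarrow> a \<star> id2 A (id1 A X) = a"
    and id_hcomp: "a \<in> Ar (hom_cat A X Y) \<Longrightarrow> id2 A (id1 A Y) \<star> a = a"
    and hcomp_assoc: "\<lbrakk>a \<in> Ar (hom_cat A X Y); b \<in> Ar (hom_cat A Y Z); c \<in> Ar (hom_cat A Z W)\<rbrakk>
      \<Longrightarrow> (c \<star> b) \<star> a = c \<star> (b \<star> a)"
    and hcomp_id2: "\<lbrakk>f \<in> Ob (hom_cat A X Y); g \<in> Ob (hom_cat A Y Z)\<rbrakk>
      \<Longrightarrow> id2 A g \<star> id2 A f = id2 A (g \<odot> f)"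
    and interchange: "\<lbrakk>a \<in> Hom (hom_cat A X Y) f f'; a' \<in> Hom (hom_cat A X Y) f' f'';
        b \<in> Hom (hom_cat A Y Z) g g'; b' \<in> Hom (hom_cat A Y Z) g' g''\<rbrakk>
      \<Longrightarrow> (b' \<bullet> b) \<star> (a' \<bullet> a) = (b' \<star> a') \<bullet> (b \<star> a)"

record ('o, 'c, 't, 'o2, 'c2, 't2) two_functor =
  F_ob :: "'o \<Rightarrow> 'o2"
  F_1 :: "'c \<Rightarrow> 'c2"
  F_2 :: "'t \<Rightarrow> 't2"

locale two_functor = A: two_category A + B: two_category B
  for A :: "('o, 'c, 't) twocat" (structure) and B :: "('o2, 'c2, 't2) twocat" (structure) +
  fixes F :: "('o, 'c, 't, 'o2, 'c2, 't2) two_functor"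
  assumes F_ob_in: "X \<in> Obj A \<Longrightarrow> F_ob F X \<in> Obj B"
    and F_hom: "\<lbrakk>X \<in> Obj A; Y \<in> Obj A\<rbrakk>
      \<Longrightarrow> cat_functor (hom_cat A X Y) (hom_cat B (F_ob F X) (F_ob F Y)) (F_1 F) (F_2 F)"
    and F_id1: "X \<in> Obj A \<Longrightarrow> F_1 F (id1 A X) = id1 B (F_ob F X)"
    and F_comp1: "\<lbrakk>f \<in> Ob (hom_cat A X Y); g \<in> Ob (hom_cat A Y Z)\<rbrakk>
      \<Longrightarrow> F_1 F (g \<odot>\<^bsub>A\<^esub> f) = F_1 F g \<odot>\<^bsub>B\<^esub> F_1 F f"
    and F_hcomp: "\<lbrakk>a \<in> Ar (hom_cat A X Y); b \<in> Ar (hom_cat A Y Z)\<rbrakk>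
      \<Longrightarrow> F_2 F (b \<star>\<^bsub>A\<^esub> a) = F_2 F b \<star>\<^bsub>B\<^esub> F_2 F a"

text \<open>
  The constraints of a pseudofunctor are invertible 2-cells
  \<open>P_comp g f : P g \<circ> P f \<Rightarrow> P (g \<circ> f)\<close> and \<open>P_unit X : 1 \<Rightarrow> P 1\<close>.
\<close>

record ('o, 'c, 't, 'o2, 'c2, 't2) pseudofunctor = "('o, 'c, 't, 'o2, 'c2, 't2) two_functor" +
  P_comp :: "'c \<Rightarrow> 'c \<Rightarrow> 't2"
  P_unit :: "'o \<Rightarrow> 't2"

locale pseudofunctor = A: two_category A + B: two_category B
  for A :: "('o, 'c, 't) twocat" (structure) and B :: "('o2, 'c2, 't2) twocat" (structure) +
  fixes F :: "('o, 'c, 't, 'o2, 'c2, 't2) pseudofunctor"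
  assumes P_ob_in: "X \<in> Obj A \<Longrightarrow> F_ob F X \<in> Obj B"
    and P_hom: "\<lbrakk>X \<in> Obj A; Y \<in> Obj A\<rbrakk>
      \<Longrightarrow> cat_functor (hom_cat A X Y) (hom_cat B (F_ob F X) (F_ob F Y)) (F_1 F) (F_2 F)"
    and P_unit_iso: "X \<in> Obj A
      \<Longrightarrow> P_unit F X \<in> Iso (hom_cat B (F_ob F X) (F_ob F X)) (id1 B (F_ob F X)) (F_1 F (id1 A X))"
    and P_comp_iso: "\<lbrakk>f \<in> Ob (hom_cat A X Y); g \<in> Ob (hom_cat A Y Z)\<rbrakk>
      \<Longrightarrow> P_comp F g f \<in> Iso (hom_cat B (F_ob F X) (F_ob F Z))
            (F_1 F g \<odot>\<^bsub>B\<^esub> F_1 F f) (F_1 F (g \<odot>\<^bsub>A\<^esub> f))"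
    and P_comp_natural: "\<lbrakk>a \<in> Hom (hom_cat A X Y) f f'; b \<in> Hom (hom_cat A Y Z) g g'\<rbrakk>
      \<Longrightarrow> P_comp F g' f' \<bullet>\<^bsub>B\<^esub> (F_2 F b \<star>\<^bsub>B\<^esub> F_2 F a)
        = F_2 F (b \<star>\<^bsub>A\<^esub> a) \<bullet>\<^bsub>B\<^esub> P_comp F g f"
    and P_assoc: "\<lbrakk>f \<in> Ob (hom_cat A X Y); g \<in> Ob (hom_cat A Y Z); h \<in> Ob (hom_cat A Z W)\<rbrakk>
      \<Longrightarrow> P_comp F h (g \<odot>\<^bsub>A\<^esub> f) \<bullet>\<^bsub>B\<^esub> (id2 B (F_1 F h) \<star>\<^bsub>B\<^esub> P_comp F g f)
        = P_comp F (h \<odot>\<^bsub>A\<^esub> g) f \<bullet>\<^bsub>B\<^esub> (P_comp F h g \<star>\<^bsub>B\<^esub> id2 B (F_1 F f))"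
    and P_unit_right: "f \<in> Ob (hom_cat A X Y)
      \<Longrightarrow> P_comp F f (id1 A X) \<bullet>\<^bsub>B\<^esub> (id2 B (F_1 F f) \<star>\<^bsub>B\<^esub> P_unit F X) = id2 B (F_1 F f)"
    and P_unit_left: "f \<in> Ob (hom_cat A X Y)
      \<Longrightarrow> P_comp F (id1 A Y) f \<bullet>\<^bsub>B\<^esub> (P_unit F Y \<star>\<^bsub>B\<^esub> id2 B (F_1 F f)) = id2 B (F_1 F f)"

text \<open>
  A 2-adjunction \<open>F \<stileturn> U\<close>: isomorphisms of categories \<open>B(F X, Y) \<cong> A(X, U Y)\<close>,
  2-natural in both variables.
\<close>

locale two_adjunction = F: two_functor A B F + U: two_functor B A U
  for A :: "('o, 'c, 't) twocat" (structure) and B :: "('o2, 'c2, 't2) twocat" (structure)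
    and F and U +
  fixes \<Phi>1 :: "'o \<Rightarrow> 'o2 \<Rightarrow> 'c2 \<Rightarrow> 'c" and \<Phi>2 :: "'o \<Rightarrow> 'o2 \<Rightarrow> 't2 \<Rightarrow> 't"
  assumes hom_iso: "\<lbrakk>X \<in> Obj A; Y \<in> Obj B\<rbrakk>
      \<Longrightarrow> isomorphism_of_categories (hom_cat B (F_ob F X) Y) (hom_cat A X (F_ob U Y)) (\<Phi>1 X Y) (\<Phi>2 X Y)"
    and natural_1: "\<lbrakk>X \<in> Obj A; Y \<in> Obj B; k \<in> Ob (hom_cat A X' X);
        h \<in> Ob (hom_cat B (F_ob F X) Y); g \<in> Ob (hom_cat B Y Y')\<rbrakk>
      \<Longrightarrow> \<Phi>1 X' Y' (g \<odot>\<^bsub>B\<^esub> h \<odot>\<^bsub>B\<^esub> F_1 F k) = F_1 U g \<odot>\<^bsub>A\<^esub> \<Phi>1 X Y h \<odot>\<^bsub>A\<^esub> k"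
    and natural_2: "\<lbrakk>X \<in> Obj A; Y \<in> Obj B; \<kappa> \<in> Ar (hom_cat A X' X);
        \<chi> \<in> Ar (hom_cat B (F_ob F X) Y); \<gamma> \<in> Ar (hom_cat B Y Y')\<rbrakk>
      \<Longrightarrow> \<Phi>2 X' Y' (\<gamma> \<star>\<^bsub>B\<^esub> \<chi> \<star>\<^bsub>B\<^esub> F_2 F \<kappa>) = F_2 U \<gamma> \<star>\<^bsub>A\<^esub> \<Phi>2 X Y \<chi> \<star>\<^bsub>A\<^esub> \<kappa>"

text \<open>
  A biadjunction between a pseudofunctor \<open>F\<close> and a 2-functor \<open>U\<close>, presented by its unit: a
  pseudonatural transformation with 1-cells \<open>\<eta> X : X \<rightarrow> U (F X)\<close> and invertible 2-cells
  \<open>\<eta>\<eta> f : U (F f) \<circ> \<eta> X \<Rightarrow> \<eta> X' \<circ> f\<close>, such that \<open>h \<mapsto> U h \<circ> \<eta> X\<close> is an equivalence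
  \<open>B(F X, Y) \<simeq> A(X, U Y)\<close> (automatically pseudonatural in \<open>X\<close> and \<open>Y\<close>).
\<close>

locale biadjunction = F: pseudofunctor A B F + U: two_functor B A U
  for A :: "('o, 'c, 't) twocat" (structure) and B :: "('o2, 'c2, 't2) twocat" (structure)
    and F and U +
  fixes \<eta> :: "'o \<Rightarrow> 'c" and \<eta>\<eta> :: "'c \<Rightarrow> 't"
  assumes unit_in: "X \<in> Obj A \<Longrightarrow> \<eta> X \<in> Ob (hom_cat A X (F_ob U (F_ob F X)))"
    and unit_cell_iso: "f \<in> Ob (hom_cat A X X')
      \<Longrightarrow> \<eta>\<eta> f \<in> Iso (hom_cat A X (F_ob U (F_ob F X')))
            (F_1 U (F_1 F f) \<odot>\<^bsub>A\<^esub> \<eta> X) (\<eta> X' \<odot>\<^bsub>A\<^esub> f)"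
    and unit_cell_natural: "a \<in> Hom (hom_cat A X X') f f'
      \<Longrightarrow> \<eta>\<eta> f' \<bullet>\<^bsub>A\<^esub> (F_2 U (F_2 F a) \<star>\<^bsub>A\<^esub> id2 A (\<eta> X))
        = (id2 A (\<eta> X') \<star>\<^bsub>A\<^esub> a) \<bullet>\<^bsub>A\<^esub> \<eta>\<eta> f"
    and unit_cell_comp: "\<lbrakk>f \<in> Ob (hom_cat A X X'); g \<in> Ob (hom_cat A X' X'')\<rbrakk>
      \<Longrightarrow> \<eta>\<eta> (g \<odot>\<^bsub>A\<^esub> f) \<bullet>\<^bsub>A\<^esub> (F_2 U (P_comp F g f) \<star>\<^bsub>A\<^esub> id2 A (\<eta> X))
        = (\<eta>\<eta> g \<star>\<^bsub>A\<^esub> id2 A f) \<bullet>\<^bsub>A\<^esub> (id2 A (F_1 U (F_1 F g)) \<star>\<^bsub>A\<^esub> \<eta>\<eta> f)"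
    and unit_cell_id: "X \<in> Obj A
      \<Longrightarrow> \<eta>\<eta> (id1 A X) \<bullet>\<^bsub>A\<^esub> (F_2 U (P_unit F X) \<star>\<^bsub>A\<^esub> id2 A (\<eta> X)) = id2 A (\<eta> X)"
    and hom_equivalence: "\<lbrakk>X \<in> Obj A; Y \<in> Obj B\<rbrakk>
      \<Longrightarrow> equivalence_of_categories (hom_cat B (F_ob F X) Y) (hom_cat A X (F_ob U Y))
            (\<lambda>h. F_1 U h \<odot>\<^bsub>A\<^esub> \<eta> X) (\<lambda>\<chi>. F_2 U \<chi> \<star>\<^bsub>A\<^esub> id2 A (\<eta> X))"

definition object_part_of_left_2_adjoint ::
  "('o, 'c, 't) twocat \<Rightarrow> ('o2, 'c2, 't2) twocat \<Rightarrow> ('o2, 'c2, 't2, 'o, 'c, 't) two_functor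
    \<Rightarrow> ('o \<Rightarrow> 'o2) \<Rightarrow> bool" where
  "object_part_of_left_2_adjoint A B U L \<longleftrightarrow>
     (\<exists>F \<Phi>1 \<Phi>2. two_adjunction A B F U \<Phi>1 \<Phi>2 \<and> (\<forall>X \<in> Obj A. F_ob F X = L X))"

definition object_part_of_left_biadjoint ::
  "('o, 'c, 't) twocat \<Rightarrow> ('o2, 'c2, 't2) twocat \<Rightarrow> ('o2, 'c2, 't2, 'o, 'c, 't) two_functor
    \<Rightarrow> ('o \<Rightarrow> 'o2) \<Rightarrow> bool" where
  "object_part_of_left_biadjoint A B U L \<longleftrightarrow>
     (\<exists>F \<eta> \<eta>\<eta>. biadjunction A B F U \<eta> \<eta>\<eta> \<and> (\<forall>X \<in> Obj A. F_ob F X = L X))"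


section \<open>Operads\<close>

text \<open>
  Positions in a list are counted from 0, and an element of the symmetric group on \<open>n\<close> letters is
  a function \<open>\<rho>\<close> with \<open>\<rho> permutes {..<n}\<close>; a permutation may be given by the list of its values.
  If \<open>\<alpha>\<close> has source \<open>is\<close>, then \<open>act \<alpha> \<rho>\<close> has source \<open>permute_list \<rho> is\<close>, whose \<open>k\<close>-th entry is
  \<open>is ! \<rho> k\<close>.
\<close>

definition list_perm :: "nat list \<Rightarrow> nat \<Rightarrow> nat" where
  "list_perm ps = (\<lambda>k. if k < length ps then ps ! k else k)"

definition offset :: "nat list \<Rightarrow> nat \<Rightarrow> nat" where
  "offset ns k = sum_list (take k ns)"

definition sum_perm :: "(nat \<Rightarrow> nat) list \<Rightarrow> nat list \<Rightarrow> nat \<Rightarrow> nat" where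
  "sum_perm \<rho>s ns = list_perm
     (concat (map (\<lambda>k. map (\<lambda>t. offset ns k + (\<rho>s ! k) t) [0..<ns ! k]) [0..<length ns]))"

definition block_perm :: "(nat \<Rightarrow> nat) \<Rightarrow> nat list \<Rightarrow> nat \<Rightarrow> nat" where
  "block_perm \<sigma> ns = list_perm
     (concat (map (\<lambda>k. map (\<lambda>t. offset ns (\<sigma> k) + t) [0..<ns ! \<sigma> k]) [0..<length ns]))"

record ('i, 'p) operad =
  Col :: "'i set"
  Ops :: "'p set"
  Src :: "'p \<Rightarrow> 'i list"
  Tgt :: "'p \<Rightarrow> 'i"
  Uni :: "'i \<Rightarrow> 'p"
  Mul :: "'p \<Rightarrow> 'p list \<Rightarrow> 'p"
  Act :: "'p \<Rightarrow> (nat \<Rightarrow> nat) \<Rightarrow> 'p"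

definition composable :: "('i, 'p) operad \<Rightarrow> 'p \<Rightarrow> 'p list \<Rightarrow> bool" where
  "composable T b as \<longleftrightarrow> b \<in> Ops T \<and> set as \<subseteq> Ops T \<and> map (Tgt T) as = Src T b"

definition arity :: "('i, 'p) operad \<Rightarrow> 'p \<Rightarrow> nat" where
  "arity T a = length (Src T a)"

locale operad =
  fixes T :: "('i, 'p) operad"
  assumes Src_in: "a \<in> Ops T \<Longrightarrow> set (Src T a) \<subseteq> Col T"
    and Tgt_in: "a \<in> Ops T \<Longrightarrow> Tgt T a \<in> Col T"
    and Uni_in: "i \<in> Col T \<Longrightarrow> Uni T i \<in> Ops T"
    and Src_Uni: "i \<in> Col T \<Longrightarrow> Src T (Uni T i) = [i]"
    and Tgt_Uni: "i \<in> Col T \<Longrightarrow> Tgt T (Uni T i) = i"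
    and Mul_in: "composable T b as \<Longrightarrow> Mul T b as \<in> Ops T"
    and Src_Mul: "composable T b as \<Longrightarrow> Src T (Mul T b as) = concat (map (Src T) as)"
    and Tgt_Mul: "composable T b as \<Longrightarrow> Tgt T (Mul T b as) = Tgt T b"
    and Act_in: "\<lbrakk>a \<in> Ops T; \<rho> permutes {..<arity T a}\<rbrakk> \<Longrightarrow> Act T a \<rho> \<in> Ops T"
    and Src_Act: "\<lbrakk>a \<in> Ops T; \<rho> permutes {..<arity T a}\<rbrakk>
      \<Longrightarrow> Src T (Act T a \<rho>) = permute_list \<rho> (Src T a)"
    and Tgt_Act: "\<lbrakk>a \<in> Ops T; \<rho> permutes {..<arity T a}\<rbrakk> \<Longrightarrow> Tgt T (Act T a \<rho>) = Tgt T a"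
    and Mul_Uni_left: "a \<in> Ops T \<Longrightarrow> Mul T (Uni T (Tgt T a)) [a] = a"
    and Mul_Uni_right: "a \<in> Ops T \<Longrightarrow> Mul T a (map (Uni T) (Src T a)) = a"
    and Mul_assoc: "\<lbrakk>composable T b as; list_all2 (composable T) as css\<rbrakk>
      \<Longrightarrow> Mul T (Mul T b as) (concat css) = Mul T b (map2 (Mul T) as css)"
    and Act_id: "a \<in> Ops T \<Longrightarrow> Act T a id = a"
    and Act_comp: "\<lbrakk>a \<in> Ops T; \<rho> permutes {..<arity T a}; \<sigma> permutes {..<arity T a}\<rbrakk>
      \<Longrightarrow> Act T (Act T a \<rho>) \<sigma> = Act T a (\<rho> \<circ> \<sigma>)"
    and Mul_Act_inner: "\<lbrakk>composable T b as; list_all2 (\<lambda>a \<rho>. \<rho> permutes {..<arity T a}) as \<rho>s\<rbrakk>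
      \<Longrightarrow> Mul T b (map2 (Act T) as \<rho>s) = Act T (Mul T b as) (sum_perm \<rho>s (map (arity T) as))"
    and Mul_Act_outer: "\<lbrakk>composable T b as; \<sigma> permutes {..<arity T b}\<rbrakk>
      \<Longrightarrow> Mul T (Act T b \<sigma>) (permute_list \<sigma> as)
        = Act T (Mul T b as) (block_perm \<sigma> (map (arity T) as))"

text \<open>
  Maps of colours, operations, objects and arrows are \<^const>\<open>undefined\<close> off the relevant carriers,
  so that equality of 1-cells and of 2-cells is the intended one.
\<close>

record ('i, 'p) operad_morphism =
  om_dom :: "('i, 'p) operad"
  om_cod :: "('i, 'p) operad"
  om_col :: "'i \<Rightarrow> 'i"
  om_op :: "'p \<Rightarrow> 'p"

locale operad_morphism = S: operad S + T: operad T
  for S T :: "('i, 'p) operad" +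
  fixes F :: "('i, 'p) operad_morphism"
  assumes om_dom: "om_dom F = S"
    and om_cod: "om_cod F = T"
    and om_col_ext: "om_col F \<in> extensional (Col S)"
    and om_op_ext: "om_op F \<in> extensional (Ops S)"
    and om_col_in: "i \<in> Col S \<Longrightarrow> om_col F i \<in> Col T"
    and om_op_in: "a \<in> Ops S \<Longrightarrow> om_op F a \<in> Ops T"
    and om_Src: "a \<in> Ops S \<Longrightarrow> Src T (om_op F a) = map (om_col F) (Src S a)"
    and om_Tgt: "a \<in> Ops S \<Longrightarrow> Tgt T (om_op F a) = om_col F (Tgt S a)"
    and om_Uni: "i \<in> Col S \<Longrightarrow> om_op F (Uni S i) = Uni T (om_col F i)"
    and om_Mul: "composable S b as
      \<Longrightarrow> om_op F (Mul S b as) = Mul T (om_op F b) (map (om_op F) as)"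
    and om_Act: "\<lbrakk>a \<in> Ops S; \<rho> permutes {..<arity S a}\<rbrakk>
      \<Longrightarrow> om_op F (Act S a \<rho>) = Act T (om_op F a) \<rho>"

definition om_id :: "('i, 'p) operad \<Rightarrow> ('i, 'p) operad_morphism" where
  "om_id T = \<lparr>om_dom = T, om_cod = T, om_col = (\<lambda>i \<in> Col T. i), om_op = (\<lambda>a \<in> Ops T. a)\<rparr>"

definition om_comp ::
  "('i, 'p) operad_morphism \<Rightarrow> ('i, 'p) operad_morphism \<Rightarrow> ('i, 'p) operad_morphism" where
  "om_comp G F = \<lparr>om_dom = om_dom F, om_cod = om_cod G,
     om_col = compose (Col (om_dom F)) (om_col G) (om_col F),
     om_op = compose (Ops (om_dom F)) (om_op G) (om_op F)\<rparr>"

record ('f, 'a, 'm) transformation =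
  t_src :: 'f
  t_tgt :: 'f
  t_at :: "'a \<Rightarrow> 'm"

type_synonym ('i, 'p) operad_transformation = "(('i, 'p) operad_morphism, 'i, 'p) transformation"

locale operad_transformation = F: operad_morphism S T "t_src \<phi>" + G: operad_morphism S T "t_tgt \<phi>"
  for S T :: "('i, 'p) operad" and \<phi> :: "('i, 'p) operad_transformation" +
  assumes t_at_ext: "t_at \<phi> \<in> extensional (Col S)"
    and t_at_in: "i \<in> Col S \<Longrightarrow> t_at \<phi> i \<in> Ops T"
    and Src_t_at: "i \<in> Col S \<Longrightarrow> Src T (t_at \<phi> i) = [om_col (t_src \<phi>) i]"
    and Tgt_t_at: "i \<in> Col S \<Longrightarrow> Tgt T (t_at \<phi> i) = om_col (t_tgt \<phi>) i"
    and t_at_natural: "a \<in> Ops S \<Longrightarrow> Mul T (t_at \<phi> (Tgt S a)) [om_op (t_src \<phi>) a]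
        = Mul T (om_op (t_tgt \<phi>) a) (map (t_at \<phi>) (Src S a))"

definition ot_id :: "('i, 'p) operad_morphism \<Rightarrow> ('i, 'p) operad_transformation" where
  "ot_id F = \<lparr>t_src = F, t_tgt = F, t_at = (\<lambda>i \<in> Col (om_dom F). Uni (om_cod F) (om_col F i))\<rparr>"

definition ot_vcomp ::
  "('i, 'p) operad_transformation \<Rightarrow> ('i, 'p) operad_transformation
    \<Rightarrow> ('i, 'p) operad_transformation" where
  "ot_vcomp \<psi> \<phi> = \<lparr>t_src = t_src \<phi>, t_tgt = t_tgt \<psi>,
     t_at = (\<lambda>i \<in> Col (om_dom (t_src \<phi>)). Mul (om_cod (t_src \<phi>)) (t_at \<psi> i) [t_at \<phi> i])\<rparr>"

definition ot_hcomp ::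
  "('i, 'p) operad_transformation \<Rightarrow> ('i, 'p) operad_transformation
    \<Rightarrow> ('i, 'p) operad_transformation" where
  "ot_hcomp \<psi> \<phi> = \<lparr>t_src = om_comp (t_src \<psi>) (t_src \<phi>), t_tgt = om_comp (t_tgt \<psi>) (t_tgt \<phi>),
     t_at = (\<lambda>i \<in> Col (om_dom (t_src \<phi>)). Mul (om_cod (t_src \<psi>))
       (t_at \<psi> (om_col (t_tgt \<phi>) i)) [om_op (t_src \<psi>) (t_at \<phi> i)])\<rparr>"

definition Opd ::
  "(('i, 'p) operad, ('i, 'p) operad_morphism, ('i, 'p) operad_transformation) twocat" where
  "Opd = \<lparr>
     Obj = {T. operad T},
     Cell1 = {F. operad_morphism (om_dom F) (om_cod F) F},
     dom1 = om_dom, cod1 = om_cod, id1 = om_id, comp1 = om_comp,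
     Cell2 = {\<phi>. operad_transformation (om_dom (t_src \<phi>)) (om_cod (t_src \<phi>)) \<phi>},
     dom2 = t_src, cod2 = t_tgt, id2 = ot_id, vcomp = ot_vcomp, hcomp = ot_hcomp\<rparr>"


section \<open>Symmetric monoidal categories\<close>

record ('a, 'm) smcat = "('a, 'm) category" +
  Tob :: "'a \<Rightarrow> 'a \<Rightarrow> 'a"  (infixr \<open>\<otimes>\<index>\<close> 70)
  Tar :: "'m \<Rightarrow> 'm \<Rightarrow> 'm"  (infixr \<open>\<boxtimes>\<index>\<close> 70)
  Unit :: 'a  (\<open>\<one>\<index>\<close>)
  Assoc :: "'a \<Rightarrow> 'a \<Rightarrow> 'a \<Rightarrow> 'm"
  Lunit :: "'a \<Rightarrow> 'm"
  Runit :: "'a \<Rightarrow> 'm"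
  Braid :: "'a \<Rightarrow> 'a \<Rightarrow> 'm"

locale symmetric_monoidal_category = category V
  for V :: "('a, 'm) smcat" (structure) +
  assumes Tob_in: "\<lbrakk>A \<in> Ob V; B \<in> Ob V\<rbrakk> \<Longrightarrow> A \<otimes> B \<in> Ob V"
    and Tar_in: "\<lbrakk>f \<in> Hom V A B; g \<in> Hom V A' B'\<rbrakk> \<Longrightarrow> f \<boxtimes> g \<in> Hom V (A \<otimes> A') (B \<otimes> B')"
    and Tar_Id: "\<lbrakk>A \<in> Ob V; B \<in> Ob V\<rbrakk> \<Longrightarrow> Id V A \<boxtimes> Id V B = Id V (A \<otimes> B)"
    and Tar_Comp: "\<lbrakk>f \<in> Hom V A B; g \<in> Hom V B C; f' \<in> Hom V A' B'; g' \<in> Hom V B' C'\<rbrakk>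
      \<Longrightarrow> (g \<cdot> f) \<boxtimes> (g' \<cdot> f') = (g \<boxtimes> g') \<cdot> (f \<boxtimes> f')"
    and Unit_in: "\<one> \<in> Ob V"
    and Assoc_iso: "\<lbrakk>A \<in> Ob V; B \<in> Ob V; C \<in> Ob V\<rbrakk>
      \<Longrightarrow> Assoc V A B C \<in> Iso V ((A \<otimes> B) \<otimes> C) (A \<otimes> (B \<otimes> C))"
    and Lunit_iso: "A \<in> Ob V \<Longrightarrow> Lunit V A \<in> Iso V (\<one> \<otimes> A) A"
    and Runit_iso: "A \<in> Ob V \<Longrightarrow> Runit V A \<in> Iso V (A \<otimes> \<one>) A"
    and Braid_in: "\<lbrakk>A \<in> Ob V; B \<in> Ob V\<rbrakk> \<Longrightarrow> Braid V A B \<in> Hom V (A \<otimes> B) (B \<otimes> A)"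
    and Assoc_natural: "\<lbrakk>f \<in> Hom V A A'; g \<in> Hom V B B'; h \<in> Hom V C C'\<rbrakk>
      \<Longrightarrow> Assoc V A' B' C' \<cdot> ((f \<boxtimes> g) \<boxtimes> h) = (f \<boxtimes> (g \<boxtimes> h)) \<cdot> Assoc V A B C"
    and Lunit_natural: "f \<in> Hom V A B \<Longrightarrow> Lunit V B \<cdot> (Id V \<one> \<boxtimes> f) = f \<cdot> Lunit V A"
    and Runit_natural: "f \<in> Hom V A B \<Longrightarrow> Runit V B \<cdot> (f \<boxtimes> Id V \<one>) = f \<cdot> Runit V A"
    and Braid_natural: "\<lbrakk>f \<in> Hom V A A'; g \<in> Hom V B B'\<rbrakk>
      \<Longrightarrow> Braid V A' B' \<cdot> (f \<boxtimes> g) = (g \<boxtimes> f) \<cdot> Braid V A B"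
    and pentagon: "\<lbrakk>A \<in> Ob V; B \<in> Ob V; C \<in> Ob V; D \<in> Ob V\<rbrakk>
      \<Longrightarrow> Assoc V A B (C \<otimes> D) \<cdot> Assoc V (A \<otimes> B) C D
        = (Id V A \<boxtimes> Assoc V B C D) \<cdot> Assoc V A (B \<otimes> C) D \<cdot> (Assoc V A B C \<boxtimes> Id V D)"
    and triangle: "\<lbrakk>A \<in> Ob V; B \<in> Ob V\<rbrakk>
      \<Longrightarrow> (Id V A \<boxtimes> Lunit V B) \<cdot> Assoc V A \<one> B = Runit V A \<boxtimes> Id V B"
    and Braid_Braid: "\<lbrakk>A \<in> Ob V; B \<in> Ob V\<rbrakk> \<Longrightarrow> Braid V B A \<cdot> Braid V A B = Id V (A \<otimes> B)"
    and hexagon: "\<lbrakk>A \<in> Ob V; B \<in> Ob V; C \<in> Ob V\<rbrakk>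
      \<Longrightarrow> Assoc V B C A \<cdot> Braid V A (B \<otimes> C) \<cdot> Assoc V A B C
        = (Id V B \<boxtimes> Braid V A C) \<cdot> Assoc V B A C \<cdot> (Braid V A B \<boxtimes> Id V C)"

locale symmetric_strict_monoidal_category = symmetric_monoidal_category +
  assumes strict_assoc: "\<lbrakk>A \<in> Ob V; B \<in> Ob V; C \<in> Ob V\<rbrakk> \<Longrightarrow> (A \<otimes> B) \<otimes> C = A \<otimes> (B \<otimes> C)"
    and strict_lunit: "A \<in> Ob V \<Longrightarrow> \<one> \<otimes> A = A"
    and strict_runit: "A \<in> Ob V \<Longrightarrow> A \<otimes> \<one> = A"
    and Assoc_strict: "\<lbrakk>A \<in> Ob V; B \<in> Ob V; C \<in> Ob V\<rbrakk>
      \<Longrightarrow> Assoc V A B C = Id V (A \<otimes> (B \<otimes> C))"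
    and Lunit_strict: "A \<in> Ob V \<Longrightarrow> Lunit V A = Id V A"
    and Runit_strict: "A \<in> Ob V \<Longrightarrow> Runit V A = Id V A"

text \<open>
  The coherence data of a strong monoidal functor are isomorphisms
  \<open>sm_mu (A, B) : F A \<otimes> F B \<rightarrow> F (A \<otimes> B)\<close> and \<open>sm_eta : \<one> \<rightarrow> F \<one>\<close>.
\<close>

record ('a, 'm) sm_functor =
  sm_dom :: "('a, 'm) smcat"
  sm_cod :: "('a, 'm) smcat"
  sm_ob :: "'a \<Rightarrow> 'a"
  sm_ar :: "'m \<Rightarrow> 'm"
  sm_mu :: "'a \<times> 'a \<Rightarrow> 'm"
  sm_eta :: 'm

locale symmetric_strong_monoidal_functor =
  V: symmetric_monoidal_category V + W: symmetric_monoidal_category W +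
  cat_functor V W "sm_ob F" "sm_ar F"
  for V W :: "('a, 'm) smcat" and F :: "('a, 'm) sm_functor" +
  assumes sm_dom: "sm_dom F = V"
    and sm_cod: "sm_cod F = W"
    and sm_ob_ext: "sm_ob F \<in> extensional (Ob V)"
    and sm_ar_ext: "sm_ar F \<in> extensional (Ar V)"
    and sm_mu_ext: "sm_mu F \<in> extensional (Ob V \<times> Ob V)"
    and sm_mu_iso: "\<lbrakk>A \<in> Ob V; B \<in> Ob V\<rbrakk>
      \<Longrightarrow> sm_mu F (A, B) \<in> Iso W (sm_ob F A \<otimes>\<^bsub>W\<^esub> sm_ob F B) (sm_ob F (A \<otimes>\<^bsub>V\<^esub> B))"
    and sm_eta_iso: "sm_eta F \<in> Iso W \<one>\<^bsub>W\<^esub> (sm_ob F \<one>\<^bsub>V\<^esub>)"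
    and sm_mu_natural: "\<lbrakk>f \<in> Hom V A A'; g \<in> Hom V B B'\<rbrakk>
      \<Longrightarrow> sm_mu F (A', B') \<cdot>\<^bsub>W\<^esub> (sm_ar F f \<boxtimes>\<^bsub>W\<^esub> sm_ar F g)
        = sm_ar F (f \<boxtimes>\<^bsub>V\<^esub> g) \<cdot>\<^bsub>W\<^esub> sm_mu F (A, B)"
    and sm_assoc: "\<lbrakk>A \<in> Ob V; B \<in> Ob V; C \<in> Ob V\<rbrakk>
      \<Longrightarrow> sm_ar F (Assoc V A B C) \<cdot>\<^bsub>W\<^esub> sm_mu F (A \<otimes>\<^bsub>V\<^esub> B, C)
            \<cdot>\<^bsub>W\<^esub> (sm_mu F (A, B) \<boxtimes>\<^bsub>W\<^esub> Id W (sm_ob F C))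
        = sm_mu F (A, B \<otimes>\<^bsub>V\<^esub> C) \<cdot>\<^bsub>W\<^esub> (Id W (sm_ob F A) \<boxtimes>\<^bsub>W\<^esub> sm_mu F (B, C))
            \<cdot>\<^bsub>W\<^esub> Assoc W (sm_ob F A) (sm_ob F B) (sm_ob F C)"
    and sm_lunit: "A \<in> Ob V
      \<Longrightarrow> sm_ar F (Lunit V A) \<cdot>\<^bsub>W\<^esub> sm_mu F (\<one>\<^bsub>V\<^esub>, A) \<cdot>\<^bsub>W\<^esub> (sm_eta F \<boxtimes>\<^bsub>W\<^esub> Id W (sm_ob F A))
        = Lunit W (sm_ob F A)"
    and sm_runit: "A \<in> Ob V
      \<Longrightarrow> sm_ar F (Runit V A) \<cdot>\<^bsub>W\<^esub> sm_mu F (A, \<one>\<^bsub>V\<^esub>) \<cdot>\<^bsub>W\<^esub> (Id W (sm_ob F A) \<boxtimes>\<^bsub>W\<^esub> sm_eta F)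
        = Runit W (sm_ob F A)"
    and sm_braid: "\<lbrakk>A \<in> Ob V; B \<in> Ob V\<rbrakk>
      \<Longrightarrow> sm_ar F (Braid V A B) \<cdot>\<^bsub>W\<^esub> sm_mu F (A, B)
        = sm_mu F (B, A) \<cdot>\<^bsub>W\<^esub> Braid W (sm_ob F A) (sm_ob F B)"

locale symmetric_strict_monoidal_functor = symmetric_strong_monoidal_functor +
  assumes strict_Tob: "\<lbrakk>A \<in> Ob V; B \<in> Ob V\<rbrakk>
      \<Longrightarrow> sm_ob F (A \<otimes>\<^bsub>V\<^esub> B) = sm_ob F A \<otimes>\<^bsub>W\<^esub> sm_ob F B"
    and strict_Unit: "sm_ob F \<one>\<^bsub>V\<^esub> = \<one>\<^bsub>W\<^esub>"
    and strict_mu: "\<lbrakk>A \<in> Ob V; B \<in> Ob V\<rbrakk>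
      \<Longrightarrow> sm_mu F (A, B) = Id W (sm_ob F A \<otimes>\<^bsub>W\<^esub> sm_ob F B)"
    and strict_eta: "sm_eta F = Id W \<one>\<^bsub>W\<^esub>"

definition sm_id :: "('a, 'm) smcat \<Rightarrow> ('a, 'm) sm_functor" where
  "sm_id V = \<lparr>sm_dom = V, sm_cod = V, sm_ob = (\<lambda>A \<in> Ob V. A), sm_ar = (\<lambda>f \<in> Ar V. f),
     sm_mu = (\<lambda>(A, B) \<in> Ob V \<times> Ob V. Id V (A \<otimes>\<^bsub>V\<^esub> B)), sm_eta = Id V \<one>\<^bsub>V\<^esub>\<rparr>"

definition sm_comp :: "('a, 'm) sm_functor \<Rightarrow> ('a, 'm) sm_functor \<Rightarrow> ('a, 'm) sm_functor" where
  "sm_comp G F = \<lparr>sm_dom = sm_dom F, sm_cod = sm_cod G,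
     sm_ob = compose (Ob (sm_dom F)) (sm_ob G) (sm_ob F),
     sm_ar = compose (Ar (sm_dom F)) (sm_ar G) (sm_ar F),
     sm_mu = (\<lambda>(A, B) \<in> Ob (sm_dom F) \<times> Ob (sm_dom F).
       sm_ar G (sm_mu F (A, B)) \<cdot>\<^bsub>sm_cod G\<^esub> sm_mu G (sm_ob F A, sm_ob F B)),
     sm_eta = sm_ar G (sm_eta F) \<cdot>\<^bsub>sm_cod G\<^esub> sm_eta G\<rparr>"

type_synonym ('a, 'm) sm_transformation = "(('a, 'm) sm_functor, 'a, 'm) transformation"

locale monoidal_transformation =
  F: symmetric_strong_monoidal_functor V W "t_src \<phi>" +
  G: symmetric_strong_monoidal_functor V W "t_tgt \<phi>"
  for V W :: "('a, 'm) smcat" and \<phi> :: "('a, 'm) sm_transformation" +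
  assumes mt_at_ext: "t_at \<phi> \<in> extensional (Ob V)"
    and mt_at_in: "A \<in> Ob V \<Longrightarrow> t_at \<phi> A \<in> Hom W (sm_ob (t_src \<phi>) A) (sm_ob (t_tgt \<phi>) A)"
    and mt_natural: "f \<in> Hom V A B
      \<Longrightarrow> t_at \<phi> B \<cdot>\<^bsub>W\<^esub> sm_ar (t_src \<phi>) f = sm_ar (t_tgt \<phi>) f \<cdot>\<^bsub>W\<^esub> t_at \<phi> A"
    and mt_mu: "\<lbrakk>A \<in> Ob V; B \<in> Ob V\<rbrakk>
      \<Longrightarrow> t_at \<phi> (A \<otimes>\<^bsub>V\<^esub> B) \<cdot>\<^bsub>W\<^esub> sm_mu (t_src \<phi>) (A, B)
        = sm_mu (t_tgt \<phi>) (A, B) \<cdot>\<^bsub>W\<^esub> (t_at \<phi> A \<boxtimes>\<^bsub>W\<^esub> t_at \<phi> B)"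
    and mt_eta: "t_at \<phi> \<one>\<^bsub>V\<^esub> \<cdot>\<^bsub>W\<^esub> sm_eta (t_src \<phi>) = sm_eta (t_tgt \<phi>)"

definition mt_id :: "('a, 'm) sm_functor \<Rightarrow> ('a, 'm) sm_transformation" where
  "mt_id F = \<lparr>t_src = F, t_tgt = F, t_at = (\<lambda>A \<in> Ob (sm_dom F). Id (sm_cod F) (sm_ob F A))\<rparr>"

definition mt_vcomp ::
  "('a, 'm) sm_transformation \<Rightarrow> ('a, 'm) sm_transformation \<Rightarrow> ('a, 'm) sm_transformation" where
  "mt_vcomp \<psi> \<phi> = \<lparr>t_src = t_src \<phi>, t_tgt = t_tgt \<psi>,
     t_at = (\<lambda>A \<in> Ob (sm_dom (t_src \<phi>)). t_at \<psi> A \<cdot>\<^bsub>sm_cod (t_src \<phi>)\<^esub> t_at \<phi> A)\<rparr>"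

definition mt_hcomp ::
  "('a, 'm) sm_transformation \<Rightarrow> ('a, 'm) sm_transformation \<Rightarrow> ('a, 'm) sm_transformation" where
  "mt_hcomp \<psi> \<phi> = \<lparr>t_src = sm_comp (t_src \<psi>) (t_src \<phi>), t_tgt = sm_comp (t_tgt \<psi>) (t_tgt \<phi>),
     t_at = (\<lambda>A \<in> Ob (sm_dom (t_src \<phi>)).
       t_at \<psi> (sm_ob (t_tgt \<phi>) A) \<cdot>\<^bsub>sm_cod (t_src \<psi>)\<^esub> sm_ar (t_src \<psi>) (t_at \<phi> A))\<rparr>"

definition SMC_ps ::
  "(('a, 'm) smcat, ('a, 'm) sm_functor, ('a, 'm) sm_transformation) twocat" where
  "SMC_ps = \<lparr>
     Obj = {V. symmetric_monoidal_category V},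
     Cell1 = {F. symmetric_strong_monoidal_functor (sm_dom F) (sm_cod F) F},
     dom1 = sm_dom, cod1 = sm_cod, id1 = sm_id, comp1 = sm_comp,
     Cell2 = {\<phi>. monoidal_transformation (sm_dom (t_src \<phi>)) (sm_cod (t_src \<phi>)) \<phi>},
     dom2 = t_src, cod2 = t_tgt, id2 = mt_id, vcomp = mt_vcomp, hcomp = mt_hcomp\<rparr>"

definition SMC_s ::
  "(('a, 'm) smcat, ('a, 'm) sm_functor, ('a, 'm) sm_transformation) twocat" where
  "SMC_s = (let
       Ob_s = {V. symmetric_strict_monoidal_category V};
       Fun_s = {F. symmetric_strict_monoidal_functor (sm_dom F) (sm_cod F) F \<and>
                   sm_dom F \<in> Ob_s \<and> sm_cod F \<in> Ob_s}
     in SMC_ps\<lparr>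
       Obj := Ob_s,
       Cell1 := Fun_s,
       Cell2 := {\<phi> \<in> Cell2 SMC_ps. t_src \<phi> \<in> Fun_s \<and> t_tgt \<phi> \<in> Fun_s}\<rparr>)"


section \<open>Coherence isomorphisms for iterated tensor products\<close>

text \<open>The product of a list is bracketed to the right; that of a one-element list is its element.\<close>

fun tens :: "('a, 'm) smcat \<Rightarrow> 'a list \<Rightarrow> 'a" where
  "tens V [] = \<one>\<^bsub>V\<^esub>"
| "tens V [A] = A"
| "tens V (A # B # As) = A \<otimes>\<^bsub>V\<^esub> tens V (B # As)"

fun tens_ar :: "('a, 'm) smcat \<Rightarrow> 'm list \<Rightarrow> 'm" where
  "tens_ar V [] = Id V \<one>\<^bsub>V\<^esub>"
| "tens_ar V [f] = f"
| "tens_ar V (f # g # fs) = f \<boxtimes>\<^bsub>V\<^esub> tens_ar V (g # fs)"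

text \<open>\<open>app_iso V As Bs : tens V As \<otimes> tens V Bs \<rightarrow> tens V (As @ Bs)\<close>\<close>

fun app_iso :: "('a, 'm) smcat \<Rightarrow> 'a list \<Rightarrow> 'a list \<Rightarrow> 'm" where
  "app_iso V [] Bs = Lunit V (tens V Bs)"
| "app_iso V (A # As) [] = Runit V (tens V (A # As))"
| "app_iso V [A] (B # Bs) = Id V (tens V (A # B # Bs))"
| "app_iso V (A # A' # As) (B # Bs) = (Id V A \<boxtimes>\<^bsub>V\<^esub> app_iso V (A' # As) (B # Bs))
     \<cdot>\<^bsub>V\<^esub> Assoc V A (tens V (A' # As)) (tens V (B # Bs))"

text \<open>\<open>flat_iso V Ass : tens V (map (tens V) Ass) \<rightarrow> tens V (concat Ass)\<close>\<close>

fun flat_iso :: "('a, 'm) smcat \<Rightarrow> 'a list list \<Rightarrow> 'm" where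
  "flat_iso V [] = Id V \<one>\<^bsub>V\<^esub>"
| "flat_iso V [As] = Id V (tens V As)"
| "flat_iso V (As # Bs # Ass) = app_iso V As (concat (Bs # Ass))
     \<cdot>\<^bsub>V\<^esub> (Id V (tens V As) \<boxtimes>\<^bsub>V\<^esub> flat_iso V (Bs # Ass))"

text \<open>
  The canonical permutation isomorphisms, built by insertion sort on lists of positions:
  \<open>insort_iso V A k ks : tens V (map A (k # ks)) \<rightarrow> tens V (map A (insort k ks))\<close> and
  \<open>sort_iso V A ks : tens V (map A ks) \<rightarrow> tens V (map A (sort ks))\<close>.
\<close>

fun insort_iso :: "('a, 'm) smcat \<Rightarrow> (nat \<Rightarrow> 'a) \<Rightarrow> nat \<Rightarrow> nat list \<Rightarrow> 'm" where
  "insort_iso V A k [] = Id V (A k)"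
| "insort_iso V A k [l] =
     (if k \<le> l then Id V (A k \<otimes>\<^bsub>V\<^esub> A l) else Braid V (A k) (A l))"
| "insort_iso V A k (l # l' # ls) =
     (let R = tens V (map A (l' # ls)) in
      if k \<le> l then Id V (A k \<otimes>\<^bsub>V\<^esub> (A l \<otimes>\<^bsub>V\<^esub> R))
      else (Id V (A l) \<boxtimes>\<^bsub>V\<^esub> insort_iso V A k (l' # ls))
        \<cdot>\<^bsub>V\<^esub> Assoc V (A l) (A k) R
        \<cdot>\<^bsub>V\<^esub> (Braid V (A k) (A l) \<boxtimes>\<^bsub>V\<^esub> Id V R)
        \<cdot>\<^bsub>V\<^esub> Inv V (Assoc V (A k) (A l) R))"

fun sort_iso :: "('a, 'm) smcat \<Rightarrow> (nat \<Rightarrow> 'a) \<Rightarrow> nat list \<Rightarrow> 'm" where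
  "sort_iso V A [] = Id V \<one>\<^bsub>V\<^esub>"
| "sort_iso V A [k] = Id V (A k)"
| "sort_iso V A (k # l # ls) = insort_iso V A k (sort (l # ls))
     \<cdot>\<^bsub>V\<^esub> (Id V (A k) \<boxtimes>\<^bsub>V\<^esub> sort_iso V A (l # ls))"

text \<open>\<open>perm_iso V \<rho> As : tens V (permute_list \<rho> As) \<rightarrow> tens V As\<close>\<close>

definition perm_iso :: "('a, 'm) smcat \<Rightarrow> (nat \<Rightarrow> nat) \<Rightarrow> 'a list \<Rightarrow> 'm" where
  "perm_iso V \<rho> As = sort_iso V ((!) As) (map \<rho> [0..<length As])"

text \<open>\<open>mu_list F As : tens W (map F As) \<rightarrow> F (tens V As)\<close> for \<open>F : V \<rightarrow> W\<close>\<close>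

fun mu_list :: "('a, 'm) sm_functor \<Rightarrow> 'a list \<Rightarrow> 'm" where
  "mu_list F [] = sm_eta F"
| "mu_list F [A] = Id (sm_cod F) (sm_ob F A)"
| "mu_list F (A # B # As) = sm_mu F (A, tens (sm_dom F) (B # As))
     \<cdot>\<^bsub>sm_cod F\<^esub> (Id (sm_cod F) (sm_ob F A) \<boxtimes>\<^bsub>sm_cod F\<^esub> mu_list F (B # As))"


section \<open>The 2-functors \<open>U\<close> and the symmetric strict monoidal category \<open>Com T\<close>\<close>

text \<open>
  Both constructions form new colours or operations out of lists. In order that they stay within
  one type, and so relate a single 2-category of operads to a single 2-category of symmetric
  monoidal categories, all structures live in a type closed under these formations. It plays the
  role of a universe of small sets: every set (of any type) embeds into \<open>'u univ\<close> for suitable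
  \<^typ>\<open>'u\<close>, by \<open>Atom\<close>. The carriers are arbitrary subsets of the type.
\<close>

datatype 'u univ =
  Atom 'u
| Seq (seq: "'u univ list")
| Mor (mor_dom: "'u univ list") (mor_fun: "nat list") (mor_ops: "'u univ list")
| Mult (mult_src: "'u univ list") (mult_ar: "'u univ")

definition U_ob :: "('u univ, 'u univ) smcat \<Rightarrow> ('u univ, 'u univ) operad" where
  "U_ob V = \<lparr>
     Col = Ob V,
     Ops = {Mult As f |As f. set As \<subseteq> Ob V \<and> f \<in> Ar V \<and> Dom V f = tens V As},
     Src = mult_src,
     Tgt = (\<lambda>a. Cod V (mult_ar a)),
     Uni = (\<lambda>A. Mult [A] (Id V A)),
     Mul = (\<lambda>b as. Mult (concat (map mult_src as))
       (mult_ar b \<cdot>\<^bsub>V\<^esub> tens_ar V (map mult_ar as) \<cdot>\<^bsub>V\<^esub> Inv V (flat_iso V (map mult_src as)))),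
     Act = (\<lambda>a \<rho>. Mult (permute_list \<rho> (mult_src a))
       (mult_ar a \<cdot>\<^bsub>V\<^esub> perm_iso V \<rho> (mult_src a)))\<rparr>"

definition U_fun ::
  "('u univ, 'u univ) sm_functor \<Rightarrow> ('u univ, 'u univ) operad_morphism" where
  "U_fun F = \<lparr>
     om_dom = U_ob (sm_dom F),
     om_cod = U_ob (sm_cod F),
     om_col = sm_ob F,
     om_op = (\<lambda>a \<in> Ops (U_ob (sm_dom F)). Mult (map (sm_ob F) (mult_src a))
       (sm_ar F (mult_ar a) \<cdot>\<^bsub>sm_cod F\<^esub> mu_list F (mult_src a)))\<rparr>"

definition U_trans ::
  "('u univ, 'u univ) sm_transformation \<Rightarrow> ('u univ, 'u univ) operad_transformation" where
  "U_trans \<phi> = \<lparr>t_src = U_fun (t_src \<phi>), t_tgt = U_fun (t_tgt \<phi>),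
     t_at = (\<lambda>A \<in> Ob (sm_dom (t_src \<phi>)). Mult [sm_ob (t_src \<phi>) A] (t_at \<phi> A))\<rparr>"

text \<open>
  The 2-functors on \<^const>\<open>SMC_s\<close> and on \<^const>\<open>SMC_ps\<close> are given by the same data, strict
  functors being strong functors with identity coherence.
\<close>

definition U ::
  "(('u univ, 'u univ) smcat, ('u univ, 'u univ) sm_functor, ('u univ, 'u univ) sm_transformation,
    ('u univ, 'u univ) operad, ('u univ, 'u univ) operad_morphism,
    ('u univ, 'u univ) operad_transformation) two_functor" where
  "U = \<lparr>F_ob = U_ob, F_1 = U_fun, F_2 = U_trans\<rparr>"

text \<open>
  In \<open>Mor is f \<alpha>s\<close> the function \<open>{0..<length is} \<rightarrow> {0..<length \<alpha>s}\<close> is the list \<open>f\<close> of its values;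
  \<open>fibre f k\<close> lists in increasing order the positions that it sends to \<open>k\<close>.
\<close>

definition fibre :: "nat list \<Rightarrow> nat \<Rightarrow> nat list" where
  "fibre f k = filter (\<lambda>l. f ! l = k) [0..<length f]"

text \<open>
  If an operation has inputs labelled by the distinct numbers \<open>ps\<close>, acting by \<open>sorting_perm ps\<close>
  puts them in increasing order: \<open>permute_list (sorting_perm ps) ps = sort ps\<close>.
\<close>

definition sorting_perm :: "nat list \<Rightarrow> nat \<Rightarrow> nat" where
  "sorting_perm ps = list_perm (map (\<lambda>p. THE t. t < length ps \<and> ps ! t = p) (sort ps))"

definition Com :: "('u univ, 'u univ) operad \<Rightarrow> ('u univ, 'u univ) smcat" where
  "Com T = \<lparr>
     Ob = {Seq is |is. set is \<subseteq> Col T},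
     Ar = {Mor is f \<alpha>s |is f \<alpha>s. set is \<subseteq> Col T \<and> length f = length is \<and>
             set f \<subseteq> {..<length \<alpha>s} \<and> set \<alpha>s \<subseteq> Ops T \<and>
             (\<forall>k < length \<alpha>s. Src T (\<alpha>s ! k) = map ((!) is) (fibre f k))},
     Dom = (\<lambda>x. Seq (mor_dom x)),
     Cod = (\<lambda>x. Seq (map (Tgt T) (mor_ops x))),
     Id = (\<lambda>A. Mor (seq A) [0..<length (seq A)] (map (Uni T) (seq A))),
     Comp = (\<lambda>y x.
       let f = mor_fun x; g = mor_fun y; \<alpha>s = mor_ops x; \<beta>s = mor_ops y in
       Mor (mor_dom x) (map ((!) g) f)
         (map (\<lambda>r. Act T (Mul T (\<beta>s ! r) (map ((!) \<alpha>s) (fibre g r)))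
                     (sorting_perm (concat (map (fibre f) (fibre g r)))))
           [0..<length \<beta>s])),
     Tob = (\<lambda>A B. Seq (seq A @ seq B)),
     Tar = (\<lambda>x y. Mor (mor_dom x @ mor_dom y)
       (mor_fun x @ map (\<lambda>k. length (mor_ops x) + k) (mor_fun y)) (mor_ops x @ mor_ops y)),
     Unit = Seq [],
     Assoc = (\<lambda>A B C. let is = seq A @ seq B @ seq C in
       Mor is [0..<length is] (map (Uni T) is)),
     Lunit = (\<lambda>A. Mor (seq A) [0..<length (seq A)] (map (Uni T) (seq A))),
     Runit = (\<lambda>A. Mor (seq A) [0..<length (seq A)] (map (Uni T) (seq A))),
     Braid = (\<lambda>A B. let m = length (seq A); n = length (seq B) in
       Mor (seq A @ seq B) ([n..<n + m] @ [0..<n]) (map (Uni T) (seq B @ seq A)))\<rparr>"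

end

(*
The strictification of a symmetric monoidal category V has finite lists of objects as objects and
arrows between iterated tensor products as arrows. By coherence, the composites of symmetries
that carry one list of distinctly labelled letters to another all agree; this common value is the
canonical arrow between the two lists. In the strictification the operations of U V are the arrows
with a one-letter target, operadic multiplication is composition with a tensor product, and the
symmetric group acts by canonical arrows.

Every arrow (f, alpha_1, ..., alpha_n) of Com T is the composite of a permutation, which makes the
fibres of f consecutive, with the tensor product of the alpha_k. An operad morphism F from T to U V
therefore determines a strict functor from Com T to the strictification of V, and so a strong
monoidal functor from Com T to V, strict if V is. A strong monoidal functor h out of Com T is
conjugate, by its coherence isomorphisms, to the functor determined by the restriction of h to T.
So restriction along the unit T -> U (Com T) is surjective on objects and fully faithful, and in
the strict case injective on objects; both adjunctions follow.
*)

theory Submission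
  imports Defs
begin


section \<open>Categories and 2-categories\<close>

text \<open>Equality on the nose keeps the two adjunctions close. Since \<open>tens V [A]\<close> is
  \<open>A\<close> itself, restricting the extension of an operad morphism along the unit returns
  that morphism exactly, whether or not V is strict. The same units serve both adjunctions, so the
  pseudofunctor of the biadjunction is the 2-functor of the strict one, with identity constraints.
  The price is that prefixing an object to a list is sometimes a right unitor;
  \<open>cons_iso\<close> absorbs this exception.

  The obstacle is the bookkeeping of permutations: composition in \<open>Com T\<close> sorts inputs,
  the operad axioms use sums and block permutations, and \<open>U V\<close> acts through insertion
  sort. All are compared by giving distinct labels to positions; a permutation or canonical arrow is
  then determined by its label lists. Distinctness matters, because the symmetry of an object with
  itself has the same boundary as an identity. The coherence that this needs is proved by hand:
  sorting absorbs every adjacent symmetry, and the sorting arrow is invertible.\<close>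

lemma Hom_iff: "f \<in> Hom C A B \<longleftrightarrow> f \<in> Ar C & Dom C f = A & Cod C f = B" by (auto simp: Hom_def)

definition is_iso :: "('a, 'm, 'z) category_scheme => 'm => bool" where
 "is_iso C f \<longleftrightarrow> (\<exists>g. inverse_arrows C f g)"

lemma Iso_iff: "f \<in> Iso C A B \<longleftrightarrow> f \<in> Ar C & Dom C f = A & Cod C f = B & is_iso C f"
 by (auto simp: Iso_def is_iso_def Hom_iff)

section \<open>Cancellation of invertible arrows, and functors\<close>

context category
begin

declare Dom_in [simp] Cod_in [simp]

lemma Id_simps [simp]:
 assumes "A \<in> Ob C" shows "Id C A \<in> Ar C" "Dom C (Id C A) = A" "Cod C (Id C A) = A" using Id_in[OF assms] by (auto simp: Hom_iff)

lemma Comp_simps [simp]: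
 assumes "f \<in> Ar C" "g \<in> Ar C" "Dom C g = Cod C f" shows "g \<cdot> f \<in> Ar C" "Dom C (g \<cdot> f) = Dom C f" "Cod C (g \<cdot> f) = Cod C g"
 using Comp_in[of f "Dom C f" "Cod C f" g "Cod C g"] assms by (auto simp: Hom_iff)

lemma Comp_Id' [simp]: "f \<in> Ar C ==> Dom C f = A ==> f \<cdot> Id C A = f"
 using Comp_Id[of f A "Cod C f"] by (auto simp: Hom_iff)

lemma Id_Comp' [simp]: "f \<in> Ar C ==> Cod C f = A ==> Id C A \<cdot> f = f"
 using Id_Comp[of f "Dom C f" A] by (auto simp: Hom_iff)

lemma Comp_assoc' [simp]:
 assumes "f \<in> Ar C" "g \<in> Ar C" "h \<in> Ar C" "Dom C g = Cod C f" "Dom C h = Cod C g" shows "(h \<cdot> g) \<cdot> f = h \<cdot> (g \<cdot> f)"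
 using Comp_assoc[of f "Dom C f" "Cod C f" g "Cod C g" h "Cod C h"] assms by (auto simp: Hom_iff)

lemma inverse_arrows_unique:
 assumes "inverse_arrows C f g" "inverse_arrows C f g'" shows "g = g'"
proof -
 have "g = (g' \<cdot> f) \<cdot> g" using assms by (subst (asm) (1 2) inverse_arrows_def) (auto simp: Hom_iff simp del: Comp_assoc')
 also have "... = g' \<cdot> (f \<cdot> g)" using assms by (intro Comp_assoc') (auto simp: Hom_iff inverse_arrows_def)
 also have "... = g'" using assms by (auto simp: Hom_iff inverse_arrows_def)
 finally show ?thesis .
qed

lemma Inv_eq: "inverse_arrows C f g ==> Inv C f = g" unfolding Inv_def using inverse_arrows_unique by blast

lemma inverse_arrows_Inv: "is_iso C f ==> inverse_arrows C f (Inv C f)" unfolding is_iso_def using Inv_eq by blast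

lemma Inv_simps [simp]:
 assumes "is_iso C f" shows "Inv C f \<in> Ar C" "Dom C (Inv C f) = Cod C f" "Cod C (Inv C f) = Dom C f"
  "Inv C f \<cdot> f = Id C (Dom C f)" "f \<cdot> Inv C f = Id C (Cod C f)" "is_iso C (Inv C f)"
 using inverse_arrows_Inv[OF assms] by (auto simp: inverse_arrows_def Hom_iff is_iso_def)

lemma is_iso_Ar: "is_iso C f ==> f \<in> Ar C" by (auto simp: is_iso_def inverse_arrows_def)

lemma is_isoI:
 assumes "f \<in> Ar C" "g \<in> Ar C" "Dom C g = Cod C f" "Cod C g = Dom C f"
  "g \<cdot> f = Id C (Dom C f)" "f \<cdot> g = Id C (Cod C f)" shows "is_iso C f" "Inv C f = g"
proof -
 have *: "inverse_arrows C f g" using assms by (auto simp: inverse_arrows_def Hom_iff)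
 then show "is_iso C f" by (auto simp: is_iso_def)
 show "Inv C f = g" using * by (rule Inv_eq)
qed

text \<open>Composites are normalised to associate to the right, so the cancellation laws need a
  version with a trailing arrow.\<close>

lemma Inv_cancel [simp]:
 assumes "is_iso C f" "g \<in> Ar C" shows "Cod C g = Dom C f ==> Inv C f \<cdot> (f \<cdot> g) = g"
  "Cod C g = Cod C f ==> f \<cdot> (Inv C f \<cdot> g) = g" using assms is_iso_Ar[of f] by (simp_all flip: Comp_assoc')

lemma is_iso_Id [simp]: "A \<in> Ob C ==> is_iso C (Id C A)" and Inv_Id [simp]: "A \<in> Ob C ==> Inv C (Id C A) = Id C A"
 using is_isoI[of "Id C A" "Id C A"] by auto

lemma Inv_Comp:
 assumes "is_iso C f" "is_iso C g" "Dom C g = Cod C f" shows "is_iso C (g \<cdot> f)" "Inv C (g \<cdot> f) = Inv C f \<cdot> Inv C g"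
 using is_isoI[of "g \<cdot> f" "Inv C f \<cdot> Inv C g"] assms is_iso_Ar[of f] is_iso_Ar[of g] by auto

lemma iso_cancel_right:
 assumes "is_iso C f" "g \<in> Ar C" "h \<in> Ar C" "Dom C g = Cod C f" "Dom C h = Cod C f"
  "g \<cdot> f = h \<cdot> f" shows "g = h"
proof -
 have "(g \<cdot> f) \<cdot> Inv C f = (h \<cdot> f) \<cdot> Inv C f" using assms(6) by simp
 then show ?thesis using assms(1-5) is_iso_Ar[of f] by simp
qed

lemma iso_cancel_left:
 assumes "is_iso C f" "g \<in> Ar C" "h \<in> Ar C" "Cod C g = Dom C f" "Cod C h = Dom C f"
  "f \<cdot> g = f \<cdot> h" shows "g = h"
proof -
 have "Inv C f \<cdot> (f \<cdot> g) = Inv C f \<cdot> (f \<cdot> h)" using assms(6) by simp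
 then show ?thesis using assms(1-5) is_iso_Ar[of f] by simp
qed

end

context cat_functor
begin

lemma F1_simps [simp]:
 assumes "f \<in> Ar C" shows "F1 f \<in> Ar D" "Dom D (F1 f) = F0 (Dom C f)" "Cod D (F1 f) = F0 (Cod C f)"
 using F1_in[of f "Dom C f" "Cod C f"] assms by (auto simp: Hom_iff)

declare F0_in [simp] F1_Id [simp]

lemma F1_Comp' [simp]:
 "[|f \<in> Ar C; g \<in> Ar C; Dom C g = Cod C f|] ==> F1 (g \<cdot>\<^bsub>C\<^esub> f) = F1 g \<cdot>\<^bsub>D\<^esub> F1 f"
 using F1_Comp[of f "Dom C f" "Cod C f" g "Cod C g"] by (auto simp: Hom_iff)

lemma F1_iso:
 assumes "is_iso C f" shows "is_iso D (F1 f)" "Inv D (F1 f) = F1 (Inv C f)"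
proof -
 have f: "f \<in> Ar C" using C.is_iso_Ar assms by blast
 have "F1 (Inv C f) \<cdot>\<^bsub>D\<^esub> F1 f = Id D (F0 (Dom C f))"
  "F1 f \<cdot>\<^bsub>D\<^esub> F1 (Inv C f) = Id D (F0 (Cod C f))"
  using f assms F1_Comp'[symmetric, of f "Inv C f"] F1_Comp'[symmetric, of "Inv C f" f] by auto
 then show "is_iso D (F1 f)" "Inv D (F1 f) = F1 (Inv C f)" using D.is_isoI[of "F1 f" "F1 (Inv C f)"] f assms by auto
qed

end

section \<open>Fully faithful functors that are surjective on objects\<close>

lemma fully_faithful_inverse:
 assumes "cat_functor C D F0 F1" and surj: "\<And>B. B \<in> Ob D ==> \<exists>A \<in> Ob C. F0 A = B"
  and ff: "\<And>A B g. [|A \<in> Ob C; B \<in> Ob C; g \<in> Hom D (F0 A) (F0 B)|]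
   ==> \<exists>!f. f \<in> Hom C A B & F1 f = g"
 shows "\<exists>G0 G1. cat_functor D C G0 G1 & (\<forall>B \<in> Ob D. F0 (G0 B) = B) & (\<forall>g \<in> Ar D. F1 (G1 g) = g)"
proof -
 interpret cat_functor C D F0 F1 by fact
 \<comment> \<open>Surjectivity holds up to equality, so a chosen preimage needs no isomorphism to
   correct it.\<close>
 define G0 where "G0 B = (SOME A. A \<in> Ob C & F0 A = B)" for B
 define G1 where "G1 g = (THE f. f \<in> Hom C (G0 (Dom D g)) (G0 (Cod D g)) & F1 f = g)" for g
 have G0: "G0 B \<in> Ob C" "F0 (G0 B) = B" if "B \<in> Ob D" for B
  using someI_ex[of "%A. A \<in> Ob C & F0 A = B"] surj[OF that] unfolding G0_def by blast+
 have G1: "G1 g \<in> Hom C (G0 (Dom D g)) (G0 (Cod D g)) & F1 (G1 g) = g" if "g \<in> Ar D" for g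
  unfolding G1_def by (rule theI') (rule ff, use that in \<open>auto simp: Hom_iff G0\<close>)
 \<comment> \<open>Faithfulness in cancellation form: every functor law for \<open>G1\<close> is
   checked after applying \<open>F1\<close>.\<close>
 have eq: "f = f'" if "f \<in> Ar C" "f' \<in> Ar C" "F1 f = F1 f'" "Dom C f = Dom C f'" "Cod C f = Cod C f'" for f f'
  using that ff[of "Dom C f" "Cod C f" "F1 f"] by (auto simp: Hom_iff)
 have "cat_functor D C G0 G1"
 proof unfold_locales
  fix A assume "A \<in> Ob D" then show "G0 A \<in> Ob C" by (rule G0)
 next
  fix f A B assume "f \<in> Hom D A B" then show "G1 f \<in> Hom C (G0 A) (G0 B)" using G1 by (auto simp: Hom_iff)
 next
  fix A assume "A \<in> Ob D" then show "G1 (Id D A) = Id C (G0 A)" using G1[of "Id D A"] by (intro eq) (auto simp: Hom_iff G0)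
 next
  fix f A B g E assume "f \<in> Hom D A B" "g \<in> Hom D B E"
  then show "G1 (g \<cdot>\<^bsub>D\<^esub> f) = G1 g \<cdot>\<^bsub>C\<^esub> G1 f"
   using G1[of f] G1[of g] G1[of "g \<cdot>\<^bsub>D\<^esub> f"] by (intro eq) (auto simp: Hom_iff G0)
 qed
 then show ?thesis using G0 G1 by blast
qed

text \<open>The section \<open>G\<close> satisfies \<open>F G = 1\<close> strictly, so only the
  isomorphism between \<open>G F\<close> and the identity has to be constructed.\<close>

lemma equivalence_of_categoriesI:
 assumes F: "cat_functor C D F0 F1" and surj: "\<And>B. B \<in> Ob D ==> \<exists>A \<in> Ob C. F0 A = B"
  and ff: "\<And>A B g. [|A \<in> Ob C; B \<in> Ob C; g \<in> Hom D (F0 A) (F0 B)|]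
   ==> \<exists>!f. f \<in> Hom C A B & F1 f = g" shows "equivalence_of_categories C D F0 F1"
proof -
 interpret cat_functor C D F0 F1 by fact
 obtain G0 G1 where G: "cat_functor D C G0 G1" and G0: "\<And>B. B \<in> Ob D ==> F0 (G0 B) = B"
  and G1: "\<And>g. g \<in> Ar D ==> F1 (G1 g) = g" using fully_faithful_inverse[OF assms] by blast
 interpret G: cat_functor D C G0 G1 by fact
 have eq: "f = f'" if "f \<in> Ar C" "f' \<in> Ar C" "F1 f = F1 f'" "Dom C f = Dom C f'" "Cod C f = Cod C f'" for f f'
  using that ff[of "Dom C f" "Cod C f" "F1 f"] by (auto simp: Hom_iff)
 \<comment> \<open>The component at \<open>A\<close> lifts the identity of \<open>F0 A\<close>,
   which has the right type because \<open>F0 (G0 (F0 A)) = F0 A\<close>.\<close>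
 have "\<exists>t. t \<in> Hom C (G0 (F0 A)) A & F1 t = Id D (F0 A)" if "A \<in> Ob C" for A
  using ff[of "G0 (F0 A)" A "Id D (F0 A)"] that by (auto simp: Hom_iff G0)
 then obtain t where t: "\<And>A. A \<in> Ob C ==> t A \<in> Hom C (G0 (F0 A)) A & F1 (t A) = Id D (F0 A)" by metis
 have t_iso: "is_iso C (t A)" if A: "A \<in> Ob C" for A
 proof -
  obtain s where s: "s \<in> Hom C A (G0 (F0 A))" "F1 s = Id D (F0 A)" using ff[of A "G0 (F0 A)" "Id D (F0 A)"] A by (auto simp: Hom_iff G0)
  show ?thesis using s t[OF A] A by (intro C.is_isoI[of _ s] eq) (auto simp: Hom_iff G0)
 qed
 have "naturally_isomorphic C C (G0 \<circ> F0) (G1 \<circ> F1) id id" unfolding naturally_isomorphic_def proof (intro exI[of _ t] conjI ballI allI)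
  fix A assume "A \<in> Ob C" then show "t A \<in> Iso C ((G0 \<circ> F0) A) (id A)" using t t_iso by (auto simp: Iso_iff Hom_iff)
 next
  fix A B f assume "f \<in> Hom C A B" then show "t B \<cdot>\<^bsub>C\<^esub> (G1 \<circ> F1) f = id f \<cdot>\<^bsub>C\<^esub> t A"
   using t[of A] t[of B] by (intro eq) (auto simp: Hom_iff G0 G1)
 qed
 moreover have "naturally_isomorphic D D (F0 \<circ> G0) (F1 \<circ> G1) id id" unfolding naturally_isomorphic_def
  by (rule exI[of _ "Id D"]) (auto simp: Iso_iff Hom_iff G0 G1)
 ultimately show ?thesis using F G by (auto simp: equivalence_of_categories_def)
qed

text \<open>Injectivity makes the chosen section a two-sided inverse: \<open>G0 (F0 A)\<close> and
  \<open>A\<close> have the same image.\<close>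

lemma isomorphism_of_categoriesI:
 assumes F: "cat_functor C D F0 F1" and surj: "\<And>B. B \<in> Ob D ==> \<exists>A \<in> Ob C. F0 A = B"
  and inj: "\<And>A A'. [|A \<in> Ob C; A' \<in> Ob C; F0 A = F0 A'|] ==> A = A'"
  and ff: "\<And>A B g. [|A \<in> Ob C; B \<in> Ob C; g \<in> Hom D (F0 A) (F0 B)|]
   ==> \<exists>!f. f \<in> Hom C A B & F1 f = g" shows "isomorphism_of_categories C D F0 F1"
proof -
 interpret cat_functor C D F0 F1 by fact
 obtain G0 G1 where G: "cat_functor D C G0 G1" and G0: "\<And>B. B \<in> Ob D ==> F0 (G0 B) = B"
  and G1: "\<And>g. g \<in> Ar D ==> F1 (G1 g) = g" using fully_faithful_inverse[OF F surj ff] by blast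
 interpret G: cat_functor D C G0 G1 by fact
 have GF: "G0 (F0 A) = A" if "A \<in> Ob C" for A using that by (intro inj) (auto simp: G0)
 have "G1 (F1 f) = f" if "f \<in> Ar C" for f using that ff[of "Dom C f" "Cod C f" "F1 f"] by (auto simp: Hom_iff G1 GF)
 then show ?thesis using F G GF G0 G1 unfolding isomorphism_of_categories_def by blast
qed

lemma isomorphism_of_categoriesD:
 assumes "isomorphism_of_categories C D F0 F1" shows "\<And>A A'. [|A \<in> Ob C; A' \<in> Ob C; F0 A = F0 A'|] ==> A = A'"
  and "\<And>B. B \<in> Ob D ==> \<exists>A \<in> Ob C. F0 A = B"
  and "\<And>f f'. [|f \<in> Ar C; f' \<in> Ar C; F1 f = F1 f'|] ==> f = f'"
  and "\<And>g. g \<in> Ar D ==> \<exists>f \<in> Ar C. F1 f = g"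
proof -
 obtain G0 G1 where F: "cat_functor C D F0 F1" and G: "cat_functor D C G0 G1"
  and e: "\<forall>A \<in> Ob C. G0 (F0 A) = A" "\<forall>f \<in> Ar C. G1 (F1 f) = f"
   "\<forall>A \<in> Ob D. F0 (G0 A) = A" "\<forall>f \<in> Ar D. F1 (G1 f) = f" using assms unfolding isomorphism_of_categories_def by blast
 show "\<And>A A'. [|A \<in> Ob C; A' \<in> Ob C; F0 A = F0 A'|] ==> A = A'" using e(1) by metis
 show "\<And>B. B \<in> Ob D ==> \<exists>A \<in> Ob C. F0 A = B" using e(3) cat_functor.F0_in[OF G] by metis
 show "\<And>f f'. [|f \<in> Ar C; f' \<in> Ar C; F1 f = F1 f'|] ==> f = f'" using e(2) by metis
 show "\<And>g. g \<in> Ar D ==> \<exists>f \<in> Ar C. F1 f = g" using e(4) cat_functor.F1_simps(1)[OF G] by metis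
qed

lemma hom_cat_simps [simp]:
 "Ob (hom_cat A X Y) = {f \<in> Cell1 A. dom1 A f = X & cod1 A f = Y}"
 "Ar (hom_cat A X Y) = {a \<in> Cell2 A. dom2 A a \<in> Cell1 A & dom1 A (dom2 A a) = X & cod1 A (dom2 A a) = Y}"
 "Dom (hom_cat A X Y) = dom2 A" "Cod (hom_cat A X Y) = cod2 A"
 "Id (hom_cat A X Y) = id2 A" "Comp (hom_cat A X Y) = vcomp A" by (auto simp: hom_cat_def Let_def)

section \<open>Calculus of 1-cells, 2-cells and whiskering\<close>

context two_category
begin

declare dom1_in [simp] cod1_in [simp] dom2_in [simp]

lemma id1_simps [simp]:
 assumes "X \<in> Obj A" shows "id1 A X \<in> Cell1 A" "dom1 A (id1 A X) = X" "cod1 A (id1 A X) = X" using id1_in[OF assms] by auto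

lemma comp1_simps [simp]:
 assumes "f \<in> Cell1 A" "g \<in> Cell1 A" "dom1 A g = cod1 A f"
 shows "g \<odot> f \<in> Cell1 A" "dom1 A (g \<odot> f) = dom1 A f" "cod1 A (g \<odot> f) = cod1 A g"
 using comp1_in[of f "dom1 A f" "cod1 A f" g "cod1 A g"] assms by auto

lemma comp1_id1' [simp]: "f \<in> Cell1 A ==> dom1 A f = X ==> f \<odot> id1 A X = f" using comp1_id1[of f X "cod1 A f"] by auto

lemma id1_comp1' [simp]: "f \<in> Cell1 A ==> cod1 A f = X ==> id1 A X \<odot> f = f" using id1_comp1[of f "dom1 A f" X] by auto

lemma comp1_assoc' [simp]:
 assumes "f \<in> Cell1 A" "g \<in> Cell1 A" "h \<in> Cell1 A" "dom1 A g = cod1 A f" "dom1 A h = cod1 A g"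
 shows "(h \<odot> g) \<odot> f = h \<odot> (g \<odot> f)" using comp1_assoc[of f "dom1 A f" "cod1 A f" g "cod1 A g" h "cod1 A h"] assms by auto

lemma cod2_simps [simp]:
 assumes "a \<in> Cell2 A" shows "cod2 A a \<in> Cell1 A" "dom1 A (cod2 A a) = dom1 A (dom2 A a)"
  "cod1 A (cod2 A a) = cod1 A (dom2 A a)"
proof -
 interpret category "hom_cat A (dom1 A (dom2 A a)) (cod1 A (dom2 A a))" using assms by (intro hom_category) auto
 show "cod2 A a \<in> Cell1 A" "dom1 A (cod2 A a) = dom1 A (dom2 A a)"
  "cod1 A (cod2 A a) = cod1 A (dom2 A a)" using Cod_in[of a] assms by auto
qed

lemma id2_simps [simp]:
 assumes "f \<in> Cell1 A" shows "id2 A f \<in> Cell2 A" "dom2 A (id2 A f) = f" "cod2 A (id2 A f) = f"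
proof -
 interpret category "hom_cat A (dom1 A f) (cod1 A f)" using assms by (intro hom_category) auto
 show "id2 A f \<in> Cell2 A" "dom2 A (id2 A f) = f" "cod2 A (id2 A f) = f" using Id_simps[of f] assms by auto
qed

lemma vcomp_simps [simp]:
 assumes "a \<in> Cell2 A" "b \<in> Cell2 A" "dom2 A b = cod2 A a"
 shows "b \<bullet> a \<in> Cell2 A" "dom2 A (b \<bullet> a) = dom2 A a" "cod2 A (b \<bullet> a) = cod2 A b"
proof -
 interpret category "hom_cat A (dom1 A (dom2 A a)) (cod1 A (dom2 A a))" using assms by (intro hom_category) auto
 show "b \<bullet> a \<in> Cell2 A" "dom2 A (b \<bullet> a) = dom2 A a" "cod2 A (b \<bullet> a) = cod2 A b" using Comp_simps[of a b] assms by auto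
qed

lemma vcomp_id2 [simp]: "a \<in> Cell2 A ==> dom2 A a = f ==> a \<bullet> id2 A f = a"
 using category.Comp_Id'[OF hom_category, of "dom1 A (dom2 A a)" "cod1 A (dom2 A a)" a f] by auto

lemma id2_vcomp [simp]: "a \<in> Cell2 A ==> cod2 A a = f ==> id2 A f \<bullet> a = a"
 using category.Id_Comp'[OF hom_category, of "dom1 A (dom2 A a)" "cod1 A (dom2 A a)" a f] by auto

lemma hcomp_simps [simp]:
 assumes "a \<in> Cell2 A" "b \<in> Cell2 A" "dom1 A (dom2 A b) = cod1 A (dom2 A a)"
 shows "b \<star> a \<in> Cell2 A" "dom2 A (b \<star> a) = dom2 A b \<odot> dom2 A a"
  "cod2 A (b \<star> a) = cod2 A b \<odot> cod2 A a" using hcomp_in[of a "dom1 A (dom2 A a)" "cod1 A (dom2 A a)" "dom2 A a" "cod2 A a"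
   b "cod1 A (dom2 A b)" "dom2 A b" "cod2 A b"] assms by (auto simp: Hom_iff)

lemma hcomp_assoc' [simp]:
 assumes "a \<in> Cell2 A" "b \<in> Cell2 A" "c \<in> Cell2 A" "dom1 A (dom2 A b) = cod1 A (dom2 A a)"
  "dom1 A (dom2 A c) = cod1 A (dom2 A b)" shows "(c \<star> b) \<star> a = c \<star> (b \<star> a)"
 using hcomp_assoc[of a "dom1 A (dom2 A a)" "cod1 A (dom2 A a)" b "cod1 A (dom2 A b)"
   c "cod1 A (dom2 A c)"] assms by auto

lemma hcomp_id2' [simp]:
 assumes "f \<in> Cell1 A" "g \<in> Cell1 A" "dom1 A g = cod1 A f" shows "id2 A g \<star> id2 A f = id2 A (g \<odot> f)"
 using hcomp_id2[of f "dom1 A f" "cod1 A f" g "cod1 A g"] assms by auto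

lemma interchange':
 assumes "a \<in> Cell2 A" "b \<in> Cell2 A" "a' \<in> Cell2 A" "b' \<in> Cell2 A"
  "dom1 A (dom2 A b) = cod1 A (dom2 A a)" "dom2 A b' = cod2 A b" "dom2 A a' = cod2 A a"
 shows "(b' \<bullet> b) \<star> (a' \<bullet> a) = (b' \<star> a') \<bullet> (b \<star> a)"
 using interchange[of a "dom1 A (dom2 A a)" "cod1 A (dom2 A a)" "dom2 A a" "cod2 A a" a' "cod2 A a'"
   b "cod1 A (dom2 A b)" "dom2 A b" "cod2 A b" b' "cod2 A b'"] assms by (auto simp: Hom_iff)

lemma vcomp_whisker_right:
 assumes "b \<in> Cell2 A" "b' \<in> Cell2 A" "f \<in> Cell1 A"
  "dom1 A (dom2 A b) = cod1 A f" "dom2 A b' = cod2 A b" shows "(b' \<bullet> b) \<star> id2 A f = (b' \<star> id2 A f) \<bullet> (b \<star> id2 A f)"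
 using interchange'[of "id2 A f" b "id2 A f" b'] assms by simp

lemma vcomp_whisker_left:
 assumes "a \<in> Cell2 A" "a' \<in> Cell2 A" "g \<in> Cell1 A"
  "dom1 A g = cod1 A (dom2 A a)" "dom2 A a' = cod2 A a" shows "id2 A g \<star> (a' \<bullet> a) = (id2 A g \<star> a') \<bullet> (id2 A g \<star> a)"
 using interchange'[of a "id2 A g" a' "id2 A g"] assms by simp

lemma hcomp_id1 [simp]:
 assumes "a \<in> Cell2 A" "dom1 A (dom2 A a) = X" shows "a \<star> id2 A (id1 A X) = a" using hcomp_id[of a X "cod1 A (dom2 A a)"] assms by auto

lemma id1_hcomp [simp]:
 assumes "a \<in> Cell2 A" "cod1 A (dom2 A a) = X" shows "id2 A (id1 A X) \<star> a = a" using id_hcomp[of a "dom1 A (dom2 A a)" X] assms by auto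

end

context two_functor
begin

declare F_ob_in [simp] F_id1 [simp]

lemma F_1_simps [simp]:
 assumes "f \<in> Cell1 A" shows "F_1 F f \<in> Cell1 B" "dom1 B (F_1 F f) = F_ob F (dom1 A f)"
  "cod1 B (F_1 F f) = F_ob F (cod1 A f)" using cat_functor.F0_in[OF F_hom, of "dom1 A f" "cod1 A f" f] assms by auto

lemma F_2_simps [simp]:
 assumes "a \<in> Cell2 A" shows "F_2 F a \<in> Cell2 B" "dom2 B (F_2 F a) = F_1 F (dom2 A a)"
  "cod2 B (F_2 F a) = F_1 F (cod2 A a)" using cat_functor.F1_simps[OF F_hom, of "dom1 A (dom2 A a)" "cod1 A (dom2 A a)" a] assms by auto

lemma F_2_id2 [simp]: "f \<in> Cell1 A ==> F_2 F (id2 A f) = id2 B (F_1 F f)"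
 using cat_functor.F1_Id[OF F_hom, of "dom1 A f" "cod1 A f" f] by auto

lemma F_2_vcomp [simp]:
 "[|a \<in> Cell2 A; b \<in> Cell2 A; dom2 A b = cod2 A a|]
  ==> F_2 F (b \<bullet>\<^bsub>A\<^esub> a) = F_2 F b \<bullet>\<^bsub>B\<^esub> F_2 F a"
 using cat_functor.F1_Comp'[OF F_hom, of "dom1 A (dom2 A a)" "cod1 A (dom2 A a)" a b] by auto

lemma F_1_comp1 [simp]:
 "[|f \<in> Cell1 A; g \<in> Cell1 A; dom1 A g = cod1 A f|]
  ==> F_1 F (g \<odot>\<^bsub>A\<^esub> f) = F_1 F g \<odot>\<^bsub>B\<^esub> F_1 F f"
 using F_comp1[of f "dom1 A f" "cod1 A f" g "cod1 A g"] by auto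

lemma F_2_hcomp [simp]:
 "[|a \<in> Cell2 A; b \<in> Cell2 A; dom1 A (dom2 A b) = cod1 A (dom2 A a)|]
  ==> F_2 F (b \<star>\<^bsub>A\<^esub> a) = F_2 F b \<star>\<^bsub>B\<^esub> F_2 F a"
 using F_hcomp[of a "dom1 A (dom2 A a)" "cod1 A (dom2 A a)" b "cod1 A (dom2 A b)"] by auto

end

section \<open>Left 2-adjoints and left biadjoints from universal arrows\<close>

locale universal_arrows = U: two_functor B A U
 for A :: "('o, 'c, 't) twocat" (structure) and B :: "('o2, 'c2, 't2) twocat" (structure) and U +
 fixes L :: "'o => 'o2" and \<eta> :: "'o => 'c"
 assumes L_in [simp]: "X \<in> Obj A ==> L X \<in> Obj B"
  and eta_in: "X \<in> Obj A ==> \<eta> X \<in> Ob (hom_cat A X (F_ob U (L X)))" and universal: "[|X \<in> Obj A; Y \<in> Obj B|]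
   ==> isomorphism_of_categories (hom_cat B (L X) Y) (hom_cat A X (F_ob U Y))
      (%h. F_1 U h \<odot>\<^bsub>A\<^esub> \<eta> X) (%\<chi>. F_2 U \<chi> \<star>\<^bsub>A\<^esub> id2 A (\<eta> X))"
begin

lemma eta_simps [simp]:
 assumes "X \<in> Obj A" shows "\<eta> X \<in> Cell1 A" "dom1 A (\<eta> X) = X" "cod1 A (\<eta> X) = F_ob U (L X)" using eta_in[OF assms] by auto

lemma ext1_unique:
 "[|X \<in> Obj A; h \<in> Cell1 B; h' \<in> Cell1 B; dom1 B h = L X; dom1 B h' = L X; cod1 B h = cod1 B h';
  F_1 U h \<odot>\<^bsub>A\<^esub> \<eta> X = F_1 U h' \<odot>\<^bsub>A\<^esub> \<eta> X|] ==> h = h'"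
 using isomorphism_of_categoriesD(1)[OF universal, of X "cod1 B h'" h h'] by auto

lemma ext2_unique:
 "[|X \<in> Obj A; \<chi> \<in> Cell2 B; \<chi>' \<in> Cell2 B; dom1 B (dom2 B \<chi>) = L X; dom1 B (dom2 B \<chi>') = L X;
  cod1 B (dom2 B \<chi>) = cod1 B (dom2 B \<chi>');
  F_2 U \<chi> \<star>\<^bsub>A\<^esub> id2 A (\<eta> X) = F_2 U \<chi>' \<star>\<^bsub>A\<^esub> id2 A (\<eta> X)|] ==> \<chi> = \<chi>'"
 using isomorphism_of_categoriesD(3)[OF universal, of X "cod1 B (dom2 B \<chi>')" \<chi> \<chi>'] by auto

text \<open>The value of the left adjoint on \<open>k\<close>: the extension of \<open>k\<close>
  followed by the unit. Existence and uniqueness come from \<open>universal\<close>.\<close>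

definition ext1 :: "'c => 'c2" where
 "ext1 k = (SOME h. h \<in> Cell1 B & dom1 B h = L (dom1 A k) & cod1 B h = L (cod1 A k) &
  F_1 U h \<odot>\<^bsub>A\<^esub> \<eta> (dom1 A k) = \<eta> (cod1 A k) \<odot>\<^bsub>A\<^esub> k)"

definition ext2 :: "'t => 't2" where
 "ext2 \<kappa> = (SOME \<chi>. \<chi> \<in> Cell2 B & dom1 B (dom2 B \<chi>) = L (dom1 A (dom2 A \<kappa>)) &
  cod1 B (dom2 B \<chi>) = L (cod1 A (dom2 A \<kappa>)) &
  F_2 U \<chi> \<star>\<^bsub>A\<^esub> id2 A (\<eta> (dom1 A (dom2 A \<kappa>))) = id2 A (\<eta> (cod1 A (dom2 A \<kappa>))) \<star>\<^bsub>A\<^esub> \<kappa>)"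

lemma ext1_simps [simp]:
 assumes "k \<in> Cell1 A" shows "ext1 k \<in> Cell1 B" "dom1 B (ext1 k) = L (dom1 A k)" "cod1 B (ext1 k) = L (cod1 A k)"
  "dom1 A k = X ==> F_1 U (ext1 k) \<odot>\<^bsub>A\<^esub> \<eta> X = \<eta> (cod1 A k) \<odot>\<^bsub>A\<^esub> k"
proof -
 have "\<exists>h. h \<in> Cell1 B & dom1 B h = L (dom1 A k) & cod1 B h = L (cod1 A k) &
  F_1 U h \<odot>\<^bsub>A\<^esub> \<eta> (dom1 A k) = \<eta> (cod1 A k) \<odot>\<^bsub>A\<^esub> k"
  using isomorphism_of_categoriesD(2)[OF universal, of "dom1 A k" "L (cod1 A k)"
    "\<eta> (cod1 A k) \<odot>\<^bsub>A\<^esub> k"] assms by auto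
 from someI_ex[OF this]
 show "ext1 k \<in> Cell1 B" "dom1 B (ext1 k) = L (dom1 A k)" "cod1 B (ext1 k) = L (cod1 A k)"
  "dom1 A k = X ==> F_1 U (ext1 k) \<odot>\<^bsub>A\<^esub> \<eta> X = \<eta> (cod1 A k) \<odot>\<^bsub>A\<^esub> k" unfolding ext1_def by blast+
qed

lemma ext2_aux:
 assumes "\<kappa> \<in> Cell2 A" shows "ext2 \<kappa> \<in> Cell2 B" "dom1 B (dom2 B (ext2 \<kappa>)) = L (dom1 A (dom2 A \<kappa>))"
  "cod1 B (dom2 B (ext2 \<kappa>)) = L (cod1 A (dom2 A \<kappa>))"
  "dom1 A (dom2 A \<kappa>) = X
   ==> F_2 U (ext2 \<kappa>) \<star>\<^bsub>A\<^esub> id2 A (\<eta> X) = id2 A (\<eta> (cod1 A (dom2 A \<kappa>))) \<star>\<^bsub>A\<^esub> \<kappa>"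
proof -
 have "\<exists>\<chi>. \<chi> \<in> Cell2 B & dom1 B (dom2 B \<chi>) = L (dom1 A (dom2 A \<kappa>)) &
  cod1 B (dom2 B \<chi>) = L (cod1 A (dom2 A \<kappa>)) &
  F_2 U \<chi> \<star>\<^bsub>A\<^esub> id2 A (\<eta> (dom1 A (dom2 A \<kappa>))) = id2 A (\<eta> (cod1 A (dom2 A \<kappa>))) \<star>\<^bsub>A\<^esub> \<kappa>"
  using isomorphism_of_categoriesD(4)[OF universal, of "dom1 A (dom2 A \<kappa>)" "L (cod1 A (dom2 A \<kappa>))"
    "id2 A (\<eta> (cod1 A (dom2 A \<kappa>))) \<star>\<^bsub>A\<^esub> \<kappa>"] assms by auto
 from someI_ex[OF this]
 show "ext2 \<kappa> \<in> Cell2 B" "dom1 B (dom2 B (ext2 \<kappa>)) = L (dom1 A (dom2 A \<kappa>))"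
  "cod1 B (dom2 B (ext2 \<kappa>)) = L (cod1 A (dom2 A \<kappa>))"
  "dom1 A (dom2 A \<kappa>) = X
   ==> F_2 U (ext2 \<kappa>) \<star>\<^bsub>A\<^esub> id2 A (\<eta> X) = id2 A (\<eta> (cod1 A (dom2 A \<kappa>))) \<star>\<^bsub>A\<^esub> \<kappa>"
  unfolding ext2_def by blast+
qed

text \<open>The 1-cells that bound the whiskered 2-cell can be read off from its defining equation;
  uniqueness of extensions then identifies the source and target of
  \<open>ext2 \<kappa>\<close>.\<close>

lemma ext2_simps [simp]:
 assumes "\<kappa> \<in> Cell2 A"
 shows "ext2 \<kappa> \<in> Cell2 B" "dom2 B (ext2 \<kappa>) = ext1 (dom2 A \<kappa>)" "cod2 B (ext2 \<kappa>) = ext1 (cod2 A \<kappa>)"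
proof -
 let ?X = "dom1 A (dom2 A \<kappa>)"
 note e = ext2_aux[OF assms]
 show "ext2 \<kappa> \<in> Cell2 B" by (rule e)
 have "dom2 A (F_2 U (ext2 \<kappa>) \<star>\<^bsub>A\<^esub> id2 A (\<eta> ?X)) = dom2 A (id2 A (\<eta> (cod1 A (dom2 A \<kappa>))) \<star>\<^bsub>A\<^esub> \<kappa>)"
  "cod2 A (F_2 U (ext2 \<kappa>) \<star>\<^bsub>A\<^esub> id2 A (\<eta> ?X)) = cod2 A (id2 A (\<eta> (cod1 A (dom2 A \<kappa>))) \<star>\<^bsub>A\<^esub> \<kappa>)"
  using e(4) by simp_all
 then show "dom2 B (ext2 \<kappa>) = ext1 (dom2 A \<kappa>)" "cod2 B (ext2 \<kappa>) = ext1 (cod2 A \<kappa>)"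
  using assms e(1-3) by (auto intro!: ext1_unique[of ?X])
qed

definition left_adjoint :: "('o, 'c, 't, 'o2, 'c2, 't2) two_functor" where
 "left_adjoint = \<lparr>F_ob = L, F_1 = ext1, F_2 = ext2\<rparr>"

lemma ext1_comp1:
 assumes "f \<in> Cell1 A" "g \<in> Cell1 A" "dom1 A g = cod1 A f" shows "ext1 (g \<odot>\<^bsub>A\<^esub> f) = ext1 g \<odot>\<^bsub>B\<^esub> ext1 f"
proof -
 \<comment> \<open>Reassociating exposes the composite of \<open>F_1 U (ext1 g)\<close> with the
   unit, to which the defining equation of \<open>ext1 g\<close> applies.\<close>
 have "F_1 U (ext1 g) \<odot>\<^bsub>A\<^esub> (\<eta> (cod1 A f) \<odot>\<^bsub>A\<^esub> f) = \<eta> (cod1 A g) \<odot>\<^bsub>A\<^esub> (g \<odot>\<^bsub>A\<^esub> f)"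
  using assms by (subst U.B.comp1_assoc'[symmetric]) auto
 then show ?thesis using assms by (intro ext1_unique[of "dom1 A f"]) auto
qed

lemma ext2_vcomp:
 assumes "a \<in> Cell2 A" "b \<in> Cell2 A" "dom2 A b = cod2 A a" shows "ext2 (b \<bullet>\<^bsub>A\<^esub> a) = ext2 b \<bullet>\<^bsub>B\<^esub> ext2 a"
 using assms by (intro ext2_unique[of "dom1 A (dom2 A a)"])
  (auto simp: ext2_aux U.B.vcomp_whisker_right U.B.vcomp_whisker_left)

lemma ext2_hcomp:
 assumes "a \<in> Cell2 A" "b \<in> Cell2 A" "dom1 A (dom2 A b) = cod1 A (dom2 A a)"
 shows "ext2 (b \<star>\<^bsub>A\<^esub> a) = ext2 b \<star>\<^bsub>B\<^esub> ext2 a"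
proof -
 have "F_2 U (ext2 b) \<star>\<^bsub>A\<^esub> (id2 A (\<eta> (cod1 A (dom2 A a))) \<star>\<^bsub>A\<^esub> a)
  = id2 A (\<eta> (cod1 A (dom2 A b))) \<star>\<^bsub>A\<^esub> (b \<star>\<^bsub>A\<^esub> a)"
  using assms by (subst U.B.hcomp_assoc'[symmetric]) (auto simp: ext2_aux)
 then show ?thesis using assms by (intro ext2_unique[of "dom1 A (dom2 A a)"]) (auto simp: ext2_aux)
qed

text \<open>Every law is an equation between extensions, so it can be checked after restriction
  along the unit.\<close>

lemma left_adjoint_two_functor: "two_functor A B left_adjoint"
proof -
 have 1: "ext2 (id2 A f) = id2 B (ext1 f)" if "f \<in> Cell1 A" for f using that by (intro ext2_unique[of "dom1 A f"]) (auto simp: ext2_aux)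
 have 2: "ext1 (id1 A X) = id1 B (L X)" if "X \<in> Obj A" for X using that by (intro ext1_unique[of X]) auto
 have 3: "cat_functor (hom_cat A X Y) (hom_cat B (L X) (L Y)) ext1 ext2"
  if "X \<in> Obj A" "Y \<in> Obj A" for X Y using that by (intro cat_functor.intro cat_functor_axioms.intro U.B.hom_category U.A.hom_category)
   (auto simp: Hom_iff 1 ext2_vcomp)
 show ?thesis by (intro two_functor.intro two_functor_axioms.intro U.A.two_category_axioms U.B.two_category_axioms)
   (auto simp: left_adjoint_def 2 3 ext1_comp1 ext2_hcomp)
qed

text \<open>The hom isomorphism is restriction along the unit, and its naturality follows from
  functoriality of \<open>U\<close> and the defining equations of \<open>ext1\<close> and
  \<open>ext2\<close>.\<close>

lemma two_adjunction:
 "two_adjunction A B left_adjoint U (%X Y h. F_1 U h \<odot>\<^bsub>A\<^esub> \<eta> X) (%X Y \<chi>. F_2 U \<chi> \<star>\<^bsub>A\<^esub> id2 A (\<eta> X))"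
proof (intro two_adjunction.intro two_adjunction_axioms.intro left_adjoint_two_functor)
 show "two_functor B A U" by unfold_locales
qed (auto simp: left_adjoint_def universal ext2_aux)

lemma left_adjoint_simps [simp]:
 "F_ob left_adjoint = L" "F_1 left_adjoint = ext1" "F_2 left_adjoint = ext2" by (simp_all add: left_adjoint_def)

end

text \<open>
 The left 2-adjoint of a 2-functor on a sub-2-category \<open>B\<close> of \<open>C\<close> is a left biadjoint of its
 extension to \<open>C\<close> as soon as the units have the weaker universal property for \<open>C\<close>.
\<close>

lemma (in universal_arrows) biadjunction:
 fixes C :: "('o2, 'c2, 't2) twocat" and F
 defines "F \<equiv> two_functor.extend left_adjoint
  (pseudofunctor.fields (%g f. id2 C (ext1 (g \<odot>\<^bsub>A\<^esub> f))) (%X. id2 C (ext1 (id1 A X))))"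
 assumes V: "two_functor C A U" and sub: "Obj B <= Obj C" "Cell1 B <= Cell1 C" "Cell2 B <= Cell2 C"
  and ops: "dom1 C = dom1 B" "cod1 C = cod1 B" "id1 C = id1 B" "comp1 C = comp1 B" "dom2 C = dom2 B"
   "cod2 C = cod2 B" "id2 C = id2 B" "vcomp C = vcomp B" "hcomp C = hcomp B" and equiv: "\<And>X Y. [|X \<in> Obj A; Y \<in> Obj C|]
   ==> equivalence_of_categories (hom_cat C (L X) Y) (hom_cat A X (F_ob U Y))
      (%h. F_1 U h \<odot>\<^bsub>A\<^esub> \<eta> X) (%\<chi>. F_2 U \<chi> \<star>\<^bsub>A\<^esub> id2 A (\<eta> X))"
 shows "biadjunction A C F U \<eta> (%f. id2 A (\<eta> (cod1 A f) \<odot>\<^bsub>A\<^esub> f))" "F_ob F = L"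
proof -
 interpret V: two_functor C A U by fact
 interpret F: two_functor A B left_adjoint by (rule left_adjoint_two_functor)
 have F_simps [simp]: "F_ob F = L" "F_1 F = ext1" "F_2 F = ext2"
  "P_comp F g f = id2 C (ext1 (g \<odot>\<^bsub>A\<^esub> f))" "P_unit F X = id2 C (ext1 (id1 A X))" for g f X
  by (simp_all add: F_def two_functor.extend_def pseudofunctor.fields_def left_adjoint_def)
 show "F_ob F = L" by simp
 have inC [simp]: "X \<in> Obj B ==> X \<in> Obj C" "f \<in> Cell1 B ==> f \<in> Cell1 C" "a \<in> Cell2 B ==> a \<in> Cell2 C"
  for X f a using sub by auto
 have iso [simp]: "is_iso (hom_cat C X Y) (id2 C f)" if "f \<in> Cell1 C" "dom1 C f = X" "cod1 C f = Y" for X Y f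
  using category.is_iso_Id[OF V.A.hom_category, of X Y f] that by auto
 have iso' [simp]: "is_iso (hom_cat A X Y) (id2 A f)" if "f \<in> Cell1 A" "dom1 A f = X" "cod1 A f = Y" for X Y f
  using category.is_iso_Id[OF U.B.hom_category, of X Y f] that by auto
 \<comment> \<open>Since \<open>ext1\<close> preserves composition and identities strictly, identity
   2-cells have the boundaries required of the constraints.\<close>
 have F': "pseudofunctor A C F" proof (intro pseudofunctor.intro pseudofunctor_axioms.intro V.A.two_category_axioms U.B.two_category_axioms)
  fix X Y assume XY: "X \<in> Obj A" "Y \<in> Obj A"
  interpret cat_functor "hom_cat A X Y" "hom_cat B (L X) (L Y)" ext1 ext2 using F.F_hom[OF XY] by simp
  show "cat_functor (hom_cat A X Y) (hom_cat C (F_ob F X) (F_ob F Y)) (F_1 F) (F_2 F)"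
   using XY by (intro cat_functor.intro cat_functor_axioms.intro U.B.hom_category V.A.hom_category)
    (auto simp: Hom_iff ops F.F_2_id2[simplified] F.F_2_vcomp[simplified])
 qed (auto simp: Iso_iff Hom_iff ops iso[simplified ops] F.F_id1[simplified] F.F_1_comp1[simplified] F.F_2_hcomp[simplified])
 have [simp]: "F_1 U (ext1 g) \<odot>\<^bsub>A\<^esub> (\<eta> (cod1 A f) \<odot>\<^bsub>A\<^esub> f) = \<eta> (cod1 A g) \<odot>\<^bsub>A\<^esub> (g \<odot>\<^bsub>A\<^esub> f)"
  if "f \<in> Cell1 A" "g \<in> Cell1 A" "dom1 A g = cod1 A f" for f g using that by (subst U.B.comp1_assoc'[symmetric]) auto
 \<comment> \<open>The naturality squares of the unit commute strictly, so identities serve as their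
   invertible fillers.\<close>
 show "biadjunction A C F U \<eta> (%f. id2 A (\<eta> (cod1 A f) \<odot>\<^bsub>A\<^esub> f))" using F' V equiv
  by (intro biadjunction.intro biadjunction_axioms.intro)
   (auto simp: Iso_iff Hom_iff ops ext2_aux)
qed

subsection \<open>The 2-category of operads\<close>

context operad
begin

declare Tgt_in [simp] Uni_in [simp] Src_Uni [simp] Tgt_Uni [simp]

lemma Src_in' [simp]: "[|a \<in> Ops T; i \<in> set (Src T a)|] ==> i \<in> Col T" using Src_in by blast

lemma composable_Mul [simp]:
 assumes "composable T b as" shows "Mul T b as \<in> Ops T" "Src T (Mul T b as) = concat (map (Src T) as)"
  "Tgt T (Mul T b as) = Tgt T b" using assms by (simp_all add: Mul_in Src_Mul Tgt_Mul)

lemma Mul_unary [simp]: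
 assumes "b \<in> Ops T" "a \<in> Ops T" "Src T b = [Tgt T a]" shows "Mul T b [a] \<in> Ops T" "Src T (Mul T b [a]) = Src T a" "Tgt T (Mul T b [a]) = Tgt T b"
 using composable_Mul[of b "[a]"] assms by (auto simp: composable_def)

lemma Mul_assoc_unary:
 assumes "composable T b as" "c \<in> Ops T" "Src T c = [Tgt T b]" shows "Mul T (Mul T c [b]) as = Mul T c [Mul T b as]"
 using Mul_assoc[of c "[b]" "[as]"] assms by (auto simp: composable_def)

lemma Mul_assoc_unary' [simp]:
 assumes "a \<in> Ops T" "b \<in> Ops T" "c \<in> Ops T" "Src T b = [Tgt T a]" "Src T c = [Tgt T b]" shows "Mul T (Mul T c [b]) [a] = Mul T c [Mul T b [a]]"
 using Mul_assoc_unary[of b "[a]" c] assms by (auto simp: composable_def)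

lemma Mul_Uni_left' [simp]: "a \<in> Ops T ==> Tgt T a = i ==> Mul T (Uni T i) [a] = a" using Mul_Uni_left by blast

lemma Mul_Uni_right' [simp]: "a \<in> Ops T ==> Src T a = [i] ==> Mul T a [Uni T i] = a" using Mul_Uni_right[of a] by simp

text \<open>The instance of associativity by which two families of unary operations, substituted one
  after the other, merge into one family. It is what composes the naturality squares of
  transformations.\<close>

lemma Mul_map_unary:
 assumes b: "b \<in> Ops T" and f: "\<And>i. i \<in> set cs ==> f i \<in> Ops T & g i \<in> Ops T & Src T (f i) = [Tgt T (g i)]"
  and s: "Src T b = map (%i. Tgt T (f i)) cs" shows "Mul T (Mul T b (map f cs)) (map g cs) = Mul T b (map (%i. Mul T (f i) [g i]) cs)"
proof -
 have "map2 (Mul T) (map f cs) (map (%i. [g i]) cs) = map (%i. Mul T (f i) [g i]) cs" for cs by (induction cs) auto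
 moreover have "concat (map (%i. [g i]) cs) = map g cs" for cs by (induction cs) auto
 moreover have "list_all2 (composable T) (map f cs) (map (%i. [g i]) cs)" using f by (auto simp: list_all2_conv_all_nth composable_def)
 moreover have "composable T b (map f cs)" using b f s by (auto simp: composable_def)
 ultimately show ?thesis using Mul_assoc[of b "map f cs" "map (%i. [g i]) cs"] by simp
qed

end

context operad_morphism
begin

declare om_dom [simp] om_cod [simp] om_col_in [simp] om_op_in [simp] om_Src [simp] om_Tgt [simp]
 om_Uni [simp] om_Mul [simp]

lemma composable_map [simp]:
 assumes "composable S b as" shows "composable T (om_op F b) (map (om_op F) as)"
proof -
 have "map (om_col F) (map (Tgt S) as) = map (om_col F) (Src S b)" using assms by (simp add: composable_def)
 then show ?thesis using assms by (auto simp: composable_def comp_def subset_iff cong: map_cong)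
qed

lemma om_Mul_unary [simp]:
 "[|b \<in> Ops S; a \<in> Ops S; Src S b = [Tgt S a]|] ==> om_op F (Mul S b [a]) = Mul T (om_op F b) [om_op F a]"
 using om_Mul[of b "[a]"] by (simp add: composable_def)

end

lemma operad_morphism_eqI:
 assumes "operad_morphism S T F" "operad_morphism S T G"
  and "\<And>i. i \<in> Col S ==> om_col F i = om_col G i" "\<And>a. a \<in> Ops S ==> om_op F a = om_op G a" shows "F = G"
proof -
 interpret F: operad_morphism S T F by fact
 interpret G: operad_morphism S T G by fact
 have "om_col F = om_col G" using F.om_col_ext G.om_col_ext assms(3) by (rule extensionalityI)
 moreover have "om_op F = om_op G" using F.om_op_ext G.om_op_ext assms(4) by (rule extensionalityI)
 ultimately show ?thesis by (intro operad_morphism.equality) simp_all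
qed

lemma om_id_morphism: "operad T ==> operad_morphism T T (om_id T)"
proof -
 assume "operad T"
 then interpret operad T .
 have *: "map (\<lambda>i \<in> Col T. i) cs = cs" if "set cs <= Col T" for cs using that by (induction cs) auto
 have **: "map (\<lambda>i \<in> Ops T. i) cs = cs" if "set cs <= Ops T" for cs using that by (induction cs) auto
 show ?thesis by unfold_locales (auto simp: om_id_def * ** Act_in composable_def Src_in Mul_in[unfolded composable_def])
qed

lemma om_comp_morphism:
 assumes "operad_morphism S T F" "operad_morphism T R G" shows "operad_morphism S R (om_comp G F)"
proof -
 interpret F: operad_morphism S T F by fact
 interpret G: operad_morphism T R G by fact
 have *: "map (compose (Col S) (om_col G) (om_col F)) cs = map (om_col G) (map (om_col F) cs)"
  if "set cs <= Col S" for cs using that by (induction cs) (auto simp: compose_def)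
 have **: "map (compose (Ops S) (om_op G) (om_op F)) cs = map (om_op G) (map (om_op F) cs)"
  if "set cs <= Ops S" for cs using that by (induction cs) (auto simp: compose_def)
 have [simp]: "arity T (om_op F a) = arity S a" if "a \<in> Ops S" for a using that by (simp add: arity_def)
 have comp: "b \<in> Ops S" "set as <= Ops S" if "composable S b as" for b as using that by (auto simp: composable_def)
 show ?thesis by unfold_locales
   (auto simp: om_comp_def compose_def[abs_def] *[unfolded compose_def] **[unfolded compose_def]
    F.om_Act G.om_Act F.S.Act_in comp)
qed

context operad_transformation
begin

declare t_at_in [simp] Src_t_at [simp] Tgt_t_at [simp]

lemma natural_unary:
 "[|a \<in> Ops S; Src S a = [i]|] ==> Mul T (t_at \<phi> (Tgt S a)) [om_op (t_src \<phi>) a] = Mul T (om_op (t_tgt \<phi>) a) [t_at \<phi> i]"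
 using t_at_natural[of a] by simp

end

lemma operad_transformation_eqI:
 assumes "operad_transformation S T \<phi>" "operad_transformation S T \<psi>"
  and "t_src \<phi> = t_src \<psi>" "t_tgt \<phi> = t_tgt \<psi>" "\<And>i. i \<in> Col S ==> t_at \<phi> i = t_at \<psi> i"
 shows "\<phi> = \<psi>"
proof -
 interpret F: operad_transformation S T \<phi> by fact
 interpret G: operad_transformation S T \<psi> by fact
 have "t_at \<phi> = t_at \<psi>" using F.t_at_ext G.t_at_ext assms(5) by (rule extensionalityI)
 then show ?thesis using assms(3,4) by (intro transformation.equality) simp_all
qed

lemma ot_id_transformation:
 assumes "operad_morphism S T F" shows "operad_transformation S T (ot_id F)"
proof -
 interpret F: operad_morphism S T F by fact
 have *: "map (\<lambda>i \<in> Col S. Uni T (om_col F i)) cs = map (Uni T) (map (om_col F) cs)"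
  if "set cs <= Col S" for cs using that by (induction cs) auto
 have nat: "Mul T (om_op F a) (map (Uni T) (map (om_col F) (Src S a))) = om_op F a" if "a \<in> Ops S" for a
  using F.T.Mul_Uni_right[of "om_op F a"] that by simp
 show ?thesis using assms by (intro operad_transformation.intro operad_transformation_axioms.intro)
   (auto simp: ot_id_def * nat F.S.Src_in simp del: map_map)
qed

text \<open>The two naturality squares are pasted, and \<open>Mul_map_unary\<close> merges the two
  families of components.\<close>

lemma ot_vcomp_transformation:
 assumes "operad_transformation S T \<phi>" "operad_transformation S T \<psi>" "t_src \<psi> = t_tgt \<phi>"
 shows "operad_transformation S T (ot_vcomp \<psi> \<phi>)"
proof -
 interpret \<phi>: operad_transformation S T \<phi> by fact
 interpret \<psi>: operad_transformation S T \<psi> by fact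
 have nat: "Mul T (Mul T (t_at \<psi> (Tgt S a)) [t_at \<phi> (Tgt S a)]) [om_op (t_src \<phi>) a] =
  Mul T (om_op (t_tgt \<psi>) a) (map (\<lambda>i \<in> Col S. Mul T (t_at \<psi> i) [t_at \<phi> i]) (Src S a))"
  if a: "a \<in> Ops S" for a
 proof -
  have c: "composable T (om_op (t_tgt \<phi>) a) (map (t_at \<phi>) (Src S a))"
   using a \<phi>.F.S.Src_in[OF a] by (auto simp: composable_def intro!: \<phi>.t_at_in)
  have "Mul T (Mul T (t_at \<psi> (Tgt S a)) [t_at \<phi> (Tgt S a)]) [om_op (t_src \<phi>) a]
   = Mul T (t_at \<psi> (Tgt S a)) [Mul T (om_op (t_tgt \<phi>) a) (map (t_at \<phi>) (Src S a))]" using a assms(3) by (simp add: \<phi>.t_at_natural)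
  also have "... = Mul T (Mul T (t_at \<psi> (Tgt S a)) [om_op (t_src \<psi>) a]) (map (t_at \<phi>) (Src S a))"
   using a assms(3) c by (simp add: \<phi>.F.T.Mul_assoc_unary)
  also have "... = Mul T (Mul T (om_op (t_tgt \<psi>) a) (map (t_at \<psi>) (Src S a))) (map (t_at \<phi>) (Src S a))"
   using a by (simp add: \<psi>.t_at_natural)
  also have "... = Mul T (om_op (t_tgt \<psi>) a) (map (%i. Mul T (t_at \<psi> i) [t_at \<phi> i]) (Src S a))"
   using a assms(3) \<phi>.F.S.Src_in[OF a] by (intro \<phi>.F.T.Mul_map_unary) auto
  also have "map (%i. Mul T (t_at \<psi> i) [t_at \<phi> i]) (Src S a) = map (\<lambda>i \<in> Col S. Mul T (t_at \<psi> i) [t_at \<phi> i]) (Src S a)"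
   using \<phi>.F.S.Src_in[OF a] by auto
  finally show ?thesis .
 qed
 show ?thesis using assms(3) \<phi>.F.operad_morphism_axioms \<psi>.G.operad_morphism_axioms
  by (intro operad_transformation.intro operad_transformation_axioms.intro)
   (auto simp: ot_vcomp_def nat simp del: \<phi>.F.T.Mul_assoc_unary')
qed

text \<open>The square of \<open>\<phi>\<close> is carried along the source of
  \<open>\<psi>\<close>, and the square of \<open>\<psi>\<close> at the image of the operation under
  the target of \<open>\<phi>\<close> is pasted to it.\<close>

lemma ot_hcomp_transformation:
 assumes "operad_transformation S T \<phi>" "operad_transformation T R \<psi>" shows "operad_transformation S R (ot_hcomp \<psi> \<phi>)"
proof -
 interpret \<phi>: operad_transformation S T \<phi> by fact
 interpret \<psi>: operad_transformation T R \<psi> by fact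
 let ?h = "%i. Mul R (t_at \<psi> (om_col (t_tgt \<phi>) i)) [om_op (t_src \<psi>) (t_at \<phi> i)]"
 have nat: "Mul R (?h (Tgt S a)) [om_op (t_src \<psi>) (om_op (t_src \<phi>) a)]
  = Mul R (om_op (t_tgt \<psi>) (om_op (t_tgt \<phi>) a)) (map (\<lambda>i \<in> Col S. ?h i) (Src S a))"
  if a: "a \<in> Ops S" for a
 proof -
  have c: "composable T (om_op (t_tgt \<phi>) a) (map (t_at \<phi>) (Src S a))"
   using a \<phi>.F.S.Src_in[OF a] by (auto simp: composable_def intro!: \<phi>.t_at_in)
  have c': "composable R (om_op (t_src \<psi>) (om_op (t_tgt \<phi>) a)) (map (om_op (t_src \<psi>)) (map (t_at \<phi>) (Src S a)))"
   using c by (rule \<psi>.F.composable_map)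
  let ?t = "t_at \<psi> (om_col (t_tgt \<phi>) (Tgt S a))"
  have "Mul R (?h (Tgt S a)) [om_op (t_src \<psi>) (om_op (t_src \<phi>) a)]
   = Mul R ?t [om_op (t_src \<psi>) (Mul T (t_at \<phi> (Tgt S a)) [om_op (t_src \<phi>) a])]" using a by simp
  also have "... = Mul R ?t [Mul R (om_op (t_src \<psi>) (om_op (t_tgt \<phi>) a)) (map (om_op (t_src \<psi>)) (map (t_at \<phi>) (Src S a)))]"
   using a c by (subst \<phi>.t_at_natural) simp_all
  also have "... = Mul R (Mul R ?t [om_op (t_src \<psi>) (om_op (t_tgt \<phi>) a)]) (map (om_op (t_src \<psi>)) (map (t_at \<phi>) (Src S a)))"
   using a c' by (simp add: \<psi>.F.T.Mul_assoc_unary)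
  also have "... = Mul R (Mul R (om_op (t_tgt \<psi>) (om_op (t_tgt \<phi>) a)) (map (%i. t_at \<psi> (om_col (t_tgt \<phi>) i)) (Src S a)))
    (map (%i. om_op (t_src \<psi>) (t_at \<phi> i)) (Src S a))" using a \<psi>.t_at_natural[of "om_op (t_tgt \<phi>) a"] by (simp add: comp_def)
  also have "... = Mul R (om_op (t_tgt \<psi>) (om_op (t_tgt \<phi>) a)) (map ?h (Src S a))"
   using a \<phi>.F.S.Src_in[OF a] by (intro \<psi>.F.T.Mul_map_unary) auto
  also have "map ?h (Src S a) = map (\<lambda>i \<in> Col S. ?h i) (Src S a)" using \<phi>.F.S.Src_in[OF a] by auto
  finally show ?thesis .
 qed
 show ?thesis using om_comp_morphism[OF \<phi>.F.operad_morphism_axioms \<psi>.F.operad_morphism_axioms]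
   om_comp_morphism[OF \<phi>.G.operad_morphism_axioms \<psi>.G.operad_morphism_axioms]
  by (intro operad_transformation.intro operad_transformation_axioms.intro)
   (auto simp: ot_hcomp_def om_comp_def compose_def nat simp del: \<psi>.F.T.Mul_assoc_unary')
qed

lemma Opd_simps [simp]:
 "Obj Opd = {T. operad T}" "Cell1 Opd = {F. operad_morphism (om_dom F) (om_cod F) F}"
 "dom1 Opd = om_dom" "cod1 Opd = om_cod" "id1 Opd = om_id" "comp1 Opd = om_comp"
 "Cell2 Opd = {\<phi>. operad_transformation (om_dom (t_src \<phi>)) (om_cod (t_src \<phi>)) \<phi>}"
 "dom2 Opd = t_src" "cod2 Opd = t_tgt" "id2 Opd = ot_id" "vcomp Opd = ot_vcomp" "hcomp Opd = ot_hcomp" by (simp_all add: Opd_def)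

lemma Opd_hom_simps:
 "F \<in> Ob (hom_cat Opd S T) \<longleftrightarrow> operad_morphism S T F"
 "\<phi> \<in> Ar (hom_cat Opd S T) \<longleftrightarrow> operad_transformation S T \<phi>"
 "\<phi> \<in> Hom (hom_cat Opd S T) F G \<longleftrightarrow> operad_transformation S T \<phi> & t_src \<phi> = F & t_tgt \<phi> = G"
proof -
 have 1: "om_dom F = S & om_cod F = T" if "operad_morphism S T F" for F :: "('a, 'b) operad_morphism" and S T
  using that by (simp add: operad_morphism.om_dom operad_morphism.om_cod)
 have 2: "operad_morphism S T (t_src \<phi>)" if "operad_transformation S T \<phi>" for \<phi> :: "('a, 'b) operad_transformation" and S T
  using that by (simp add: operad_transformation_def)
 show "F \<in> Ob (hom_cat Opd S T) \<longleftrightarrow> operad_morphism S T F" using 1[of S T F] by auto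
 show "\<phi> \<in> Ar (hom_cat Opd S T) \<longleftrightarrow> operad_transformation S T \<phi>" using 1[OF 2] 2 by auto
 then show "\<phi> \<in> Hom (hom_cat Opd S T) F G \<longleftrightarrow> operad_transformation S T \<phi> & t_src \<phi> = F & t_tgt \<phi> = G"
  by (simp add: Hom_iff)
qed

lemma Opd_hom_category:
 assumes "operad S" "operad T" shows "category (hom_cat Opd S T)"
proof -
 note [simp] = Opd_hom_simps and [simp del] = hom_cat_simps(1,2)
 have id: "ot_vcomp f (ot_id (t_src f)) = f" "ot_vcomp (ot_id (t_tgt f)) f = f"
  if "operad_transformation S T f" for f
 proof -
  interpret f: operad_transformation S T f by fact
  show "ot_vcomp f (ot_id (t_src f)) = f" "ot_vcomp (ot_id (t_tgt f)) f = f"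
   by (rule operad_transformation_eqI[where S = S and T = T], rule ot_vcomp_transformation;
     (intro ot_id_transformation f.operad_transformation_axioms f.F.operad_morphism_axioms f.G.operad_morphism_axioms)?;
     simp add: ot_vcomp_def ot_id_def)+
 qed
 have assoc: "ot_vcomp (ot_vcomp h g) f = ot_vcomp h (ot_vcomp g f)"
  if f: "operad_transformation S T f" and g: "operad_transformation S T g" and h: "operad_transformation S T h"
   and fg: "t_src g = t_tgt f" "t_src h = t_tgt g" for f g h
 proof -
  interpret f: operad_transformation S T f by fact
  interpret g: operad_transformation S T g by fact
  interpret h: operad_transformation S T h by fact
  show ?thesis using fg by (intro operad_transformation_eqI[where S = S and T = T] ot_vcomp_transformation f g h)
    (auto simp: ot_vcomp_def)
 qed
 show ?thesis
 proof
  fix f assume "f \<in> Ar (hom_cat Opd S T)"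
  then show "Dom (hom_cat Opd S T) f \<in> Ob (hom_cat Opd S T)" "Cod (hom_cat Opd S T) f \<in> Ob (hom_cat Opd S T)"
   by (simp_all add: operad_transformation_def)
 next
  fix F assume "F \<in> Ob (hom_cat Opd S T)"
  then show "Id (hom_cat Opd S T) F \<in> Hom (hom_cat Opd S T) F F" using ot_id_transformation by (simp add: ot_id_def)
 next
  fix f F G g H assume "f \<in> Hom (hom_cat Opd S T) F G" "g \<in> Hom (hom_cat Opd S T) G H"
  then show "g \<cdot>\<^bsub>hom_cat Opd S T\<^esub> f \<in> Hom (hom_cat Opd S T) F H" using ot_vcomp_transformation[of S T f g] by (auto simp: ot_vcomp_def)
 qed (auto simp: id assoc)
qed

lemma om_id_comp:
 assumes "operad_morphism S T F" shows "om_comp F (om_id S) = F" "om_comp (om_id T) F = F"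
proof -
 interpret F: operad_morphism S T F by fact
 have S: "operad S" and T: "operad T" by unfold_locales
 show "om_comp F (om_id S) = F" by (rule operad_morphism_eqI[OF om_comp_morphism[OF om_id_morphism[OF S] assms] assms])
   (auto simp: om_comp_def om_id_def compose_def)
 show "om_comp (om_id T) F = F" by (rule operad_morphism_eqI[OF om_comp_morphism[OF assms om_id_morphism[OF T]] assms])
   (auto simp: om_comp_def om_id_def compose_def)
qed

lemma om_comp_assoc:
 assumes "operad_morphism S T F" "operad_morphism T R G" "operad_morphism R Q H" shows "om_comp (om_comp H G) F = om_comp H (om_comp G F)"
proof -
 interpret F: operad_morphism S T F by fact
 interpret G: operad_morphism T R G by fact
 show ?thesis by (rule operad_morphism_eqI[where S = S and T = Q]; (intro om_comp_morphism assms)?)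
   (auto simp: om_comp_def compose_def intro: om_comp_morphism[OF _ assms(3)] om_comp_morphism[OF assms(1)] assms
    om_comp_morphism[OF assms(2,3)] om_comp_morphism[OF assms(1,2)])
qed

lemma Opd_two_category: "two_category (Opd :: (('i, 'p) operad, _, _) twocat)"
proof -
 note [simp] = Opd_hom_simps and [simp del] = hom_cat_simps(1,2)
 have hid: "ot_hcomp a (ot_id (om_id S)) = a" "ot_hcomp (ot_id (om_id T)) a = a"
  if "operad_transformation S T a" for S T :: "('i, 'p) operad" and a
 proof -
  interpret a: operad_transformation S T a by fact
  have S: "operad S" and T: "operad T" by unfold_locales
  show "ot_hcomp a (ot_id (om_id S)) = a"
   by (rule operad_transformation_eqI[OF ot_hcomp_transformation[OF ot_id_transformation[OF om_id_morphism[OF S]] that] that])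
    (auto simp: ot_hcomp_def ot_id_def om_id_comp[OF a.F.operad_morphism_axioms] om_id_comp[OF a.G.operad_morphism_axioms],
    auto simp: om_id_def)
  show "ot_hcomp (ot_id (om_id T)) a = a"
   by (rule operad_transformation_eqI[OF ot_hcomp_transformation[OF that ot_id_transformation[OF om_id_morphism[OF T]]] that])
    (auto simp: ot_hcomp_def ot_id_def om_id_comp[OF a.F.operad_morphism_axioms] om_id_comp[OF a.G.operad_morphism_axioms],
    auto simp: om_id_def)
 qed
 have hassoc: "ot_hcomp (ot_hcomp c b) a = ot_hcomp c (ot_hcomp b a)"
  if a: "operad_transformation S T a" and b: "operad_transformation T R b" and c: "operad_transformation R Q c"
  for S T R Q :: "('i, 'p) operad" and a b c
 proof -
  interpret a: operad_transformation S T a by fact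
  interpret b: operad_transformation T R b by fact
  interpret c: operad_transformation R Q c by fact
  show ?thesis by (rule operad_transformation_eqI[OF ot_hcomp_transformation[OF a ot_hcomp_transformation[OF b c]]
      ot_hcomp_transformation[OF ot_hcomp_transformation[OF a b] c]])
    (auto simp: ot_hcomp_def om_comp_assoc[OF a.F.operad_morphism_axioms b.F.operad_morphism_axioms c.F.operad_morphism_axioms]
     om_comp_assoc[OF a.G.operad_morphism_axioms b.G.operad_morphism_axioms c.G.operad_morphism_axioms],
    auto simp: om_comp_def compose_def)
 qed
 have hids: "ot_hcomp (ot_id g) (ot_id f) = ot_id (om_comp g f)"
  if f: "operad_morphism S T f" and g: "operad_morphism T R g" for S T R :: "('i, 'p) operad" and f g
 proof -
  interpret f: operad_morphism S T f by fact
  interpret g: operad_morphism T R g by fact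
  show ?thesis by (rule operad_transformation_eqI[OF ot_hcomp_transformation[OF ot_id_transformation[OF f] ot_id_transformation[OF g]]
    ot_id_transformation[OF om_comp_morphism[OF f g]]])
    (auto simp: ot_hcomp_def ot_id_def om_comp_def compose_def)
 qed
 have inter: "ot_hcomp (ot_vcomp b' b) (ot_vcomp a' a) = ot_vcomp (ot_hcomp b' a') (ot_hcomp b a)"
  if a: "operad_transformation S T a" and a': "operad_transformation S T a'" "t_src a' = t_tgt a"
   and b: "operad_transformation T R b" and b': "operad_transformation T R b'" "t_src b' = t_tgt b"
  for S T R :: "('i, 'p) operad" and a a' b b'
 proof -
  interpret a: operad_transformation S T a by fact
  interpret b: operad_transformation T R b by fact
  interpret a': operad_transformation S T a' by fact
  interpret b': operad_transformation T R b' by fact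
  \<comment> \<open>Interchange reduces to naturality of \<open>b\<close> at the unary operation
    \<open>t_at a' i\<close>.\<close>
  have *: "Mul R (t_at b (om_col (t_tgt a') i)) [Mul R (om_op (t_src b) (t_at a' i)) [om_op (t_src b) (t_at a i)]]
   = Mul R (om_op (t_tgt b) (t_at a' i)) [Mul R (t_at b (om_col (t_tgt a) i)) [om_op (t_src b) (t_at a i)]]"
   if i: "i \<in> Col S" for i
  proof -
   have n: "Mul R (t_at b (om_col (t_tgt a') i)) [om_op (t_src b) (t_at a' i)] =
    Mul R (om_op (t_tgt b) (t_at a' i)) [t_at b (om_col (t_tgt a) i)]" using b.natural_unary[of "t_at a' i"] i a'(2) by simp
   have "Mul R (Mul R (t_at b (om_col (t_tgt a') i)) [om_op (t_src b) (t_at a' i)]) [om_op (t_src b) (t_at a i)] =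
    Mul R (Mul R (om_op (t_tgt b) (t_at a' i)) [t_at b (om_col (t_tgt a) i)]) [om_op (t_src b) (t_at a i)]" by (simp only: n)
   then show ?thesis using i a'(2) by simp
  qed
  have h: "operad_transformation S R (ot_hcomp b a)" "operad_transformation S R (ot_hcomp b' a')"
   "operad_transformation S T (ot_vcomp a' a)" "operad_transformation T R (ot_vcomp b' b)"
   using a a' b b' by (auto intro: ot_hcomp_transformation ot_vcomp_transformation)
  have l: "operad_transformation S R (ot_vcomp (ot_hcomp b' a') (ot_hcomp b a))" using a'(2) b'(2) by (intro ot_vcomp_transformation h) (simp add: ot_hcomp_def)
  show ?thesis by (rule operad_transformation_eqI[OF ot_hcomp_transformation[OF h(3,4)] l])
   (use a'(2) b'(2) in \<open>auto simp: ot_hcomp_def ot_vcomp_def om_comp_def compose_def *\<close>)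
 qed
 have dom: "operad (om_dom f)" "operad (om_cod f)"
  if "operad_morphism (om_dom f) (om_cod f) f" for f :: "('i, 'p) operad_morphism" using that by (auto simp: operad_morphism_def)
 have h12: "ot_hcomp b a \<in> Hom (hom_cat Opd X Z) (om_comp g f) (om_comp g' f')"
  if "a \<in> Hom (hom_cat Opd X Y) f f'" "b \<in> Hom (hom_cat Opd Y Z) g g'" for X Y Z :: "('i, 'p) operad" and a b f f' g g'
  using that ot_hcomp_transformation[of X Y a Z b] by (auto simp: ot_hcomp_def)
 have dom2: "operad_morphism (om_dom (t_src a)) (om_cod (t_src a)) (t_src a)"
  if "operad_transformation (om_dom (t_src a)) (om_cod (t_src a)) a" for a :: "('i, 'p) operad_transformation"
  using that by (simp add: operad_transformation_def)
 show ?thesis by (intro two_category.intro)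
   (simp_all add: dom dom2 om_id_morphism om_comp_morphism om_id_comp om_comp_assoc Opd_hom_category
    hid hassoc hids inter h12[simplified])
qed

subsection \<open>The 2-categories of symmetric monoidal categories\<close>

context category
begin

text \<open>Lets an equation between two-fold composites rewrite the head of a longer composite,
  which right association would otherwise hide from simplification.\<close>

lemma comp_head2:
 assumes "x \<cdot> y = z \<cdot> w" "x \<in> Ar C" "y \<in> Ar C" "z \<in> Ar C" "w \<in> Ar C" "k \<in> Ar C"
  "Dom C x = Cod C y" "Dom C z = Cod C w" "Cod C k = Dom C y" shows "x \<cdot> (y \<cdot> k) = z \<cdot> (w \<cdot> k)"
proof -
 have "Dom C (x \<cdot> y) = Dom C (z \<cdot> w)" using assms(1) by simp
 then have "Dom C y = Dom C w" using assms(2-) by simp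
 then show ?thesis using assms Comp_assoc'[of k y x] Comp_assoc'[of k w z] by simp
qed

end

context symmetric_monoidal_category
begin

declare Tob_in [simp] Unit_in [simp] Tar_Id [simp]

lemma Tar_simps [simp]:
 assumes "f \<in> Ar V" "g \<in> Ar V"
 shows "f \<boxtimes> g \<in> Ar V" "Dom V (f \<boxtimes> g) = Dom V f \<otimes> Dom V g" "Cod V (f \<boxtimes> g) = Cod V f \<otimes> Cod V g"
 using Tar_in[of f "Dom V f" "Cod V f" g "Dom V g" "Cod V g"] assms by (auto simp: Hom_iff)

text \<open>Oriented against \<open>Tar_Comp\<close>, so that a composite of tensor products is
  merged into one tensor product. The next lemma is the same rule at the head of a longer
  composite.\<close>

lemma interchange:
 assumes "f \<in> Ar V" "g \<in> Ar V" "f' \<in> Ar V" "g' \<in> Ar V" "Dom V g = Cod V f" "Dom V g' = Cod V f'"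
 shows "(g \<boxtimes> g') \<cdot> (f \<boxtimes> f') = (g \<cdot> f) \<boxtimes> (g' \<cdot> f')"
 using Tar_Comp[of f "Dom V f" "Cod V f" g "Cod V g" f' "Dom V f'" "Cod V f'" g' "Cod V g'"] assms by (simp add: Hom_iff)

lemma interchange_assoc:
 assumes "f \<in> Ar V" "g \<in> Ar V" "f' \<in> Ar V" "g' \<in> Ar V" "Dom V g = Cod V f" "Dom V g' = Cod V f'"
  "h \<in> Ar V" "Cod V h = Dom V f \<otimes> Dom V f'"
 shows "(g \<boxtimes> g') \<cdot> ((f \<boxtimes> f') \<cdot> h) = ((g \<cdot> f) \<boxtimes> (g' \<cdot> f')) \<cdot> h"
 using Comp_assoc'[of h "f \<boxtimes> f'" "g \<boxtimes> g'"] assms by (simp add: interchange)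

lemma coherence_simps [simp]: shows "[|A \<in> Ob V; B \<in> Ob V; C \<in> Ob V|] ==> Assoc V A B C \<in> Ar V"
  and "[|A \<in> Ob V; B \<in> Ob V; C \<in> Ob V|] ==> Dom V (Assoc V A B C) = (A \<otimes> B) \<otimes> C"
  and "[|A \<in> Ob V; B \<in> Ob V; C \<in> Ob V|] ==> Cod V (Assoc V A B C) = A \<otimes> (B \<otimes> C)"
  and "[|A \<in> Ob V; B \<in> Ob V; C \<in> Ob V|] ==> is_iso V (Assoc V A B C)"
  and "A \<in> Ob V ==> Lunit V A \<in> Ar V" and "A \<in> Ob V ==> Dom V (Lunit V A) = \<one> \<otimes> A"
  and "A \<in> Ob V ==> Cod V (Lunit V A) = A" and "A \<in> Ob V ==> is_iso V (Lunit V A)"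
  and "A \<in> Ob V ==> Runit V A \<in> Ar V" and "A \<in> Ob V ==> Dom V (Runit V A) = A \<otimes> \<one>"
  and "A \<in> Ob V ==> Cod V (Runit V A) = A" and "A \<in> Ob V ==> is_iso V (Runit V A)"
  and "[|A \<in> Ob V; B \<in> Ob V|] ==> Braid V A B \<in> Ar V"
  and "[|A \<in> Ob V; B \<in> Ob V|] ==> Dom V (Braid V A B) = A \<otimes> B"
  and "[|A \<in> Ob V; B \<in> Ob V|] ==> Cod V (Braid V A B) = B \<otimes> A"
 using Assoc_iso[of A B C] Lunit_iso[of A] Runit_iso[of A] Braid_in[of A B] by (auto simp: Iso_iff Hom_iff)

declare Braid_Braid [simp]

lemma Braid_iso [simp]: "[|A \<in> Ob V; B \<in> Ob V|] ==> is_iso V (Braid V A B)"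
 and Inv_Braid [simp]: "[|A \<in> Ob V; B \<in> Ob V|] ==> Inv V (Braid V A B) = Braid V B A"
 using is_isoI[of "Braid V A B" "Braid V B A"] by auto

lemma Tar_iso [simp]:
 assumes "is_iso V f" "is_iso V g" shows "is_iso V (f \<boxtimes> g)" "Inv V (f \<boxtimes> g) = Inv V f \<boxtimes> Inv V g"
 using is_isoI[of "f \<boxtimes> g" "Inv V f \<boxtimes> Inv V g"] assms is_iso_Ar[of f] is_iso_Ar[of g] by (auto simp: interchange)

lemma Assoc_nat:
 "[|f \<in> Ar V; g \<in> Ar V; h \<in> Ar V; A = Cod V f; B = Cod V g; C = Cod V h|]
  ==> Assoc V A B C \<cdot> ((f \<boxtimes> g) \<boxtimes> h) = (f \<boxtimes> (g \<boxtimes> h)) \<cdot> Assoc V (Dom V f) (Dom V g) (Dom V h)"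
 using Assoc_natural[of f "Dom V f" A g "Dom V g" B h "Dom V h" C] by (simp add: Hom_iff)

lemma Lunit_nat: "[|f \<in> Ar V; B = Cod V f|] ==> Lunit V B \<cdot> (Id V \<one> \<boxtimes> f) = f \<cdot> Lunit V (Dom V f)"
 using Lunit_natural[of f "Dom V f" B] by (simp add: Hom_iff)

lemma Runit_nat: "[|f \<in> Ar V; B = Cod V f|] ==> Runit V B \<cdot> (f \<boxtimes> Id V \<one>) = f \<cdot> Runit V (Dom V f)"
 using Runit_natural[of f "Dom V f" B] by (simp add: Hom_iff)

lemma Braid_nat:
 "[|f \<in> Ar V; g \<in> Ar V; A = Cod V f; B = Cod V g|]
  ==> Braid V A B \<cdot> (f \<boxtimes> g) = (g \<boxtimes> f) \<cdot> Braid V (Dom V f) (Dom V g)"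
 using Braid_natural[of f "Dom V f" A g "Dom V g" B] by (simp add: Hom_iff)

end

context symmetric_strong_monoidal_functor
begin

declare sm_dom [simp] sm_cod [simp]

lemma sm_simps [simp]: shows "[|A \<in> Ob V; B \<in> Ob V|] ==> sm_mu F (A, B) \<in> Ar W"
  and "[|A \<in> Ob V; B \<in> Ob V|] ==> Dom W (sm_mu F (A, B)) = sm_ob F A \<otimes>\<^bsub>W\<^esub> sm_ob F B"
  and "[|A \<in> Ob V; B \<in> Ob V|] ==> Cod W (sm_mu F (A, B)) = sm_ob F (A \<otimes>\<^bsub>V\<^esub> B)"
  and "[|A \<in> Ob V; B \<in> Ob V|] ==> is_iso W (sm_mu F (A, B))"
  and "sm_eta F \<in> Ar W" and "Dom W (sm_eta F) = \<one>\<^bsub>W\<^esub>" and "Cod W (sm_eta F) = sm_ob F \<one>\<^bsub>V\<^esub>" and "is_iso W (sm_eta F)"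
 using sm_mu_iso[of A B] sm_eta_iso by (auto simp: Iso_iff)

lemma mu_nat:
 "[|f \<in> Ar V; g \<in> Ar V; A = Cod V f; B = Cod V g|]
  ==> sm_mu F (A, B) \<cdot>\<^bsub>W\<^esub> (sm_ar F f \<boxtimes>\<^bsub>W\<^esub> sm_ar F g)
   = sm_ar F (f \<boxtimes>\<^bsub>V\<^esub> g) \<cdot>\<^bsub>W\<^esub> sm_mu F (Dom V f, Dom V g)"
 using sm_mu_natural[of f "Dom V f" A g "Dom V g" B] by (simp add: Hom_iff)

lemma assoc_mu:
 "[|A \<in> Ob V; B \<in> Ob V; C \<in> Ob V|]
  ==> sm_ar F (Assoc V A B C) \<cdot>\<^bsub>W\<^esub> (sm_mu F (A \<otimes>\<^bsub>V\<^esub> B, C) \<cdot>\<^bsub>W\<^esub> (sm_mu F (A, B) \<boxtimes>\<^bsub>W\<^esub> Id W (sm_ob F C)))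
   = sm_mu F (A, B \<otimes>\<^bsub>V\<^esub> C) \<cdot>\<^bsub>W\<^esub> ((Id W (sm_ob F A) \<boxtimes>\<^bsub>W\<^esub> sm_mu F (B, C))
      \<cdot>\<^bsub>W\<^esub> Assoc W (sm_ob F A) (sm_ob F B) (sm_ob F C))" using sm_assoc[of A B C] by simp

lemma lunit_mu:
 "A \<in> Ob V ==> sm_ar F (Lunit V A) \<cdot>\<^bsub>W\<^esub> (sm_mu F (\<one>\<^bsub>V\<^esub>, A) \<cdot>\<^bsub>W\<^esub> (sm_eta F \<boxtimes>\<^bsub>W\<^esub> Id W (sm_ob F A)))
  = Lunit W (sm_ob F A)" using sm_lunit[of A] by simp

lemma runit_mu:
 "A \<in> Ob V ==> sm_ar F (Runit V A) \<cdot>\<^bsub>W\<^esub> (sm_mu F (A, \<one>\<^bsub>V\<^esub>) \<cdot>\<^bsub>W\<^esub> (Id W (sm_ob F A) \<boxtimes>\<^bsub>W\<^esub> sm_eta F))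
  = Runit W (sm_ob F A)" using sm_runit[of A] by simp

end

lemma sm_functor_eqI:
 assumes "symmetric_strong_monoidal_functor V W F" "symmetric_strong_monoidal_functor V W G"
  and "\<And>A. A \<in> Ob V ==> sm_ob F A = sm_ob G A" "\<And>f. f \<in> Ar V ==> sm_ar F f = sm_ar G f"
  and "\<And>A B. [|A \<in> Ob V; B \<in> Ob V|] ==> sm_mu F (A, B) = sm_mu G (A, B)" "sm_eta F = sm_eta G" shows "F = G"
proof -
 interpret F: symmetric_strong_monoidal_functor V W F by fact
 interpret G: symmetric_strong_monoidal_functor V W G by fact
 have "sm_ob F = sm_ob G" using F.sm_ob_ext G.sm_ob_ext assms(3) by (rule extensionalityI)
 moreover have "sm_ar F = sm_ar G" using F.sm_ar_ext G.sm_ar_ext assms(4) by (rule extensionalityI)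
 moreover have "sm_mu F = sm_mu G" using F.sm_mu_ext G.sm_mu_ext by (rule extensionalityI) (auto simp: assms(5))
 ultimately show ?thesis using assms(6) by (intro sm_functor.equality) simp_all
qed

lemma sm_id_functor:
 assumes "symmetric_monoidal_category V" shows "symmetric_strong_monoidal_functor V V (sm_id V)"
proof -
 interpret symmetric_monoidal_category V by fact
 show ?thesis by unfold_locales (auto simp: sm_id_def Hom_iff Iso_iff Id_in[unfolded Hom_iff])
qed

lemma sm_comp_functor:
 assumes "symmetric_strong_monoidal_functor V W F" "symmetric_strong_monoidal_functor W X G" shows "symmetric_strong_monoidal_functor V X (sm_comp G F)"
proof -
 interpret F: symmetric_strong_monoidal_functor V W F by fact
 interpret G: symmetric_strong_monoidal_functor W X G by fact
 \<comment> \<open>The composition law of \<open>G\<close> is reversed, so that arrows in its image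
   are collected under one application of \<open>sm_ar G\<close>, where the laws of \<open>F\<close>
   apply.\<close>
 note [simp] = G.F1_Comp'[symmetric] and [simp del] = G.F1_Comp'
 have ob: "sm_ob (sm_comp G F) A = sm_ob G (sm_ob F A)" if "A \<in> Ob V" for A using that by (simp add: sm_comp_def compose_def)
 have ar: "sm_ar (sm_comp G F) f = sm_ar G (sm_ar F f)" if "f \<in> Ar V" for f using that by (simp add: sm_comp_def compose_def)
 have mu: "sm_mu (sm_comp G F) (A, B) = sm_ar G (sm_mu F (A, B)) \<cdot>\<^bsub>X\<^esub> sm_mu G (sm_ob F A, sm_ob F B)"
  if "A \<in> Ob V" "B \<in> Ob V" for A B using that by (simp add: sm_comp_def)
 have eta: "sm_eta (sm_comp G F) = sm_ar G (sm_eta F) \<cdot>\<^bsub>X\<^esub> sm_eta G" by (simp add: sm_comp_def)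
 have head: "sm_ar G f \<cdot>\<^bsub>X\<^esub> (sm_ar G g \<cdot>\<^bsub>X\<^esub> k) = sm_ar G (f \<cdot>\<^bsub>W\<^esub> g) \<cdot>\<^bsub>X\<^esub> k"
  if "f \<in> Ar W" "g \<in> Ar W" "Dom W f = Cod W g" "k \<in> Ar X" "Cod X k = sm_ob G (Dom W g)" for f g k
  using that G.W.Comp_assoc'[of k "sm_ar G g" "sm_ar G f"] by simp
 note comps = ob ar mu eta
 have cf: "cat_functor V X (sm_ob (sm_comp G F)) (sm_ar (sm_comp G F))" by unfold_locales (auto simp: comps Hom_iff)
 then interpret GF: cat_functor V X "sm_ob (sm_comp G F)" "sm_ar (sm_comp G F)" .
 have nat: "sm_mu (sm_comp G F) (A', B') \<cdot>\<^bsub>X\<^esub> (sm_ar (sm_comp G F) f \<boxtimes>\<^bsub>X\<^esub> sm_ar (sm_comp G F) g)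
    = sm_ar (sm_comp G F) (f \<boxtimes>\<^bsub>V\<^esub> g) \<cdot>\<^bsub>X\<^esub> sm_mu (sm_comp G F) (A, B)"
  if "f \<in> Hom V A A'" "g \<in> Hom V B B'" for f g A A' B B' using that by (auto simp: Hom_iff comps G.mu_nat F.mu_nat head)
 have "sm_ar (sm_comp G F) (Assoc V A B C) \<cdot>\<^bsub>X\<^esub> sm_mu (sm_comp G F) (A \<otimes>\<^bsub>V\<^esub> B, C)
      \<cdot>\<^bsub>X\<^esub> (sm_mu (sm_comp G F) (A, B) \<boxtimes>\<^bsub>X\<^esub> Id X (sm_ob (sm_comp G F) C))
    = sm_mu (sm_comp G F) (A, B \<otimes>\<^bsub>V\<^esub> C) \<cdot>\<^bsub>X\<^esub> (Id X (sm_ob (sm_comp G F) A) \<boxtimes>\<^bsub>X\<^esub> sm_mu (sm_comp G F) (B, C))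
      \<cdot>\<^bsub>X\<^esub> Assoc X (sm_ob (sm_comp G F) A) (sm_ob (sm_comp G F) B) (sm_ob (sm_comp G F) C)"
  if [simp]: "A \<in> Ob V" "B \<in> Ob V" "C \<in> Ob V" for A B C
 proof -
  let ?a = "sm_ob F A" and ?b = "sm_ob F B" and ?c = "sm_ob F C"
  \<comment> \<open>Splits off the factor in the image of \<open>G\<close>, which can then pass
    through \<open>sm_mu G\<close> by naturality.\<close>
  have split: "(sm_ar G f \<cdot>\<^bsub>X\<^esub> g) \<boxtimes>\<^bsub>X\<^esub> Id X (sm_ob G R) = (sm_ar G f \<boxtimes>\<^bsub>X\<^esub> sm_ar G (Id W R)) \<cdot>\<^bsub>X\<^esub> (g \<boxtimes>\<^bsub>X\<^esub> Id X (sm_ob G R))"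
   "Id X (sm_ob G R) \<boxtimes>\<^bsub>X\<^esub> (sm_ar G f \<cdot>\<^bsub>X\<^esub> g) = (sm_ar G (Id W R) \<boxtimes>\<^bsub>X\<^esub> sm_ar G f) \<cdot>\<^bsub>X\<^esub> (Id X (sm_ob G R) \<boxtimes>\<^bsub>X\<^esub> g)"
   if "f \<in> Ar W" "g \<in> Ar X" "sm_ob G (Dom W f) = Cod X g" "R \<in> Ob W" for f g R using that by (simp_all add: G.W.interchange)
  note nats = G.W.comp_head2[OF G.mu_nat]
  \<comment> \<open>Naturality of \<open>sm_mu G\<close> collects all the coherence of
    \<open>F\<close> under \<open>sm_ar G\<close>. The associativity law of \<open>F\<close> applies
    there, and that of \<open>G\<close> to the remaining factor.\<close>
  have "sm_ar (sm_comp G F) (Assoc V A B C) \<cdot>\<^bsub>X\<^esub> (sm_mu (sm_comp G F) (A \<otimes>\<^bsub>V\<^esub> B, C)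
      \<cdot>\<^bsub>X\<^esub> (sm_mu (sm_comp G F) (A, B) \<boxtimes>\<^bsub>X\<^esub> Id X (sm_ob (sm_comp G F) C)))
   = sm_ar G (sm_ar F (Assoc V A B C) \<cdot>\<^bsub>W\<^esub> (sm_mu F (A \<otimes>\<^bsub>V\<^esub> B, C) \<cdot>\<^bsub>W\<^esub> (sm_mu F (A, B) \<boxtimes>\<^bsub>W\<^esub> Id W ?c)))
     \<cdot>\<^bsub>X\<^esub> (sm_mu G (?a \<otimes>\<^bsub>W\<^esub> ?b, ?c) \<cdot>\<^bsub>X\<^esub> (sm_mu G (?a, ?b) \<boxtimes>\<^bsub>X\<^esub> Id X (sm_ob G ?c)))"
   by (simp add: comps split nats head del: G.F1_Id)
  also have "... = sm_ar G (sm_mu F (A, B \<otimes>\<^bsub>V\<^esub> C) \<cdot>\<^bsub>W\<^esub> (Id W ?a \<boxtimes>\<^bsub>W\<^esub> sm_mu F (B, C)))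
     \<cdot>\<^bsub>X\<^esub> (sm_ar G (Assoc W ?a ?b ?c) \<cdot>\<^bsub>X\<^esub> (sm_mu G (?a \<otimes>\<^bsub>W\<^esub> ?b, ?c) \<cdot>\<^bsub>X\<^esub> (sm_mu G (?a, ?b) \<boxtimes>\<^bsub>X\<^esub> Id X (sm_ob G ?c))))"
   by (simp add: F.assoc_mu head)
  also have "... = sm_ar G (sm_mu F (A, B \<otimes>\<^bsub>V\<^esub> C) \<cdot>\<^bsub>W\<^esub> (Id W ?a \<boxtimes>\<^bsub>W\<^esub> sm_mu F (B, C)))
     \<cdot>\<^bsub>X\<^esub> (sm_mu G (?a, ?b \<otimes>\<^bsub>W\<^esub> ?c) \<cdot>\<^bsub>X\<^esub> ((Id X (sm_ob G ?a) \<boxtimes>\<^bsub>X\<^esub> sm_mu G (?b, ?c)) \<cdot>\<^bsub>X\<^esub> Assoc X (sm_ob G ?a) (sm_ob G ?b) (sm_ob G ?c)))"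
   by (simp only: G.assoc_mu F.F0_in that)
  also have "... = sm_mu (sm_comp G F) (A, B \<otimes>\<^bsub>V\<^esub> C) \<cdot>\<^bsub>X\<^esub> ((Id X (sm_ob (sm_comp G F) A) \<boxtimes>\<^bsub>X\<^esub> sm_mu (sm_comp G F) (B, C))
      \<cdot>\<^bsub>X\<^esub> Assoc X (sm_ob (sm_comp G F) A) (sm_ob (sm_comp G F) B) (sm_ob (sm_comp G F) C))"
   by (simp add: comps split nats head del: G.F1_Id)
  finally show ?thesis by (simp add: comps)
 qed
 moreover have "sm_ar (sm_comp G F) (Lunit V A) \<cdot>\<^bsub>X\<^esub> sm_mu (sm_comp G F) (\<one>\<^bsub>V\<^esub>, A) \<cdot>\<^bsub>X\<^esub> (sm_eta (sm_comp G F) \<boxtimes>\<^bsub>X\<^esub> Id X (sm_ob (sm_comp G F) A))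
    = Lunit X (sm_ob (sm_comp G F) A)" if [simp]: "A \<in> Ob V" for A
 proof -
  have "(sm_ar G (sm_eta F) \<cdot>\<^bsub>X\<^esub> sm_eta G) \<boxtimes>\<^bsub>X\<^esub> Id X (sm_ob G (sm_ob F A))
   = (sm_ar G (sm_eta F) \<boxtimes>\<^bsub>X\<^esub> sm_ar G (Id W (sm_ob F A))) \<cdot>\<^bsub>X\<^esub> (sm_eta G \<boxtimes>\<^bsub>X\<^esub> Id X (sm_ob G (sm_ob F A)))"
   by (simp add: G.W.interchange)
  then show ?thesis using G.lunit_mu[of "sm_ob F A"] F.lunit_mu[of A] by (simp add: comps G.W.comp_head2[OF G.mu_nat] head del: G.F1_Id)
 qed
 moreover have "sm_ar (sm_comp G F) (Runit V A) \<cdot>\<^bsub>X\<^esub> sm_mu (sm_comp G F) (A, \<one>\<^bsub>V\<^esub>) \<cdot>\<^bsub>X\<^esub> (Id X (sm_ob (sm_comp G F) A) \<boxtimes>\<^bsub>X\<^esub> sm_eta (sm_comp G F))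
    = Runit X (sm_ob (sm_comp G F) A)" if [simp]: "A \<in> Ob V" for A
 proof -
  have "Id X (sm_ob G (sm_ob F A)) \<boxtimes>\<^bsub>X\<^esub> (sm_ar G (sm_eta F) \<cdot>\<^bsub>X\<^esub> sm_eta G)
   = (sm_ar G (Id W (sm_ob F A)) \<boxtimes>\<^bsub>X\<^esub> sm_ar G (sm_eta F)) \<cdot>\<^bsub>X\<^esub> (Id X (sm_ob G (sm_ob F A)) \<boxtimes>\<^bsub>X\<^esub> sm_eta G)"
   by (simp add: G.W.interchange)
  then show ?thesis using G.runit_mu[of "sm_ob F A"] F.runit_mu[of A] by (simp add: comps G.W.comp_head2[OF G.mu_nat] head del: G.F1_Id)
 qed
 moreover have "sm_ar (sm_comp G F) (Braid V A B) \<cdot>\<^bsub>X\<^esub> sm_mu (sm_comp G F) (A, B)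
    = sm_mu (sm_comp G F) (B, A) \<cdot>\<^bsub>X\<^esub> Braid X (sm_ob (sm_comp G F) A) (sm_ob (sm_comp G F) B)"
  if [simp]: "A \<in> Ob V" "B \<in> Ob V" for A B using G.sm_braid[of "sm_ob F A" "sm_ob F B", symmetric] by (simp add: comps head F.sm_braid)
 ultimately show ?thesis using nat cf by (intro symmetric_strong_monoidal_functor.intro symmetric_strong_monoidal_functor_axioms.intro
    F.V.symmetric_monoidal_category_axioms G.W.symmetric_monoidal_category_axioms)
   (auto simp: comps Iso_iff G.W.Inv_Comp G.F1_iso,
   auto simp: sm_comp_def)
qed

lemma sm_comp_simps:
 assumes "symmetric_strong_monoidal_functor V W F" "symmetric_strong_monoidal_functor W X G"
 shows "A \<in> Ob V ==> sm_ob (sm_comp G F) A = sm_ob G (sm_ob F A)"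
  and "f \<in> Ar V ==> sm_ar (sm_comp G F) f = sm_ar G (sm_ar F f)"
  and "[|A \<in> Ob V; B \<in> Ob V|] ==> sm_mu (sm_comp G F) (A, B) = sm_ar G (sm_mu F (A, B)) \<cdot>\<^bsub>X\<^esub> sm_mu G (sm_ob F A, sm_ob F B)"
  and "sm_eta (sm_comp G F) = sm_ar G (sm_eta F) \<cdot>\<^bsub>X\<^esub> sm_eta G"
 using assms symmetric_strong_monoidal_functor.sm_dom[of V W F] symmetric_strong_monoidal_functor.sm_cod[of W X G] by (auto simp: sm_comp_def compose_def)

context monoidal_transformation
begin

lemma at_simps [simp]:
 assumes "A \<in> Ob V" shows "t_at \<phi> A \<in> Ar W" "Dom W (t_at \<phi> A) = sm_ob (t_src \<phi>) A" "Cod W (t_at \<phi> A) = sm_ob (t_tgt \<phi>) A"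
 using mt_at_in[OF assms] by (auto simp: Hom_iff)

lemma at_nat:
 "[|f \<in> Ar V; B = Cod V f|] ==> t_at \<phi> B \<cdot>\<^bsub>W\<^esub> sm_ar (t_src \<phi>) f = sm_ar (t_tgt \<phi>) f \<cdot>\<^bsub>W\<^esub> t_at \<phi> (Dom V f)"
 using mt_natural[of f "Dom V f" B] by (simp add: Hom_iff)

end

lemma monoidal_transformation_eqI:
 assumes "monoidal_transformation V W \<phi>" "monoidal_transformation V W \<psi>"
  and "t_src \<phi> = t_src \<psi>" "t_tgt \<phi> = t_tgt \<psi>" "\<And>A. A \<in> Ob V ==> t_at \<phi> A = t_at \<psi> A"
 shows "\<phi> = \<psi>"
proof -
 interpret F: monoidal_transformation V W \<phi> by fact
 interpret G: monoidal_transformation V W \<psi> by fact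
 have "t_at \<phi> = t_at \<psi>" using F.mt_at_ext G.mt_at_ext assms(5) by (rule extensionalityI)
 then show ?thesis using assms(3,4) by (intro transformation.equality) simp_all
qed

lemma mt_id_transformation:
 assumes "symmetric_strong_monoidal_functor V W F" shows "monoidal_transformation V W (mt_id F)"
proof -
 interpret F: symmetric_strong_monoidal_functor V W F by fact
 show ?thesis using assms by (intro monoidal_transformation.intro monoidal_transformation_axioms.intro)
   (auto simp: mt_id_def Hom_iff)
qed

lemma mt_vcomp_transformation:
 assumes "monoidal_transformation V W \<phi>" "monoidal_transformation V W \<psi>" "t_src \<psi> = t_tgt \<phi>"
 shows "monoidal_transformation V W (mt_vcomp \<psi> \<phi>)"
proof -
 interpret \<phi>: monoidal_transformation V W \<phi> by fact
 interpret \<psi>: monoidal_transformation V W \<psi> by fact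
 show ?thesis proof (intro monoidal_transformation.intro monoidal_transformation_axioms.intro)
  show "symmetric_strong_monoidal_functor V W (t_src (mt_vcomp \<psi> \<phi>))"
   "symmetric_strong_monoidal_functor V W (t_tgt (mt_vcomp \<psi> \<phi>))"
   by (simp_all add: mt_vcomp_def \<phi>.F.symmetric_strong_monoidal_functor_axioms \<psi>.G.symmetric_strong_monoidal_functor_axioms)
  show "t_at (mt_vcomp \<psi> \<phi>) \<in> extensional (Ob V)" by (simp add: mt_vcomp_def)
 next
  fix A assume "A \<in> Ob V"
  then show "t_at (mt_vcomp \<psi> \<phi>) A \<in> Hom W (sm_ob (t_src (mt_vcomp \<psi> \<phi>)) A) (sm_ob (t_tgt (mt_vcomp \<psi> \<phi>)) A)"
   using assms(3) by (simp add: mt_vcomp_def Hom_iff)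
 next
  fix f A B assume f: "f \<in> Hom V A B"
  have [simp]: "A \<in> Ob V" "B \<in> Ob V" "f \<in> Ar V" "Dom V f = A" "Cod V f = B" using f by (auto simp: Hom_iff)
  have e: "t_at \<psi> B \<cdot>\<^bsub>W\<^esub> sm_ar (t_tgt \<phi>) f = sm_ar (t_tgt \<psi>) f \<cdot>\<^bsub>W\<^esub> t_at \<psi> A"
   using \<psi>.at_nat[of f B] assms(3) by simp
  show "t_at (mt_vcomp \<psi> \<phi>) B \<cdot>\<^bsub>W\<^esub> sm_ar (t_src (mt_vcomp \<psi> \<phi>)) f
   = sm_ar (t_tgt (mt_vcomp \<psi> \<phi>)) f \<cdot>\<^bsub>W\<^esub> t_at (mt_vcomp \<psi> \<phi>) A"
   using assms(3) by (simp add: mt_vcomp_def \<phi>.at_nat \<phi>.F.W.comp_head2[OF e])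
 next
  fix A B assume [simp]: "A \<in> Ob V" "B \<in> Ob V"
  have "t_at \<psi> (A \<otimes>\<^bsub>V\<^esub> B) \<cdot>\<^bsub>W\<^esub> sm_mu (t_tgt \<phi>) (A, B) = sm_mu (t_tgt \<psi>) (A, B) \<cdot>\<^bsub>W\<^esub> (t_at \<psi> A \<boxtimes>\<^bsub>W\<^esub> t_at \<psi> B)"
   using \<psi>.mt_mu[of A B] assms(3) by simp
  note e = \<phi>.F.W.comp_head2[OF this]
  show "t_at (mt_vcomp \<psi> \<phi>) (A \<otimes>\<^bsub>V\<^esub> B) \<cdot>\<^bsub>W\<^esub> sm_mu (t_src (mt_vcomp \<psi> \<phi>)) (A, B)
    = sm_mu (t_tgt (mt_vcomp \<psi> \<phi>)) (A, B) \<cdot>\<^bsub>W\<^esub> (t_at (mt_vcomp \<psi> \<phi>) A \<boxtimes>\<^bsub>W\<^esub> t_at (mt_vcomp \<psi> \<phi>) B)"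
   using assms(3) by (simp add: mt_vcomp_def \<phi>.mt_mu e \<phi>.F.W.interchange)
 next
  show "t_at (mt_vcomp \<psi> \<phi>) \<one>\<^bsub>V\<^esub> \<cdot>\<^bsub>W\<^esub> sm_eta (t_src (mt_vcomp \<psi> \<phi>)) = sm_eta (t_tgt (mt_vcomp \<psi> \<phi>))"
   using assms(3) by (simp add: mt_vcomp_def \<phi>.mt_eta \<psi>.mt_eta[symmetric])
 qed
qed

lemma mt_hcomp_transformation:
 assumes "monoidal_transformation V W \<phi>" "monoidal_transformation W X \<psi>" shows "monoidal_transformation V X (mt_hcomp \<psi> \<phi>)"
proof -
 interpret \<phi>: monoidal_transformation V W \<phi> by fact
 interpret \<psi>: monoidal_transformation W X \<psi> by fact
 note F = \<phi>.F.symmetric_strong_monoidal_functor_axioms \<phi>.G.symmetric_strong_monoidal_functor_axioms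
  \<psi>.F.symmetric_strong_monoidal_functor_axioms \<psi>.G.symmetric_strong_monoidal_functor_axioms
 note S = sm_comp_simps[OF F(1,3)] sm_comp_simps[OF F(2,4)]
 have H: "t_src (mt_hcomp \<psi> \<phi>) = sm_comp (t_src \<psi>) (t_src \<phi>)" "t_tgt (mt_hcomp \<psi> \<phi>) = sm_comp (t_tgt \<psi>) (t_tgt \<phi>)"
  "A \<in> Ob V ==> t_at (mt_hcomp \<psi> \<phi>) A = t_at \<psi> (sm_ob (t_tgt \<phi>) A) \<cdot>\<^bsub>X\<^esub> sm_ar (t_src \<psi>) (t_at \<phi> A)" for A
  by (simp_all add: mt_hcomp_def)
 note head2 = \<psi>.F.W.comp_head2
 have head: "sm_ar (t_src \<psi>) f \<cdot>\<^bsub>X\<^esub> (sm_ar (t_src \<psi>) g \<cdot>\<^bsub>X\<^esub> k) = sm_ar (t_src \<psi>) (f \<cdot>\<^bsub>W\<^esub> g) \<cdot>\<^bsub>X\<^esub> k"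
  if "f \<in> Ar W" "g \<in> Ar W" "Dom W f = Cod W g" "k \<in> Ar X" "Cod X k = sm_ob (t_src \<psi>) (Dom W g)" for f g k using that by simp
 show ?thesis proof (intro monoidal_transformation.intro monoidal_transformation_axioms.intro)
  show "symmetric_strong_monoidal_functor V X (t_src (mt_hcomp \<psi> \<phi>))"
   "symmetric_strong_monoidal_functor V X (t_tgt (mt_hcomp \<psi> \<phi>))" using F by (auto simp: H intro: sm_comp_functor)
  show "t_at (mt_hcomp \<psi> \<phi>) \<in> extensional (Ob V)" by (simp add: mt_hcomp_def)
 next
  fix A assume "A \<in> Ob V"
  then show "t_at (mt_hcomp \<psi> \<phi>) A \<in> Hom X (sm_ob (t_src (mt_hcomp \<psi> \<phi>)) A) (sm_ob (t_tgt (mt_hcomp \<psi> \<phi>)) A)"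
   by (simp add: H Hom_iff S)
 next
  fix f A B assume f: "f \<in> Hom V A B"
  have [simp]: "A \<in> Ob V" "B \<in> Ob V" "f \<in> Ar V" "Dom V f = A" "Cod V f = B" using f by (auto simp: Hom_iff)
  have e: "sm_ar (t_src \<psi>) (t_at \<phi> B) \<cdot>\<^bsub>X\<^esub> sm_ar (t_src \<psi>) (sm_ar (t_src \<phi>) f)
   = sm_ar (t_src \<psi>) (sm_ar (t_tgt \<phi>) f) \<cdot>\<^bsub>X\<^esub> sm_ar (t_src \<psi>) (t_at \<phi> A)"
   by (simp add: \<psi>.F.F1_Comp'[symmetric] \<phi>.at_nat del: \<psi>.F.F1_Comp')
  show "t_at (mt_hcomp \<psi> \<phi>) B \<cdot>\<^bsub>X\<^esub> sm_ar (t_src (mt_hcomp \<psi> \<phi>)) f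
   = sm_ar (t_tgt (mt_hcomp \<psi> \<phi>)) f \<cdot>\<^bsub>X\<^esub> t_at (mt_hcomp \<psi> \<phi>) A" by (simp add: H S e head2[OF \<psi>.at_nat])
 next
  fix A B assume [simp]: "A \<in> Ob V" "B \<in> Ob V"
  \<comment> \<open>Naturality of the constraint of the target of \<open>\<psi>\<close> at the
    components of \<open>\<phi>\<close>; this is what moves the two constraints past each
    other.\<close>
  have m: "sm_ar (t_tgt \<psi>) (t_at \<phi> A \<boxtimes>\<^bsub>W\<^esub> t_at \<phi> B) \<cdot>\<^bsub>X\<^esub> sm_mu (t_tgt \<psi>) (sm_ob (t_src \<phi>) A, sm_ob (t_src \<phi>) B)
   = sm_mu (t_tgt \<psi>) (sm_ob (t_tgt \<phi>) A, sm_ob (t_tgt \<phi>) B) \<cdot>\<^bsub>X\<^esub> (sm_ar (t_tgt \<psi>) (t_at \<phi> A) \<boxtimes>\<^bsub>X\<^esub> sm_ar (t_tgt \<psi>) (t_at \<phi> B))"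
   using \<psi>.G.mu_nat[of "t_at \<phi> A" "t_at \<phi> B"] by simp
  have e': "sm_ar (t_tgt \<psi>) (t_at \<phi> (A \<otimes>\<^bsub>V\<^esub> B)) \<cdot>\<^bsub>X\<^esub> sm_ar (t_tgt \<psi>) (sm_mu (t_src \<phi>) (A, B))
   = sm_ar (t_tgt \<psi>) (sm_mu (t_tgt \<phi>) (A, B)) \<cdot>\<^bsub>X\<^esub> sm_ar (t_tgt \<psi>) (t_at \<phi> A \<boxtimes>\<^bsub>W\<^esub> t_at \<phi> B)"
   by (simp add: \<psi>.G.F1_Comp'[symmetric] \<phi>.mt_mu del: \<psi>.G.F1_Comp')
  show "t_at (mt_hcomp \<psi> \<phi>) (A \<otimes>\<^bsub>V\<^esub> B) \<cdot>\<^bsub>X\<^esub> sm_mu (t_src (mt_hcomp \<psi> \<phi>)) (A, B)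
    = sm_mu (t_tgt (mt_hcomp \<psi> \<phi>)) (A, B) \<cdot>\<^bsub>X\<^esub> (t_at (mt_hcomp \<psi> \<phi>) A \<boxtimes>\<^bsub>X\<^esub> t_at (mt_hcomp \<psi> \<phi>) B)"
   by (simp add: H S head2[OF e'] head2[OF \<psi>.at_nat] \<psi>.at_nat \<psi>.mt_mu head2[OF m] \<psi>.F.W.interchange)
 next
  have e: "sm_ar (t_src \<psi>) (t_at \<phi> \<one>\<^bsub>V\<^esub>) \<cdot>\<^bsub>X\<^esub> (sm_ar (t_src \<psi>) (sm_eta (t_src \<phi>)) \<cdot>\<^bsub>X\<^esub> sm_eta (t_src \<psi>))
   = sm_ar (t_src \<psi>) (sm_eta (t_tgt \<phi>)) \<cdot>\<^bsub>X\<^esub> sm_eta (t_src \<psi>)"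
   by (simp add: \<psi>.F.W.Comp_assoc'[symmetric] \<psi>.F.F1_Comp'[symmetric] \<phi>.mt_eta del: \<psi>.F.F1_Comp' \<psi>.F.W.Comp_assoc')
  show "t_at (mt_hcomp \<psi> \<phi>) \<one>\<^bsub>V\<^esub> \<cdot>\<^bsub>X\<^esub> sm_eta (t_src (mt_hcomp \<psi> \<phi>)) = sm_eta (t_tgt (mt_hcomp \<psi> \<phi>))"
   by (simp add: H S e head2[OF \<psi>.at_nat] \<psi>.mt_eta)
 qed
qed

lemma SMC_ps_simps [simp]:
 "Obj SMC_ps = {V. symmetric_monoidal_category V}"
 "Cell1 SMC_ps = {F. symmetric_strong_monoidal_functor (sm_dom F) (sm_cod F) F}"
 "dom1 SMC_ps = sm_dom" "cod1 SMC_ps = sm_cod" "id1 SMC_ps = sm_id" "comp1 SMC_ps = sm_comp"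
 "Cell2 SMC_ps = {\<phi>. monoidal_transformation (sm_dom (t_src \<phi>)) (sm_cod (t_src \<phi>)) \<phi>}"
 "dom2 SMC_ps = t_src" "cod2 SMC_ps = t_tgt" "id2 SMC_ps = mt_id" "vcomp SMC_ps = mt_vcomp" "hcomp SMC_ps = mt_hcomp" by (simp_all add: SMC_ps_def)

lemma SMC_ps_hom_simps:
 "F \<in> Ob (hom_cat SMC_ps V W) \<longleftrightarrow> symmetric_strong_monoidal_functor V W F"
 "\<phi> \<in> Ar (hom_cat SMC_ps V W) \<longleftrightarrow> monoidal_transformation V W \<phi>"
 "\<phi> \<in> Hom (hom_cat SMC_ps V W) F G \<longleftrightarrow> monoidal_transformation V W \<phi> & t_src \<phi> = F & t_tgt \<phi> = G"
proof -
 have 1: "sm_dom F = V & sm_cod F = W" if "symmetric_strong_monoidal_functor V W F" for F :: "('a, 'b) sm_functor" and V W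
  using that by (simp add: symmetric_strong_monoidal_functor.sm_dom symmetric_strong_monoidal_functor.sm_cod)
 have 2: "symmetric_strong_monoidal_functor V W (t_src \<phi>)" if "monoidal_transformation V W \<phi>" for \<phi> :: "('a, 'b) sm_transformation" and V W
  using that by (simp add: monoidal_transformation_def)
 show "F \<in> Ob (hom_cat SMC_ps V W) \<longleftrightarrow> symmetric_strong_monoidal_functor V W F" using 1[of V W F] by auto
 show "\<phi> \<in> Ar (hom_cat SMC_ps V W) \<longleftrightarrow> monoidal_transformation V W \<phi>" using 1[OF 2] 2 by auto
 then show "\<phi> \<in> Hom (hom_cat SMC_ps V W) F G \<longleftrightarrow> monoidal_transformation V W \<phi> & t_src \<phi> = F & t_tgt \<phi> = G"
  by (simp add: Hom_iff)
qed

lemma SMC_ps_hom_category: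
 assumes "symmetric_monoidal_category V" "symmetric_monoidal_category W" shows "category (hom_cat SMC_ps V W)"
proof -
 note [simp] = SMC_ps_hom_simps and [simp del] = hom_cat_simps(1,2)
 have id: "mt_vcomp f (mt_id (t_src f)) = f" "mt_vcomp (mt_id (t_tgt f)) f = f"
  if "monoidal_transformation V W f" for f
 proof -
  interpret f: monoidal_transformation V W f by fact
  note i = mt_id_transformation[OF f.F.symmetric_strong_monoidal_functor_axioms]
   mt_id_transformation[OF f.G.symmetric_strong_monoidal_functor_axioms]
  show "mt_vcomp f (mt_id (t_src f)) = f"
   by (rule monoidal_transformation_eqI[OF mt_vcomp_transformation[OF i(1) that] that]) (auto simp: mt_vcomp_def mt_id_def)
  show "mt_vcomp (mt_id (t_tgt f)) f = f"
   by (rule monoidal_transformation_eqI[OF mt_vcomp_transformation[OF that i(2)] that]) (auto simp: mt_vcomp_def mt_id_def)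
 qed
 have assoc: "mt_vcomp (mt_vcomp h g) f = mt_vcomp h (mt_vcomp g f)"
  if f: "monoidal_transformation V W f" and g: "monoidal_transformation V W g" and h: "monoidal_transformation V W h"
   and fg: "t_src g = t_tgt f" "t_src h = t_tgt g" for f g h
 proof -
  interpret f: monoidal_transformation V W f by fact
  interpret g: monoidal_transformation V W g by fact
  interpret h: monoidal_transformation V W h by fact
  show ?thesis using fg by (intro monoidal_transformation_eqI[where V = V and W = W] mt_vcomp_transformation f g h)
    (auto simp: mt_vcomp_def)
 qed
 show ?thesis
 proof
  fix f assume "f \<in> Ar (hom_cat SMC_ps V W)"
  then show "Dom (hom_cat SMC_ps V W) f \<in> Ob (hom_cat SMC_ps V W)" "Cod (hom_cat SMC_ps V W) f \<in> Ob (hom_cat SMC_ps V W)"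
   by (simp_all add: monoidal_transformation_def)
 next
  fix F assume "F \<in> Ob (hom_cat SMC_ps V W)"
  then show "Id (hom_cat SMC_ps V W) F \<in> Hom (hom_cat SMC_ps V W) F F" using mt_id_transformation by (simp add: mt_id_def)
 next
  fix f F G g H assume "f \<in> Hom (hom_cat SMC_ps V W) F G" "g \<in> Hom (hom_cat SMC_ps V W) G H"
  then show "g \<cdot>\<^bsub>hom_cat SMC_ps V W\<^esub> f \<in> Hom (hom_cat SMC_ps V W) F H"
   using mt_vcomp_transformation[of V W f g] by (auto simp: mt_vcomp_def)
 qed (auto simp: id assoc)
qed

lemma sm_id_simps:
 "A \<in> Ob V ==> sm_ob (sm_id V) A = A" "f \<in> Ar V ==> sm_ar (sm_id V) f = f"
 "[|A \<in> Ob V; B \<in> Ob V|] ==> sm_mu (sm_id V) (A, B) = Id V (A \<otimes>\<^bsub>V\<^esub> B)" "sm_eta (sm_id V) = Id V \<one>\<^bsub>V\<^esub>"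
 by (simp_all add: sm_id_def)

lemma sm_id_comp:
 assumes "symmetric_strong_monoidal_functor V W F" shows "sm_comp F (sm_id V) = F" "sm_comp (sm_id W) F = F"
proof -
 interpret F: symmetric_strong_monoidal_functor V W F by fact
 note V = sm_id_functor[OF F.V.symmetric_monoidal_category_axioms] and W = sm_id_functor[OF F.W.symmetric_monoidal_category_axioms]
 show "sm_comp F (sm_id V) = F" by (rule sm_functor_eqI[OF sm_comp_functor[OF V assms] assms])
   (auto simp: sm_comp_simps[OF V assms] sm_id_simps)
 show "sm_comp (sm_id W) F = F" by (rule sm_functor_eqI[OF sm_comp_functor[OF assms W] assms])
   (auto simp: sm_comp_simps[OF assms W] sm_id_simps)
qed

lemma sm_comp_assoc:
 assumes "symmetric_strong_monoidal_functor V W F" "symmetric_strong_monoidal_functor W X G" "symmetric_strong_monoidal_functor X Y H"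
 shows "sm_comp (sm_comp H G) F = sm_comp H (sm_comp G F)"
proof -
 interpret F: symmetric_strong_monoidal_functor V W F by fact
 interpret G: symmetric_strong_monoidal_functor W X G by fact
 interpret H: symmetric_strong_monoidal_functor X Y H by fact
 note GF = sm_comp_functor[OF assms(1,2)] and HG = sm_comp_functor[OF assms(2,3)]
 show ?thesis by (rule sm_functor_eqI[OF sm_comp_functor[OF assms(1) HG] sm_comp_functor[OF GF assms(3)]])
   (auto simp: sm_comp_simps[OF assms(1) HG] sm_comp_simps[OF GF assms(3)] sm_comp_simps[OF assms(1,2)] sm_comp_simps[OF assms(2,3)])
qed

lemma mt_hcomp_simps:
 assumes "monoidal_transformation V W \<phi>" "monoidal_transformation W X \<psi>"
 shows "t_src (mt_hcomp \<psi> \<phi>) = sm_comp (t_src \<psi>) (t_src \<phi>)" "t_tgt (mt_hcomp \<psi> \<phi>) = sm_comp (t_tgt \<psi>) (t_tgt \<phi>)"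
  "A \<in> Ob V ==> t_at (mt_hcomp \<psi> \<phi>) A = t_at \<psi> (sm_ob (t_tgt \<phi>) A) \<cdot>\<^bsub>X\<^esub> sm_ar (t_src \<psi>) (t_at \<phi> A)"
proof -
 interpret \<phi>: monoidal_transformation V W \<phi> by fact
 interpret \<psi>: monoidal_transformation W X \<psi> by fact
 show "t_src (mt_hcomp \<psi> \<phi>) = sm_comp (t_src \<psi>) (t_src \<phi>)" "t_tgt (mt_hcomp \<psi> \<phi>) = sm_comp (t_tgt \<psi>) (t_tgt \<phi>)"
  "A \<in> Ob V ==> t_at (mt_hcomp \<psi> \<phi>) A = t_at \<psi> (sm_ob (t_tgt \<phi>) A) \<cdot>\<^bsub>X\<^esub> sm_ar (t_src \<psi>) (t_at \<phi> A)"
  by (simp_all add: mt_hcomp_def)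
qed

lemma SMC_ps_two_category: "two_category (SMC_ps :: (('a, 'm) smcat, _, _) twocat)"
proof -
 note [simp] = SMC_ps_hom_simps and [simp del] = hom_cat_simps(1,2)
 have hid: "mt_hcomp a (mt_id (sm_id V)) = a" "mt_hcomp (mt_id (sm_id W)) a = a"
  if a: "monoidal_transformation V W a" for V W :: "('a, 'm) smcat" and a
 proof -
  interpret a: monoidal_transformation V W a by fact
  note V = sm_id_functor[OF a.F.V.symmetric_monoidal_category_axioms] and W = sm_id_functor[OF a.F.W.symmetric_monoidal_category_axioms]
  interpret iV: symmetric_strong_monoidal_functor V V "sm_id V" by (rule V)
  interpret iW: symmetric_strong_monoidal_functor W W "sm_id W" by (rule W)
  note F = a.F.symmetric_strong_monoidal_functor_axioms and G = a.G.symmetric_strong_monoidal_functor_axioms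
  note V' = mt_id_transformation[OF V] and W' = mt_id_transformation[OF W]
  have [simp]: "t_src (mt_id F) = F" "t_tgt (mt_id F) = F" for F by (simp_all add: mt_id_def)
  show "mt_hcomp a (mt_id (sm_id V)) = a" by (rule monoidal_transformation_eqI[OF mt_hcomp_transformation[OF V' a] a])
    (simp_all add: mt_hcomp_simps[OF V' a] sm_id_comp[OF F] sm_id_comp[OF G],
    simp add: mt_id_def sm_id_simps)
  show "mt_hcomp (mt_id (sm_id W)) a = a" by (rule monoidal_transformation_eqI[OF mt_hcomp_transformation[OF a W'] a])
    (simp_all add: mt_hcomp_simps[OF a W'] sm_id_comp[OF F] sm_id_comp[OF G],
    simp add: mt_id_def sm_id_simps)
 qed
 have hassoc: "mt_hcomp (mt_hcomp c b) a = mt_hcomp c (mt_hcomp b a)"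
  if a: "monoidal_transformation V W a" and b: "monoidal_transformation W X b" and c: "monoidal_transformation X Y c"
  for V W X Y :: "('a, 'm) smcat" and a b c
 proof -
  interpret a: monoidal_transformation V W a by fact
  interpret b: monoidal_transformation W X b by fact
  interpret c: monoidal_transformation X Y c by fact
  note ba = mt_hcomp_transformation[OF a b] and cb = mt_hcomp_transformation[OF b c]
  note F = a.F.symmetric_strong_monoidal_functor_axioms b.F.symmetric_strong_monoidal_functor_axioms c.F.symmetric_strong_monoidal_functor_axioms
  note G = a.G.symmetric_strong_monoidal_functor_axioms b.G.symmetric_strong_monoidal_functor_axioms c.G.symmetric_strong_monoidal_functor_axioms
  show ?thesis by (rule monoidal_transformation_eqI[OF mt_hcomp_transformation[OF a cb] mt_hcomp_transformation[OF ba c]])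
    (simp_all add: mt_hcomp_simps[OF a cb] mt_hcomp_simps[OF ba c] mt_hcomp_simps[OF a b] mt_hcomp_simps[OF b c]
     sm_comp_assoc[OF F] sm_comp_assoc[OF G] sm_comp_simps[OF F(2,3)] sm_comp_simps[OF G(1,2)])
 qed
 have hids: "mt_hcomp (mt_id g) (mt_id f) = mt_id (sm_comp g f)"
  if f: "symmetric_strong_monoidal_functor V W f" and g: "symmetric_strong_monoidal_functor W X g"
  for V W X :: "('a, 'm) smcat" and f g
 proof -
  interpret f: symmetric_strong_monoidal_functor V W f by fact
  interpret g: symmetric_strong_monoidal_functor W X g by fact
  interpret gf: symmetric_strong_monoidal_functor V X "sm_comp g f" using f g by (rule sm_comp_functor)
  note i = mt_id_transformation[OF f] mt_id_transformation[OF g]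
  show ?thesis by (rule monoidal_transformation_eqI[OF mt_hcomp_transformation[OF i] mt_id_transformation[OF sm_comp_functor[OF f g]]])
    (simp_all add: mt_hcomp_simps[OF i], simp_all add: mt_id_def sm_comp_simps[OF f g])
 qed
 have inter: "mt_hcomp (mt_vcomp b' b) (mt_vcomp a' a) = mt_vcomp (mt_hcomp b' a') (mt_hcomp b a)"
  if a: "monoidal_transformation V W a" and a': "monoidal_transformation V W a'" "t_src a' = t_tgt a"
   and b: "monoidal_transformation W X b" and b': "monoidal_transformation W X b'" "t_src b' = t_tgt b"
  for V W X :: "('a, 'm) smcat" and a a' b b'
 proof -
  interpret a: monoidal_transformation V W a by fact
  interpret b: monoidal_transformation W X b by fact
  interpret a': monoidal_transformation V W a' by fact
  interpret b': monoidal_transformation W X b' by fact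
  note va = mt_vcomp_transformation[OF a a'] and vb = mt_vcomp_transformation[OF b b']
  note h = mt_hcomp_transformation[OF va vb] mt_hcomp_transformation[OF a b] mt_hcomp_transformation[OF a'(1) b'(1)]
  have l: "monoidal_transformation V X (mt_vcomp (mt_hcomp b' a') (mt_hcomp b a))"
   using a'(2) b'(2) by (intro mt_vcomp_transformation h) (simp add: mt_hcomp_simps[OF a b] mt_hcomp_simps[OF a'(1) b'(1)])
  have v: "t_src (mt_vcomp \<psi> \<phi>) = t_src \<phi>" "t_tgt (mt_vcomp \<psi> \<phi>) = t_tgt \<psi>" for \<phi> \<psi> :: "('a, 'm) sm_transformation"
   by (simp_all add: mt_vcomp_def)
  have va': "t_at (mt_vcomp a' a) A = t_at a' A \<cdot>\<^bsub>W\<^esub> t_at a A" if "A \<in> Ob V" for A using that by (simp add: mt_vcomp_def)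
  have vb': "t_at (mt_vcomp b' b) A = t_at b' A \<cdot>\<^bsub>X\<^esub> t_at b A" if "A \<in> Ob W" for A using that by (simp add: mt_vcomp_def)
  have ba: "sm_dom (t_src (mt_hcomp b a)) = V" "sm_cod (t_src (mt_hcomp b a)) = X" by (simp_all add: mt_hcomp_simps[OF a b] sm_comp_def)
  have v': "t_at (mt_vcomp (mt_hcomp b' a') (mt_hcomp b a)) A = t_at (mt_hcomp b' a') A \<cdot>\<^bsub>X\<^esub> t_at (mt_hcomp b a) A" if "A \<in> Ob V" for A
   unfolding mt_vcomp_def[of "mt_hcomp b' a'"] using that by (simp add: ba)
  \<comment> \<open>As for operads, interchange is naturality of \<open>b\<close> at a component of
    \<open>a'\<close>.\<close>
  have n: "t_at b (sm_ob (t_tgt a') A) \<cdot>\<^bsub>X\<^esub> sm_ar (t_src b) (t_at a' A)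
   = sm_ar (t_tgt b) (t_at a' A) \<cdot>\<^bsub>X\<^esub> t_at b (sm_ob (t_tgt a) A)" if "A \<in> Ob V" for A
   using b.at_nat[of "t_at a' A" "sm_ob (t_tgt a') A"] that a'(2) by simp
  show ?thesis by (rule monoidal_transformation_eqI[OF h(1) l])
   (use a'(2) b'(2) in \<open>simp_all add: v va' vb' v' mt_hcomp_simps[OF va vb] mt_hcomp_simps[OF a b] mt_hcomp_simps[OF a'(1) b'(1)]
    b.F.W.comp_head2[OF n]\<close>)
 qed
 have dom: "symmetric_monoidal_category (sm_dom f)" "symmetric_monoidal_category (sm_cod f)"
  if "symmetric_strong_monoidal_functor (sm_dom f) (sm_cod f) f" for f :: "('a, 'm) sm_functor" using that by (auto simp: symmetric_strong_monoidal_functor_def)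
 have h12: "mt_hcomp b a \<in> Hom (hom_cat SMC_ps X Z) (sm_comp g f) (sm_comp g' f')"
  if "a \<in> Hom (hom_cat SMC_ps X Y) f f'" "b \<in> Hom (hom_cat SMC_ps Y Z) g g'" for X Y Z :: "('a, 'm) smcat" and a b f f' g g'
  using that mt_hcomp_transformation[of X Y a Z b] by (auto simp: mt_hcomp_def)
 have dom2: "symmetric_strong_monoidal_functor (sm_dom (t_src a)) (sm_cod (t_src a)) (t_src a)"
  if "monoidal_transformation (sm_dom (t_src a)) (sm_cod (t_src a)) a" for a :: "('a, 'm) sm_transformation"
  using that by (simp add: monoidal_transformation_def)
 show ?thesis by (intro two_category.intro)
   (simp_all add: dom dom2 sm_id_functor sm_comp_functor sm_id_comp sm_comp_assoc SMC_ps_hom_category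
    hid hassoc hids inter h12[simplified])
qed

lemma (in two_category) vcomp_assoc [simp]:
 assumes "a \<in> Cell2 A" "b \<in> Cell2 A" "c \<in> Cell2 A" "dom2 A b = cod2 A a" "dom2 A c = cod2 A b"
 shows "(c \<bullet> b) \<bullet> a = c \<bullet> (b \<bullet> a)"
 using category.Comp_assoc'[OF hom_category, of "dom1 A (dom2 A a)" "cod1 A (dom2 A a)" a b c] assms by auto

section \<open>Sub-2-categories that are full on 2-cells, and the strict case\<close>

locale sub_two_category = A: two_category A
 for A :: "('o, 'c, 't) twocat" (structure) and B :: "('o, 'c, 't) twocat" +
 assumes sub: "Obj B <= Obj A" "Cell1 B <= Cell1 A"
  and full: "Cell2 B = {a \<in> Cell2 A. dom2 A a \<in> Cell1 B & cod2 A a \<in> Cell1 B}"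
  and ops: "dom1 B = dom1 A" "cod1 B = cod1 A" "id1 B = id1 A" "comp1 B = comp1 A" "dom2 B = dom2 A"
   "cod2 B = cod2 A" "id2 B = id2 A" "vcomp B = vcomp A" "hcomp B = hcomp A"
  and closed: "f \<in> Cell1 B ==> dom1 A f \<in> Obj B" "f \<in> Cell1 B ==> cod1 A f \<in> Obj B"
   "X \<in> Obj B ==> id1 A X \<in> Cell1 B"
   "[|f \<in> Cell1 B; g \<in> Cell1 B; dom1 A g = cod1 A f|] ==> g \<odot> f \<in> Cell1 B"
begin

lemma sub_in [simp]: "X \<in> Obj B ==> X \<in> Obj A" "f \<in> Cell1 B ==> f \<in> Cell1 A" using sub by auto

lemma two_category_sub: "two_category B"
proof -
 have cat: "category (hom_cat B X Y)" if "X \<in> Obj B" "Y \<in> Obj B" for X Y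
 proof -
  interpret category "hom_cat A X Y" using that by (intro A.hom_category) auto
  show ?thesis by unfold_locales (auto simp: Hom_iff ops full)
 qed
 show ?thesis by (intro two_category.intro) (auto simp: Hom_iff ops full closed cat intro: A.interchange')
qed

lemma two_functor_sub:
 assumes "two_functor A D F" shows "two_functor B D F"
proof -
 interpret F: two_functor A D F by fact
 interpret B: two_category B by (rule two_category_sub)
 have "cat_functor (hom_cat B X Y) (hom_cat D (F_ob F X) (F_ob F Y)) (F_1 F) (F_2 F)" if "X \<in> Obj B" "Y \<in> Obj B" for X Y
  using that by (intro cat_functor.intro cat_functor_axioms.intro B.hom_category F.B.hom_category)
   (auto simp: Hom_iff ops full)
 then show ?thesis by (intro two_functor.intro two_functor_axioms.intro two_category_sub F.B.two_category_axioms)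
   (auto simp: ops full)
qed

end

lemma sm_id_strict:
 "symmetric_strict_monoidal_category V ==> symmetric_strict_monoidal_functor V V (sm_id V)"
 by (auto intro!: symmetric_strict_monoidal_functor.intro symmetric_strict_monoidal_functor_axioms.intro sm_id_functor
   simp: symmetric_strict_monoidal_category.axioms(1) sm_id_simps symmetric_monoidal_category.Tob_in symmetric_monoidal_category.Unit_in)

lemma sm_comp_strict:
 assumes "symmetric_strict_monoidal_functor V W F" "symmetric_strict_monoidal_functor W X G" shows "symmetric_strict_monoidal_functor V X (sm_comp G F)"
proof -
 interpret F: symmetric_strict_monoidal_functor V W F by fact
 interpret G: symmetric_strict_monoidal_functor W X G by fact
 note FG = F.symmetric_strong_monoidal_functor_axioms G.symmetric_strong_monoidal_functor_axioms
 note [simp] = F.strict_Tob F.strict_Unit F.strict_mu F.strict_eta G.strict_Tob G.strict_Unit G.strict_mu G.strict_eta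
 show ?thesis by (intro symmetric_strict_monoidal_functor.intro symmetric_strict_monoidal_functor_axioms.intro sm_comp_functor[OF FG])
   (simp_all add: sm_comp_simps[OF FG])
qed

lemma SMC_s_simps [simp]:
 "Obj SMC_s = {V. symmetric_strict_monoidal_category V}"
 "Cell1 SMC_s = {F. symmetric_strict_monoidal_functor (sm_dom F) (sm_cod F) F &
  symmetric_strict_monoidal_category (sm_dom F) & symmetric_strict_monoidal_category (sm_cod F)}"
 "dom1 SMC_s = sm_dom" "cod1 SMC_s = sm_cod" "id1 SMC_s = sm_id" "comp1 SMC_s = sm_comp"
 "Cell2 SMC_s = {\<phi> \<in> Cell2 SMC_ps. t_src \<phi> \<in> Cell1 SMC_s & t_tgt \<phi> \<in> Cell1 SMC_s}"
 "dom2 SMC_s = t_src" "cod2 SMC_s = t_tgt" "id2 SMC_s = mt_id" "vcomp SMC_s = mt_vcomp" "hcomp SMC_s = mt_hcomp" by (simp_all add: SMC_s_def Let_def)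

lemma SMC_s_sub: "sub_two_category SMC_ps SMC_s"
proof -
 interpret two_category SMC_ps by (rule SMC_ps_two_category)
 have [simp]: "sm_dom (sm_comp g f) = sm_dom f" "sm_cod (sm_comp g f) = sm_cod g" for f g :: "('a, 'm) sm_functor" by (simp_all add: sm_comp_def)
 have [simp]: "sm_dom (sm_id V) = V" "sm_cod (sm_id V) = V" for V :: "('a, 'm) smcat" by (simp_all add: sm_id_def)
 have comp: "symmetric_strict_monoidal_functor (sm_dom f) (sm_cod g) (sm_comp g f)"
  if "symmetric_strict_monoidal_functor (sm_dom f) (sm_cod f) f" "symmetric_strict_monoidal_functor (sm_dom g) (sm_cod g) g"
   "sm_dom g = sm_cod f" for f g :: "('a, 'm) sm_functor" using sm_comp_strict[of "sm_dom f" "sm_cod f" f "sm_cod g" g] that by simp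
 show ?thesis by (intro sub_two_category.intro sub_two_category_axioms.intro SMC_ps_two_category)
   (auto simp: comp sm_id_strict symmetric_strict_monoidal_category.axioms(1) symmetric_strict_monoidal_functor.axioms(1))
qed

section \<open>Strictification\<close>

subsection \<open>Coherence of iterated tensor products\<close>

lemma (in symmetric_monoidal_category) Braid_Braid_cancel [simp]:
 "[|A \<in> Ob V; B \<in> Ob V; f \<in> Ar V; Cod V f = A \<otimes> B|] ==> Braid V B A \<cdot> (Braid V A B \<cdot> f) = f"
 using Inv_cancel(1)[of "Braid V A B" f] by simp

text \<open>Since \<^const>\<open>tens\<close> omits the unit at the end of a list, attaching a head to a tail is an identity or a unitor.\<close>

definition cons_iso :: "('a, 'm) smcat => 'a => 'a list => 'm" where
 "cons_iso V A As = (if As = [] then Runit V A else Id V (tens V (A # As)))"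

context symmetric_monoidal_category
begin

text \<open>The left unitor is a natural isomorphism from tensoring with the unit to the identity
  functor, so this tensoring is faithful.\<close>

lemma Unit_Tar_inj:
 assumes "Id V \<one> \<boxtimes> f = Id V \<one> \<boxtimes> g" "f \<in> Ar V" "g \<in> Ar V" "Dom V f = Dom V g" "Cod V f = Cod V g" shows "f = g"
 by (rule iso_cancel_right[of "Lunit V (Dom V g)"])
  (use assms Lunit_nat[of f "Cod V f"] Lunit_nat[of g "Cod V g"] in simp_all)

lemma Tar_Unit_inj:
 assumes "f \<boxtimes> Id V \<one> = g \<boxtimes> Id V \<one>" "f \<in> Ar V" "g \<in> Ar V" "Dom V f = Dom V g" "Cod V f = Cod V g" shows "f = g"
 by (rule iso_cancel_right[of "Runit V (Dom V g)"])
  (use assms Runit_nat[of f "Cod V f"] Runit_nat[of g "Cod V g"] in simp_all)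

lemma pentagon':
 "[|A \<in> Ob V; B \<in> Ob V; C \<in> Ob V; D \<in> Ob V|]
  ==> Assoc V A B (C \<otimes> D) \<cdot> Assoc V (A \<otimes> B) C D
   = (Id V A \<boxtimes> Assoc V B C D) \<cdot> (Assoc V A (B \<otimes> C) D \<cdot> (Assoc V A B C \<boxtimes> Id V D))" using pentagon[of A B C D] by simp

text \<open>Kelly's argument: after tensoring with the unit on the left, the pentagon at unit, unit,
  \<open>A\<close>, \<open>B\<close> and two instances of the triangle give the equation.\<close>

lemma Lunit_Tob:
 assumes [simp]: "A \<in> Ob V" "B \<in> Ob V" shows "Lunit V (A \<otimes> B) \<cdot> Assoc V \<one> A B = Lunit V A \<boxtimes> Id V B"
proof (rule Unit_Tar_inj)
 let ?e = "Assoc V \<one> (\<one> \<otimes> A) B \<cdot> (Assoc V \<one> \<one> A \<boxtimes> Id V B)"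
 have e: "is_iso V ?e" by (intro Inv_Comp) auto
 have "(Id V \<one> \<boxtimes> (Lunit V (A \<otimes> B) \<cdot> Assoc V \<one> A B)) \<cdot> ?e
  = (Id V \<one> \<boxtimes> Lunit V (A \<otimes> B)) \<cdot> ((Id V \<one> \<boxtimes> Assoc V \<one> A B) \<cdot> ?e)" by (simp add: interchange_assoc)
 also have "... = ((Id V \<one> \<boxtimes> Lunit V (A \<otimes> B)) \<cdot> Assoc V \<one> \<one> (A \<otimes> B)) \<cdot> Assoc V (\<one> \<otimes> \<one>) A B"
  by (simp add: pentagon')
 also have "... = (Runit V \<one> \<boxtimes> (Id V A \<boxtimes> Id V B)) \<cdot> Assoc V (\<one> \<otimes> \<one>) A B" by (subst triangle) simp_all
 also have "... = Assoc V \<one> A B \<cdot> ((Runit V \<one> \<boxtimes> Id V A) \<boxtimes> Id V B)" by (simp add: Assoc_nat del: Tar_Id)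
 also have "... = Assoc V \<one> A B \<cdot> (((Id V \<one> \<boxtimes> Lunit V A) \<boxtimes> Id V B) \<cdot> (Assoc V \<one> \<one> A \<boxtimes> Id V B))"
  by (simp add: triangle[symmetric] interchange)
 also have "... = (Id V \<one> \<boxtimes> (Lunit V A \<boxtimes> Id V B)) \<cdot> ?e" by (simp add: comp_head2[OF Assoc_nat])
 finally show "Id V \<one> \<boxtimes> (Lunit V (A \<otimes> B) \<cdot> Assoc V \<one> A B) = Id V \<one> \<boxtimes> (Lunit V A \<boxtimes> Id V B)"
  by (rule iso_cancel_right[OF e, rotated 4]) simp_all
qed simp_all

text \<open>The mirror image of the preceding argument, with the pentagon at \<open>A\<close>,
  \<open>B\<close>, unit, unit.\<close>

lemma Runit_Tob:
 assumes [simp]: "A \<in> Ob V" "B \<in> Ob V" shows "(Id V A \<boxtimes> Runit V B) \<cdot> Assoc V A B \<one> = Runit V (A \<otimes> B)"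
proof (rule Tar_Unit_inj)
 let ?l = "(Id V A \<boxtimes> Runit V B) \<cdot> Assoc V A B \<one>"
 have "Assoc V A B \<one> \<cdot> (?l \<boxtimes> Id V \<one>)
  = Assoc V A B \<one> \<cdot> (((Id V A \<boxtimes> Runit V B) \<boxtimes> Id V \<one>) \<cdot> (Assoc V A B \<one> \<boxtimes> Id V \<one>))"
  by (simp add: interchange)
 also have "... = (Id V A \<boxtimes> (Runit V B \<boxtimes> Id V \<one>)) \<cdot> (Assoc V A (B \<otimes> \<one>) \<one> \<cdot> (Assoc V A B \<one> \<boxtimes> Id V \<one>))"
  by (simp add: comp_head2[OF Assoc_nat])
 also have "... = (Id V A \<boxtimes> (Id V B \<boxtimes> Lunit V \<one>)) \<cdot> ((Id V A \<boxtimes> Assoc V B \<one> \<one>) \<cdot> (Assoc V A (B \<otimes> \<one>) \<one> \<cdot> (Assoc V A B \<one> \<boxtimes> Id V \<one>)))"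
  by (simp add: triangle[symmetric] interchange_assoc)
 also have "... = (Id V A \<boxtimes> (Id V B \<boxtimes> Lunit V \<one>)) \<cdot> (Assoc V A B (\<one> \<otimes> \<one>) \<cdot> Assoc V (A \<otimes> B) \<one> \<one>)"
  by (simp add: pentagon')
 also have "... = Assoc V A B \<one> \<cdot> (((Id V A \<boxtimes> Id V B) \<boxtimes> Lunit V \<one>) \<cdot> Assoc V (A \<otimes> B) \<one> \<one>)"
  by (simp add: comp_head2[OF Assoc_nat] del: Tar_Id)
 also have "... = Assoc V A B \<one> \<cdot> (Runit V (A \<otimes> B) \<boxtimes> Id V \<one>)" by (simp add: triangle)
 finally show "?l \<boxtimes> Id V \<one> = Runit V (A \<otimes> B) \<boxtimes> Id V \<one>"
  by (rule iso_cancel_left[of "Assoc V A B \<one>", rotated 5]) simp_all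
qed simp_all

text \<open>Naturality of the left unitor at itself shows that tensoring it with the unit gives the
  unitor of a product. The triangle and \<open>Lunit_Tob\<close> then identify both unitors after
  tensoring with the unit.\<close>

lemma Lunit_Unit: "Lunit V \<one> = Runit V \<one>" proof (rule Tar_Unit_inj)
 have "Lunit V \<one> \<cdot> (Id V \<one> \<boxtimes> Lunit V \<one>) = Lunit V \<one> \<cdot> Lunit V (\<one> \<otimes> \<one>)" by (simp add: Lunit_nat)
 then have "Id V \<one> \<boxtimes> Lunit V \<one> = Lunit V (\<one> \<otimes> \<one>)" by (rule iso_cancel_left[of "Lunit V \<one>", rotated 5]) simp_all
 then show "Lunit V \<one> \<boxtimes> Id V \<one> = Runit V \<one> \<boxtimes> Id V \<one>"
  using triangle[of \<one> \<one>] Lunit_Tob[of \<one> \<one>] by simp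
qed simp_all

lemma tens_in [simp]: "set As <= Ob V ==> tens V As \<in> Ob V" by (induction As rule: induct_list012) auto

lemma tens_Cons: "As \<noteq> [] ==> tens V (A # As) = A \<otimes> tens V As" by (cases As) auto

lemma cons_iso_simps [simp]:
 assumes "A \<in> Ob V" "set As <= Ob V" shows "cons_iso V A As \<in> Ar V" "Dom V (cons_iso V A As) = A \<otimes> tens V As"
  "Cod V (cons_iso V A As) = tens V (A # As)" "is_iso V (cons_iso V A As)" using assms by (simp_all add: cons_iso_def tens_Cons)

text \<open>For two empty lists \<open>app_iso\<close> is defined by the left unitor, so the two
  unitors have to agree at the unit object.\<close>

lemma app_iso_Nil_right: "app_iso V As [] = Runit V (tens V As)" by (cases As) (auto simp: Lunit_Unit)

lemma app_iso_simps [simp]: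
 assumes "set As <= Ob V" "set Bs <= Ob V" shows "app_iso V As Bs \<in> Ar V" "Dom V (app_iso V As Bs) = tens V As \<otimes> tens V Bs"
  "Cod V (app_iso V As Bs) = tens V (As @ Bs)" "is_iso V (app_iso V As Bs)"
proof -
 have "app_iso V As Bs \<in> Ar V & Dom V (app_iso V As Bs) = tens V As \<otimes> tens V Bs &
  Cod V (app_iso V As Bs) = tens V (As @ Bs) & is_iso V (app_iso V As Bs)" using assms(1) proof (induction As rule: induct_list012)
  case 1
  then show ?case using assms(2) by simp
 next
  case (2 A)
  then show ?case using assms(2) by (cases Bs) (auto simp: tens_Cons)
 next
  case (3 A A' As)
  then show ?case using assms(2) by (cases Bs) (auto simp: Inv_Comp(1))
 qed
 then show "app_iso V As Bs \<in> Ar V" "Dom V (app_iso V As Bs) = tens V As \<otimes> tens V Bs"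
  "Cod V (app_iso V As Bs) = tens V (As @ Bs)" "is_iso V (app_iso V As Bs)" by auto
qed

text \<open>A recursion without case distinction: \<open>cons_iso\<close> supplies the right unitor
  where \<open>tens\<close> has dropped the trailing unit. The exceptional cases are the triangle
  and \<open>Runit_Tob\<close>.\<close>

lemma app_iso_Cons:
 assumes [simp]: "A \<in> Ob V" "set As <= Ob V" "set Bs <= Ob V"
 shows "app_iso V (A # As) Bs \<cdot> (cons_iso V A As \<boxtimes> Id V (tens V Bs))
  = cons_iso V A (As @ Bs) \<cdot> ((Id V A \<boxtimes> app_iso V As Bs) \<cdot> Assoc V A (tens V As) (tens V Bs))" proof (cases "As = []")
 case True
 show ?thesis proof (cases "Bs = []")
  case True
  with \<open>As = []\<close> show ?thesis using triangle[of A \<one>] by (simp add: cons_iso_def)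
 next
  case False
  then obtain B Bs' where [simp]: "Bs = B # Bs'" by (cases Bs) auto
  show ?thesis using True triangle[of A "tens V Bs"] assms(3) by (simp add: cons_iso_def tens_Cons)
 qed
next
 case False
 then obtain A' As' where As: "As = A' # As'" by (cases As) auto
 show ?thesis proof (cases "Bs = []")
  case True
  then show ?thesis using False Runit_Tob[of A "tens V As"] by (simp add: cons_iso_def app_iso_Nil_right tens_Cons)
 next
  case False
  then obtain B Bs' where Bs: "Bs = B # Bs'" by (cases Bs) auto
  have "app_iso V (A # As) Bs = (Id V A \<boxtimes> app_iso V As Bs) \<cdot> Assoc V A (tens V As) (tens V Bs)" unfolding As Bs by simp
  moreover have "cons_iso V A As \<boxtimes> Id V (tens V Bs) = Id V ((A \<otimes> tens V As) \<otimes> tens V Bs)"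
   using \<open>As \<noteq> []\<close> by (simp add: cons_iso_def tens_Cons)
  moreover have "cons_iso V A (As @ Bs) = Id V (A \<otimes> tens V (As @ Bs))" using \<open>As \<noteq> []\<close> by (simp add: cons_iso_def tens_Cons)
  ultimately show ?thesis by simp
 qed
qed

text \<open>The coherence law behind strict associativity of \<open>str V\<close>. The induction
  uses the pentagon once for each letter of the first list.\<close>

lemma app_iso_assoc:
 assumes "set As <= Ob V" and [simp]: "set Bs <= Ob V" "set Cs <= Ob V"
 shows "app_iso V As (Bs @ Cs) \<cdot> ((Id V (tens V As) \<boxtimes> app_iso V Bs Cs) \<cdot> Assoc V (tens V As) (tens V Bs) (tens V Cs))
  = app_iso V (As @ Bs) Cs \<cdot> (app_iso V As Bs \<boxtimes> Id V (tens V Cs))" using assms(1) proof (induction As)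
 case Nil
 then show ?case by (simp add: comp_head2[OF Lunit_nat] Lunit_Tob)
next
 case (Cons A As)
 have [simp]: "A \<in> Ob V" and As [simp]: "set As <= Ob V" using Cons.prems by auto
 let ?a = "tens V As" and ?b = "tens V Bs" and ?c = "tens V Cs" and ?d = "tens V (A # As)"
 let ?e = "(cons_iso V A As \<boxtimes> Id V ?b) \<boxtimes> Id V ?c"
 have IH: "app_iso V As (Bs @ Cs) \<cdot> ((Id V ?a \<boxtimes> app_iso V Bs Cs) \<cdot> Assoc V ?a ?b ?c)
  = app_iso V (As @ Bs) Cs \<cdot> (app_iso V As Bs \<boxtimes> Id V ?c)" using Cons.IH[OF As] .
 have d [simp]: "?d \<in> Ob V" by (rule tens_in) simp
 \<comment> \<open>Precomposing with the isomorphism \<open>?e\<close> makes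
   \<open>app_iso_Cons\<close> applicable; it is cancelled at the end.\<close>
 have "(app_iso V (A # As) (Bs @ Cs) \<cdot> ((Id V ?d \<boxtimes> app_iso V Bs Cs) \<cdot> Assoc V ?d ?b ?c)) \<cdot> ?e
  = app_iso V (A # As) (Bs @ Cs) \<cdot> ((Id V ?d \<boxtimes> app_iso V Bs Cs) \<cdot> ((cons_iso V A As \<boxtimes> Id V (?b \<otimes> ?c)) \<cdot> Assoc V (A \<otimes> ?a) ?b ?c))"
  by (simp add: Assoc_nat del: tens.simps)
 also have "... = app_iso V (A # As) (Bs @ Cs) \<cdot> ((cons_iso V A As \<boxtimes> Id V (tens V (Bs @ Cs))) \<cdot> ((Id V (A \<otimes> ?a) \<boxtimes> app_iso V Bs Cs) \<cdot> Assoc V (A \<otimes> ?a) ?b ?c))"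
  by (simp add: interchange_assoc del: tens.simps)
 also have "... = cons_iso V A (As @ Bs @ Cs) \<cdot> ((Id V A \<boxtimes> app_iso V As (Bs @ Cs)) \<cdot> (Assoc V A ?a (tens V (Bs @ Cs)) \<cdot> ((Id V (A \<otimes> ?a) \<boxtimes> app_iso V Bs Cs) \<cdot> Assoc V (A \<otimes> ?a) ?b ?c)))"
  using comp_head2[OF app_iso_Cons[of A As "Bs @ Cs"], where k = "(Id V (A \<otimes> ?a) \<boxtimes> app_iso V Bs Cs) \<cdot> Assoc V (A \<otimes> ?a) ?b ?c"]
  by (simp del: tens.simps)
 also have "... = cons_iso V A (As @ Bs @ Cs) \<cdot> ((Id V A \<boxtimes> app_iso V As (Bs @ Cs)) \<cdot> ((Id V A \<boxtimes> (Id V ?a \<boxtimes> app_iso V Bs Cs)) \<cdot> (Assoc V A ?a (?b \<otimes> ?c) \<cdot> Assoc V (A \<otimes> ?a) ?b ?c)))"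
  using comp_head2[OF Assoc_nat[of "Id V A" "Id V ?a" "app_iso V Bs Cs"], where k = "Assoc V (A \<otimes> ?a) ?b ?c"] by simp
 \<comment> \<open>The pentagon at \<open>A\<close> and the three products; afterwards the induction
   hypothesis applies in the tensor factor next to \<open>A\<close>.\<close>
 also have "... = cons_iso V A (As @ Bs @ Cs) \<cdot> ((Id V A \<boxtimes> (app_iso V As (Bs @ Cs) \<cdot> ((Id V ?a \<boxtimes> app_iso V Bs Cs) \<cdot> Assoc V ?a ?b ?c)))
   \<cdot> (Assoc V A (?a \<otimes> ?b) ?c \<cdot> (Assoc V A ?a ?b \<boxtimes> Id V ?c)))" by (simp add: pentagon' interchange_assoc)
 also have "... = cons_iso V A (As @ Bs @ Cs) \<cdot> ((Id V A \<boxtimes> app_iso V (As @ Bs) Cs) \<cdot> ((Id V A \<boxtimes> (app_iso V As Bs \<boxtimes> Id V ?c))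
   \<cdot> (Assoc V A (?a \<otimes> ?b) ?c \<cdot> (Assoc V A ?a ?b \<boxtimes> Id V ?c))))" unfolding IH by (simp add: interchange_assoc)
 also have "... = cons_iso V A (As @ Bs @ Cs) \<cdot> ((Id V A \<boxtimes> app_iso V (As @ Bs) Cs) \<cdot> (Assoc V A (tens V (As @ Bs)) ?c
   \<cdot> (((Id V A \<boxtimes> app_iso V As Bs) \<boxtimes> Id V ?c) \<cdot> (Assoc V A ?a ?b \<boxtimes> Id V ?c))))" by (simp add: comp_head2[OF Assoc_nat])
 also have "... = app_iso V (A # As @ Bs) Cs \<cdot> ((cons_iso V A (As @ Bs) \<boxtimes> Id V ?c)
   \<cdot> (((Id V A \<boxtimes> app_iso V As Bs) \<boxtimes> Id V ?c) \<cdot> (Assoc V A ?a ?b \<boxtimes> Id V ?c)))"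
  using comp_head2[OF app_iso_Cons[of A "As @ Bs" Cs], where k = "((Id V A \<boxtimes> app_iso V As Bs) \<boxtimes> Id V ?c) \<cdot> (Assoc V A ?a ?b \<boxtimes> Id V ?c)"]
  by (simp del: tens.simps)
 also have "... = app_iso V (A # As @ Bs) Cs \<cdot> ((app_iso V (A # As) Bs \<cdot> (cons_iso V A As \<boxtimes> Id V ?b)) \<boxtimes> Id V ?c)"
  unfolding app_iso_Cons[OF \<open>A \<in> Ob V\<close> \<open>set As <= Ob V\<close> assms(2)] by (simp add: interchange del: tens.simps)
 also have "... = (app_iso V ((A # As) @ Bs) Cs \<cdot> (app_iso V (A # As) Bs \<boxtimes> Id V ?c)) \<cdot> ?e" by (simp add: interchange del: tens.simps)
 finally show ?case by (rule iso_cancel_right[of ?e, rotated 5]) (simp_all del: tens.simps)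
qed

end

subsection \<open>The strictification of a symmetric monoidal category\<close>

text \<open>An arrow carries its two words because \<open>tens V\<close> does not determine a list.
  Conjugating the tensor product of arrows by \<open>app_iso\<close> is what allows the associator
  and unitors to be identities.\<close>

definition str :: "('a, 'm) smcat => ('a list, 'a list \<times> 'm \<times> 'a list) smcat" where
 "str V = \<lparr>Ob = {As. set As <= Ob V},
  Ar = {(As, f, Bs). set As <= Ob V & set Bs <= Ob V & f \<in> Hom V (tens V As) (tens V Bs)},
  Dom = fst, Cod = (%x. snd (snd x)), Id = (%As. (As, Id V (tens V As), As)),
  Comp = (%y x. (fst x, fst (snd y) \<cdot>\<^bsub>V\<^esub> fst (snd x), snd (snd y))),
  Tob = (@),
  Tar = (%x y. (fst x @ fst y, app_iso V (snd (snd x)) (snd (snd y)) \<cdot>\<^bsub>V\<^esub>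
    ((fst (snd x) \<boxtimes>\<^bsub>V\<^esub> fst (snd y)) \<cdot>\<^bsub>V\<^esub> Inv V (app_iso V (fst x) (fst y))), snd (snd x) @ snd (snd y))),
  Unit = [],
  Assoc = (%As Bs Cs. (As @ Bs @ Cs, Id V (tens V (As @ Bs @ Cs)), As @ Bs @ Cs)),
  Lunit = (%As. (As, Id V (tens V As), As)), Runit = (%As. (As, Id V (tens V As), As)),
  Braid = (%As Bs. (As @ Bs, app_iso V Bs As \<cdot>\<^bsub>V\<^esub> (Braid V (tens V As) (tens V Bs) \<cdot>\<^bsub>V\<^esub> Inv V (app_iso V As Bs)), Bs @ As))\<rparr>"

abbreviation mid :: "'a list \<times> 'm \<times> 'a list => 'm" where
 "mid x \<equiv> fst (snd x)"

lemma str_simps [simp]: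
 "Ob (str V) = {As. set As <= Ob V}" "Tob (str V) = (@)" "Unit (str V) = []"
 "Dom (str V) = fst" "Cod (str V) = (%x. snd (snd x))"
 "fst (Id (str V) As) = As" "mid (Id (str V) As) = Id V (tens V As)" "snd (snd (Id (str V) As)) = As"
 "Assoc (str V) As Bs Cs = Id (str V) (As @ Bs @ Cs)" "Lunit (str V) As = Id (str V) As" "Runit (str V) As = Id (str V) As"
 "fst (y \<cdot>\<^bsub>str V\<^esub> x) = fst x" "mid (y \<cdot>\<^bsub>str V\<^esub> x) = mid y \<cdot>\<^bsub>V\<^esub> mid x" "snd (snd (y \<cdot>\<^bsub>str V\<^esub> x)) = snd (snd y)"
 "fst (x \<boxtimes>\<^bsub>str V\<^esub> y) = fst x @ fst y" "snd (snd (x \<boxtimes>\<^bsub>str V\<^esub> y)) = snd (snd x) @ snd (snd y)"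
 "fst (Braid (str V) As Bs) = As @ Bs" "snd (snd (Braid (str V) As Bs)) = Bs @ As" by (simp_all add: str_def)

lemma mid_str:
 "mid (x \<boxtimes>\<^bsub>str V\<^esub> y) = app_iso V (snd (snd x)) (snd (snd y)) \<cdot>\<^bsub>V\<^esub>
    ((mid x \<boxtimes>\<^bsub>V\<^esub> mid y) \<cdot>\<^bsub>V\<^esub> Inv V (app_iso V (fst x) (fst y)))"
 "mid (Braid (str V) As Bs) = app_iso V Bs As \<cdot>\<^bsub>V\<^esub> (Braid V (tens V As) (tens V Bs) \<cdot>\<^bsub>V\<^esub> Inv V (app_iso V As Bs))"
 by (simp_all add: str_def)

lemma str_Ar: "x \<in> Ar (str V) \<longleftrightarrow> set (fst x) <= Ob V & set (snd (snd x)) <= Ob V &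
 mid x \<in> Ar V & Dom V (mid x) = tens V (fst x) & Cod V (mid x) = tens V (snd (snd x))" by (cases x) (auto simp: str_def Hom_iff)

context symmetric_monoidal_category
begin

text \<open>The defining conjugation rewritten as a square without inverses, the form in which it
  pastes with \<open>app_iso_assoc\<close>.\<close>

lemma mid_Tar:
 assumes "x \<in> Ar (str V)" "y \<in> Ar (str V)"
 shows "mid (x \<boxtimes>\<^bsub>str V\<^esub> y) \<cdot> app_iso V (fst x) (fst y) = app_iso V (snd (snd x)) (snd (snd y)) \<cdot> (mid x \<boxtimes> mid y)"
 using assms by (simp add: str_Ar mid_str)

lemma mid_Braid:
 assumes "set As <= Ob V" "set Bs <= Ob V"
 shows "mid (Braid (str V) As Bs) \<cdot> app_iso V As Bs = app_iso V Bs As \<cdot> Braid V (tens V As) (tens V Bs)" using assms by (simp add: mid_str)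

lemma str_Ar_simps [simp]:
 "[|x \<in> Ar (str V); y \<in> Ar (str V)|] ==> x \<boxtimes>\<^bsub>str V\<^esub> y \<in> Ar (str V)"
 "[|x \<in> Ar (str V); y \<in> Ar (str V); fst y = snd (snd x)|] ==> y \<cdot>\<^bsub>str V\<^esub> x \<in> Ar (str V)"
 "[|set As <= Ob V; set Bs <= Ob V|] ==> Braid (str V) As Bs \<in> Ar (str V)" by (auto simp: str_Ar mid_str)

text \<open>Both bracketings are precomposed with the isomorphism \<open>?z\<close> and unfolded by
  \<open>mid_Tar\<close>. Coherence on the source and target words, together with naturality of the
  associator, makes them agree.\<close>

lemma str_Tar_assoc:
 assumes "x \<in> Ar (str V)" "y \<in> Ar (str V)" "z \<in> Ar (str V)"
 shows "(x \<boxtimes>\<^bsub>str V\<^esub> y) \<boxtimes>\<^bsub>str V\<^esub> z = x \<boxtimes>\<^bsub>str V\<^esub> (y \<boxtimes>\<^bsub>str V\<^esub> z)"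
proof -
 obtain A f A' where x: "x = (A, f, A')" by (cases x) auto
 obtain B g B' where y: "y = (B, g, B')" by (cases y) auto
 obtain C h C' where z: "z = (C, h, C')" by (cases z) auto
 have [simp]: "set A <= Ob V" "set A' <= Ob V" "f \<in> Ar V" "Dom V f = tens V A" "Cod V f = tens V A'"
  "set B <= Ob V" "set B' <= Ob V" "g \<in> Ar V" "Dom V g = tens V B" "Cod V g = tens V B'"
  "set C <= Ob V" "set C' <= Ob V" "h \<in> Ar V" "Dom V h = tens V C" "Cod V h = tens V C'" using assms by (auto simp: x y z str_Ar)
 let ?z = "app_iso V (A @ B) C \<cdot> (app_iso V A B \<boxtimes> Id V (tens V C))"
 have xy: "mid (x \<boxtimes>\<^bsub>str V\<^esub> y) \<in> Ar V" "Dom V (mid (x \<boxtimes>\<^bsub>str V\<^esub> y)) = tens V (A @ B)" "Cod V (mid (x \<boxtimes>\<^bsub>str V\<^esub> y)) = tens V (A' @ B')"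
  using str_Ar_simps(1)[OF assms(1,2)] by (auto simp: str_Ar x y)
 have yz: "mid (y \<boxtimes>\<^bsub>str V\<^esub> z) \<in> Ar V" "Dom V (mid (y \<boxtimes>\<^bsub>str V\<^esub> z)) = tens V (B @ C)" "Cod V (mid (y \<boxtimes>\<^bsub>str V\<^esub> z)) = tens V (B' @ C')"
  using str_Ar_simps(1)[OF assms(2,3)] by (auto simp: str_Ar y z)
 have l: "mid ((x \<boxtimes>\<^bsub>str V\<^esub> y) \<boxtimes>\<^bsub>str V\<^esub> z) \<in> Ar V" "Dom V (mid ((x \<boxtimes>\<^bsub>str V\<^esub> y) \<boxtimes>\<^bsub>str V\<^esub> z)) = tens V (A @ B @ C)"
  "Cod V (mid ((x \<boxtimes>\<^bsub>str V\<^esub> y) \<boxtimes>\<^bsub>str V\<^esub> z)) = tens V (A' @ B' @ C')"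
  using str_Ar_simps(1)[OF str_Ar_simps(1)[OF assms(1,2)] assms(3)] by (auto simp: str_Ar x y z)
 have r: "mid (x \<boxtimes>\<^bsub>str V\<^esub> (y \<boxtimes>\<^bsub>str V\<^esub> z)) \<in> Ar V" "Dom V (mid (x \<boxtimes>\<^bsub>str V\<^esub> (y \<boxtimes>\<^bsub>str V\<^esub> z))) = tens V (A @ B @ C)"
  "Cod V (mid (x \<boxtimes>\<^bsub>str V\<^esub> (y \<boxtimes>\<^bsub>str V\<^esub> z))) = tens V (A' @ B' @ C')"
  using str_Ar_simps(1)[OF assms(1) str_Ar_simps(1)[OF assms(2,3)]] by (auto simp: str_Ar x y z)
 have mxy: "mid (x \<boxtimes>\<^bsub>str V\<^esub> y) \<cdot> app_iso V A B = app_iso V A' B' \<cdot> (f \<boxtimes> g)"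
  using mid_Tar[OF assms(1,2)] by (simp add: x y)
 have myz: "mid (y \<boxtimes>\<^bsub>str V\<^esub> z) \<cdot> app_iso V B C = app_iso V B' C' \<cdot> (g \<boxtimes> h)"
  using mid_Tar[OF assms(2,3)] by (simp add: z y)
 have ml: "mid ((x \<boxtimes>\<^bsub>str V\<^esub> y) \<boxtimes>\<^bsub>str V\<^esub> z) \<cdot> app_iso V (A @ B) C = app_iso V (A' @ B') C' \<cdot> (mid (x \<boxtimes>\<^bsub>str V\<^esub> y) \<boxtimes> h)"
  using mid_Tar[OF str_Ar_simps(1)[OF assms(1,2)] assms(3)] by (simp add: x y z)
 have mr: "mid (x \<boxtimes>\<^bsub>str V\<^esub> (y \<boxtimes>\<^bsub>str V\<^esub> z)) \<cdot> app_iso V A (B @ C) = app_iso V A' (B' @ C') \<cdot> (f \<boxtimes> mid (y \<boxtimes>\<^bsub>str V\<^esub> z))"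
  using mid_Tar[OF assms(1) str_Ar_simps(1)[OF assms(2,3)]] by (simp add: x y z)
 have "mid ((x \<boxtimes>\<^bsub>str V\<^esub> y) \<boxtimes>\<^bsub>str V\<^esub> z) \<cdot> ?z = app_iso V (A' @ B') C' \<cdot> ((mid (x \<boxtimes>\<^bsub>str V\<^esub> y) \<boxtimes> h) \<cdot> (app_iso V A B \<boxtimes> Id V (tens V C)))"
  using comp_head2[OF ml, where k = "app_iso V A B \<boxtimes> Id V (tens V C)"] by (simp add: l xy)
 also have "... = (app_iso V (A' @ B') C' \<cdot> (app_iso V A' B' \<boxtimes> Id V (tens V C'))) \<cdot> ((f \<boxtimes> g) \<boxtimes> h)"
  by (simp add: interchange xy mxy)
 also have "... = app_iso V A' (B' @ C') \<cdot> ((Id V (tens V A') \<boxtimes> app_iso V B' C') \<cdot> ((f \<boxtimes> (g \<boxtimes> h)) \<cdot> Assoc V (tens V A) (tens V B) (tens V C)))"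
  by (simp add: app_iso_assoc[symmetric] Assoc_nat)
 also have "... = app_iso V A' (B' @ C') \<cdot> ((f \<boxtimes> mid (y \<boxtimes>\<^bsub>str V\<^esub> z)) \<cdot> ((Id V (tens V A) \<boxtimes> app_iso V B C) \<cdot> Assoc V (tens V A) (tens V B) (tens V C)))"
  by (simp add: interchange_assoc yz myz)
 also have "... = mid (x \<boxtimes>\<^bsub>str V\<^esub> (y \<boxtimes>\<^bsub>str V\<^esub> z)) \<cdot> ?z"
  using comp_head2[OF mr, where k = "(Id V (tens V A) \<boxtimes> app_iso V B C) \<cdot> Assoc V (tens V A) (tens V B) (tens V C)"]
  by (simp add: app_iso_assoc[symmetric] r yz)
 finally have "mid ((x \<boxtimes>\<^bsub>str V\<^esub> y) \<boxtimes>\<^bsub>str V\<^esub> z) = mid (x \<boxtimes>\<^bsub>str V\<^esub> (y \<boxtimes>\<^bsub>str V\<^esub> z))"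
  by (rule iso_cancel_right[of ?z, rotated 5]) (simp_all add: l r Inv_Comp)
 then show ?thesis by (intro prod_eqI) simp_all
qed

text \<open>After precomposition with \<open>?z\<close> both sides become composites in
  \<open>V\<close>, where the hexagon at the three iterated products and naturality of the symmetry
  apply.\<close>

lemma str_hexagon:
 assumes [simp]: "set A <= Ob V" "set B <= Ob V" "set C <= Ob V"
 shows "Braid (str V) A (B @ C) = (Id (str V) B \<boxtimes>\<^bsub>str V\<^esub> Braid (str V) A C) \<cdot>\<^bsub>str V\<^esub> (Braid (str V) A B \<boxtimes>\<^bsub>str V\<^esub> Id (str V) C)"
proof -
 let ?a = "tens V A" and ?b = "tens V B" and ?c = "tens V C"
 let ?z = "app_iso V (A @ B) C \<cdot> (app_iso V A B \<boxtimes> Id V ?c)"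
 let ?x = "Id (str V) B \<boxtimes>\<^bsub>str V\<^esub> Braid (str V) A C" and ?y = "Braid (str V) A B \<boxtimes>\<^bsub>str V\<^esub> Id (str V) C"
 have br: "mid (Braid (str V) X Y) \<in> Ar V" "Dom V (mid (Braid (str V) X Y)) = tens V (X @ Y)" "Cod V (mid (Braid (str V) X Y)) = tens V (Y @ X)"
  if "set X <= Ob V" "set Y <= Ob V" for X Y using str_Ar_simps(3)[OF that] by (auto simp: str_Ar)
 have I: "Id (str V) X \<in> Ar (str V)" if "set X <= Ob V" for X using that by (simp add: str_Ar)
 have x: "?x \<in> Ar (str V)" and y: "?y \<in> Ar (str V)" by (intro str_Ar_simps I; simp)+
 have xm: "mid ?x \<in> Ar V" "Dom V (mid ?x) = tens V (B @ A @ C)" "Cod V (mid ?x) = tens V (B @ C @ A)" using x by (auto simp: str_Ar)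
 have ym: "mid ?y \<in> Ar V" "Dom V (mid ?y) = tens V (A @ B @ C)" "Cod V (mid ?y) = tens V (B @ A @ C)" using y by (auto simp: str_Ar)
 have mx: "mid ?x \<cdot> app_iso V B (A @ C) = app_iso V B (C @ A) \<cdot> (Id V ?b \<boxtimes> mid (Braid (str V) A C))"
  using mid_Tar[OF I str_Ar_simps(3), of B A C] by simp
 have my: "mid ?y \<cdot> app_iso V (A @ B) C = app_iso V (B @ A) C \<cdot> (mid (Braid (str V) A B) \<boxtimes> Id V ?c)"
  using mid_Tar[OF str_Ar_simps(3) I, of A B C] by simp
 have "(mid ?x \<cdot> mid ?y) \<cdot> ?z = mid ?x \<cdot> (mid ?y \<cdot> ?z)" by (simp add: xm ym)
 also have "... = mid ?x \<cdot> (app_iso V (B @ A) C \<cdot> ((mid (Braid (str V) A B) \<boxtimes> Id V ?c) \<cdot> (app_iso V A B \<boxtimes> Id V ?c)))"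
  using comp_head2[OF my, where k = "app_iso V A B \<boxtimes> Id V ?c"] by (simp add: ym br)
 also have "... = mid ?x \<cdot> ((app_iso V (B @ A) C \<cdot> (app_iso V B A \<boxtimes> Id V ?c)) \<cdot> (Braid V ?a ?b \<boxtimes> Id V ?c))"
  by (simp add: interchange br mid_Braid)
 also have "... = mid ?x \<cdot> (app_iso V B (A @ C) \<cdot> ((Id V ?b \<boxtimes> app_iso V A C) \<cdot> (Assoc V ?b ?a ?c \<cdot> (Braid V ?a ?b \<boxtimes> Id V ?c))))"
  by (simp add: app_iso_assoc[symmetric])
 also have "... = app_iso V B (C @ A) \<cdot> ((Id V ?b \<boxtimes> mid (Braid (str V) A C)) \<cdot> ((Id V ?b \<boxtimes> app_iso V A C) \<cdot> (Assoc V ?b ?a ?c \<cdot> (Braid V ?a ?b \<boxtimes> Id V ?c))))"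
  using comp_head2[OF mx, where k = "(Id V ?b \<boxtimes> app_iso V A C) \<cdot> (Assoc V ?b ?a ?c \<cdot> (Braid V ?a ?b \<boxtimes> Id V ?c))"] by (simp add: xm br)
 also have "... = app_iso V B (C @ A) \<cdot> ((Id V ?b \<boxtimes> app_iso V C A) \<cdot> ((Id V ?b \<boxtimes> Braid V ?a ?c) \<cdot> (Assoc V ?b ?a ?c \<cdot> (Braid V ?a ?b \<boxtimes> Id V ?c))))"
  by (simp add: interchange_assoc br mid_Braid)
 also have "... = app_iso V B (C @ A) \<cdot> ((Id V ?b \<boxtimes> app_iso V C A) \<cdot> (Assoc V ?b ?c ?a \<cdot> (Braid V ?a (?b \<otimes> ?c) \<cdot> Assoc V ?a ?b ?c)))"
  using hexagon[of ?a ?b ?c] by simp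
 also have "... = (app_iso V (B @ C) A \<cdot> (app_iso V B C \<boxtimes> Id V ?a)) \<cdot> (Braid V ?a (?b \<otimes> ?c) \<cdot> Assoc V ?a ?b ?c)"
  by (simp add: app_iso_assoc[symmetric])
 also have "... = app_iso V (B @ C) A \<cdot> (Braid V ?a (tens V (B @ C)) \<cdot> ((Id V ?a \<boxtimes> app_iso V B C) \<cdot> Assoc V ?a ?b ?c))"
  by (simp add: comp_head2[OF Braid_nat])
 also have "... = (mid (Braid (str V) A (B @ C)) \<cdot> app_iso V A (B @ C)) \<cdot> ((Id V ?a \<boxtimes> app_iso V B C) \<cdot> Assoc V ?a ?b ?c)"
  by (simp add: mid_Braid)
 also have "... = mid (Braid (str V) A (B @ C)) \<cdot> ?z" by (simp add: br app_iso_assoc[symmetric])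
 finally have "mid ?x \<cdot> mid ?y = mid (Braid (str V) A (B @ C))" by (rule iso_cancel_right[of ?z, rotated 5]) (simp_all add: xm ym br Inv_Comp)
 then show ?thesis by (intro prod_eqI) simp_all
qed

lemma str_strict: "symmetric_strict_monoidal_category (str V)"
proof -
 have cat: "category (str V)" by unfold_locales (auto simp: Hom_iff str_Ar intro!: prod_eqI)
 then interpret S: category "str V" .
 \<comment> \<open>With an empty word \<open>app_iso\<close> is a unitor, so the unit laws for
   arrows are naturality of the unitors.\<close>
 have nat: "x \<boxtimes>\<^bsub>str V\<^esub> Id (str V) [] = x" "Id (str V) [] \<boxtimes>\<^bsub>str V\<^esub> x = x" if "x \<in> Ar (str V)" for x
  using that comp_head2[OF Runit_nat[of "mid x" "tens V (snd (snd x))"], where k = "Inv V (Runit V (tens V (fst x)))"]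
   comp_head2[OF Lunit_nat[of "mid x" "tens V (snd (snd x))"], where k = "Inv V (Lunit V (tens V (fst x)))"]
  by (auto intro!: prod_eqI simp: mid_str app_iso_Nil_right str_Ar)
 have Tar_Id: "Id (str V) A \<boxtimes>\<^bsub>str V\<^esub> Id (str V) B = Id (str V) (A @ B)" if "set A <= Ob V" "set B <= Ob V" for A B
  using that by (auto intro!: prod_eqI simp: mid_str)
 have comp: "(g \<cdot>\<^bsub>str V\<^esub> f) \<boxtimes>\<^bsub>str V\<^esub> (g' \<cdot>\<^bsub>str V\<^esub> f') = (g \<boxtimes>\<^bsub>str V\<^esub> g') \<cdot>\<^bsub>str V\<^esub> (f \<boxtimes>\<^bsub>str V\<^esub> f')"
  if "f \<in> Ar (str V)" "g \<in> Ar (str V)" "f' \<in> Ar (str V)" "g' \<in> Ar (str V)" "fst g = snd (snd f)" "fst g' = snd (snd f')" for f g f' g'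
  using that by (auto intro!: prod_eqI simp: mid_str str_Ar interchange_assoc)
 have I: "Id (str V) A \<in> Ar (str V)" "is_iso (str V) (Id (str V) A)" if "set A <= Ob V" for A
  using that S.Id_simps(1)[of A] S.is_iso_Id[of A] by simp_all
 have Bnat: "Braid (str V) A' B' \<cdot>\<^bsub>str V\<^esub> (f \<boxtimes>\<^bsub>str V\<^esub> g) = (g \<boxtimes>\<^bsub>str V\<^esub> f) \<cdot>\<^bsub>str V\<^esub> Braid (str V) A B"
  if "f \<in> Ar (str V)" "g \<in> Ar (str V)" "A' = snd (snd f)" "B' = snd (snd g)" "A = fst f" "B = fst g" for f g A B A' B'
  using that by (auto intro!: prod_eqI simp: mid_str str_Ar comp_head2[OF Braid_nat])
 have BB: "Braid (str V) B A \<cdot>\<^bsub>str V\<^esub> Braid (str V) A B = Id (str V) (A @ B)" if "set A <= Ob V" "set B <= Ob V" for A B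
  using that by (auto intro!: prod_eqI simp: mid_str)
 note [simp] = nat Tar_Id comp str_Tar_assoc BB I
 show ?thesis by (intro symmetric_strict_monoidal_category.intro symmetric_strict_monoidal_category_axioms.intro
    symmetric_monoidal_category.intro symmetric_monoidal_category_axioms.intro cat)
   (auto simp: Hom_iff Iso_iff Bnat str_hexagon)
qed

end

section \<open>Permutations in strict symmetric monoidal categories of words\<close>

inductive adj_swap :: "'a list => 'a list => bool" where
 "adj_swap (xs @ a # b # ys) (xs @ b # a # ys)"

lemma adj_swaps_Cons: "adj_swap\<^sup>*\<^sup>* ks ls ==> adj_swap\<^sup>*\<^sup>* (k # ks) (k # ls)" proof (induction rule: rtranclp_induct)
 case (step ls ms)
 from step(2) obtain xs a b ys where "ls = xs @ a # b # ys" "ms = xs @ b # a # ys" by (cases rule: adj_swap.cases)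
 then have "adj_swap (k # ls) (k # ms)" using adj_swap.intros[of "k # xs" a b ys] by simp
 with step(3) show ?case by simp
qed simp

lemma adj_swaps_move: "adj_swap\<^sup>*\<^sup>* (k # us @ vs) (us @ k # vs)" proof (induction us)
 case (Cons u us)
 have "adj_swap (k # u # us @ vs) (u # k # us @ vs)" using adj_swap.intros[of "[]" k u "us @ vs"] by simp
 with adj_swaps_Cons[OF Cons, of u] show ?case by simp
qed simp

text \<open>The tail is first rearranged into the remainder of the target list; the head is then
  bubbled to its place.\<close>

lemma adj_swaps_mset: "mset ls = mset ks ==> adj_swap\<^sup>*\<^sup>* ks ls" proof (induction ks arbitrary: ls)
 case (Cons k ks)
 then have "k \<in> set ls" by (metis list.set_intros(1) mset_eq_setD)
 then obtain us vs where ls: "ls = us @ k # vs" by (meson split_list)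
 then have "adj_swap\<^sup>*\<^sup>* ks (us @ vs)" using Cons by simp
 then have "adj_swap\<^sup>*\<^sup>* (k # ks) (k # us @ vs)" by (rule adj_swaps_Cons)
 with adj_swaps_move[of k us vs] show ?case by (simp add: ls)
qed simp

text \<open>
 \<open>parr P A ks ls f\<close>: the arrow \<open>f\<close>, from the word labelled by \<open>ks\<close> to the word labelled by
 \<open>ls\<close>, is a composite of symmetries of adjacent letters.
\<close>

inductive parr :: "('a list, 'm) smcat => (nat => 'a) => nat list => nat list => 'm => bool"
 for P A ks where
 parr_refl: "parr P A ks ks (Id P (map A ks))"
| parr_step: "parr P A ks (xs @ a # b # ys) f ==> parr P A ks (xs @ b # a # ys)
  ((Id P (map A xs) \<boxtimes>\<^bsub>P\<^esub> (Braid P [A a] [A b] \<boxtimes>\<^bsub>P\<^esub> Id P (map A ys))) \<cdot>\<^bsub>P\<^esub> f)"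

lemma parr_mset: "parr P A ks ls f ==> mset ls = mset ks" by (induction rule: parr.induct) (auto simp: add_mset_commute)

lemma parr_exists:
 assumes "mset ls = mset ks" shows "\<exists>f. parr P A ks ls f" using adj_swaps_mset[OF assms] proof (induction rule: rtranclp_induct)
 case base
 show ?case by (rule exI, rule parr_refl)
next
 case (step ls ms)
 from step(2) obtain xs a b ys where "ls = xs @ a # b # ys" "ms = xs @ b # a # ys" by (cases rule: adj_swap.cases)
 with step(3) parr_step[of P A ks xs a b ys] show ?case by blast
qed

text \<open>Labels are only names for letters. This is what allows positions in a sublist to be
  renamed as positions in a concatenation.\<close>

lemma parr_relabel: "parr P (A \<circ> p) ks ls f ==> parr P A (map p ks) (map p ls) f" proof (induction rule: parr.induct)
 case parr_refl
 show ?case using parr.parr_refl[of P A "map p ks"] by (simp add: comp_def)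
next
 case (parr_step xs a b ys f)
 then show ?case using parr.parr_step[of P A "map p ks" "map p xs" "p a" "p b" "map p ys" f] by (simp add: comp_def)
qed

lemma parr_cong:
 assumes "parr P A ks ls f" "\<And>k. k \<in> set ks ==> A k = B k" shows "parr P B ks ls f" using assms(1) proof (induction rule: parr.induct)
 case parr_refl
 have *: "map A ks = map B ks" using assms(2) by simp
 show ?case unfolding * by (rule parr.parr_refl)
next
 case (parr_step xs a b ys f)
 have "set (xs @ a # b # ys) = set ks" using parr_mset[OF parr_step(1)] by (metis mset_eq_setD)
 then have *: "A a = B a" "A b = B b" "map A xs = map B xs" "map A ys = map B ys" using assms(2) by auto
 show ?case unfolding * by (rule parr.parr_step[OF parr_step(2)])
qed

text \<open>The arrow that accompanies \<open>insort\<close> and, in the next definition,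
  \<open>sort\<close>. Sorting is the fixed reference with which every composite of adjacent
  symmetries is compared.\<close>

primrec ins_ar :: "('a list, 'm) smcat => (nat => 'a) => nat => nat list => 'm" where
 "ins_ar P A k [] = Id P [A k]"
| "ins_ar P A k (l # ls) = (if k \<le> l then Id P (map A (k # l # ls))
  else (Id P [A l] \<boxtimes>\<^bsub>P\<^esub> ins_ar P A k ls) \<cdot>\<^bsub>P\<^esub> (Braid P [A k] [A l] \<boxtimes>\<^bsub>P\<^esub> Id P (map A ls)))"

primrec sort_ar :: "('a list, 'm) smcat => (nat => 'a) => nat list => 'm" where
 "sort_ar P A [] = Id P []"
| "sort_ar P A (k # ks) = ins_ar P A k (sort ks) \<cdot>\<^bsub>P\<^esub> (Id P [A k] \<boxtimes>\<^bsub>P\<^esub> sort_ar P A ks)"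

text \<open>The description is unique for distinct labels, by \<open>can_eqI\<close>. With a
  repeated label it can fail: exchanging two equal letters has the same boundary as the
  identity.\<close>

definition can :: "('a list, 'm) smcat => (nat => 'a) => nat list => nat list => 'm" where
 "can P A ks ls = (THE f. parr P A ks ls f)"

definition tensl :: "('a list, 'm) smcat => 'm list => 'm" where
 "tensl P fs = foldr (Tar P) fs (Id P [])"

lemma tensl_simps [simp]: "tensl P [] = Id P []" "tensl P (f # fs) = f \<boxtimes>\<^bsub>P\<^esub> tensl P fs" by (simp_all add: tensl_def)

lemma mset_concat_cong:
 "(\<And>k. k \<in> set ks ==> mset (K' k) = mset (K k)) ==> mset (concat (map K' ks)) = mset (concat (map K ks))"
 by (induction ks) auto

lemma mset_concat_map: "mset ls = mset ks ==> mset (concat (map K ls)) = mset (concat (map K ks))"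
 by (simp add: mset_concat comp_def flip: sum_mset_sum_list)

text \<open>Isolates the case of words under concatenation, so that the arguments about permutations
  use strict laws only. The instance that matters is \<open>str V\<close>.\<close>

locale word_smc = symmetric_strict_monoidal_category P
 for P :: "('a list, 'm) smcat" (structure) +
 fixes L :: "'a set"
 assumes Ob_P [simp]: "Ob P = {As. set As <= L}" and Tob_P [simp]: "Tob P = (@)" and Unit_P [simp]: "Unit P = []"
begin

declare image_Un [simp]

lemma Tar_assoc [simp]: "[|f \<in> Ar P; g \<in> Ar P; h \<in> Ar P|] ==> (f \<boxtimes> g) \<boxtimes> h = f \<boxtimes> (g \<boxtimes> h)"
 using Assoc_nat[of f g h "Cod P f" "Cod P g" "Cod P h"]
  Dom_in[of f] Cod_in[of f] Dom_in[of g] Cod_in[of g] Dom_in[of h] Cod_in[of h] by (simp add: Assoc_strict del: Dom_in Cod_in)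

lemma Tar_Unit [simp]:
 assumes "f \<in> Ar P" shows "f \<boxtimes> Id P [] = f" "Id P [] \<boxtimes> f = f"
 using Runit_nat[of f "Cod P f"] Lunit_nat[of f "Cod P f"] assms Dom_in[of f] Cod_in[of f] by (simp_all add: Runit_strict Lunit_strict del: Dom_in Cod_in)

lemma Dom_letters [simp]: "f \<in> Ar P ==> set (Dom P f) <= L" and Cod_letters [simp]: "f \<in> Ar P ==> set (Cod P f) <= L"
 using Dom_in[of f] Cod_in[of f] by (simp_all del: Dom_in Cod_in)

text \<open>Merges adjacent identities, giving right-nested tensor products a normal form.\<close>

lemma Id_Tar_Id_Tar [simp]:
 "[|f \<in> Ar P; set As <= L; set Bs <= L|] ==> Id P As \<boxtimes> (Id P Bs \<boxtimes> f) = Id P (As @ Bs) \<boxtimes> f"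
 using Tar_assoc[of "Id P As" "Id P Bs" f] by (simp del: Tar_assoc)

lemma Braid_append_right:
 assumes "set A <= L" "set B <= L" "set C <= L"
 shows "Braid P A (B @ C) = (Id P B \<boxtimes> Braid P A C) \<cdot> (Braid P A B \<boxtimes> Id P C)" using hexagon[of A B C] assms by (simp add: Assoc_strict)

text \<open>The other hexagon, obtained by inversion because the inverse of a symmetry is again a
  symmetry.\<close>

lemma Braid_append_left:
 assumes [simp]: "set A <= L" "set B <= L" "set C <= L"
 shows "Braid P (A @ B) C = (Braid P A C \<boxtimes> Id P B) \<cdot> (Id P A \<boxtimes> Braid P B C)"
proof -
 have "Braid P (A @ B) C = Inv P (Braid P C (A @ B))" by simp
 also have "... = Inv P ((Id P A \<boxtimes> Braid P C B) \<cdot> (Braid P C A \<boxtimes> Id P B))" by (simp only: Braid_append_right assms)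
 also have "... = (Braid P A C \<boxtimes> Id P B) \<cdot> (Id P A \<boxtimes> Braid P B C)" by (subst Inv_Comp(2)) simp_all
 finally show ?thesis .
qed

text \<open>The hexagon with empty words makes this symmetry idempotent, and an invertible
  idempotent is an identity.\<close>

lemma Braid_Nil [simp]:
 assumes "set A <= L" shows "Braid P A [] = Id P A" "Braid P [] A = Id P A"
proof -
 have "Braid P A [] \<cdot> Braid P A [] = Braid P A [] \<cdot> Id P A" using Braid_append_right[of A "[]" "[]"] assms by simp
 then show *: "Braid P A [] = Id P A" by (rule iso_cancel_left[rotated 5]) (use assms in simp_all)
 have "Braid P [] A = Inv P (Braid P A [])" using assms by simp
 also have "... = Id P A" using assms by (simp only: * Inv_Id Ob_P mem_Collect_eq)
 finally show "Braid P [] A = Id P A" .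
qed

text \<open>Naturality of the symmetry of \<open>A\<close> with respect to
  \<open>Braid P B C\<close>, with symmetries past a concatenation split by the hexagon.\<close>

lemma yang_baxter:
 assumes [simp]: "set A <= L" "set B <= L" "set C <= L"
 shows "(Braid P B C \<boxtimes> Id P A) \<cdot> ((Id P B \<boxtimes> Braid P A C) \<cdot> (Braid P A B \<boxtimes> Id P C))
  = (Id P C \<boxtimes> Braid P A B) \<cdot> ((Braid P A C \<boxtimes> Id P B) \<cdot> (Id P A \<boxtimes> Braid P B C))"
 using Braid_nat[of "Id P A" "Braid P B C" A "C @ B"] by (simp add: Braid_append_right)

lemma parr_simps:
 assumes "parr P A ks ls f" "A ` set ks <= L" shows "f \<in> Ar P" "Dom P f = map A ks" "Cod P f = map A ls" "A ` set ls <= L"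
proof -
 have "f \<in> Ar P & Dom P f = map A ks & Cod P f = map A ls & A ` set ls <= L" using assms by (induction rule: parr.induct) simp_all
 then show "f \<in> Ar P" "Dom P f = map A ks" "Cod P f = map A ls" "A ` set ls <= L" by auto
qed

lemma parr_trans:
 assumes "parr P A ks ls f" "parr P A ls ms g" "A ` set ks <= L" shows "parr P A ks ms (g \<cdot> f)" using assms(2)
proof (induction rule: parr.induct)
 case parr_refl
 show ?case using assms parr_simps[OF assms(1,3)] by simp
next
 case (parr_step xs a b ys g)
 note f = parr_simps[OF assms(1,3)]
 note g = parr_simps[OF parr_step(1) f(4)]
 show ?case using parr.parr_step[OF parr_step(2)] f g by simp
qed

lemma parr_left:
 assumes "parr P A ls ms g" "A ` set ls <= L" "A ` set ks <= L" shows "parr P A (ks @ ls) (ks @ ms) (Id P (map A ks) \<boxtimes> g)"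
 using assms(1) proof (induction rule: parr.induct)
 case parr_refl
 show ?case using parr.parr_refl[of P A "ks @ ls"] assms by simp
next
 case (parr_step xs a b ys g)
 note g = parr_simps[OF parr_step(1) assms(2)]
 let ?s = "Id P (map A xs) \<boxtimes> (Braid P [A a] [A b] \<boxtimes> Id P (map A ys))"
 have "Id P (map A ks) \<boxtimes> (?s \<cdot> g) = (Id P (map A ks) \<boxtimes> ?s) \<cdot> (Id P (map A ks) \<boxtimes> g)"
  using g assms by (subst interchange) simp_all
 then show ?case using parr.parr_step[of P A "ks @ ls" "ks @ xs" a b ys] parr_step(2) g assms by simp
qed

lemma parr_right:
 assumes "parr P A ls ms g" "A ` set ls <= L" "A ` set ks <= L" shows "parr P A (ls @ ks) (ms @ ks) (g \<boxtimes> Id P (map A ks))"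
 using assms(1) proof (induction rule: parr.induct)
 case parr_refl
 show ?case using parr.parr_refl[of P A "ls @ ks"] assms by simp
next
 case (parr_step xs a b ys g)
 note g = parr_simps[OF parr_step(1) assms(2)]
 let ?s = "Id P (map A xs) \<boxtimes> (Braid P [A a] [A b] \<boxtimes> Id P (map A ys))"
 have "(?s \<cdot> g) \<boxtimes> Id P (map A ks) = (?s \<boxtimes> Id P (map A ks)) \<cdot> (g \<boxtimes> Id P (map A ks))"
  using g assms by (subst interchange) simp_all
 then show ?case using parr.parr_step[of P A "ls @ ks" xs a b "ys @ ks"] parr_step(2) g assms by simp
qed

lemma parr_Tar:
 assumes "parr P A ks ks' f" "parr P A ls ls' g" "A ` set ks <= L" "A ` set ls <= L" shows "parr P A (ks @ ls) (ks' @ ls') (f \<boxtimes> g)"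
proof -
 note f = parr_simps[OF assms(1,3)] and g = parr_simps[OF assms(2,4)]
 have "parr P A (ks @ ls) (ks' @ ls') ((Id P (map A ks') \<boxtimes> g) \<cdot> (f \<boxtimes> Id P (map A ls)))"
  using assms f by (intro parr_trans[OF parr_right parr_left]) auto
 then show ?thesis using assms(3,4) f g by (simp add: interchange)
qed

lemma parr_Braid1:
 assumes [simp]: "A k \<in> L" "A ` set ls <= L" shows "parr P A (k # ls) (ls @ [k]) (Braid P [A k] (map A ls))" using assms(2) proof (induction ls)
 case Nil
 show ?case using parr_refl[of P A "[k]"] by simp
next
 case (Cons l ls)
 have 1: "parr P A (k # l # ls) (l # k # ls) (Braid P [A k] [A l] \<boxtimes> Id P (map A ls))"
  using parr_step[OF parr_refl, of P A "[]" k l ls] Cons.prems by simp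
 have 2: "parr P A (l # k # ls) (l # ls @ [k]) (Id P [A l] \<boxtimes> Braid P [A k] (map A ls))"
  using parr_left[of A "k # ls" "ls @ [k]" "Braid P [A k] (map A ls)" "[l]"] Cons by simp
 show ?case using parr_trans[OF 1 2] Cons.prems Braid_append_right[of "[A k]" "[A l]" "map A ls"] by simp
qed

text \<open>The hexagons decompose the symmetry of two words into symmetries of letters, which makes
  it a canonical arrow.\<close>

lemma parr_Braid:
 assumes [simp]: "A ` set ks <= L" "A ` set ls <= L" shows "parr P A (ks @ ls) (ls @ ks) (Braid P (map A ks) (map A ls))" using assms(1)
proof (induction ks)
 case Nil
 show ?case using parr_refl[of P A ls] by simp
next
 case (Cons k ks)
 have 1: "parr P A (k # ks @ ls) (k # ls @ ks) (Id P [A k] \<boxtimes> Braid P (map A ks) (map A ls))"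
  using parr_left[of A "ks @ ls" "ls @ ks" "Braid P (map A ks) (map A ls)" "[k]"] Cons by simp
 have 2: "parr P A (k # ls @ ks) (ls @ k # ks) (Braid P [A k] (map A ls) \<boxtimes> Id P (map A ks))"
  using parr_right[OF parr_Braid1[of A k ls], of ks] Cons.prems by simp
 show ?case using parr_trans[OF 1 2] Cons.prems Braid_append_left[of "[A k]" "map A ks" "map A ls"] by simp
qed

section \<open>Insertion sort as a normal form for permutation arrows\<close>

lemma ins_ar_simps [simp]:
 assumes "A k \<in> L" "A ` set ls <= L" shows "ins_ar P A k ls \<in> Ar P" "Dom P (ins_ar P A k ls) = A k # map A ls"
  "Cod P (ins_ar P A k ls) = map A (insort k ls)" "is_iso P (ins_ar P A k ls)"
proof -
 have "ins_ar P A k ls \<in> Ar P & Dom P (ins_ar P A k ls) = A k # map A ls &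
  Cod P (ins_ar P A k ls) = map A (insort k ls) & is_iso P (ins_ar P A k ls)" using assms by (induction ls) (auto simp: Inv_Comp(1))
 then show "ins_ar P A k ls \<in> Ar P" "Dom P (ins_ar P A k ls) = A k # map A ls"
  "Cod P (ins_ar P A k ls) = map A (insort k ls)" "is_iso P (ins_ar P A k ls)" by auto
qed

lemma sort_ar_simps [simp]:
 assumes "A ` set ls <= L" shows "sort_ar P A ls \<in> Ar P" "Dom P (sort_ar P A ls) = map A ls"
  "Cod P (sort_ar P A ls) = map A (sort ls)" "is_iso P (sort_ar P A ls)"
proof -
 have "sort_ar P A ls \<in> Ar P & Dom P (sort_ar P A ls) = map A ls &
  Cod P (sort_ar P A ls) = map A (sort ls) & is_iso P (sort_ar P A ls)" using assms by (induction ls) (auto simp: Inv_Comp(1))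
 then show "sort_ar P A ls \<in> Ar P" "Dom P (sort_ar P A ls) = map A ls"
  "Cod P (sort_ar P A ls) = map A (sort ls)" "is_iso P (sort_ar P A ls)" by auto
qed

lemma ins_ar_min: "\<forall>z \<in> set zs. a < z ==> insort a zs = a # zs & ins_ar P A a zs = Id P (map A (a # zs))" by (cases zs) auto

text \<open>The least letter \<open>a\<close> stays in front. On the left \<open>b\<close> has to
  cross it during insertion, and this crossing cancels against the symmetry; on the right inserting
  \<open>a\<close> is an identity.\<close>

lemma ins_ar_swap_min:
 assumes [simp]: "A a \<in> L" "A b \<in> L" "A ` set zs <= L" and ab: "a < b" and z: "\<forall>z \<in> set zs. a < z"
 shows "ins_ar P A b (insort a zs) \<cdot> ((Id P [A b] \<boxtimes> ins_ar P A a zs) \<cdot> (Braid P [A a] [A b] \<boxtimes> Id P (map A zs)))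
  = ins_ar P A a (insort b zs) \<cdot> (Id P [A a] \<boxtimes> ins_ar P A b zs)"
proof -
 have "ins_ar P A a (insort b zs) = Id P (map A (a # insort b zs))" using ins_ar_min[of "insort b zs" a A] ab z by (simp add: set_insort_key)
 moreover have "(Id P [A a] \<boxtimes> ins_ar P A b zs) \<cdot> ((Braid P [A b] [A a] \<boxtimes> Id P (map A zs)) \<cdot> (Braid P [A a] [A b] \<boxtimes> Id P (map A zs)))
  = Id P [A a] \<boxtimes> ins_ar P A b zs" by (simp add: interchange)
 ultimately show ?thesis using ins_ar_min[OF z, of A] ab by (simp add: set_insort_key)
qed

text \<open>The symmetry is an involution, so the statement for \<open>(a, b)\<close> can be solved
  for the one for \<open>(b, a)\<close>.\<close>

lemma ins_ar_swap_sym: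
 assumes [simp]: "A a \<in> L" "A b \<in> L" "A ` set zs <= L"
  and *: "ins_ar P A b (insort a zs) \<cdot> ((Id P [A b] \<boxtimes> ins_ar P A a zs) \<cdot> (Braid P [A a] [A b] \<boxtimes> Id P (map A zs)))
  = ins_ar P A a (insort b zs) \<cdot> (Id P [A a] \<boxtimes> ins_ar P A b zs)"
 shows "ins_ar P A a (insort b zs) \<cdot> ((Id P [A a] \<boxtimes> ins_ar P A b zs) \<cdot> (Braid P [A b] [A a] \<boxtimes> Id P (map A zs)))
  = ins_ar P A b (insort a zs) \<cdot> (Id P [A b] \<boxtimes> ins_ar P A a zs)"
proof -
 have "(ins_ar P A a (insort b zs) \<cdot> (Id P [A a] \<boxtimes> ins_ar P A b zs)) \<cdot> (Braid P [A b] [A a] \<boxtimes> Id P (map A zs))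
  = ins_ar P A b (insort a zs) \<cdot> ((Id P [A b] \<boxtimes> ins_ar P A a zs) \<cdot> ((Braid P [A a] [A b] \<boxtimes> Id P (map A zs)) \<cdot> (Braid P [A b] [A a] \<boxtimes> Id P (map A zs))))"
  unfolding *[symmetric] by (simp add: set_insort_key)
 also have "(Braid P [A a] [A b] \<boxtimes> Id P (map A zs)) \<cdot> (Braid P [A b] [A a] \<boxtimes> Id P (map A zs)) = Id P ([A b] @ [A a] @ map A zs)"
  by (simp add: interchange)
 finally show ?thesis by (simp add: set_insort_key)
qed

text \<open>Two letters may be inserted in either order. If one of them precedes the whole list,
  crossings cancel; if the head of the list precedes both, they cross it and the Yang-Baxter
  equation rearranges the three crossings.\<close>

lemma ins_ar_swap:
 assumes "A a \<in> L" "A b \<in> L" "A ` set zs <= L" "sorted zs" "distinct (a # b # zs)"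
 shows "ins_ar P A b (insort a zs) \<cdot> ((Id P [A b] \<boxtimes> ins_ar P A a zs) \<cdot> (Braid P [A a] [A b] \<boxtimes> Id P (map A zs)))
  = ins_ar P A a (insort b zs) \<cdot> (Id P [A a] \<boxtimes> ins_ar P A b zs)" using assms proof (induction zs)
 case Nil
 then have *: "A a \<in> L" "A b \<in> L" "A ` set [] <= L" "a < b \<or> b < a" by auto
 then show ?case using ins_ar_swap_min[OF *(1-3)] ins_ar_swap_sym[OF *(2,1,3) ins_ar_swap_min[OF *(2,1,3)]] by (auto simp del: ins_ar.simps)
next
 case (Cons z zs)
 note [simp] = Cons.prems(1,2)
 have [simp]: "A z \<in> L" "A ` set zs <= L" using Cons.prems by auto
 \<comment> \<open>Distinctness makes exactly one of \<open>a\<close>, \<open>b\<close>,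
   \<open>z\<close> the least.\<close>
 consider "a < b" "a < z" | "b < a" "b < z" | "z < a" "z < b" using Cons.prems(5) by fastforce
 then show ?case
 proof cases
  case 1
  then show ?thesis using Cons.prems by (intro ins_ar_swap_min) auto
 next
  case 2
  then show ?thesis using Cons.prems by (intro ins_ar_swap_sym[OF _ _ _ ins_ar_swap_min]) auto
 next
  case 3
  let ?Z = "Id P [A z]" and ?a = "Id P [A a]" and ?b = "Id P [A b]" and ?R = "Id P (map A zs)"
  let ?\<beta> = "%x y. Braid P [A x] [A y]"
  have zab: "A z \<in> L" "A a \<in> L" "A b \<in> L" by auto
  have IH: "ins_ar P A b (insort a zs) \<cdot> ((?b \<boxtimes> ins_ar P A a zs) \<cdot> (?\<beta> a b \<boxtimes> ?R))
   = ins_ar P A a (insort b zs) \<cdot> (?a \<boxtimes> ins_ar P A b zs)" using Cons by simp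
  \<comment> \<open>Separates the crossings with \<open>z\<close>, which are performed first, from
    the insertions into the tail, which are performed behind \<open>z\<close>.\<close>
  have pull: "(?Z \<boxtimes> ins_ar P A y (insort x zs)) \<cdot> ((?\<beta> y z \<boxtimes> Id P (map A (insort x zs))) \<cdot> ((Id P [A y] \<boxtimes> ((?Z \<boxtimes> ins_ar P A x zs) \<cdot> (?\<beta> x z \<boxtimes> ?R))) \<cdot> k))
   = (?Z \<boxtimes> (ins_ar P A y (insort x zs) \<cdot> (Id P [A y] \<boxtimes> ins_ar P A x zs))) \<cdot> ((?\<beta> y z \<boxtimes> Id P (A x # map A zs)) \<cdot> ((Id P [A y] \<boxtimes> (?\<beta> x z \<boxtimes> ?R)) \<cdot> k))"
   if [simp]: "A x \<in> L" "A y \<in> L" and k: "k \<in> Ar P" "Cod P k = A y # A x # A z # map A zs" for x y k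
  proof -
   have 1: "Id P [A y] \<boxtimes> ((?Z \<boxtimes> ins_ar P A x zs) \<cdot> (?\<beta> x z \<boxtimes> ?R)) = (Id P [A y, A z] \<boxtimes> ins_ar P A x zs) \<cdot> (Id P [A y] \<boxtimes> (?\<beta> x z \<boxtimes> ?R))"
    using interchange[of "Id P [A y]" "Id P [A y]" "?\<beta> x z \<boxtimes> ?R" "?Z \<boxtimes> ins_ar P A x zs"] by simp
   have 2: "(?\<beta> y z \<boxtimes> Id P (map A (insort x zs))) \<cdot> (Id P [A y, A z] \<boxtimes> ins_ar P A x zs)
    = (Id P [A z, A y] \<boxtimes> ins_ar P A x zs) \<cdot> (?\<beta> y z \<boxtimes> Id P (A x # map A zs))" by (simp add: interchange set_insort_key)
   have 3: "(?Z \<boxtimes> ins_ar P A y (insort x zs)) \<cdot> (Id P [A z, A y] \<boxtimes> ins_ar P A x zs)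
    = ?Z \<boxtimes> (ins_ar P A y (insort x zs) \<cdot> (Id P [A y] \<boxtimes> ins_ar P A x zs))"
    using interchange[of ?Z ?Z "Id P [A y] \<boxtimes> ins_ar P A x zs" "ins_ar P A y (insort x zs)"] by (simp add: set_insort_key)
   let ?q = "(Id P [A y] \<boxtimes> (?\<beta> x z \<boxtimes> ?R)) \<cdot> k"
   have q: "?q \<in> Ar P" "Cod P ?q = A y # A z # A x # map A zs" using k by simp_all
   have "(?Z \<boxtimes> ins_ar P A y (insort x zs)) \<cdot> ((?\<beta> y z \<boxtimes> Id P (map A (insort x zs))) \<cdot> (((Id P [A y, A z] \<boxtimes> ins_ar P A x zs) \<cdot> (Id P [A y] \<boxtimes> (?\<beta> x z \<boxtimes> ?R))) \<cdot> k))
    = (?Z \<boxtimes> ins_ar P A y (insort x zs)) \<cdot> (((?\<beta> y z \<boxtimes> Id P (map A (insort x zs))) \<cdot> (Id P [A y, A z] \<boxtimes> ins_ar P A x zs)) \<cdot> ?q)"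
    using k by (simp add: set_insort_key)
   also have "... = ((?Z \<boxtimes> ins_ar P A y (insort x zs)) \<cdot> (Id P [A z, A y] \<boxtimes> ins_ar P A x zs)) \<cdot> ((?\<beta> y z \<boxtimes> Id P (A x # map A zs)) \<cdot> ?q)"
    unfolding 2 using q by (simp add: set_insort_key)
   finally show ?thesis unfolding 1 3 .
  qed
  \<comment> \<open>The Yang-Baxter equation for the three letters, tensored with the rest of the
    list.\<close>
  have yb: "(?\<beta> b z \<boxtimes> Id P (A a # map A zs)) \<cdot> ((?b \<boxtimes> (?\<beta> a z \<boxtimes> ?R)) \<cdot> (?\<beta> a b \<boxtimes> Id P (A z # map A zs)))
   = (?Z \<boxtimes> (?\<beta> a b \<boxtimes> ?R)) \<cdot> ((?\<beta> a z \<boxtimes> Id P (A b # map A zs)) \<cdot> (?a \<boxtimes> (?\<beta> b z \<boxtimes> ?R)))"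
  proof -
   have "Id P (A x # map A zs) = Id P [A x] \<boxtimes> ?R" if "A x \<in> L" for x using that by simp
   then have "(?\<beta> b z \<boxtimes> Id P (A a # map A zs)) \<cdot> ((?b \<boxtimes> (?\<beta> a z \<boxtimes> ?R)) \<cdot> (?\<beta> a b \<boxtimes> Id P (A z # map A zs)))
    = ((?\<beta> b z \<boxtimes> ?a) \<boxtimes> ?R) \<cdot> (((?b \<boxtimes> ?\<beta> a z) \<boxtimes> ?R) \<cdot> ((?\<beta> a b \<boxtimes> ?Z) \<boxtimes> ?R))"
    by simp
   also have "... = ((?\<beta> b z \<boxtimes> ?a) \<cdot> ((?b \<boxtimes> ?\<beta> a z) \<cdot> (?\<beta> a b \<boxtimes> ?Z))) \<boxtimes> ?R"
    by (simp add: interchange del: Tar_assoc)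
   also have "... = ((?Z \<boxtimes> ?\<beta> a b) \<cdot> ((?\<beta> a z \<boxtimes> ?b) \<cdot> (?a \<boxtimes> ?\<beta> b z))) \<boxtimes> ?R"
    using yang_baxter[of "[A a]" "[A b]" "[A z]"] by simp
   also have "... = ((?Z \<boxtimes> ?\<beta> a b) \<boxtimes> ?R) \<cdot> (((?\<beta> a z \<boxtimes> ?b) \<boxtimes> ?R) \<cdot> ((?a \<boxtimes> ?\<beta> b z) \<boxtimes> ?R))"
    by (simp add: interchange del: Tar_assoc)
   finally show ?thesis by simp
  qed
  have "ins_ar P A b (insort a (z # zs)) \<cdot> ((?b \<boxtimes> ins_ar P A a (z # zs)) \<cdot> (?\<beta> a b \<boxtimes> Id P (map A (z # zs))))
   = (?Z \<boxtimes> ins_ar P A b (insort a zs)) \<cdot> ((?\<beta> b z \<boxtimes> Id P (map A (insort a zs))) \<cdot> ((?b \<boxtimes> ((?Z \<boxtimes> ins_ar P A a zs) \<cdot> (?\<beta> a z \<boxtimes> ?R))) \<cdot> (?\<beta> a b \<boxtimes> Id P (A z # map A zs))))"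
   using 3 by (simp add: set_insort_key)
  also have "... = (?Z \<boxtimes> (ins_ar P A b (insort a zs) \<cdot> (?b \<boxtimes> ins_ar P A a zs))) \<cdot> ((?\<beta> b z \<boxtimes> Id P (A a # map A zs)) \<cdot> ((?b \<boxtimes> (?\<beta> a z \<boxtimes> ?R)) \<cdot> (?\<beta> a b \<boxtimes> Id P (A z # map A zs))))"
   by (rule pull) simp_all
  also have "... = ((?Z \<boxtimes> (ins_ar P A b (insort a zs) \<cdot> (?b \<boxtimes> ins_ar P A a zs))) \<cdot> (?Z \<boxtimes> (?\<beta> a b \<boxtimes> ?R))) \<cdot> ((?\<beta> a z \<boxtimes> Id P (A b # map A zs)) \<cdot> (?a \<boxtimes> (?\<beta> b z \<boxtimes> ?R)))"
   unfolding yb by (simp add: set_insort_key)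
  also have "(?Z \<boxtimes> (ins_ar P A b (insort a zs) \<cdot> (?b \<boxtimes> ins_ar P A a zs))) \<cdot> (?Z \<boxtimes> (?\<beta> a b \<boxtimes> ?R))
   = ?Z \<boxtimes> (ins_ar P A a (insort b zs) \<cdot> (?a \<boxtimes> ins_ar P A b zs))" unfolding IH[symmetric]
   using interchange[of ?Z ?Z "?\<beta> a b \<boxtimes> ?R" "ins_ar P A b (insort a zs) \<cdot> (?b \<boxtimes> ins_ar P A a zs)"] by (simp add: set_insort_key)
  also have "(?Z \<boxtimes> (ins_ar P A a (insort b zs) \<cdot> (?a \<boxtimes> ins_ar P A b zs))) \<cdot> ((?\<beta> a z \<boxtimes> Id P (A b # map A zs)) \<cdot> (?a \<boxtimes> (?\<beta> b z \<boxtimes> ?R)))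
   = (?Z \<boxtimes> ins_ar P A a (insort b zs)) \<cdot> ((?\<beta> a z \<boxtimes> Id P (map A (insort b zs))) \<cdot> (?a \<boxtimes> ((?Z \<boxtimes> ins_ar P A b zs) \<cdot> (?\<beta> b z \<boxtimes> ?R))))"
   using pull[of b a "Id P (A a # A b # A z # map A zs)"] by simp
  also have "... = ins_ar P A a (insort b (z # zs)) \<cdot> (?a \<boxtimes> ins_ar P A b (z # zs))" using 3 by (simp add: set_insort_key)
  finally show ?thesis .
 qed
qed

text \<open>Sorting absorbs an adjacent symmetry: \<open>ins_ar_swap\<close> treats the first two
  letters, and the letters before them are carried along by the recursion.\<close>

lemma sort_ar_swap:
 assumes "A ` set (xs @ a # b # ys) <= L" "distinct (xs @ a # b # ys)"
 shows "sort_ar P A (xs @ b # a # ys) \<cdot> (Id P (map A xs) \<boxtimes> (Braid P [A a] [A b] \<boxtimes> Id P (map A ys))) = sort_ar P A (xs @ a # b # ys)"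
 using assms proof (induction xs)
 case Nil
 then have [simp]: "A a \<in> L" "A b \<in> L" "A ` set ys <= L" by auto
 let ?s = "sort_ar P A ys" and ?a = "Id P [A a]" and ?b = "Id P [A b]"
 let ?ia = "ins_ar P A a (sort ys)" and ?ib = "ins_ar P A b (insort a (sort ys))"
 have 1: "?b \<boxtimes> (?ia \<cdot> (?a \<boxtimes> ?s)) = (?b \<boxtimes> ?ia) \<cdot> (Id P [A b, A a] \<boxtimes> ?s)"
  using interchange[of ?b ?b "?a \<boxtimes> ?s" ?ia] by simp
 have 2: "(Id P [A b, A a] \<boxtimes> ?s) \<cdot> (Braid P [A a] [A b] \<boxtimes> Id P (map A ys)) = (Braid P [A a] [A b] \<boxtimes> Id P (map A (sort ys))) \<cdot> (Id P [A a, A b] \<boxtimes> ?s)"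
  by (simp add: interchange)
 have 3: "?a \<boxtimes> (ins_ar P A b (sort ys) \<cdot> (?b \<boxtimes> ?s)) = (?a \<boxtimes> ins_ar P A b (sort ys)) \<cdot> (Id P [A a, A b] \<boxtimes> ?s)"
  using interchange[of ?a ?a "?b \<boxtimes> ?s" "ins_ar P A b (sort ys)"] by simp
 have sw: "?ib \<cdot> ((?b \<boxtimes> ?ia) \<cdot> (Braid P [A a] [A b] \<boxtimes> Id P (map A (sort ys))))
  = ins_ar P A a (insort b (sort ys)) \<cdot> (?a \<boxtimes> ins_ar P A b (sort ys))" using Nil by (intro ins_ar_swap) auto
 have "sort_ar P A (b # a # ys) \<cdot> (Braid P [A a] [A b] \<boxtimes> Id P (map A ys))
  = ?ib \<cdot> ((?b \<boxtimes> ?ia) \<cdot> ((Id P [A b, A a] \<boxtimes> ?s) \<cdot> (Braid P [A a] [A b] \<boxtimes> Id P (map A ys))))"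
  by (simp add: 1 set_insort_key)
 also have "... = (?ib \<cdot> ((?b \<boxtimes> ?ia) \<cdot> (Braid P [A a] [A b] \<boxtimes> Id P (map A (sort ys))))) \<cdot> (Id P [A a, A b] \<boxtimes> ?s)"
  unfolding 2 by (simp add: set_insort_key)
 also have "... = sort_ar P A (a # b # ys)" unfolding sw by (simp add: 3 set_insort_key)
 finally show ?case by simp
next
 case (Cons x xs)
 then have [simp]: "A x \<in> L" "A a \<in> L" "A b \<in> L" "A ` set xs <= L" "A ` set ys <= L" by auto
 have s: "sort (xs @ b # a # ys) = sort (xs @ a # b # ys)" by (rule properties_for_sort) simp_all
 let ?w = "Id P (map A xs) \<boxtimes> (Braid P [A a] [A b] \<boxtimes> Id P (map A ys))"
 have "Id P (map A (x # xs)) \<boxtimes> (Braid P [A a] [A b] \<boxtimes> Id P (map A ys)) = Id P [A x] \<boxtimes> ?w" by simp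
 moreover have "(Id P [A x] \<boxtimes> sort_ar P A (xs @ b # a # ys)) \<cdot> (Id P [A x] \<boxtimes> ?w) = Id P [A x] \<boxtimes> sort_ar P A (xs @ a # b # ys)"
  using interchange[of "Id P [A x]" "Id P [A x]" ?w "sort_ar P A (xs @ b # a # ys)"] Cons by (simp del: Id_Tar_Id_Tar)
 ultimately show ?case using Cons by (simp add: s del: Id_Tar_Id_Tar)
qed

lemma sort_ar_parr:
 assumes "parr P A ks ls f" "A ` set ks <= L" "distinct ks" shows "sort_ar P A ls \<cdot> f = sort_ar P A ks" using assms(1)
proof (induction rule: parr.induct)
 case parr_refl
 show ?case using assms by simp
next
 case (parr_step xs a b ys f)
 note f = parr_simps[OF parr_step(1) assms(2)]
 have "distinct (xs @ a # b # ys)" using parr_mset[OF parr_step(1)] assms(3) mset_eq_imp_distinct_iff by blast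
 then show ?case using parr_step(2) f sort_ar_swap[OF f(4)]
   Comp_assoc'[of f "Id P (map A xs) \<boxtimes> (Braid P [A a] [A b] \<boxtimes> Id P (map A ys))" "sort_ar P A (xs @ b # a # ys)"] by simp
qed

text \<open>The coherence statement for permutations. Any two composites of symmetries with the same
  label lists become equal when followed by the sorting arrow, and that arrow is invertible.\<close>

lemma can_eqI:
 assumes f: "parr P A ks ls f" and A: "A ` set ks <= L" and d: "distinct ks" shows "can P A ks ls = f" unfolding can_def proof (rule the_equality)
 fix g assume g: "parr P A ks ls g"
 show "g = f" by (rule iso_cancel_left[of "sort_ar P A ls"])
   (use sort_ar_parr[OF f A d] sort_ar_parr[OF g A d] parr_simps[OF f A] parr_simps[OF g A] in simp_all)
qed (rule f)

lemma can_parr: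
 assumes "mset ls = mset ks" "A ` set ks <= L" "distinct ks" shows "parr P A ks ls (can P A ks ls)"
 using parr_exists[OF assms(1), of P A] can_eqI assms by auto

lemma can_simps [simp]:
 assumes "mset ls = mset ks" "A ` set ks <= L" "distinct ks"
 shows "can P A ks ls \<in> Ar P" "Dom P (can P A ks ls) = map A ks" "Cod P (can P A ks ls) = map A ls" using parr_simps[OF can_parr[OF assms] assms(2)] by auto

lemma can_refl [simp]: "[|A ` set ks <= L; distinct ks|] ==> can P A ks ks = Id P (map A ks)" by (intro can_eqI parr_refl)

lemma can_comp [simp]:
 assumes "mset ls = mset ks" "mset ms = mset ks" "A ` set ks <= L" "distinct ks" shows "can P A ls ms \<cdot> can P A ks ls = can P A ks ms"
proof -
 have "A ` set ls <= L" "distinct ls" using assms mset_eq_setD[OF assms(1)] mset_eq_imp_distinct_iff[OF assms(1)] by auto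
 then show ?thesis using assms by (intro can_eqI[symmetric] parr_trans[OF can_parr can_parr]) auto
qed

lemma can_comp_cancel [simp]:
 assumes "mset ls = mset ks" "mset ms = mset ks" "A ` set ks <= L" "distinct ks" "f \<in> Ar P" "Cod P f = map A ks"
 shows "can P A ls ms \<cdot> (can P A ks ls \<cdot> f) = can P A ks ms \<cdot> f"
proof -
 have "A ` set ls <= L" "distinct ls" using assms mset_eq_setD[OF assms(1)] mset_eq_imp_distinct_iff[OF assms(1)] by auto
 then show ?thesis using Comp_assoc'[of f "can P A ks ls" "can P A ls ms"] assms by simp
qed

text \<open>Uniqueness turns relabelling of composites into an equation between canonical arrows,
  provided that the new labels are still distinct.\<close>

lemma can_relabel:
 assumes "mset ls = mset ks" "A ` p ` set ks <= L" "distinct (map p ks)" shows "can P A (map p ks) (map p ls) = can P (A \<circ> p) ks ls"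
 using assms by (intro can_eqI parr_relabel can_parr) (auto simp: distinct_map image_comp)

lemma can_cong:
 assumes "\<And>k. k \<in> set ks ==> A k = B k" "mset ls = mset ks" "A ` set ks <= L" "distinct ks"
 shows "can P A ks ls = can P B ks ls" using assms by (intro can_eqI[symmetric] parr_cong[OF can_parr]) auto

lemma can_Tar:
 assumes "distinct (ks @ ls)" "A ` set ks <= L" "A ` set ls <= L" "mset ks' = mset ks" "mset ls' = mset ls"
 shows "can P A ks ks' \<boxtimes> can P A ls ls' = can P A (ks @ ls) (ks' @ ls')" using assms by (intro can_eqI[symmetric] parr_Tar can_parr) auto

lemma can_Braid:
 assumes "distinct (ks @ ls)" "A ` set ks <= L" "A ` set ls <= L" shows "Braid P (map A ks) (map A ls) = can P A (ks @ ls) (ls @ ks)"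
 using assms by (intro can_eqI[symmetric] parr_Braid) auto

section \<open>Tensor products of lists of arrows\<close>

lemma tensl_in [simp]:
 assumes "set fs <= Ar P" shows "tensl P fs \<in> Ar P" "Dom P (tensl P fs) = concat (map (Dom P) fs)" "Cod P (tensl P fs) = concat (map (Cod P) fs)"
 using assms by (induction fs) auto

lemma tensl_append [simp]: "[|set fs <= Ar P; set gs <= Ar P|] ==> tensl P (fs @ gs) = tensl P fs \<boxtimes> tensl P gs"
 by (induction fs) auto

lemma tensl_concat: "\<forall>fs \<in> set fss. set fs <= Ar P ==> tensl P (concat fss) = tensl P (map (tensl P) fss)"
 by (induction fss) (auto simp: UN_subset_iff)

lemma tensl_comp:
 assumes "\<And>k. k \<in> set ks ==> f k \<in> Ar P & g k \<in> Ar P & Dom P (g k) = Cod P (f k)"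
 shows "tensl P (map (%k. g k \<cdot> f k) ks) = tensl P (map g ks) \<cdot> tensl P (map f ks)" using assms proof (induction ks)
 case (Cons k ks)
 then have "concat (map (Dom P \<circ> g) ks) = concat (map (Cod P \<circ> f) ks)" by (intro arg_cong[where f = concat]) simp
 with Cons show ?case by (simp add: interchange image_subset_iff)
qed simp

lemma can_tensl:
 assumes "distinct (concat (map K ks))" "\<And>k. k \<in> set ks ==> mset (K' k) = mset (K k)"
  "\<And>k. k \<in> set ks ==> A ` set (K k) <= L"
 shows "tensl P (map (%k. can P A (K k) (K' k)) ks) = can P A (concat (map K ks)) (concat (map K' ks))" using assms proof (induction ks)
 case (Cons k ks)
 have "mset (concat (map K' ks)) = mset (concat (map K ks))" using Cons.prems(2) by (intro mset_concat_cong) auto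
 moreover have "A ` set (concat (map K ks)) <= L" using Cons.prems(3) by fastforce
 ultimately show ?case using Cons by (simp add: can_Tar)
qed simp

text \<open>Naturality of block permutations, by reduction to adjacent blocks.\<close>

lemma can_blocks:
 assumes "mset ls = mset ks" "distinct (concat (map B ks))" "distinct (concat (map B' ks))"
  and f: "\<And>k. k \<in> set ks ==> f k \<in> Ar P & Dom P (f k) = map A (B k) & Cod P (f k) = map A' (B' k)"
 shows "can P A' (concat (map B' ks)) (concat (map B' ls)) \<cdot> tensl P (map f ks)
  = tensl P (map f ls) \<cdot> can P A (concat (map B ks)) (concat (map B ls))" using adj_swaps_mset[OF assms(1)] proof (induction rule: rtranclp_induct)
 case base
 have fL: "A ` set (B k) <= L & A' ` set (B' k) <= L" if "k \<in> set ks" for k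
  using f[OF that] Dom_letters[of "f k"] Cod_letters[of "f k"] by auto
 have A: "A ` set (concat (map B ks)) <= L" "A' ` set (concat (map B' ks)) <= L" using fL by (auto simp: image_UN UN_subset_iff)
 have "map A (concat (map B ks)) = concat (map (Dom P \<circ> f) ks)" "map A' (concat (map B' ks)) = concat (map (Cod P \<circ> f) ks)"
  using f by (induction ks) auto
 then show ?case using assms f A by (simp add: image_subset_iff)
next
 case (step ls ms)
 from step(2) obtain xs a b ys where ls: "ls = xs @ a # b # ys" and ms: "ms = xs @ b # a # ys" by (cases rule: adj_swap.cases)
 have m: "mset ls = mset ks" using step(1) by (induction rule: rtranclp_induct) (auto elim!: adj_swap.cases simp: add_mset_commute)
 have d: "distinct (concat (map B ls))" "distinct (concat (map B' ls))" using mset_eq_imp_distinct_iff[OF mset_concat_map[OF m]] assms(2,3) by auto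
 have f': "f k \<in> Ar P & Dom P (f k) = map A (B k) & Cod P (f k) = map A' (B' k)" if "k \<in> set ls" for k using f that mset_eq_setD[OF m] by auto
 have AL: "A ` set (B k) <= L" "A' ` set (B' k) <= L" if "k \<in> set ls" for k
  using f'[OF that] Dom_letters[of "f k"] Cod_letters[of "f k"] by auto
 have dc: "concat (map (Dom P \<circ> f) zs) = map A (concat (map B zs))" "concat (map (Cod P \<circ> f) zs) = map A' (concat (map B' zs))"
  "set (map f zs) <= Ar P" "A ` set (concat (map B zs)) <= L" "A' ` set (concat (map B' zs)) <= L" if "set zs <= set ls" for zs
  using that f' AL by (induction zs) auto
 have K: "A ` set (concat (map B ks)) <= L" "A' ` set (concat (map B' ks)) <= L" using dc(4,5)[of ks] mset_eq_setD[OF m] by auto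
 have t: "tensl P (map f zs) \<in> Ar P" "Dom P (tensl P (map f zs)) = map A (concat (map B zs))"
  "Cod P (tensl P (map f zs)) = map A' (concat (map B' zs))" if "set zs <= set ls" for zs using dc[OF that] by auto
 have m': "mset ms = mset ks" using m by (simp add: ls ms add_mset_commute)
 \<comment> \<open>Exchanging two neighbouring blocks is one symmetry of words:
   \<open>can_Tar\<close> splits off the blocks on both sides and \<open>can_Braid\<close>
   identifies the middle factor.\<close>
 have sw: "can P A0 (concat (map B0 ls)) (concat (map B0 ms))
   = Id P (map A0 (concat (map B0 xs))) \<boxtimes> (Braid P (map A0 (B0 a)) (map A0 (B0 b)) \<boxtimes> Id P (map A0 (concat (map B0 ys))))"
  if "distinct (concat (map B0 ls))" "A0 ` set (concat (map B0 ls)) <= L" for A0 B0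
 proof -
  have "can P A0 (concat (map B0 ls)) (concat (map B0 ms))
   = can P A0 (concat (map B0 xs)) (concat (map B0 xs)) \<boxtimes> (can P A0 (B0 a @ B0 b) (B0 b @ B0 a) \<boxtimes> can P A0 (concat (map B0 ys)) (concat (map B0 ys)))"
   using that by (simp add: ls ms can_Tar image_Un del: can_refl)
  also have "can P A0 (B0 a @ B0 b) (B0 b @ B0 a) = Braid P (map A0 (B0 a)) (map A0 (B0 b))" using that by (intro can_Braid[symmetric]) (auto simp: ls)
  finally show ?thesis using that by (simp add: ls image_Un)
 qed
 let ?x = "tensl P (map f xs)" and ?y = "tensl P (map f ys)"
 have sub: "set xs <= set ls" "set ys <= set ls" "a \<in> set ls" "b \<in> set ls" by (auto simp: ls)
 have "can P A' (concat (map B' ls)) (concat (map B' ms)) \<cdot> tensl P (map f ls)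
  = (Id P (map A' (concat (map B' xs))) \<boxtimes> (Braid P (map A' (B' a)) (map A' (B' b)) \<boxtimes> Id P (map A' (concat (map B' ys)))))
   \<cdot> (?x \<boxtimes> ((f a \<boxtimes> f b) \<boxtimes> ?y))" using sw[OF d(2) dc(5)[OF subset_refl]] f' t sub dc(3)[of ls] by (simp add: ls)
 also have "... = ?x \<boxtimes> ((Braid P (map A' (B' a)) (map A' (B' b)) \<cdot> (f a \<boxtimes> f b)) \<boxtimes> ?y)"
  using f'[OF sub(3)] f'[OF sub(4)] t[OF sub(1)] t[OF sub(2)] AL[OF sub(3)] AL[OF sub(4)] dc(5)[OF sub(1)] dc(5)[OF sub(2)]
  by (simp add: interchange del: Tar_assoc)
 also have "... = ?x \<boxtimes> (((f b \<boxtimes> f a) \<cdot> Braid P (map A (B a)) (map A (B b))) \<boxtimes> ?y)"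
  using f'[OF sub(3)] f'[OF sub(4)] by (simp add: Braid_nat)
 also have "... = (?x \<boxtimes> ((f b \<boxtimes> f a) \<boxtimes> ?y)) \<cdot> (Id P (map A (concat (map B xs))) \<boxtimes> (Braid P (map A (B a)) (map A (B b)) \<boxtimes> Id P (map A (concat (map B ys)))))"
  using f'[OF sub(3)] f'[OF sub(4)] t[OF sub(1)] t[OF sub(2)] AL[OF sub(3)] AL[OF sub(4)] dc(4)[OF sub(1)] dc(4)[OF sub(2)]
  by (simp add: interchange del: Tar_assoc)
 also have "... = tensl P (map f ms) \<cdot> can P A (concat (map B ls)) (concat (map B ms))"
  using sw[OF d(1) dc(4)[OF subset_refl]] f' t sub dc(3)[of ls] by (simp add: ls ms)
 finally have one: "can P A' (concat (map B' ls)) (concat (map B' ms)) \<cdot> tensl P (map f ls)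
  = tensl P (map f ms) \<cdot> can P A (concat (map B ls)) (concat (map B ms))" .
 have tk: "set ks <= set ls" "set ms <= set ls" using mset_eq_setD[OF m] mset_eq_setD[OF m'] by auto
 note mm [simp] = mset_concat_map[OF m] mset_concat_map[OF m']
 \<comment> \<open>The naturality square of the last exchange is pasted after the square of the
   induction hypothesis.\<close>
 have "can P A' (concat (map B' ks)) (concat (map B' ms)) \<cdot> tensl P (map f ks)
  = can P A' (concat (map B' ls)) (concat (map B' ms)) \<cdot> (can P A' (concat (map B' ks)) (concat (map B' ls)) \<cdot> tensl P (map f ks))"
  using assms K t[OF tk(1)] by (intro can_comp_cancel[symmetric] mm) simp_all
 also have "... = (can P A' (concat (map B' ls)) (concat (map B' ms)) \<cdot> tensl P (map f ls)) \<cdot> can P A (concat (map B ks)) (concat (map B ls))"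
  unfolding step(3) using assms K d dc(4,5)[of ls] t[of ls] by simp
 also have "... = tensl P (map f ms) \<cdot> can P A (concat (map B ks)) (concat (map B ms))"
  unfolding one using assms K d dc(4,5)[of ls] t[OF tk(2)] by simp
 finally show ?case .
qed

end

text \<open>Permutation arrows are preserved by anything that preserves composition, tensor products and symmetries of letters.\<close>

lemma parr_map:
 assumes "word_smc P L" "parr P A ks ls f" "A ` set ks <= L" and "\<And>As. set As <= L ==> H (Id P As) = Id Q (map \<phi> As)"
  and "\<And>f g. [|f \<in> Ar P; g \<in> Ar P; Dom P g = Cod P f|] ==> H (g \<cdot>\<^bsub>P\<^esub> f) = H g \<cdot>\<^bsub>Q\<^esub> H f"
  and "\<And>f g. [|f \<in> Ar P; g \<in> Ar P|] ==> H (f \<boxtimes>\<^bsub>P\<^esub> g) = H f \<boxtimes>\<^bsub>Q\<^esub> H g"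
  and "\<And>a b. [|a \<in> L; b \<in> L|] ==> H (Braid P [a] [b]) = Braid Q [\<phi> a] [\<phi> b]"
 shows "parr Q (\<phi> \<circ> A) ks ls (H f)" using assms(2) proof (induction rule: parr.induct)
 case parr_refl
 have "H (Id P (map A ks)) = Id Q (map (\<phi> \<circ> A) ks)" using assms(3,4) by simp
 then show ?case using parr.parr_refl[of Q "\<phi> \<circ> A" ks] by (simp only:)
next
 case (parr_step xs a b ys f)
 interpret word_smc P L by fact
 note f = parr_simps[OF parr_step(1) assms(3)]
 have "H ((Id P (map A xs) \<boxtimes>\<^bsub>P\<^esub> (Braid P [A a] [A b] \<boxtimes>\<^bsub>P\<^esub> Id P (map A ys))) \<cdot>\<^bsub>P\<^esub> f)
  = (Id Q (map (\<phi> \<circ> A) xs) \<boxtimes>\<^bsub>Q\<^esub> (Braid Q [(\<phi> \<circ> A) a] [(\<phi> \<circ> A) b] \<boxtimes>\<^bsub>Q\<^esub> Id Q (map (\<phi> \<circ> A) ys))) \<cdot>\<^bsub>Q\<^esub> H f"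
  using f by (simp add: assms(4-7))
 then show ?case using parr.parr_step[OF parr_step(2)] by (simp only:)
qed

section \<open>Permutations given by lists\<close>

lemma map_list_perm [simp]: "map (list_perm ps) [0..<length ps] = ps" by (rule nth_equalityI) (auto simp: list_perm_def)

text \<open>In this form a permutation qualifies for \<open>can\<close>: its list of values is a
  rearrangement of the positions.\<close>

lemma mset_map_permutes: "\<rho> permutes {..<n} ==> mset (map \<rho> [0..<n]) = mset [0..<n]"
proof -
 assume \<rho>: "\<rho> permutes {..<n}"
 have *: "permute_list \<rho> [0..<n] = map \<rho> [0..<n]" unfolding permute_list_def using permutes_in_image[OF \<rho>] by (intro map_cong) auto
 have "mset (permute_list \<rho> [0..<n]) = mset [0..<n]" by (rule mset_permute_list) (use \<rho> in simp)
 then show ?thesis by (simp only: *)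
qed

lemma list_perm_permutes:
 assumes "mset ps = mset [0..<n]" shows "list_perm ps permutes {..<n}" proof (rule bij_imp_permutes)
 have l: "length ps = n" using mset_eq_length[OF assms] by (simp only: length_upt diff_zero)
 have d: "distinct ps" using mset_eq_imp_distinct_iff[OF assms] by simp
 have s: "set ps = {..<n}" using mset_eq_setD[OF assms] by (simp only: set_upt atLeast0LessThan)
 show "bij_betw (list_perm ps) {..<n} {..<n}" proof (rule bij_betw_imageI)
  show "inj_on (list_perm ps) {..<n}" by (rule inj_onI) (use d l in \<open>auto simp: list_perm_def nth_eq_iff_index_eq\<close>)
  have "list_perm ps ` {..<n} = (!) ps ` {..<length ps}" using l by (intro image_cong) (auto simp: list_perm_def)
  also have "... = {..<n}" using s by (auto simp: set_conv_nth)
  finally show "list_perm ps ` {..<n} = {..<n}" .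
 qed
 show "\<And>x. x \<notin> {..<n} ==> list_perm ps x = x" using l by (simp add: list_perm_def)
qed

lemma permute_list_list_perm: "length xs = length ps ==> permute_list (list_perm ps) xs = map ((!) xs) ps"
 by (intro nth_equalityI) (simp_all add: permute_list_def list_perm_def)

lemma offset_simps [simp]:
 "offset ns 0 = 0" "offset (n # ns) (Suc k) = n + offset ns k" by (simp_all add: offset_def)

lemma nth_concat_offset:
 "[|k < length xss; t < length (xss ! k)|] ==> concat xss ! (offset (map length xss) k + t) = xss ! k ! t"
proof (induction xss arbitrary: k)
 case (Cons xs xss)
 then show ?case by (cases k) (auto simp: nth_append add.assoc)
qed simp

text \<open>The positions that the \<open>k\<close>-th of several lists, with lengths
  \<open>ns\<close>, occupies in their concatenation.\<close>

definition block :: "nat list => nat => nat list" where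
 "block ns k = map ((+) (offset ns k)) [0..<ns ! k]"

lemma concat_blocks: "concat (map (block ns) [0..<length ns]) = [0..<sum_list ns]" proof (induction ns)
 case (Cons n ns)
 have "[0..<length (n # ns)] = 0 # map Suc [0..<length ns]" by (simp only: map_Suc_upt upt_conv_Cons list.size) (simp add: upt_conv_Cons del: upt_Suc)
 then have "map (block (n # ns)) [0..<length (n # ns)] = block (n # ns) 0 # map (%k. block (n # ns) (Suc k)) [0..<length ns]"
  by (simp only: list.map map_map comp_def)
 moreover have "block (n # ns) (Suc k) = map ((+) n) (block ns k)" for k by (simp add: block_def add.assoc)
 moreover have "block (n # ns) 0 = [0..<n]" by (simp add: block_def map_idI)
 ultimately have "concat (map (block (n # ns)) [0..<length (n # ns)]) = [0..<n] @ map ((+) n) (concat (map (block ns) [0..<length ns]))"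
  by (simp add: map_concat comp_def)
 moreover have "map ((+) n) [0..<sum_list ns] = [n..<n + sum_list ns]" by (rule nth_equalityI) simp_all
 ultimately show ?case using Cons upt_add_eq_append[of 0 n "sum_list ns"] by simp
qed simp

lemma sum_perm_list:
 "sum_perm \<rho>s ns = list_perm (concat (map (%k. map ((+) (offset ns k)) (map (\<rho>s ! k) [0..<ns ! k])) [0..<length ns]))"
 by (simp add: sum_perm_def comp_def)

lemma block_perm_list: "block_perm \<sigma> ns = list_perm (concat (map (block ns) (map \<sigma> [0..<length ns])))"
 by (simp only: block_perm_def block_def[abs_def] map_map comp_def)

lemma sum_perm_mset:
 assumes "\<And>k. k < length ns ==> (\<rho>s ! k) permutes {..<ns ! k}"
 shows "mset (concat (map (%k. map ((+) (offset ns k)) (map (\<rho>s ! k) [0..<ns ! k])) [0..<length ns])) = mset [0..<sum_list ns]"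
proof -
 have "mset (map ((+) (offset ns k)) (map (\<rho>s ! k) [0..<ns ! k])) = mset (block ns k)" if "k < length ns" for k
  using mset_map_permutes[OF assms[OF that]] unfolding block_def mset_map by simp
 then show ?thesis unfolding concat_blocks[symmetric] by (intro mset_concat_cong) auto
qed

lemma block_perm_mset:
 assumes "\<sigma> permutes {..<length ns}" shows "mset (concat (map (block ns) (map \<sigma> [0..<length ns]))) = mset [0..<sum_list ns]"
 unfolding concat_blocks[symmetric] by (intro mset_concat_map mset_map_permutes assms)

lemma sum_perm_permutes:
 "(\<And>k. k < length ns ==> (\<rho>s ! k) permutes {..<ns ! k}) ==> sum_perm \<rho>s ns permutes {..<sum_list ns}"
 unfolding sum_perm_list by (intro list_perm_permutes sum_perm_mset)

lemma block_perm_permutes: "\<sigma> permutes {..<length ns} ==> block_perm \<sigma> ns permutes {..<sum_list ns}"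
 unfolding block_perm_list by (intro list_perm_permutes block_perm_mset)

text \<open>This lemma and its counterpart for block permutations give the effect on concatenated
  label lists, from which \<open>relabel_unique\<close> later recognises these permutations.\<close>

lemma permute_list_sum_perm:
 assumes "\<And>k. k < length xss ==> (\<rho>s ! k) permutes {..<length (xss ! k)}" "length \<rho>s = length xss"
 shows "permute_list (sum_perm \<rho>s (map length xss)) (concat xss) = concat (map2 permute_list \<rho>s xss)"
proof -
 let ?ns = "map length xss"
 have ns: "?ns ! k = length (xss ! k)" if "k < length xss" for k using that by simp
 have m: "mset (concat (map (%k. map ((+) (offset ?ns k)) (map (\<rho>s ! k) [0..<?ns ! k])) [0..<length ?ns])) = mset [0..<sum_list ?ns]"
  using assms by (intro sum_perm_mset) auto
 have "permute_list (sum_perm \<rho>s ?ns) (concat xss) = map ((!) (concat xss)) (concat (map (%k. map ((+) (offset ?ns k)) (map (\<rho>s ! k) [0..<?ns ! k])) [0..<length ?ns]))"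
  unfolding sum_perm_list using mset_eq_length[OF m] by (intro permute_list_list_perm) (simp add: length_concat)
 also have "... = concat (map (%k. permute_list (\<rho>s ! k) (xss ! k)) [0..<length xss])"
 proof -
  have "concat xss ! (offset ?ns k + (\<rho>s ! k) t) = xss ! k ! (\<rho>s ! k) t" if "k < length xss" "t < length (xss ! k)" for k t
  proof (rule nth_concat_offset[OF that(1)])
   show "(\<rho>s ! k) t < length (xss ! k)" using permutes_in_image[OF assms(1)[OF that(1)], of t] that(2) by simp
  qed
  then show ?thesis unfolding map_concat map_map by (intro arg_cong[where f = concat] map_cong) (auto simp: permute_list_def)
 qed
 also have "map (%k. permute_list (\<rho>s ! k) (xss ! k)) [0..<length xss] = map2 permute_list \<rho>s xss"
  using assms(2) by (intro nth_equalityI) auto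
 finally show ?thesis .
qed

lemma permute_list_block_perm:
 assumes "\<sigma> permutes {..<length xss}" shows "permute_list (block_perm \<sigma> (map length xss)) (concat xss) = concat (permute_list \<sigma> xss)"
proof -
 let ?ns = "map length xss"
 have m: "mset (concat (map (block ?ns) (map \<sigma> [0..<length ?ns]))) = mset [0..<sum_list ?ns]" using assms by (intro block_perm_mset) auto
 have \<sigma>: "\<sigma> k < length xss" if "k < length xss" for k using permutes_in_image[OF assms, of k] that by simp
 have "permute_list (block_perm \<sigma> ?ns) (concat xss) = map ((!) (concat xss)) (concat (map (block ?ns) (map \<sigma> [0..<length ?ns])))"
  unfolding block_perm_list using mset_eq_length[OF m] by (intro permute_list_list_perm) (simp add: length_concat)
 also have "... = concat (permute_list \<sigma> xss)"
 proof -
  have "map ((!) (concat xss)) (block ?ns k) = xss ! k" if "k < length xss" for k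
   using that by (intro nth_equalityI) (simp_all add: block_def nth_concat_offset)
  then show ?thesis unfolding map_concat map_map permute_list_def using \<sigma> by (intro arg_cong[where f = concat] map_cong) simp_all
 qed
 finally show ?thesis .
qed

section \<open>Coherence isomorphisms in the strictification\<close>

context symmetric_monoidal_category
begin

lemma str_word: "word_smc (str V) (Ob V)" by (intro word_smc.intro str_strict word_smc_axioms.intro) simp_all

lemma app_iso_single: "Bs \<noteq> [] ==> app_iso V [B] Bs = Id V (tens V (B # Bs))" by (cases Bs) auto

text \<open>In the strictification the associators around the symmetry in \<open>insort_iso\<close>
  are the coherence of \<open>Braid (str V)\<close> tensored with an identity, so each recursive
  step is one adjacent symmetry.\<close>

lemma insort_iso_parr:
 assumes "A k \<in> Ob V" "A ` set zs <= Ob V" shows "parr (str V) A (k # zs) (insort k zs) (map A (k # zs), insort_iso V A k zs, map A (insort k zs))"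
 using assms(2) proof (induction zs rule: induct_list012)
 case 1
 have "(map A [k], insort_iso V A k [], map A (insort k [])) = Id (str V) (map A [k])" by (intro prod_eqI) simp_all
 then show ?case using parr_refl[of "str V" A "[k]"] by simp
next
 case (2 l)
 interpret S: word_smc "str V" "Ob V" by (rule str_word)
 note [simp] = assms(1)
 have [simp]: "A l \<in> Ob V" using 2 by simp
 show ?case proof (cases "k \<le> l")
  case True
  have "(map A [k, l], insort_iso V A k [l], map A (insort k [l])) = Id (str V) (map A [k, l])" using True by (intro prod_eqI) simp_all
  then show ?thesis using parr_refl[of "str V" A "[k, l]"] True by simp
 next
  case False
  have "(map A [k, l], insort_iso V A k [l], map A (insort k [l])) = Braid (str V) [A k] [A l]" using False by (intro prod_eqI) (simp_all add: mid_str)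
  then show ?thesis using parr_step[OF parr_refl, of "str V" A "[]" k l "[]"] False by simp
 qed
next
 case (3 l l' ls)
 interpret S: word_smc "str V" "Ob V" by (rule str_word)
 note [simp] = assms(1)
 let ?r = "l' # ls"
 have [simp]: "A l \<in> Ob V" "A l' \<in> Ob V" "A ` set ls <= Ob V" using 3 by simp_all
 have t [simp]: "tens V (A l' # map A ls) \<in> Ob V" by (intro tens_in) simp
 show ?case proof (cases "k \<le> l")
  case True
  have "(map A (k # l # ?r), insort_iso V A k (l # ?r), map A (insort k (l # ?r))) = Id (str V) (map A (k # l # ?r))"
   using True by (intro prod_eqI) (simp_all add: Let_def)
  then show ?thesis using parr_refl[of "str V" A "k # l # ?r"] True by simp
 next
  case False
  let ?i = "(map A (k # ?r), insort_iso V A k ?r, map A (insort k ?r))"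
  have ih: "parr (str V) A (k # ?r) (insort k ?r) ?i" using 3 by simp
  have i: "?i \<in> Ar (str V)" using S.parr_simps(1)[OF ih] by simp
  have b: "parr (str V) A (k # l # ?r) (l # k # ?r) (Braid (str V) [A k] [A l] \<boxtimes>\<^bsub>str V\<^esub> Id (str V) (map A ?r))"
   using parr_step[OF parr_refl, of "str V" A "[]" k l ?r] by simp
  have c: "parr (str V) A (l # k # ?r) (l # insort k ?r) (Id (str V) [A l] \<boxtimes>\<^bsub>str V\<^esub> ?i)" using S.parr_left[OF ih, of "[l]"] by simp
  have ne: "map A (insort k ?r) \<noteq> []" by (simp add: insort_not_Nil)
  have im: "insort_iso V A k ?r \<in> Ar V" "Dom V (insort_iso V A k ?r) = A k \<otimes> tens V (map A ?r)"
   "Cod V (insort_iso V A k ?r) = tens V (map A (insort k ?r))" using i by (auto simp: str_Ar)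
  have sI: "set (map A (insort k ?r)) <= Ob V" by (simp add: set_insort_key)
  have tI [simp]: "tens V (map A (insort k ?r)) \<in> Ob V" using sI by (rule tens_in)
  have tC: "tens V (A l # map A (insort k ?r)) = A l \<otimes> tens V (map A (insort k ?r))" using ne by (rule tens_Cons)
  \<comment> \<open>Concatenating one letter with a nonempty word has identity coherence, so this
    tensor product is the plain one in \<open>V\<close>.\<close>
  have m1: "mid (Id (str V) [A l] \<boxtimes>\<^bsub>str V\<^esub> ?i) = Id V (A l) \<boxtimes> insort_iso V A k ?r"
   using im tC by (simp add: mid_str app_iso_single[OF ne] del: insort_iso.simps insort_key.simps)
  have m2: "mid (Braid (str V) [A k] [A l] \<boxtimes>\<^bsub>str V\<^esub> Id (str V) (map A ?r))
   = Assoc V (A l) (A k) (tens V (map A ?r)) \<cdot> ((Braid V (A k) (A l) \<boxtimes> Id V (tens V (map A ?r))) \<cdot> Inv V (Assoc V (A k) (A l) (tens V (map A ?r))))"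
   by (simp add: mid_str)
  have ins: "insort k (l # ?r) = l # insort k ?r" using False by simp
  have iso: "insort_iso V A k (l # ?r) = (Id V (A l) \<boxtimes> insort_iso V A k ?r) \<cdot>
   (Assoc V (A l) (A k) (tens V (map A ?r)) \<cdot> ((Braid V (A k) (A l) \<boxtimes> Id V (tens V (map A ?r))) \<cdot> Inv V (Assoc V (A k) (A l) (tens V (map A ?r)))))"
   using False im(1,2) by (simp add: Let_def)
  let ?f = "(map A (k # l # ?r), insort_iso V A k (l # ?r), map A (insort k (l # ?r)))"
  let ?g = "(Id (str V) [A l] \<boxtimes>\<^bsub>str V\<^esub> ?i) \<cdot>\<^bsub>str V\<^esub> (Braid (str V) [A k] [A l] \<boxtimes>\<^bsub>str V\<^esub> Id (str V) (map A ?r))"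
  have "fst ?f = fst ?g" by simp
  moreover have "mid ?f = mid ?g" by (simp only: str_simps fst_conv snd_conv m1 m2 iso)
  moreover have "snd (snd ?f) = snd (snd ?g)" by (simp add: ins del: insort_key.simps)
  ultimately have "?f = ?g" by (intro prod_eqI)
  then show ?thesis using S.parr_trans[OF b c] False by simp
 qed
qed

lemma sort_iso_parr:
 assumes "A ` set ks <= Ob V" shows "parr (str V) A ks (sort ks) (map A ks, sort_iso V A ks, map A (sort ks))" using assms
proof (induction ks rule: induct_list012)
 case 1
 have "(map A [], sort_iso V A [], map A (sort [])) = Id (str V) (map A [])" by (intro prod_eqI) simp_all
 then show ?case using parr_refl[of "str V" A "[]"] by simp
next
 case (2 k)
 have "(map A [k], sort_iso V A [k], map A (sort [k])) = Id (str V) (map A [k])" by (intro prod_eqI) simp_all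
 then show ?case using parr_refl[of "str V" A "[k]"] by simp
next
 case (3 k l ls)
 interpret S: word_smc "str V" "Ob V" by (rule str_word)
 have [simp]: "A k \<in> Ob V" "A l \<in> Ob V" "A ` set ls <= Ob V" using 3 by simp_all
 let ?r = "l # ls"
 let ?s = "(map A ?r, sort_iso V A ?r, map A (sort ?r))"
 have ih: "parr (str V) A ?r (sort ?r) ?s" using 3 by simp
 have s: "?s \<in> Ar (str V)" using S.parr_simps(1)[OF ih] by simp
 have b: "parr (str V) A (k # ?r) (k # sort ?r) (Id (str V) [A k] \<boxtimes>\<^bsub>str V\<^esub> ?s)" using S.parr_left[OF ih, of "[k]"] by simp
 have c: "parr (str V) A (k # sort ?r) (sort (k # ?r)) (map A (k # sort ?r), insort_iso V A k (sort ?r), map A (insort k (sort ?r)))"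
  using insort_iso_parr[of A k "sort ?r"] by (simp add: set_insort_key)
 have ne: "map A (sort ?r) \<noteq> []" by (simp add: insort_not_Nil)
 have sm: "sort_iso V A ?r \<in> Ar V" "Dom V (sort_iso V A ?r) = tens V (map A ?r)"
  "Cod V (sort_iso V A ?r) = tens V (map A (sort ?r))" using s by (auto simp: str_Ar)
 have tI1: "set (map A (sort ?r)) <= Ob V" by (simp add: set_insort_key)
 have "tens V (map A ?r) \<in> Ob V" by (intro tens_in) simp
 note tI = tI1 this
 have tC: "tens V (A k # map A (sort ?r)) = A k \<otimes> tens V (map A (sort ?r))" using ne by (rule tens_Cons)
 have m1: "mid (Id (str V) [A k] \<boxtimes>\<^bsub>str V\<^esub> ?s) = Id V (A k) \<boxtimes> sort_iso V A ?r"
  using sm tC tI tens_in[OF tI(1)] by (simp add: mid_str app_iso_single[OF ne] del: sort_iso.simps sort_key_simps)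
 let ?f = "(map A (k # ?r), sort_iso V A (k # ?r), map A (sort (k # ?r)))"
 let ?g = "(map A (k # sort ?r), insort_iso V A k (sort ?r), map A (insort k (sort ?r))) \<cdot>\<^bsub>str V\<^esub> (Id (str V) [A k] \<boxtimes>\<^bsub>str V\<^esub> ?s)"
 have "fst ?f = fst ?g" by simp
 moreover have "mid ?f = mid ?g" by (simp only: str_simps fst_conv snd_conv m1 sort_iso.simps)
 moreover have "snd (snd ?f) = snd (snd ?g)" by simp
 ultimately have "?f = ?g" by (intro prod_eqI)
 then show ?case using S.parr_trans[OF b c] by simp
qed

text \<open>Sorting the list of values of \<open>\<rho>\<close> gives all positions in order, so the
  sorting isomorphism has the boundary of a canonical arrow and equals it by uniqueness.\<close>

lemma perm_iso_can:
 assumes "\<rho> permutes {..<length As}" "set As <= Ob V"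
 shows "(permute_list \<rho> As, perm_iso V \<rho> As, As) = can (str V) ((!) As) (map \<rho> [0..<length As]) [0..<length As]"
proof -
 interpret S: word_smc "str V" "Ob V" by (rule str_word)
 let ?n = "length As" and ?ks = "map \<rho> [0..<length As]"
 have m: "mset ?ks = mset [0..<?n]" by (rule mset_map_permutes[OF assms(1)])
 have sort: "sort ?ks = [0..<?n]" by (rule properties_for_sort) (use m in simp_all)
 have s: "set ?ks = set [0..<?n]" by (rule mset_eq_setD[OF m])
 have A: "(!) As ` set ?ks <= Ob V" unfolding s using assms(2) by (auto simp: subset_iff)
 have "map ((!) As) ?ks = permute_list \<rho> As" "map ((!) As) [0..<?n] = As" by (simp_all add: permute_list_def map_nth)
 moreover have "distinct ?ks" using mset_eq_imp_distinct_iff[OF m] by simp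
 ultimately show ?thesis using S.can_eqI[OF sort_iso_parr[OF A] A] sort by (simp add: perm_iso_def)
qed

lemma tens_ar_simps [simp]:
 assumes "set fs <= Ar V"
 shows "tens_ar V fs \<in> Ar V" "Dom V (tens_ar V fs) = tens V (map (Dom V) fs)" "Cod V (tens_ar V fs) = tens V (map (Cod V) fs)"
 using assms by (induction fs rule: induct_list012) auto

lemma flat_iso_simps [simp]:
 assumes "\<forall>As \<in> set Ass. set As <= Ob V" shows "flat_iso V Ass \<in> Ar V" "Dom V (flat_iso V Ass) = tens V (map (tens V) Ass)"
  "Cod V (flat_iso V Ass) = tens V (concat Ass)" "is_iso V (flat_iso V Ass)"
proof -
 have "flat_iso V Ass \<in> Ar V & Dom V (flat_iso V Ass) = tens V (map (tens V) Ass) &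
  Cod V (flat_iso V Ass) = tens V (concat Ass) & is_iso V (flat_iso V Ass)" using assms proof (induction Ass rule: induct_list012)
  case (3 As Bs Ass)
  then show ?case by (simp add: Inv_Comp(1) UN_subset_iff)
 qed auto
 then show "flat_iso V Ass \<in> Ar V" "Dom V (flat_iso V Ass) = tens V (map (tens V) Ass)"
  "Cod V (flat_iso V Ass) = tens V (concat Ass)" "is_iso V (flat_iso V Ass)" by auto
qed

text \<open>One-letter targets make the coherence on the target side trivial; on the source side the
  inverses of \<open>app_iso\<close> assemble into the inverse of \<open>flat_iso\<close>. This is
  the form in which \<open>U_ob\<close> defines multiplication.\<close>

lemma mid_tensl:
 assumes "\<forall>x \<in> set xs. x \<in> Ar (str V) & (\<exists>B. snd (snd x) = [B])"
 shows "mid (tensl (str V) xs) = tens_ar V (map mid xs) \<cdot> Inv V (flat_iso V (map fst xs))" using assms proof (induction xs rule: induct_list012)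
 case (2 x)
 interpret S: word_smc "str V" "Ob V" by (rule str_word)
 show ?case using 2 by (auto simp: str_Ar)
next
 case (3 x y xs)
 interpret S: word_smc "str V" "Ob V" by (rule str_word)
 let ?r = "tensl (str V) (y # xs)"
 let ?A = "fst x" and ?C = "concat (map fst (y # xs))"
 obtain B where B: "snd (snd x) = [B]" using 3 by auto
 obtain B' where B': "snd (snd y) = [B']" using 3 by auto
 have sub: "set (y # xs) <= Ar (str V)" using 3 by auto
 have r: "?r \<in> Ar (str V)" "fst ?r = ?C" "snd (snd ?r) \<noteq> []" using S.tensl_in[OF sub] B' by simp_all
 have rm: "set ?C <= Ob V" "mid ?r \<in> Ar V" "Dom V (mid ?r) = tens V ?C" "Cod V (mid ?r) = tens V (snd (snd ?r))" "set (snd (snd ?r)) <= Ob V"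
  using r by (simp_all add: str_Ar del: tensl_simps)
 have xm: "set ?A <= Ob V" "mid x \<in> Ar V" "Dom V (mid x) = tens V ?A" "Cod V (mid x) = B" "B \<in> Ob V" using 3 B by (simp_all add: str_Ar)
 have ih: "mid ?r = tens_ar V (map mid (y # xs)) \<cdot> Inv V (flat_iso V (map fst (y # xs)))" using 3 by simp
 have fl: "\<forall>As \<in> set (map fst (y # xs)). set As <= Ob V" using 3 by (auto simp: str_Ar)
 have ta: "set (map mid (y # xs)) <= Ar V" using 3 by (auto simp: str_Ar)
 have dm: "map (Dom V) (map mid (y # xs)) = map (tens V) (map fst (y # xs))" using 3 by (auto simp: str_Ar)
 note f = flat_iso_simps[OF fl] and t = tens_ar_simps(1,3)[OF ta] tens_ar_simps(2)[OF ta, unfolded dm]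
 have tC: "tens V (B # snd (snd ?r)) = B \<otimes> tens V (snd (snd ?r))" using r(3) by (rule tens_Cons)
 have "mid (tensl (str V) (x # y # xs)) = mid (x \<boxtimes>\<^bsub>str V\<^esub> ?r)" by simp
 also have "... = (mid x \<boxtimes> mid ?r) \<cdot> Inv V (app_iso V ?A ?C)"
  using rm xm tC unfolding mid_str B r(2) by (simp add: app_iso_single[OF r(3)] del: tensl_simps concat.simps list.map)
 also have "... = ((mid x \<boxtimes> tens_ar V (map mid (y # xs))) \<cdot> (Id V (tens V ?A) \<boxtimes> Inv V (flat_iso V (map fst (y # xs))))) \<cdot> Inv V (app_iso V ?A ?C)"
  unfolding ih using xm f t by (subst interchange) (simp_all del: flat_iso.simps tens_ar.simps list.map)
 also have "... = (mid x \<boxtimes> tens_ar V (map mid (y # xs))) \<cdot> Inv V (app_iso V ?A ?C \<cdot> (Id V (tens V ?A) \<boxtimes> flat_iso V (map fst (y # xs))))"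
  using xm f t rm(1) by (subst Inv_Comp(2)) (simp_all del: flat_iso.simps tens_ar.simps list.map concat.simps)
 finally show ?case by simp
qed simp

end

section \<open>Strong monoidal functors and strictification\<close>

context symmetric_strong_monoidal_functor
begin

lemma map_ob_in [simp]: "set As <= Ob V ==> sm_ob F ` set As <= Ob W" by auto

lemma mu_list_simps [simp]:
 assumes "set As <= Ob V" shows "mu_list F As \<in> Ar W" "Dom W (mu_list F As) = tens W (map (sm_ob F) As)"
  "Cod W (mu_list F As) = sm_ob F (tens V As)" "is_iso W (mu_list F As)"
proof -
 have "mu_list F As \<in> Ar W & Dom W (mu_list F As) = tens W (map (sm_ob F) As) &
  Cod W (mu_list F As) = sm_ob F (tens V As) & is_iso W (mu_list F As)" using assms proof (induction As rule: induct_list012)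
  case (3 A B As)
  have "tens V (B # As) \<in> Ob V" using 3 by (intro V.tens_in) auto
  with 3 show ?case by (simp add: W.Inv_Comp(1) del: tens.simps(2))
 qed auto
 then show "mu_list F As \<in> Ar W" "Dom W (mu_list F As) = tens W (map (sm_ob F) As)"
  "Cod W (mu_list F As) = sm_ob F (tens V As)" "is_iso W (mu_list F As)" by auto
qed

text \<open>The recursion of \<open>mu_list\<close> made uniform by \<open>cons_iso\<close>; the
  case of an empty tail is the right unit law of \<open>F\<close>.\<close>

lemma mu_list_Cons:
 assumes [simp]: "A \<in> Ob V" "set As <= Ob V" shows "mu_list F (A # As) \<cdot>\<^bsub>W\<^esub> cons_iso W (sm_ob F A) (map (sm_ob F) As)
  = sm_ar F (cons_iso V A As) \<cdot>\<^bsub>W\<^esub> (sm_mu F (A, tens V As) \<cdot>\<^bsub>W\<^esub> (Id W (sm_ob F A) \<boxtimes>\<^bsub>W\<^esub> mu_list F As))"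
proof (cases As)
 case Nil
 then show ?thesis using runit_mu[of A] by (simp add: cons_iso_def)
next
 case (Cons B Bs)
 have "tens V (B # Bs) \<in> Ob V" using assms Cons by (intro V.tens_in) simp
 moreover have "tens W (map (sm_ob F) (B # Bs)) \<in> Ob W" using assms Cons by (intro W.tens_in) auto
 moreover have "mu_list F (B # Bs) \<in> Ar W" "Dom W (mu_list F (B # Bs)) = tens W (map (sm_ob F) (B # Bs))"
  "Cod W (mu_list F (B # Bs)) = sm_ob F (tens V (B # Bs))" using mu_list_simps[of "B # Bs"] assms Cons by auto
 ultimately show ?thesis using Cons by (simp add: cons_iso_def)
qed

text \<open>Coherence of the iterated constraints with concatenation, by an induction parallel to
  \<open>app_iso_assoc\<close>. The left unit law of \<open>F\<close> starts it.\<close>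

lemma mu_list_append:
 assumes "set As <= Ob V" and [simp]: "set Bs <= Ob V"
 shows "mu_list F (As @ Bs) \<cdot>\<^bsub>W\<^esub> app_iso W (map (sm_ob F) As) (map (sm_ob F) Bs)
  = sm_ar F (app_iso V As Bs) \<cdot>\<^bsub>W\<^esub> (sm_mu F (tens V As, tens V Bs) \<cdot>\<^bsub>W\<^esub> (mu_list F As \<boxtimes>\<^bsub>W\<^esub> mu_list F Bs))"
 using assms(1) proof (induction As)
 case Nil
 let ?b = "tens V Bs"
 have "sm_eta F \<boxtimes>\<^bsub>W\<^esub> mu_list F Bs = (sm_eta F \<boxtimes>\<^bsub>W\<^esub> Id W (sm_ob F ?b)) \<cdot>\<^bsub>W\<^esub> (Id W \<one>\<^bsub>W\<^esub> \<boxtimes>\<^bsub>W\<^esub> mu_list F Bs)"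
  by (simp add: W.interchange)
 then have "sm_ar F (app_iso V [] Bs) \<cdot>\<^bsub>W\<^esub> (sm_mu F (tens V [], ?b) \<cdot>\<^bsub>W\<^esub> (mu_list F [] \<boxtimes>\<^bsub>W\<^esub> mu_list F Bs))
  = (sm_ar F (Lunit V ?b) \<cdot>\<^bsub>W\<^esub> (sm_mu F (\<one>\<^bsub>V\<^esub>, ?b) \<cdot>\<^bsub>W\<^esub> (sm_eta F \<boxtimes>\<^bsub>W\<^esub> Id W (sm_ob F ?b)))) \<cdot>\<^bsub>W\<^esub> (Id W \<one>\<^bsub>W\<^esub> \<boxtimes>\<^bsub>W\<^esub> mu_list F Bs)"
  by simp
 also have "... = Lunit W (sm_ob F ?b) \<cdot>\<^bsub>W\<^esub> (Id W \<one>\<^bsub>W\<^esub> \<boxtimes>\<^bsub>W\<^esub> mu_list F Bs)"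
  by (subst lunit_mu) simp_all
 also have "... = mu_list F Bs \<cdot>\<^bsub>W\<^esub> Lunit W (tens W (map (sm_ob F) Bs))" by (simp add: W.Lunit_nat)
 finally show ?case by simp
next
 case (Cons A As)
 have A [simp]: "A \<in> Ob V" and As [simp]: "set As <= Ob V" using Cons.prems by auto
 have AAs: "set (A # As) <= Ob V" by simp
 have [simp]: "tens V (A # As) \<in> Ob V" "tens V (A # As @ Bs) \<in> Ob V" by (intro V.tens_in; simp)+
 have FA: "sm_ob F A \<in> Ob W" "set (map (sm_ob F) As) <= Ob W" "set (map (sm_ob F) Bs) <= Ob W" by simp_all
 let ?Fa = "sm_ob F A" and ?FAs = "map (sm_ob F) As" and ?FBs = "map (sm_ob F) Bs"
 let ?a = "tens V As" and ?b = "tens V Bs" and ?fa = "tens W ?FAs" and ?fb = "tens W ?FBs"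
 let ?e = "cons_iso W ?Fa ?FAs \<boxtimes>\<^bsub>W\<^esub> Id W ?fb"
 have AM: "set (?Fa # ?FAs) <= Ob W" using FA by simp
 have AMB: "set (?Fa # ?FAs @ ?FBs) <= Ob W" using FA by simp
 note aW = W.app_iso_simps[OF AM FA(3)]
 note mA = mu_list_simps[OF AAs] and mAB = mu_list_simps[of "A # As @ Bs"]
 have IH: "mu_list F (As @ Bs) \<cdot>\<^bsub>W\<^esub> app_iso W ?FAs ?FBs = sm_ar F (app_iso V As Bs) \<cdot>\<^bsub>W\<^esub> (sm_mu F (?a, ?b) \<cdot>\<^bsub>W\<^esub> (mu_list F As \<boxtimes>\<^bsub>W\<^esub> mu_list F Bs))"
  by (rule Cons.IH[OF As])
 note [simp del] = mu_list.simps tens.simps app_iso.simps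
 have "(mu_list F (A # As @ Bs) \<cdot>\<^bsub>W\<^esub> app_iso W (?Fa # ?FAs) ?FBs) \<cdot>\<^bsub>W\<^esub> ?e
  = mu_list F (A # As @ Bs) \<cdot>\<^bsub>W\<^esub> (cons_iso W ?Fa (?FAs @ ?FBs) \<cdot>\<^bsub>W\<^esub> ((Id W ?Fa \<boxtimes>\<^bsub>W\<^esub> app_iso W ?FAs ?FBs) \<cdot>\<^bsub>W\<^esub> Assoc W ?Fa ?fa ?fb))"
  using mAB aW W.app_iso_Cons[OF FA] by simp
 also have "... = (sm_ar F (cons_iso V A (As @ Bs)) \<cdot>\<^bsub>W\<^esub> (sm_mu F (A, tens V (As @ Bs)) \<cdot>\<^bsub>W\<^esub> (Id W ?Fa \<boxtimes>\<^bsub>W\<^esub> mu_list F (As @ Bs))))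
   \<cdot>\<^bsub>W\<^esub> ((Id W ?Fa \<boxtimes>\<^bsub>W\<^esub> app_iso W ?FAs ?FBs) \<cdot>\<^bsub>W\<^esub> Assoc W ?Fa ?fa ?fb)"
  using mu_list_Cons[of A "As @ Bs", symmetric] mAB by simp
 also have "... = sm_ar F (cons_iso V A (As @ Bs)) \<cdot>\<^bsub>W\<^esub> (sm_mu F (A, tens V (As @ Bs))
   \<cdot>\<^bsub>W\<^esub> ((Id W ?Fa \<boxtimes>\<^bsub>W\<^esub> (mu_list F (As @ Bs) \<cdot>\<^bsub>W\<^esub> app_iso W ?FAs ?FBs)) \<cdot>\<^bsub>W\<^esub> Assoc W ?Fa ?fa ?fb))"
  by (simp add: W.interchange_assoc)
 also have "... = sm_ar F (cons_iso V A (As @ Bs)) \<cdot>\<^bsub>W\<^esub> (sm_mu F (A, tens V (As @ Bs))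
   \<cdot>\<^bsub>W\<^esub> ((sm_ar F (Id V A) \<boxtimes>\<^bsub>W\<^esub> sm_ar F (app_iso V As Bs)) \<cdot>\<^bsub>W\<^esub> ((Id W ?Fa \<boxtimes>\<^bsub>W\<^esub> sm_mu F (?a, ?b)) \<cdot>\<^bsub>W\<^esub> ((Id W ?Fa \<boxtimes>\<^bsub>W\<^esub> (mu_list F As \<boxtimes>\<^bsub>W\<^esub> mu_list F Bs)) \<cdot>\<^bsub>W\<^esub> Assoc W ?Fa ?fa ?fb))))"
  unfolding IH by (simp add: W.interchange_assoc)
 also have "... = sm_ar F (cons_iso V A (As @ Bs)) \<cdot>\<^bsub>W\<^esub> (sm_ar F (Id V A \<boxtimes>\<^bsub>V\<^esub> app_iso V As Bs) \<cdot>\<^bsub>W\<^esub> (sm_mu F (A, ?a \<otimes>\<^bsub>V\<^esub> ?b)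
   \<cdot>\<^bsub>W\<^esub> ((Id W ?Fa \<boxtimes>\<^bsub>W\<^esub> sm_mu F (?a, ?b)) \<cdot>\<^bsub>W\<^esub> (Assoc W ?Fa (sm_ob F ?a) (sm_ob F ?b) \<cdot>\<^bsub>W\<^esub> ((Id W ?Fa \<boxtimes>\<^bsub>W\<^esub> mu_list F As) \<boxtimes>\<^bsub>W\<^esub> mu_list F Bs)))))"
  by (simp add: W.comp_head2[OF mu_nat] W.Assoc_nat del: F1_Id)
 \<comment> \<open>The associativity law of \<open>F\<close> enters here, in the role that the
   pentagon has for \<open>app_iso_assoc\<close>.\<close>
 also have "... = sm_ar F (cons_iso V A (As @ Bs)) \<cdot>\<^bsub>W\<^esub> (sm_ar F (Id V A \<boxtimes>\<^bsub>V\<^esub> app_iso V As Bs) \<cdot>\<^bsub>W\<^esub> ((sm_ar F (Assoc V A ?a ?b) \<cdot>\<^bsub>W\<^esub> (sm_mu F (A \<otimes>\<^bsub>V\<^esub> ?a, ?b) \<cdot>\<^bsub>W\<^esub> (sm_mu F (A, ?a) \<boxtimes>\<^bsub>W\<^esub> Id W (sm_ob F ?b))))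
   \<cdot>\<^bsub>W\<^esub> ((Id W ?Fa \<boxtimes>\<^bsub>W\<^esub> mu_list F As) \<boxtimes>\<^bsub>W\<^esub> mu_list F Bs)))"
  unfolding assoc_mu[OF A V.tens_in[OF As] V.tens_in[OF assms(2)]] by simp
 also have "... = sm_ar F (cons_iso V A (As @ Bs) \<cdot>\<^bsub>V\<^esub> ((Id V A \<boxtimes>\<^bsub>V\<^esub> app_iso V As Bs) \<cdot>\<^bsub>V\<^esub> Assoc V A ?a ?b)) \<cdot>\<^bsub>W\<^esub> (sm_mu F (A \<otimes>\<^bsub>V\<^esub> ?a, ?b)
   \<cdot>\<^bsub>W\<^esub> ((sm_mu F (A, ?a) \<cdot>\<^bsub>W\<^esub> (Id W ?Fa \<boxtimes>\<^bsub>W\<^esub> mu_list F As)) \<boxtimes>\<^bsub>W\<^esub> mu_list F Bs))"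
  by (simp add: W.interchange)
 also have "... = sm_ar F (app_iso V (A # As) Bs) \<cdot>\<^bsub>W\<^esub> (sm_ar F (cons_iso V A As \<boxtimes>\<^bsub>V\<^esub> Id V ?b) \<cdot>\<^bsub>W\<^esub> (sm_mu F (A \<otimes>\<^bsub>V\<^esub> ?a, ?b)
   \<cdot>\<^bsub>W\<^esub> ((sm_mu F (A, ?a) \<cdot>\<^bsub>W\<^esub> (Id W ?Fa \<boxtimes>\<^bsub>W\<^esub> mu_list F As)) \<boxtimes>\<^bsub>W\<^esub> mu_list F Bs)))"
  unfolding V.app_iso_Cons[OF A As assms(2), symmetric] using V.app_iso_simps[OF AAs assms(2)] by simp
 also have "... = sm_ar F (app_iso V (A # As) Bs) \<cdot>\<^bsub>W\<^esub> (sm_mu F (tens V (A # As), ?b) \<cdot>\<^bsub>W\<^esub> ((sm_ar F (cons_iso V A As) \<boxtimes>\<^bsub>W\<^esub> sm_ar F (Id V ?b))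
   \<cdot>\<^bsub>W\<^esub> ((sm_mu F (A, ?a) \<cdot>\<^bsub>W\<^esub> (Id W ?Fa \<boxtimes>\<^bsub>W\<^esub> mu_list F As)) \<boxtimes>\<^bsub>W\<^esub> mu_list F Bs)))"
  by (simp add: W.comp_head2[OF mu_nat] del: F1_Id)
 also have "... = sm_ar F (app_iso V (A # As) Bs) \<cdot>\<^bsub>W\<^esub> (sm_mu F (tens V (A # As), ?b) \<cdot>\<^bsub>W\<^esub>
   ((mu_list F (A # As) \<cdot>\<^bsub>W\<^esub> cons_iso W ?Fa ?FAs) \<boxtimes>\<^bsub>W\<^esub> mu_list F Bs))"
  unfolding mu_list_Cons[OF A As] by (simp add: W.interchange)
 also have "... = (sm_ar F (app_iso V (A # As) Bs) \<cdot>\<^bsub>W\<^esub> (sm_mu F (tens V (A # As), ?b) \<cdot>\<^bsub>W\<^esub> (mu_list F (A # As) \<boxtimes>\<^bsub>W\<^esub> mu_list F Bs))) \<cdot>\<^bsub>W\<^esub> ?e"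
  using mA V.app_iso_simps[OF AAs assms(2)] by (simp add: W.interchange)
 finally have "mu_list F (A # As @ Bs) \<cdot>\<^bsub>W\<^esub> app_iso W (?Fa # ?FAs) ?FBs
  = sm_ar F (app_iso V (A # As) Bs) \<cdot>\<^bsub>W\<^esub> (sm_mu F (tens V (A # As), ?b) \<cdot>\<^bsub>W\<^esub> (mu_list F (A # As) \<boxtimes>\<^bsub>W\<^esub> mu_list F Bs))"
  by (rule W.iso_cancel_right[of ?e, rotated 5]) (use mA mAB aW V.app_iso_simps[OF AAs assms(2)] in simp_all)
 then show ?case by simp
qed

text \<open>Conjugation by the iterated constraints replaces \<open>F\<close> by a functor of
  strictifications that preserves tensor products strictly.\<close>

definition str_ar where
 "str_ar x = (map (sm_ob F) (fst x), Inv W (mu_list F (snd (snd x))) \<cdot>\<^bsub>W\<^esub> (sm_ar F (mid x) \<cdot>\<^bsub>W\<^esub> mu_list F (fst x)), map (sm_ob F) (snd (snd x)))"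

lemma str_ar_sel [simp]:
 "fst (str_ar x) = map (sm_ob F) (fst x)" "snd (snd (str_ar x)) = map (sm_ob F) (snd (snd x))"
 "mid (str_ar x) = Inv W (mu_list F (snd (snd x))) \<cdot>\<^bsub>W\<^esub> (sm_ar F (mid x) \<cdot>\<^bsub>W\<^esub> mu_list F (fst x))"
 by (simp_all add: str_ar_def)

lemma str_ar_Id [simp]: "set As <= Ob V ==> str_ar (Id (str V) As) = Id (str W) (map (sm_ob F) As)" by (intro prod_eqI) simp_all

lemma str_ar_Comp [simp]:
 "[|x \<in> Ar (str V); y \<in> Ar (str V); fst y = snd (snd x)|] ==> str_ar (y \<cdot>\<^bsub>str V\<^esub> x) = str_ar y \<cdot>\<^bsub>str W\<^esub> str_ar x"
 by (intro prod_eqI) (auto simp: str_Ar)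

lemma Inv_mu_list_append:
 assumes "set As <= Ob V" "set Bs <= Ob V"
 shows "Inv W (mu_list F (As @ Bs)) \<cdot>\<^bsub>W\<^esub> (sm_ar F (app_iso V As Bs) \<cdot>\<^bsub>W\<^esub> sm_mu F (tens V As, tens V Bs))
  = app_iso W (map (sm_ob F) As) (map (sm_ob F) Bs) \<cdot>\<^bsub>W\<^esub> (Inv W (mu_list F As) \<boxtimes>\<^bsub>W\<^esub> Inv W (mu_list F Bs))"
proof -
 note [simp] = assms
 let ?e = "mu_list F As \<boxtimes>\<^bsub>W\<^esub> mu_list F Bs"
 have "(Inv W (mu_list F (As @ Bs)) \<cdot>\<^bsub>W\<^esub> (sm_ar F (app_iso V As Bs) \<cdot>\<^bsub>W\<^esub> sm_mu F (tens V As, tens V Bs))) \<cdot>\<^bsub>W\<^esub> ?e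
  = (app_iso W (map (sm_ob F) As) (map (sm_ob F) Bs) \<cdot>\<^bsub>W\<^esub> (Inv W (mu_list F As) \<boxtimes>\<^bsub>W\<^esub> Inv W (mu_list F Bs))) \<cdot>\<^bsub>W\<^esub> ?e"
  by (simp add: mu_list_append[symmetric] W.interchange)
 then show ?thesis by (rule W.iso_cancel_right[of ?e, rotated 5]) simp_all
qed

text \<open>Coherence with concatenation on both words leaves exactly the naturality square of
  \<open>sm_mu F\<close>.\<close>

lemma str_ar_Tar [simp]:
 assumes "x \<in> Ar (str V)" "y \<in> Ar (str V)" shows "str_ar (x \<boxtimes>\<^bsub>str V\<^esub> y) = str_ar x \<boxtimes>\<^bsub>str W\<^esub> str_ar y"
proof -
 obtain A f A' where x: "x = (A, f, A')" by (cases x) auto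
 obtain B g B' where y: "y = (B, g, B')" by (cases y) auto
 have [simp]: "set A <= Ob V" "set A' <= Ob V" "f \<in> Ar V" "Dom V f = tens V A" "Cod V f = tens V A'"
  "set B <= Ob V" "set B' <= Ob V" "g \<in> Ar V" "Dom V g = tens V B" "Cod V g = tens V B'" using assms by (auto simp: x y str_Ar)
 let ?aW = "app_iso W (map (sm_ob F) A) (map (sm_ob F) B)"
 have "mid (str_ar (x \<boxtimes>\<^bsub>str V\<^esub> y)) \<cdot>\<^bsub>W\<^esub> ?aW
  = Inv W (mu_list F (A' @ B')) \<cdot>\<^bsub>W\<^esub> (sm_ar F (app_iso V A' B') \<cdot>\<^bsub>W\<^esub> (sm_ar F (f \<boxtimes>\<^bsub>V\<^esub> g) \<cdot>\<^bsub>W\<^esub> (sm_ar F (Inv V (app_iso V A B)) \<cdot>\<^bsub>W\<^esub>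
    (sm_ar F (app_iso V A B) \<cdot>\<^bsub>W\<^esub> (sm_mu F (tens V A, tens V B) \<cdot>\<^bsub>W\<^esub> (mu_list F A \<boxtimes>\<^bsub>W\<^esub> mu_list F B))))))"
  by (simp add: x y mid_str mu_list_append)
 also have "... = Inv W (mu_list F (A' @ B')) \<cdot>\<^bsub>W\<^esub> (sm_ar F (app_iso V A' B') \<cdot>\<^bsub>W\<^esub> (sm_ar F (f \<boxtimes>\<^bsub>V\<^esub> g) \<cdot>\<^bsub>W\<^esub> (sm_mu F (tens V A, tens V B) \<cdot>\<^bsub>W\<^esub> (mu_list F A \<boxtimes>\<^bsub>W\<^esub> mu_list F B))))"
  by (simp add: F1_iso(1) flip: F1_iso(2))
 also have "... = (Inv W (mu_list F (A' @ B')) \<cdot>\<^bsub>W\<^esub> (sm_ar F (app_iso V A' B') \<cdot>\<^bsub>W\<^esub> sm_mu F (tens V A', tens V B'))) \<cdot>\<^bsub>W\<^esub> ((sm_ar F f \<boxtimes>\<^bsub>W\<^esub> sm_ar F g) \<cdot>\<^bsub>W\<^esub> (mu_list F A \<boxtimes>\<^bsub>W\<^esub> mu_list F B))"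
  by (simp add: W.comp_head2[OF mu_nat])
 also have "... = mid (str_ar x \<boxtimes>\<^bsub>str W\<^esub> str_ar y) \<cdot>\<^bsub>W\<^esub> ?aW"
  by (subst Inv_mu_list_append) (simp_all add: x y mid_str W.interchange)
 finally have "mid (str_ar (x \<boxtimes>\<^bsub>str V\<^esub> y)) = mid (str_ar x \<boxtimes>\<^bsub>str W\<^esub> str_ar y)"
  by (rule W.iso_cancel_right[of ?aW, rotated 5]) (simp_all add: x y mid_str)
 then show ?thesis by (intro prod_eqI) simp_all
qed

lemma str_ar_Braid [simp]:
 assumes [simp]: "set A <= Ob V" "set B <= Ob V" shows "str_ar (Braid (str V) A B) = Braid (str W) (map (sm_ob F) A) (map (sm_ob F) B)"
proof -
 let ?aW = "app_iso W (map (sm_ob F) A) (map (sm_ob F) B)"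
 have "mid (str_ar (Braid (str V) A B)) \<cdot>\<^bsub>W\<^esub> ?aW
  = Inv W (mu_list F (B @ A)) \<cdot>\<^bsub>W\<^esub> (sm_ar F (app_iso V B A) \<cdot>\<^bsub>W\<^esub> (sm_ar F (Braid V (tens V A) (tens V B)) \<cdot>\<^bsub>W\<^esub> (sm_ar F (Inv V (app_iso V A B)) \<cdot>\<^bsub>W\<^esub>
    (sm_ar F (app_iso V A B) \<cdot>\<^bsub>W\<^esub> (sm_mu F (tens V A, tens V B) \<cdot>\<^bsub>W\<^esub> (mu_list F A \<boxtimes>\<^bsub>W\<^esub> mu_list F B))))))"
  by (simp add: mid_str mu_list_append)
 also have "... = Inv W (mu_list F (B @ A)) \<cdot>\<^bsub>W\<^esub> (sm_ar F (app_iso V B A) \<cdot>\<^bsub>W\<^esub> (sm_ar F (Braid V (tens V A) (tens V B)) \<cdot>\<^bsub>W\<^esub> (sm_mu F (tens V A, tens V B) \<cdot>\<^bsub>W\<^esub> (mu_list F A \<boxtimes>\<^bsub>W\<^esub> mu_list F B))))"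
  by (simp add: F1_iso(1) flip: F1_iso(2))
 also have "... = (Inv W (mu_list F (B @ A)) \<cdot>\<^bsub>W\<^esub> (sm_ar F (app_iso V B A) \<cdot>\<^bsub>W\<^esub> sm_mu F (tens V B, tens V A))) \<cdot>\<^bsub>W\<^esub> ((mu_list F B \<boxtimes>\<^bsub>W\<^esub> mu_list F A) \<cdot>\<^bsub>W\<^esub> Braid W (tens W (map (sm_ob F) A)) (tens W (map (sm_ob F) B)))"
  by (simp add: W.comp_head2[OF sm_braid] W.Braid_nat)
 also have "... = mid (Braid (str W) (map (sm_ob F) A) (map (sm_ob F) B)) \<cdot>\<^bsub>W\<^esub> ?aW"
  by (subst Inv_mu_list_append) (simp_all add: mid_str W.interchange_assoc)
 finally have "mid (str_ar (Braid (str V) A B)) = mid (Braid (str W) (map (sm_ob F) A) (map (sm_ob F) B))"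
  by (rule W.iso_cancel_right[of ?aW, rotated 5]) (simp_all add: mid_str)
 then show ?thesis by (intro prod_eqI) simp_all
qed

text \<open>The image of a composite of adjacent symmetries is again such a composite, hence
  canonical by uniqueness in \<open>str W\<close>.\<close>

lemma str_ar_can:
 assumes "mset ls = mset ks" "A ` set ks <= Ob V" "distinct ks" shows "str_ar (can (str V) A ks ls) = can (str W) (sm_ob F \<circ> A) ks ls"
proof -
 interpret S: word_smc "str V" "Ob V" by (rule V.str_word)
 interpret T: word_smc "str W" "Ob W" by (rule W.str_word)
 show ?thesis using assms by (intro T.can_eqI[symmetric] parr_map[OF V.str_word S.can_parr]) auto
qed

lemma str_ar_tensl: "set xs <= Ar (str V) ==> str_ar (tensl (str V) xs) = tensl (str W) (map str_ar xs)" proof (induction xs)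
 case Nil
 then show ?case using str_ar_Id[of "[]"] by simp
next
 case (Cons x xs)
 interpret S: word_smc "str V" "Ob V" by (rule V.str_word)
 show ?case using Cons by simp
qed

end

section \<open>The 2-functor \<open>U\<close>\<close>

text \<open>
 Operations of \<open>U V\<close> are the arrows of the strictification with a one-letter target. In these
 terms multiplication is composition with a tensor product and the symmetric group acts through
 canonical arrows, so that the operad axioms become laws of strict monoidal categories.
\<close>

definition opar :: "('u univ, 'u univ) smcat => 'u univ => 'u univ list \<times> 'u univ \<times> 'u univ list" where
 "opar V a = (mult_src a, mult_ar a, [Cod V (mult_ar a)])"

lemma opar_sel [simp]:
 "fst (opar V a) = mult_src a" "mid (opar V a) = mult_ar a" "snd (snd (opar V a)) = [Cod V (mult_ar a)]" by (simp_all add: opar_def)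

lemma U_ob_simps [simp]:
 "Col (U_ob V) = Ob V" "Src (U_ob V) = mult_src" "Tgt (U_ob V) = (%a. Cod V (mult_ar a))"
 "Uni (U_ob V) A = Mult [A] (Id V A)" "arity (U_ob V) a = length (mult_src a)" by (simp_all add: U_ob_def arity_def)

lemma U_ops: "a \<in> Ops (U_ob V) \<longleftrightarrow>
 (\<exists>As f. a = Mult As f & set As <= Ob V & f \<in> Ar V & Dom V f = tens V As)" by (auto simp: U_ob_def)

locale univ_smc = symmetric_monoidal_category V for V :: "('u univ, 'u univ) smcat" (structure)
begin

sublocale S: word_smc "str V" "Ob V" by (rule str_word)

lemma opar_in [simp]: "a \<in> Ops (U_ob V) ==> opar V a \<in> Ar (str V)" by (auto simp: U_ops str_Ar)

lemma U_ops_iff: "Mult As f \<in> Ops (U_ob V) \<longleftrightarrow> set As <= Ob V & f \<in> Ar V & Dom V f = tens V As"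
 by (auto simp: U_ops)

lemma U_ops_simps:
 assumes "a \<in> Ops (U_ob V)" shows "set (mult_src a) <= Ob V" "mult_ar a \<in> Ar V" "Dom V (mult_ar a) = tens V (mult_src a)"
 using assms by (auto simp: U_ops)

lemma U_eqI: "[|a \<in> Ops (U_ob V); b \<in> Ops (U_ob V); opar V a = opar V b|] ==> a = b" by (auto simp: U_ops opar_def)

lemma Mult_in:
 assumes "x \<in> Ar (str V)" "snd (snd x) = [B]" shows "Mult (fst x) (mid x) \<in> Ops (U_ob V)" "opar V (Mult (fst x) (mid x)) = x"
 using assms by (auto simp: U_ops str_Ar opar_def intro!: prod_eqI)

lemma composable_tensl:
 assumes "composable (U_ob V) b as" shows "set (map (opar V) as) <= Ar (str V)" "fst (tensl (str V) (map (opar V) as)) = concat (map mult_src as)"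
  "snd (snd (tensl (str V) (map (opar V) as))) = mult_src b" "tensl (str V) (map (opar V) as) \<in> Ar (str V)"
  "mid (tensl (str V) (map (opar V) as)) = tens_ar V (map mult_ar as) \<cdot> Inv V (flat_iso V (map mult_src as))"
proof -
 have as: "set as <= Ops (U_ob V)" "map (%a. Cod V (mult_ar a)) as = mult_src b" using assms by (simp_all add: composable_def cong: map_cong)
 show *: "set (map (opar V) as) <= Ar (str V)" using as(1) by auto
 have "concat (map (%a. [Cod V (mult_ar a)]) as) = map (%a. Cod V (mult_ar a)) as" by (induction as) auto
 with S.tensl_in[OF *] as(2) show "fst (tensl (str V) (map (opar V) as)) = concat (map mult_src as)"
  "snd (snd (tensl (str V) (map (opar V) as))) = mult_src b" "tensl (str V) (map (opar V) as) \<in> Ar (str V)" by (simp_all add: comp_def)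
 show "mid (tensl (str V) (map (opar V) as)) = tens_ar V (map mult_ar as) \<cdot> Inv V (flat_iso V (map mult_src as))"
  using mid_tensl[of "map (opar V) as"] * by (auto simp: comp_def)
qed

text \<open>By \<open>mid_tensl\<close> the inverse of \<open>flat_iso\<close> in the definition of
  multiplication is precisely the coherence of a tensor product in \<open>str V\<close>.\<close>

lemma U_Mul:
 assumes "composable (U_ob V) b as" shows "Mul (U_ob V) b as \<in> Ops (U_ob V)"
  "opar V (Mul (U_ob V) b as) = opar V b \<cdot>\<^bsub>str V\<^esub> tensl (str V) (map (opar V) as)"
proof -
 let ?x = "opar V b \<cdot>\<^bsub>str V\<^esub> tensl (str V) (map (opar V) as)"
 note t = composable_tensl[OF assms]
 have b: "b \<in> Ops (U_ob V)" and as: "set as <= Ops (U_ob V)" "map (%a. Cod V (mult_ar a)) as = mult_src b"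
  using assms by (simp_all add: composable_def cong: map_cong)
 have x: "?x \<in> Ar (str V)" using b t by simp
 have ta: "set (map mult_ar as) <= Ar V" using as(1) U_ops_simps by auto
 have fl: "\<forall>As \<in> set (map mult_src as). set As <= Ob V" using as(1) U_ops_simps by auto
 have "map (Dom V) (map mult_ar as) = map (tens V) (map mult_src as)" using as(1) U_ops_simps(3) by auto
 note ts = tens_ar_simps(1,3)[OF ta] tens_ar_simps(2)[OF ta, unfolded this] flat_iso_simps[OF fl]
 have "map (Cod V) (map mult_ar as) = mult_src b" using as(2) by (simp add: comp_def)
 note ts = ts(1) ts(2)[unfolded this] ts(3-)
 have "mid ?x = mult_ar b \<cdot> (tens_ar V (map mult_ar as) \<cdot> Inv V (flat_iso V (map mult_src as)))" using t by simp
 also have "... = mult_ar b \<cdot> tens_ar V (map mult_ar as) \<cdot> Inv V (flat_iso V (map mult_src as))"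
  using ts U_ops_simps[OF b] by (intro Comp_assoc'[symmetric]) simp_all
 finally have "Mul (U_ob V) b as = Mult (fst ?x) (mid ?x)" using t by (simp add: U_ob_def)
 then show "Mul (U_ob V) b as \<in> Ops (U_ob V)" "opar V (Mul (U_ob V) b as) = ?x" using Mult_in[OF x] by auto
qed

lemma U_Act:
 assumes a: "a \<in> Ops (U_ob V)" and \<rho>: "\<rho> permutes {..<length (mult_src a)}" shows "Act (U_ob V) a \<rho> \<in> Ops (U_ob V)"
  "opar V (Act (U_ob V) a \<rho>) = opar V a \<cdot>\<^bsub>str V\<^esub> can (str V) ((!) (mult_src a)) (map \<rho> [0..<length (mult_src a)]) [0..<length (mult_src a)]"
proof -
 note s = U_ops_simps[OF a]
 let ?x = "opar V a \<cdot>\<^bsub>str V\<^esub> (permute_list \<rho> (mult_src a), perm_iso V \<rho> (mult_src a), mult_src a)"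
 let ?n = "length (mult_src a)"
 have m: "mset (map \<rho> [0..<?n]) = mset [0..<?n]" by (rule mset_map_permutes[OF \<rho>])
 have "can (str V) ((!) (mult_src a)) (map \<rho> [0..<?n]) [0..<?n] \<in> Ar (str V)" proof (rule S.can_simps)
  show "mset [0..<?n] = mset (map \<rho> [0..<?n])" using m by simp
  show "(!) (mult_src a) ` set (map \<rho> [0..<?n]) <= Ob V" unfolding mset_eq_setD[OF m] using s(1) by (auto simp: subset_iff)
  show "distinct (map \<rho> [0..<?n])" using mset_eq_imp_distinct_iff[OF m] by simp
 qed
 then have x: "?x \<in> Ar (str V)" using a unfolding perm_iso_can[OF \<rho> s(1)] by (simp add: perm_iso_can[OF \<rho> s(1), symmetric])
 have "Act (U_ob V) a \<rho> = Mult (fst ?x) (mid ?x)" by (simp add: U_ob_def)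
 then show "Act (U_ob V) a \<rho> \<in> Ops (U_ob V)" "opar V (Act (U_ob V) a \<rho>) = opar V a \<cdot>\<^bsub>str V\<^esub> can (str V) ((!) (mult_src a)) (map \<rho> [0..<?n]) [0..<?n]"
  using Mult_in[OF x] perm_iso_can[OF \<rho> s(1)] by auto
qed

text \<open>The side conditions under which \<open>can\<close> is determined, for the positions of a
  list in permuted order.\<close>

lemma permuted_labels:
 assumes "\<rho> permutes {..<length As}" "set As <= Ob V"
 shows "mset [0..<length As] = mset (map \<rho> [0..<length As])" "(!) As ` set (map \<rho> [0..<length As]) <= Ob V"
  "distinct (map \<rho> [0..<length As])" "mset (map \<rho> [0..<length As]) = mset [0..<length As]"
proof -
 show m: "mset (map \<rho> [0..<length As]) = mset [0..<length As]" by (rule mset_map_permutes[OF assms(1)])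
 show "mset [0..<length As] = mset (map \<rho> [0..<length As])" by (rule m[symmetric])
 show "(!) As ` set (map \<rho> [0..<length As]) <= Ob V" unfolding mset_eq_setD[OF m] using assms(2) by (auto simp: subset_iff)
 show "distinct (map \<rho> [0..<length As])" using mset_eq_imp_distinct_iff[OF m] by simp
qed

lemma U_Act_sel:
 assumes "a \<in> Ops (U_ob V)" "\<rho> permutes {..<length (mult_src a)}"
 shows "mult_src (Act (U_ob V) a \<rho>) = permute_list \<rho> (mult_src a)" "Cod V (mult_ar (Act (U_ob V) a \<rho>)) = Cod V (mult_ar a)"
proof -
 show "mult_src (Act (U_ob V) a \<rho>) = permute_list \<rho> (mult_src a)" by (simp add: U_ob_def)
 have "snd (snd (opar V (Act (U_ob V) a \<rho>))) = snd (snd (opar V a))" by (simp only: U_Act(2)[OF assms] str_simps)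
 then show "Cod V (mult_ar (Act (U_ob V) a \<rho>)) = Cod V (mult_ar a)" by simp
qed

lemma U_Mul_sel:
 assumes "composable (U_ob V) b as" shows "mult_src (Mul (U_ob V) b as) = concat (map mult_src as)" "Cod V (mult_ar (Mul (U_ob V) b as)) = Cod V (mult_ar b)"
proof -
 show "mult_src (Mul (U_ob V) b as) = concat (map mult_src as)" by (simp add: U_ob_def)
 have "snd (snd (opar V (Mul (U_ob V) b as))) = snd (snd (opar V b))" by (simp only: U_Mul(2)[OF assms] str_simps)
 then show "Cod V (mult_ar (Mul (U_ob V) b as)) = Cod V (mult_ar b)" by simp
qed

text \<open>A tensor product of canonical arrows is canonical, and the one obtained from the inner
  permutations belongs to their sum.\<close>

lemma U_Mul_Act_inner:
 assumes c: "composable (U_ob V) b as" and l: "list_all2 (%a \<rho>. \<rho> permutes {..<arity (U_ob V) a}) as \<rho>s"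
 shows "Mul (U_ob V) b (map2 (Act (U_ob V)) as \<rho>s) = Act (U_ob V) (Mul (U_ob V) b as) (sum_perm \<rho>s (map (arity (U_ob V)) as))"
proof -
 have len: "length \<rho>s = length as" using l by (simp add: list_all2_lengthD)
 have \<rho>: "\<rho>s ! k permutes {..<length (mult_src (as ! k))}" if "k < length as" for k using that l by (auto simp: list_all2_conv_all_nth)
 let ?n = "length as" and ?ns = "map (length \<circ> mult_src) as"
 let ?As = "concat (map mult_src as)"
 have as: "as ! k \<in> Ops (U_ob V)" if "k < ?n" for k using c that by (auto simp: composable_def)
 note sas = U_ops_simps[OF as]
 have ns: "map (arity (U_ob V)) as = ?ns" "?ns = map length (map mult_src as)" "sum_list ?ns = length ?As" "length ?ns = ?n"
  by (simp_all add: length_concat comp_def)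
 have nsk: "?ns ! k = length (mult_src (as ! k))" if "k < ?n" for k using that by simp
 let ?A = "%k. Act (U_ob V) (as ! k) (\<rho>s ! k)"
 have m2: "map2 (Act (U_ob V)) as \<rho>s = map ?A [0..<?n]" using len by (intro nth_equalityI) simp_all
 have A: "?A k \<in> Ops (U_ob V)" if "k < ?n" for k by (rule U_Act(1)[OF as[OF that] \<rho>[OF that]])
 have c2: "composable (U_ob V) b (map2 (Act (U_ob V)) as \<rho>s)"
 proof -
  have "map (Tgt (U_ob V)) (map2 (Act (U_ob V)) as \<rho>s) = map (Tgt (U_ob V)) as"
   unfolding m2 using U_Act_sel(2)[OF as \<rho>] by (intro nth_equalityI) simp_all
  moreover have "set (map2 (Act (U_ob V)) as \<rho>s) <= Ops (U_ob V)" unfolding m2 using A by auto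
  ultimately show ?thesis using c by (simp add: composable_def)
 qed
 let ?\<sigma> = "sum_perm \<rho>s ?ns"
 let ?K = "%k. map ((+) (offset ?ns k)) (map (\<rho>s ! k) [0..<?ns ! k])"
 have \<sigma>: "?\<sigma> permutes {..<sum_list ?ns}" using \<rho> by (intro sum_perm_permutes) simp_all
 have sm: "mset (concat (map ?K [0..<length ?ns])) = mset [0..<sum_list ?ns]" using \<rho> by (intro sum_perm_mset) simp_all
 have lK: "length (concat (map ?K [0..<?n])) = length ?As" using mset_eq_length[OF sm] unfolding ns(3,4) by simp
 have \<sigma>l: "map ?\<sigma> [0..<length ?As] = concat (map ?K [0..<?n])"
  using map_list_perm[of "concat (map ?K [0..<?n])"] unfolding lK sum_perm_list ns(4) .
 let ?M = "Mul (U_ob V) b as"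
 have M: "?M \<in> Ops (U_ob V)" "mult_src ?M = ?As" using U_Mul(1)[OF c] U_Mul_sel(1)[OF c] by auto
 have \<sigma>': "?\<sigma> permutes {..<length (mult_src ?M)}" using \<sigma> by (simp add: M ns(3))
 have AsL: "set ?As <= Ob V" using U_ops_simps(1)[OF M(1)] M(2) by simp
 \<comment> \<open>Each permutation is moved from positions in its own source to positions in the
   concatenation, a shift by the offset of its block, so that \<open>can_tensl\<close> can join
   them.\<close>
 have one: "can (str V) ((!) (mult_src (as ! k))) (map (\<rho>s ! k) [0..<length (mult_src (as ! k))]) [0..<length (mult_src (as ! k))]
  = can (str V) ((!) ?As) (?K k) (block ?ns k)" if k: "k < ?n" for k
 proof -
  note L = permuted_labels[OF \<rho>[OF k] sas(1)[OF k]]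
  have nth: "(!) (mult_src (as ! k)) t = ((!) ?As \<circ> (+) (offset ?ns k)) t" if "t \<in> set (map (\<rho>s ! k) [0..<length (mult_src (as ! k))])" for t
  proof -
   have "t < length (mult_src (as ! k))" using that unfolding mset_eq_setD[OF L(4)] by simp
   then show ?thesis using nth_concat_offset[of k "map mult_src as" t] k by (simp add: comp_def)
  qed
  have im: "((!) ?As \<circ> (+) (offset ?ns k)) ` set (map (\<rho>s ! k) [0..<length (mult_src (as ! k))]) <= Ob V"
   using L(2) nth by (simp add: image_def)
  have "can (str V) ((!) (mult_src (as ! k))) (map (\<rho>s ! k) [0..<length (mult_src (as ! k))]) [0..<length (mult_src (as ! k))]
   = can (str V) ((!) ?As \<circ> (+) (offset ?ns k)) (map (\<rho>s ! k) [0..<length (mult_src (as ! k))]) [0..<length (mult_src (as ! k))]"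
   by (rule S.can_cong[OF nth L(1-3)])
  also have "... = can (str V) ((!) ?As) (?K k) (block ?ns k)" unfolding block_def nsk[OF k] using L im
   by (intro S.can_relabel[symmetric]) (simp_all add: image_comp distinct_map comp_inj_on)
  finally show ?thesis .
 qed
 have Kd: "distinct (concat (map ?K [0..<?n]))" using mset_eq_imp_distinct_iff[OF sm] ns(4) by simp
 have KA: "(!) ?As ` set (?K k) <= Ob V" if "k < ?n" for k
 proof -
  have "set (?K k) <= set (concat (map ?K [0..<length ?ns]))" using that ns(4) by auto
  also have "... = {0..<length ?As}" using mset_eq_setD[OF sm] by (simp only: ns(3) set_upt)
  finally have sub: "set (?K k) <= {0..<length ?As}" .
  show ?thesis proof (rule image_subsetI)
   fix t assume "t \<in> set (?K k)"
   then have "t \<in> {0..<length ?As}" by (rule subsetD[OF sub])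
   then have "t < length ?As" by (rule atLeastLessThan_iff[THEN iffD1, THEN conjunct2])
   then show "?As ! t \<in> Ob V" by (rule subsetD[OF AsL nth_mem])
  qed
 qed
 have Km: "mset (block ?ns k) = mset (?K k)" if "k < ?n" for k using mset_map_permutes[OF \<rho>[OF that]] unfolding block_def mset_map nsk[OF that] by simp
 \<comment> \<open>Interchange separates the operations from their permutations; the latter combine
   into a single canonical arrow.\<close>
 have t: "tensl (str V) (map (opar V) (map ?A [0..<?n])) = tensl (str V) (map (opar V) as) \<cdot>\<^bsub>str V\<^esub> can (str V) ((!) ?As) (map ?\<sigma> [0..<length ?As]) [0..<length ?As]"
 proof -
  have e1: "map (opar V) (map ?A [0..<?n]) = map (%k. opar V (as ! k) \<cdot>\<^bsub>str V\<^esub> can (str V) ((!) ?As) (?K k) (block ?ns k)) [0..<?n]"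
   using U_Act(2)[OF as \<rho>] one by auto
  have e2: "tensl (str V) (map (%k. opar V (as ! k) \<cdot>\<^bsub>str V\<^esub> can (str V) ((!) ?As) (?K k) (block ?ns k)) [0..<?n]) = tensl (str V) (map (%k. opar V (as ! k)) [0..<?n]) \<cdot>\<^bsub>str V\<^esub> tensl (str V) (map (%k. can (str V) ((!) ?As) (?K k) (block ?ns k)) [0..<?n])"
  proof (rule S.tensl_comp)
   fix k assume "k \<in> set [0..<?n]"
   then have k: "k < ?n" by simp
   have Kd': "distinct (?K k)" using Kd k by (simp add: distinct_concat_iff)
   have "map ((!) ?As) (block ?ns k) = mult_src (as ! k)" using nth_concat_offset[of k "map mult_src as"] k unfolding block_def
    by (intro nth_equalityI) (simp_all add: comp_def)
   then show "can (str V) ((!) ?As) (?K k) (block ?ns k) \<in> Ar (str V) & opar V (as ! k) \<in> Ar (str V) &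
    Dom (str V) (opar V (as ! k)) = Cod (str V) (can (str V) ((!) ?As) (?K k) (block ?ns k))" using S.can_simps[OF Km[OF k] KA[OF k] Kd'] as[OF k] by simp
  qed
  have e3: "tensl (str V) (map (%k. can (str V) ((!) ?As) (?K k) (block ?ns k)) [0..<?n]) = can (str V) ((!) ?As) (concat (map ?K [0..<?n])) (concat (map (block ?ns) [0..<?n]))"
   using Kd Km KA by (intro S.can_tensl) simp_all
  have e4: "concat (map (block ?ns) [0..<?n]) = [0..<length ?As]" using concat_blocks[of ?ns] ns(3,4) by simp
  have e5: "map (%k. opar V (as ! k)) [0..<?n] = map (opar V) as" by (intro nth_equalityI) simp_all
  show ?thesis unfolding e1 e2 e3 e4 e5 \<sigma>l ..
 qed
 note L = permuted_labels[OF \<sigma>'[unfolded M(2)] AsL]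
 have "opar V (Mul (U_ob V) b (map2 (Act (U_ob V)) as \<rho>s)) = opar V b \<cdot>\<^bsub>str V\<^esub> (tensl (str V) (map (opar V) as) \<cdot>\<^bsub>str V\<^esub> can (str V) ((!) ?As) (map ?\<sigma> [0..<length ?As]) [0..<length ?As])"
  unfolding t[symmetric] m2[symmetric] by (rule U_Mul(2)[OF c2])
 also have "... = (opar V b \<cdot>\<^bsub>str V\<^esub> tensl (str V) (map (opar V) as)) \<cdot>\<^bsub>str V\<^esub> can (str V) ((!) ?As) (map ?\<sigma> [0..<length ?As]) [0..<length ?As]"
  using c composable_tensl[OF c] S.can_simps[OF L(1-3)] by (intro S.Comp_assoc'[symmetric]) (simp_all add: composable_def map_nth del: map_map)
 also have "... = opar V (Act (U_ob V) ?M ?\<sigma>)" unfolding U_Act(2)[OF M(1) \<sigma>'] U_Mul(2)[OF c] M(2) ..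
 finally show ?thesis unfolding ns(1) by (rule U_eqI[OF U_Mul(1)[OF c2] U_Act(1)[OF M(1) \<sigma>']])
qed

text \<open>Naturality of block permutations, \<open>can_blocks\<close>, moves the outer permutation
  from the targets of the inner operations to blocks of their sources.\<close>

lemma U_Mul_Act_outer:
 assumes c: "composable (U_ob V) b as" and "\<sigma> permutes {..<arity (U_ob V) b}"
 shows "Mul (U_ob V) (Act (U_ob V) b \<sigma>) (permute_list \<sigma> as) = Act (U_ob V) (Mul (U_ob V) b as) (block_perm \<sigma> (map (arity (U_ob V)) as))"
proof -
 have \<sigma>: "\<sigma> permutes {..<length (mult_src b)}" using assms(2) by simp
 have b: "b \<in> Ops (U_ob V)" and ass: "set as <= Ops (U_ob V)" and tg: "map (Tgt (U_ob V)) as = mult_src b"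
  using c by (simp_all add: composable_def)
 have len: "length (mult_src b) = length as" using arg_cong[OF tg, of length] by simp
 let ?n = "length as" and ?ns = "map (length \<circ> mult_src) as" and ?As = "concat (map mult_src as)"
 have ns: "map (arity (U_ob V)) as = ?ns" "sum_list ?ns = length ?As" "length ?ns = ?n" by (simp_all add: length_concat comp_def)
 have as: "as ! k \<in> Ops (U_ob V)" if "k < ?n" for k using ass that by auto
 have \<sigma>n: "\<sigma> permutes {..<?n}" using \<sigma> by (simp add: len)
 have c2: "composable (U_ob V) (Act (U_ob V) b \<sigma>) (permute_list \<sigma> as)"
 proof -
  have "map (Tgt (U_ob V)) (permute_list \<sigma> as) = permute_list \<sigma> (map (Tgt (U_ob V)) as)" by (rule permute_list_map[OF \<sigma>n, symmetric])
  then show ?thesis using U_Act(1)[OF b \<sigma>] U_Act_sel(1)[OF b \<sigma>] ass tg \<sigma>n by (simp add: composable_def)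
 qed
 let ?\<beta> = "block_perm \<sigma> ?ns"
 let ?M = "Mul (U_ob V) b as"
 have M: "?M \<in> Ops (U_ob V)" "mult_src ?M = ?As" using U_Mul(1)[OF c] U_Mul_sel(1)[OF c] by auto
 have \<sigma>ns: "\<sigma> permutes {..<length ?ns}" using \<sigma>n by simp
 have \<beta>: "?\<beta> permutes {..<length (mult_src ?M)}" using block_perm_permutes[OF \<sigma>ns] unfolding M(2) ns(2) .
 have AsL: "set ?As <= Ob V" using U_ops_simps(1)[OF M(1)] M(2) by simp
 note L = permuted_labels[OF \<beta>[unfolded M(2)] AsL]
 have bm: "mset (concat (map (block ?ns) (map \<sigma> [0..<?n]))) = mset [0..<length ?As]" using block_perm_mset[OF \<sigma>ns] unfolding ns(2,3) .
 have lB: "length (concat (map (block ?ns) (map \<sigma> [0..<?n]))) = length ?As" using mset_eq_length[OF bm] by simp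
 have \<beta>l: "map ?\<beta> [0..<length ?As] = concat (map (block ?ns) (map \<sigma> [0..<?n]))"
  using map_list_perm[of "concat (map (block ?ns) (map \<sigma> [0..<?n]))"] unfolding lB block_perm_list ns(3) .
 note Ls = permuted_labels[OF \<sigma> U_ops_simps(1)[OF b], unfolded len]
 \<comment> \<open>Each operation has one output, so on the target side every block is a single
   position.\<close>
 have blocks: "can (str V) ((!) (mult_src b)) (concat (map (%k. [k]) (map \<sigma> [0..<?n]))) (concat (map (%k. [k]) [0..<?n])) \<cdot>\<^bsub>str V\<^esub> tensl (str V) (map (%k. opar V (as ! k)) (map \<sigma> [0..<?n]))
  = tensl (str V) (map (%k. opar V (as ! k)) [0..<?n]) \<cdot>\<^bsub>str V\<^esub> can (str V) ((!) ?As) (concat (map (block ?ns) (map \<sigma> [0..<?n]))) (concat (map (block ?ns) [0..<?n]))"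
 proof (rule S.can_blocks)
  show "mset [0..<?n] = mset (map \<sigma> [0..<?n])" by (rule Ls(1))
  show "distinct (concat (map (block ?ns) (map \<sigma> [0..<?n])))" using mset_eq_imp_distinct_iff[OF bm] by simp
  have "concat (map (%k. [k]) ks) = ks" for ks :: "nat list" by (induction ks) auto
  then show "distinct (concat (map (%k. [k]) (map \<sigma> [0..<?n])))" using Ls(3) by (simp only:)
  fix k assume "k \<in> set (map \<sigma> [0..<?n])"
  then have k: "k < ?n" unfolding mset_eq_setD[OF Ls(4)] by simp
  have "map ((!) ?As) (block ?ns k) = mult_src (as ! k)" using nth_concat_offset[of k "map mult_src as"] k unfolding block_def
   by (intro nth_equalityI) (simp_all add: comp_def)
  moreover have "Cod V (mult_ar (as ! k)) = mult_src b ! k" using arg_cong[OF tg, of "%xs. xs ! k"] k by simp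
  ultimately show "opar V (as ! k) \<in> Ar (str V) & Dom (str V) (opar V (as ! k)) = map ((!) ?As) (block ?ns k) &
   Cod (str V) (opar V (as ! k)) = map ((!) (mult_src b)) [k]" using as[OF k] by simp
 qed
 have single: "concat (map (%k. [k]) ks) = ks" for ks :: "nat list" by (induction ks) auto
 have perm: "map (opar V) (permute_list \<sigma> as) = map (%k. opar V (as ! k)) (map \<sigma> [0..<?n])" by (simp add: permute_list_def comp_def)
 have asn: "map (%k. opar V (as ! k)) [0..<?n] = map (opar V) as" by (intro nth_equalityI) simp_all
 have cb: "concat (map (block ?ns) [0..<?n]) = [0..<length ?As]" using concat_blocks[of ?ns] ns(2,3) by simp
 have "opar V (Mul (U_ob V) (Act (U_ob V) b \<sigma>) (permute_list \<sigma> as))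
  = (opar V b \<cdot>\<^bsub>str V\<^esub> can (str V) ((!) (mult_src b)) (map \<sigma> [0..<?n]) [0..<?n]) \<cdot>\<^bsub>str V\<^esub> tensl (str V) (map (opar V) (permute_list \<sigma> as))"
  unfolding U_Mul(2)[OF c2] U_Act(2)[OF b \<sigma>] len ..
 also have "... = opar V b \<cdot>\<^bsub>str V\<^esub> (can (str V) ((!) (mult_src b)) (map \<sigma> [0..<?n]) [0..<?n] \<cdot>\<^bsub>str V\<^esub> tensl (str V) (map (opar V) (permute_list \<sigma> as)))"
 proof (rule S.Comp_assoc')
  show "opar V b \<in> Ar (str V)" using b by simp
  show "tensl (str V) (map (opar V) (permute_list \<sigma> as)) \<in> Ar (str V)" by (rule composable_tensl[OF c2])
  show "can (str V) ((!) (mult_src b)) (map \<sigma> [0..<?n]) [0..<?n] \<in> Ar (str V)" by (rule S.can_simps[OF Ls(1-3)])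
  show "Dom (str V) (can (str V) ((!) (mult_src b)) (map \<sigma> [0..<?n]) [0..<?n]) = Cod (str V) (tensl (str V) (map (opar V) (permute_list \<sigma> as)))"
   using S.can_simps(2)[OF Ls(1-3)] composable_tensl(3)[OF c2] U_Act_sel(1)[OF b \<sigma>] by (simp add: permute_list_def len comp_def)
  show "Dom (str V) (opar V b) = Cod (str V) (can (str V) ((!) (mult_src b)) (map \<sigma> [0..<?n]) [0..<?n])"
   using S.can_simps(3)[OF Ls(1-3)] by (simp add: map_nth flip: len)
 qed
 also have "can (str V) ((!) (mult_src b)) (map \<sigma> [0..<?n]) [0..<?n] \<cdot>\<^bsub>str V\<^esub> tensl (str V) (map (opar V) (permute_list \<sigma> as))
  = tensl (str V) (map (opar V) as) \<cdot>\<^bsub>str V\<^esub> can (str V) ((!) ?As) (map ?\<beta> [0..<length ?As]) [0..<length ?As]"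
  using blocks unfolding single perm asn cb \<beta>l .
 also have "opar V b \<cdot>\<^bsub>str V\<^esub> ... = (opar V b \<cdot>\<^bsub>str V\<^esub> tensl (str V) (map (opar V) as)) \<cdot>\<^bsub>str V\<^esub> can (str V) ((!) ?As) (map ?\<beta> [0..<length ?As]) [0..<length ?As]"
  using b composable_tensl[OF c] S.can_simps[OF L(1-3)] by (intro S.Comp_assoc'[symmetric]) (simp_all add: map_nth del: map_map)
 also have "... = opar V (Act (U_ob V) ?M ?\<beta>)" unfolding U_Act(2)[OF M(1) \<beta>] U_Mul(2)[OF c] M(2) ..
 finally show ?thesis unfolding ns(1) by (rule U_eqI[OF U_Mul(1)[OF c2] U_Act(1)[OF M(1) \<beta>]])
qed

lemma U_Uni: "A \<in> Ob V ==> Uni (U_ob V) A \<in> Ops (U_ob V) & opar V (Uni (U_ob V) A) = Id (str V) [A]"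
 by (auto simp: U_ops opar_def intro!: prod_eqI)

text \<open>Nested tensor products flatten by \<open>tensl_concat\<close>, and interchange, in the
  form of \<open>tensl_comp\<close>, turns composition of tensor products into componentwise
  composition.\<close>

lemma U_Mul_assoc:
 assumes c: "composable (U_ob V) b as" and cs: "list_all2 (composable (U_ob V)) as css"
 shows "Mul (U_ob V) (Mul (U_ob V) b as) (concat css) = Mul (U_ob V) b (map2 (Mul (U_ob V)) as css)"
proof -
 have len: "length css = length as" using cs by (simp add: list_all2_lengthD)
 have cs': "composable (U_ob V) (as ! k) (css ! k)" if "k < length as" for k using cs that by (rule list_all2_nthD)
 have as: "set as <= Ops (U_ob V)" using c by (simp add: composable_def)
 have zip: "composable (U_ob V) (fst p) (snd p)" if "p \<in> set (zip as css)" for p using that cs' len by (auto simp: set_zip)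
 have css: "\<forall>cs \<in> set css. set cs <= Ops (U_ob V)" using cs' len by (metis composable_def in_set_conv_nth)
 have c1: "composable (U_ob V) (Mul (U_ob V) b as) (concat css)"
 proof -
  have "map (Tgt (U_ob V)) (concat css) = concat (map (map (Tgt (U_ob V))) css)" by (simp add: map_concat)
  also have "map (map (Tgt (U_ob V))) css = map mult_src as" using cs' len by (intro nth_equalityI) (simp_all add: composable_def)
  finally show ?thesis using U_Mul[OF c] U_Mul_sel[OF c] css by (auto simp: composable_def)
 qed
 have c2: "composable (U_ob V) b (map2 (Mul (U_ob V)) as css)"
 proof -
  have "map (Tgt (U_ob V)) (map2 (Mul (U_ob V)) as css) = map (Tgt (U_ob V)) as" using cs' len U_Mul_sel(2) by (intro nth_equalityI) simp_all
  moreover have "set (map2 (Mul (U_ob V)) as css) <= Ops (U_ob V)" using zip U_Mul(1) by auto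
  ultimately show ?thesis using c by (simp add: composable_def)
 qed
 have t: "tensl (str V) (map (opar V) (concat css)) = tensl (str V) (map (%p. tensl (str V) (map (opar V) (snd p))) (zip as css))"
 proof -
  have "map (opar V) (concat css) = concat (map (map (opar V)) css)" by (simp add: map_concat)
  also have "tensl (str V) ... = tensl (str V) (map (tensl (str V)) (map (map (opar V)) css))"
   using css opar_in by (intro S.tensl_concat) (simp add: image_subset_iff subset_eq del: split_paired_All)
  also have "map (tensl (str V)) (map (map (opar V)) css) = map (%p. tensl (str V) (map (opar V) (snd p))) (zip as css)"
   using len by (intro nth_equalityI) simp_all
  finally show ?thesis .
 qed
 have t': "map (opar V) as = map (%p. opar V (fst p)) (zip as css)" using len by (intro nth_equalityI) simp_all
 have m: "map (opar V) (map2 (Mul (U_ob V)) as css) = map (%p. opar V (fst p) \<cdot>\<^bsub>str V\<^esub> tensl (str V) (map (opar V) (snd p))) (zip as css)"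
  using zip by (auto simp: U_Mul(2) case_prod_beta)
 have "opar V (Mul (U_ob V) b (map2 (Mul (U_ob V)) as css)) = opar V b \<cdot>\<^bsub>str V\<^esub> (tensl (str V) (map (opar V) as) \<cdot>\<^bsub>str V\<^esub> tensl (str V) (map (opar V) (concat css)))"
  unfolding U_Mul(2)[OF c2] m t t' proof (rule arg_cong[where f = "Comp (str V) (opar V b)"], rule S.tensl_comp)
  fix p assume "p \<in> set (zip as css)"
  note z = zip[OF this]
  show "tensl (str V) (map (opar V) (snd p)) \<in> Ar (str V) & opar V (fst p) \<in> Ar (str V) & Dom (str V) (opar V (fst p)) = Cod (str V) (tensl (str V) (map (opar V) (snd p)))"
   using composable_tensl[OF z] z by (simp add: composable_def)
 qed
 also have "... = (opar V b \<cdot>\<^bsub>str V\<^esub> tensl (str V) (map (opar V) as)) \<cdot>\<^bsub>str V\<^esub> tensl (str V) (map (opar V) (concat css))"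
  using c composable_tensl[OF c] composable_tensl[OF c1] U_Mul_sel[OF c] by (intro S.Comp_assoc'[symmetric]) (simp_all add: composable_def)
 finally show ?thesis by (intro U_eqI[OF U_Mul(1)[OF c1] U_Mul(1)[OF c2]]) (simp only: U_Mul(2)[OF c1] U_Mul(2)[OF c])
qed

text \<open>Relabelling the canonical arrow of \<open>\<sigma>\<close> by \<open>\<rho>\<close>
  makes the two canonical arrows consecutive, so that \<open>can_comp\<close> applies.\<close>

lemma U_Act_comp:
 assumes a: "a \<in> Ops (U_ob V)" and \<rho>: "\<rho> permutes {..<length (mult_src a)}" and \<sigma>: "\<sigma> permutes {..<length (mult_src a)}"
 shows "Act (U_ob V) (Act (U_ob V) a \<rho>) \<sigma> = Act (U_ob V) a (\<rho> \<circ> \<sigma>)"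
proof -
 let ?As = "mult_src a" let ?n = "length ?As"
 note s = U_ops_simps[OF a]
 have b: "Act (U_ob V) a \<rho> \<in> Ops (U_ob V)" by (rule U_Act[OF a \<rho>])
 have src: "mult_src (Act (U_ob V) a \<rho>) = permute_list \<rho> ?As" by (rule U_Act_sel[OF a \<rho>])
 have \<sigma>': "\<sigma> permutes {..<length (mult_src (Act (U_ob V) a \<rho>))}" using \<sigma> by (simp add: src)
 have \<rho>\<sigma>: "(\<rho> \<circ> \<sigma>) permutes {..<?n}" by (rule permutes_compose[OF \<sigma> \<rho>])
 note L = permuted_labels[OF \<rho> s(1)] and L' = permuted_labels[OF \<rho>\<sigma> s(1)] and L\<sigma> = permuted_labels[OF \<sigma> s(1)]
 have "can (str V) ((!) (permute_list \<rho> ?As)) (map \<sigma> [0..<?n]) [0..<?n] = can (str V) ((!) ?As) (map \<rho> (map \<sigma> [0..<?n])) (map \<rho> [0..<?n])"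
 proof -
  have "can (str V) ((!) ?As) (map \<rho> (map \<sigma> [0..<?n])) (map \<rho> [0..<?n]) = can (str V) ((!) ?As \<circ> \<rho>) (map \<sigma> [0..<?n]) [0..<?n]"
   using L' L\<sigma> by (intro S.can_relabel) (simp_all add: image_comp)
  also have "... = can (str V) ((!) (permute_list \<rho> ?As)) (map \<sigma> [0..<?n]) [0..<?n]" proof (rule S.can_cong)
   fix k assume "k \<in> set (map \<sigma> [0..<?n])"
   then have "k < ?n" unfolding mset_eq_setD[OF L\<sigma>(4)] by simp
   then show "((!) ?As \<circ> \<rho>) k = permute_list \<rho> ?As ! k" by (simp add: permute_list_nth[OF \<rho>])
  qed (use L' L\<sigma> in \<open>simp_all add: image_comp comp_assoc\<close>)
  finally show ?thesis by simp
 qed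
 then have "opar V (Act (U_ob V) (Act (U_ob V) a \<rho>) \<sigma>) = (opar V a \<cdot>\<^bsub>str V\<^esub> can (str V) ((!) ?As) (map \<rho> [0..<?n]) [0..<?n])
   \<cdot>\<^bsub>str V\<^esub> can (str V) ((!) ?As) (map (\<rho> \<circ> \<sigma>) [0..<?n]) (map \<rho> [0..<?n])"
  using U_Act(2)[OF b \<sigma>'] U_Act(2)[OF a \<rho>] by (simp add: src)
 also have "... = opar V a \<cdot>\<^bsub>str V\<^esub> (can (str V) ((!) ?As) (map \<rho> [0..<?n]) [0..<?n]
   \<cdot>\<^bsub>str V\<^esub> can (str V) ((!) ?As) (map (\<rho> \<circ> \<sigma>) [0..<?n]) (map \<rho> [0..<?n]))"
  using a S.can_simps[OF L(1-3)] S.can_simps[OF trans[OF L(4) L'(1)] L'(2,3)] by (intro S.Comp_assoc') (simp_all add: map_nth)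
 also have "can (str V) ((!) ?As) (map \<rho> [0..<?n]) [0..<?n] \<cdot>\<^bsub>str V\<^esub> can (str V) ((!) ?As) (map (\<rho> \<circ> \<sigma>) [0..<?n]) (map \<rho> [0..<?n])
   = can (str V) ((!) ?As) (map (\<rho> \<circ> \<sigma>) [0..<?n]) [0..<?n]" by (rule S.can_comp[OF trans[OF L(4) L'(1)] L'(1-3)])
 also have "opar V a \<cdot>\<^bsub>str V\<^esub> ... = opar V (Act (U_ob V) a (\<rho> \<circ> \<sigma>))" using U_Act(2)[OF a \<rho>\<sigma>] by simp
 finally show ?thesis by (rule U_eqI[OF U_Act(1)[OF b \<sigma>'] U_Act(1)[OF a \<rho>\<sigma>]])
qed

lemma U_operad: "operad (U_ob V)" proof (rule operad.intro)
 fix a assume a: "a \<in> Ops (U_ob V)"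
 note s = U_ops_simps[OF a]
 show "set (Src (U_ob V) a) <= Col (U_ob V)" "Tgt (U_ob V) a \<in> Col (U_ob V)" using s by simp_all
 note U = U_Uni[THEN conjunct1] U_Uni[THEN conjunct2]
 show "Mul (U_ob V) (Uni (U_ob V) (Tgt (U_ob V) a)) [a] = a" proof (rule U_eqI)
  have c: "composable (U_ob V) (Uni (U_ob V) (Tgt (U_ob V) a)) [a]" using a U[of "Tgt (U_ob V) a"] s by (simp add: composable_def)
  show "Mul (U_ob V) (Uni (U_ob V) (Tgt (U_ob V) a)) [a] \<in> Ops (U_ob V)" by (rule U_Mul[OF c])
  have "opar V (Mul (U_ob V) (Uni (U_ob V) (Tgt (U_ob V) a)) [a]) = Id (str V) [Cod V (mult_ar a)] \<cdot>\<^bsub>str V\<^esub> opar V a"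
   using U_Mul(2)[OF c] U(2)[of "Tgt (U_ob V) a"] a s by simp
  also have "... = opar V a" using a by (intro S.Id_Comp') simp_all
  finally show "opar V (Mul (U_ob V) (Uni (U_ob V) (Tgt (U_ob V) a)) [a]) = opar V a" .
 qed (rule a)
 show "Mul (U_ob V) a (map (Uni (U_ob V)) (Src (U_ob V) a)) = a" proof (rule U_eqI)
  have c: "composable (U_ob V) a (map (Uni (U_ob V)) (Src (U_ob V) a))" using a s U by (auto simp: composable_def comp_def subset_iff intro!: map_idI)
  show "Mul (U_ob V) a (map (Uni (U_ob V)) (Src (U_ob V) a)) \<in> Ops (U_ob V)" by (rule U_Mul[OF c])
  have "tensl (str V) (map (%A. opar V (Mult [A] (Id V A))) As) = Id (str V) As" if "set As <= Ob V" for As using that U by (induction As) auto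
  then have "opar V (Mul (U_ob V) a (map (Uni (U_ob V)) (Src (U_ob V) a))) = opar V a \<cdot>\<^bsub>str V\<^esub> Id (str V) (mult_src a)"
   using U_Mul(2)[OF c] s by (simp add: comp_def)
  also have "... = opar V a" using a by (intro S.Comp_Id') simp_all
  finally show "opar V (Mul (U_ob V) a (map (Uni (U_ob V)) (Src (U_ob V) a))) = opar V a" .
 qed (rule a)
 show "Act (U_ob V) a id = a" proof (rule U_eqI)
  have p: "id permutes {..<length (mult_src a)}" by (rule permutes_id)
  show "Act (U_ob V) a id \<in> Ops (U_ob V)" by (rule U_Act[OF a p])
  have "(!) (mult_src a) ` {0..<length (mult_src a)} <= Ob V" using s(1) by (auto simp: subset_iff)
  then have "can (str V) ((!) (mult_src a)) [0..<length (mult_src a)] [0..<length (mult_src a)] = Id (str V) (mult_src a)"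
   using S.can_refl[of "(!) (mult_src a)" "[0..<length (mult_src a)]"] by (simp add: map_nth)
  then have "opar V (Act (U_ob V) a id) = opar V a \<cdot>\<^bsub>str V\<^esub> Id (str V) (mult_src a)" using U_Act(2)[OF a p] by simp
  also have "... = opar V a" using a by (intro S.Comp_Id') simp_all
  finally show "opar V (Act (U_ob V) a id) = opar V a" .
 qed (rule a)
next
 fix i assume "i \<in> Col (U_ob V)"
 then show "Uni (U_ob V) i \<in> Ops (U_ob V)" "Src (U_ob V) (Uni (U_ob V) i) = [i]" "Tgt (U_ob V) (Uni (U_ob V) i) = i" by (auto simp: U_ops)
next
 fix b as assume c: "composable (U_ob V) b as"
 show "Mul (U_ob V) b as \<in> Ops (U_ob V)" by (rule U_Mul[OF c])
 show "Src (U_ob V) (Mul (U_ob V) b as) = concat (map (Src (U_ob V)) as)" "Tgt (U_ob V) (Mul (U_ob V) b as) = Tgt (U_ob V) b" using U_Mul_sel[OF c] by simp_all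
next
 fix a \<rho> assume a: "a \<in> Ops (U_ob V)" and "\<rho> permutes {..<arity (U_ob V) a}"
 then have p: "\<rho> permutes {..<length (mult_src a)}" by simp
 show "Act (U_ob V) a \<rho> \<in> Ops (U_ob V)" by (rule U_Act[OF a p])
 show "Src (U_ob V) (Act (U_ob V) a \<rho>) = permute_list \<rho> (Src (U_ob V) a)" "Tgt (U_ob V) (Act (U_ob V) a \<rho>) = Tgt (U_ob V) a"
  using U_Act_sel[OF a p] by simp_all
next
 fix a \<rho> \<sigma> assume "a \<in> Ops (U_ob V)" "\<rho> permutes {..<arity (U_ob V) a}" "\<sigma> permutes {..<arity (U_ob V) a}"
 then show "Act (U_ob V) (Act (U_ob V) a \<rho>) \<sigma> = Act (U_ob V) a (\<rho> \<circ> \<sigma>)" using U_Act_comp[of a \<rho> \<sigma>] by simp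
qed (fact U_Mul_assoc U_Mul_Act_inner U_Mul_Act_outer)+

end

lemma univ_smcI: "symmetric_monoidal_category V ==> univ_smc V" by (simp add: univ_smc_def)

section \<open>The action of \<open>U\<close> on 1-cells and 2-cells\<close>

context univ_smc
begin

lemma U_Mul_unary:
 assumes "Mult As f \<in> Ops (U_ob V)" "g \<in> Ar V" "Dom V g = Cod V f" shows "Mul (U_ob V) (Mult [Cod V f] g) [Mult As f] = Mult As (g \<cdot> f)"
 using assms by (simp add: U_ob_def)

lemma flat_iso_single: "set As <= Ob V ==> flat_iso V (map (%A. [A]) As) = Id V (tens V As)"
proof (induction As rule: induct_list012)
 case (3 A B As)
 have "concat (map (%A. [A]) As) = As" by (induction As) auto
 moreover have "tens V (B # As) \<in> Ob V" using 3 by (intro tens_in) simp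
 ultimately show ?case using 3 by simp
qed auto

end

locale univ_functor = symmetric_strong_monoidal_functor V W F
 for V W :: "('u univ, 'u univ) smcat" and F
begin

sublocale UV: univ_smc V by unfold_locales
sublocale UW: univ_smc W by unfold_locales

lemma U_fun_sel [simp]:
 "om_dom (U_fun F) = U_ob V" "om_cod (U_fun F) = U_ob W" "om_col (U_fun F) = sm_ob F" by (simp_all add: U_fun_def sm_dom sm_cod)

lemma U_fun_op:
 assumes "a \<in> Ops (U_ob V)"
 shows "om_op (U_fun F) a = Mult (map (sm_ob F) (mult_src a)) (sm_ar F (mult_ar a) \<cdot>\<^bsub>W\<^esub> mu_list F (mult_src a))"
  "om_op (U_fun F) a \<in> Ops (U_ob W)" "opar W (om_op (U_fun F) a) = str_ar (opar V a)"
  "mult_src (om_op (U_fun F) a) = map (sm_ob F) (mult_src a)" "Cod W (mult_ar (om_op (U_fun F) a)) = sm_ob F (Cod V (mult_ar a))"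
proof -
 note s = UV.U_ops_simps[OF assms]
 show e: "om_op (U_fun F) a = Mult (map (sm_ob F) (mult_src a)) (sm_ar F (mult_ar a) \<cdot>\<^bsub>W\<^esub> mu_list F (mult_src a))"
  using assms by (simp add: U_fun_def)
 show "om_op (U_fun F) a \<in> Ops (U_ob W)" unfolding e using s by (simp add: UW.U_ops_iff)
 show "opar W (om_op (U_fun F) a) = str_ar (opar V a)" unfolding e using s by (intro prod_eqI) (simp_all add: opar_def)
 show "mult_src (om_op (U_fun F) a) = map (sm_ob F) (mult_src a)" "Cod W (mult_ar (om_op (U_fun F) a)) = sm_ob F (Cod V (mult_ar a))"
  unfolding e using s by simp_all
qed

text \<open>Read through \<open>opar\<close>, the map on operations is \<open>str_ar\<close>, which
  preserves composition, tensor products and canonical arrows.\<close>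

lemma U_fun_morphism: "operad_morphism (U_ob V) (U_ob W) (U_fun F)" proof (intro operad_morphism.intro operad_morphism_axioms.intro UV.U_operad UW.U_operad)
 show "om_col (U_fun F) \<in> extensional (Col (U_ob V))" using sm_ob_ext by simp
 show "om_op (U_fun F) \<in> extensional (Ops (U_ob V))" by (simp add: U_fun_def)
next
 fix i assume i: "i \<in> Col (U_ob V)"
 then show "om_col (U_fun F) i \<in> Col (U_ob W)" by simp
 have "Mult [i] (Id V i) \<in> Ops (U_ob V)" using i by (simp add: UV.U_ops_iff)
 then show "om_op (U_fun F) (Uni (U_ob V) i) = Uni (U_ob W) (om_col (U_fun F) i)" using i by (simp add: U_fun_op(1))
next
 fix a assume a: "a \<in> Ops (U_ob V)"
 show "om_op (U_fun F) a \<in> Ops (U_ob W)" by (rule U_fun_op[OF a])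
 show "Src (U_ob W) (om_op (U_fun F) a) = map (om_col (U_fun F)) (Src (U_ob V) a)"
  "Tgt (U_ob W) (om_op (U_fun F) a) = om_col (U_fun F) (Tgt (U_ob V) a)" using U_fun_op(4,5)[OF a] by simp_all
next
 fix b as assume c: "composable (U_ob V) b as"
 have b: "b \<in> Ops (U_ob V)" and as: "set as <= Ops (U_ob V)" and tg: "map (Tgt (U_ob V)) as = mult_src b" using c by (simp_all add: composable_def)
 have tgW: "map (Tgt (U_ob W)) (map (om_op (U_fun F)) as) = map (sm_ob F) (map (Tgt (U_ob V)) as)" using as U_fun_op(5) by auto
 have c': "composable (U_ob W) (om_op (U_fun F) b) (map (om_op (U_fun F)) as)"
  unfolding composable_def tgW tg using as U_fun_op(2)[OF b] U_fun_op(4)[OF b] U_fun_op(2) by auto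
 have m: "map (opar W) (map (om_op (U_fun F)) as) = map str_ar (map (opar V) as)" using as U_fun_op(3) by (auto simp: subset_iff)
 note t = UV.composable_tensl[OF c]
 have "opar W (om_op (U_fun F) (Mul (U_ob V) b as)) = opar W (Mul (U_ob W) (om_op (U_fun F) b) (map (om_op (U_fun F)) as))"
  unfolding UW.U_Mul(2)[OF c'] U_fun_op(3)[OF UV.U_Mul(1)[OF c]] U_fun_op(3)[OF b] UV.U_Mul(2)[OF c] m str_ar_tensl[OF t(1), symmetric]
  using b t by (intro str_ar_Comp) simp_all
 then show "om_op (U_fun F) (Mul (U_ob V) b as) = Mul (U_ob W) (om_op (U_fun F) b) (map (om_op (U_fun F)) as)"
  by (rule UW.U_eqI[OF U_fun_op(2)[OF UV.U_Mul(1)[OF c]] UW.U_Mul(1)[OF c']])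
next
 fix a \<rho> assume a: "a \<in> Ops (U_ob V)" and "\<rho> permutes {..<arity (U_ob V) a}"
 then have \<rho>: "\<rho> permutes {..<length (mult_src a)}" by simp
 have b: "om_op (U_fun F) a \<in> Ops (U_ob W)" by (rule U_fun_op[OF a])
 have \<rho>': "\<rho> permutes {..<length (mult_src (om_op (U_fun F) a))}" using \<rho> U_fun_op(4)[OF a] by simp
 let ?n = "length (mult_src a)"
 note L = UV.permuted_labels[OF \<rho> UV.U_ops_simps(1)[OF a]]
 have "can (str W) (sm_ob F \<circ> (!) (mult_src a)) (map \<rho> [0..<?n]) [0..<?n] = can (str W) ((!) (map (sm_ob F) (mult_src a))) (map \<rho> [0..<?n]) [0..<?n]"
 proof (rule UW.S.can_cong)
  fix k assume "k \<in> set (map \<rho> [0..<?n])"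
  then have "k < ?n" unfolding mset_eq_setD[OF L(4)] by simp
  then show "(sm_ob F \<circ> (!) (mult_src a)) k = map (sm_ob F) (mult_src a) ! k" by simp
 next
  show "(sm_ob F \<circ> (!) (mult_src a)) ` set (map \<rho> [0..<?n]) <= Ob W" using L(2) F0_in unfolding image_comp[symmetric] by blast
 qed (rule L)+
 then have e: "can (str W) ((!) (mult_src (om_op (U_fun F) a))) (map \<rho> [0..<length (mult_src (om_op (U_fun F) a))]) [0..<length (mult_src (om_op (U_fun F) a))]
  = str_ar (can (str V) ((!) (mult_src a)) (map \<rho> [0..<?n]) [0..<?n])" unfolding str_ar_can[OF L(1-3)] U_fun_op(4)[OF a] by simp
 have "opar W (om_op (U_fun F) (Act (U_ob V) a \<rho>)) = opar W (Act (U_ob W) (om_op (U_fun F) a) \<rho>)"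
  unfolding UW.U_Act(2)[OF b \<rho>'] U_fun_op(3)[OF UV.U_Act(1)[OF a \<rho>]] U_fun_op(3)[OF a] UV.U_Act(2)[OF a \<rho>] e
  using a UV.S.can_simps[OF L(1-3)] by (intro str_ar_Comp) (simp_all add: map_nth)
 then show "om_op (U_fun F) (Act (U_ob V) a \<rho>) = Act (U_ob W) (om_op (U_fun F) a) \<rho>"
  by (rule UW.U_eqI[OF U_fun_op(2)[OF UV.U_Act(1)[OF a \<rho>]] UW.U_Act(1)[OF b \<rho>']])
qed (rule U_fun_sel)+

end

lemma univ_functorI: "symmetric_strong_monoidal_functor V W F ==> univ_functor V W F" by (simp add: univ_functor_def)

lemmas U_fun_morphism = univ_functor.U_fun_morphism[OF univ_functorI]

text \<open>Compatibility with the constraints iterated along a list; the empty list is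
  compatibility with the unit constraint.\<close>

lemma (in monoidal_transformation) mu_list_nat:
 "set As <= Ob V ==> t_at \<phi> (tens V As) \<cdot>\<^bsub>W\<^esub> mu_list (t_src \<phi>) As = mu_list (t_tgt \<phi>) As \<cdot>\<^bsub>W\<^esub> tens_ar W (map (t_at \<phi>) As)"
proof (induction As rule: induct_list012)
 case (3 A B As)
 let ?BAs = "B # As"
 have [simp]: "A \<in> Ob V" and s: "set ?BAs <= Ob V" using 3 by auto
 have t [simp]: "tens V ?BAs \<in> Ob V" using s by (rule F.V.tens_in)
 have tW [simp]: "tens W (map (sm_ob (t_src \<phi>)) ?BAs) \<in> Ob W" "tens W (map (sm_ob (t_tgt \<phi>)) ?BAs) \<in> Ob W"
  using s by (auto intro!: F.W.tens_in)
 note m = F.mu_list_simps[OF s] G.mu_list_simps[OF s]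
 have ta: "set (map (t_at \<phi>) ?BAs) <= Ar W" using s by auto
 have "map (Dom W) (map (t_at \<phi>) ?BAs) = map (sm_ob (t_src \<phi>)) ?BAs" "map (Cod W) (map (t_at \<phi>) ?BAs) = map (sm_ob (t_tgt \<phi>)) ?BAs"
  using s by auto
 note T = F.W.tens_ar_simps(1)[OF ta] F.W.tens_ar_simps(2,3)[OF ta, unfolded this]
 have IH: "t_at \<phi> (tens V ?BAs) \<cdot>\<^bsub>W\<^esub> mu_list (t_src \<phi>) ?BAs = mu_list (t_tgt \<phi>) ?BAs \<cdot>\<^bsub>W\<^esub> tens_ar W (map (t_at \<phi>) ?BAs)"
  using 3 by simp
 have e: "mu_list X (A # ?BAs) = sm_mu X (A, tens V ?BAs) \<cdot>\<^bsub>W\<^esub> (Id W (sm_ob X A) \<boxtimes>\<^bsub>W\<^esub> mu_list X ?BAs)"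
  if "sm_dom X = V" "sm_cod X = W" for X using that by simp
 note [simp del] = mu_list.simps tens.simps tens_ar.simps list.map
 have tt: "tens_ar W (map (t_at \<phi>) (A # ?BAs)) = t_at \<phi> A \<boxtimes>\<^bsub>W\<^esub> tens_ar W (map (t_at \<phi>) ?BAs)"
  by (simp add: list.map tens_ar.simps)
 have tV: "tens V (A # ?BAs) = A \<otimes>\<^bsub>V\<^esub> tens V ?BAs" by (simp add: tens.simps)
 have "t_at \<phi> (A \<otimes>\<^bsub>V\<^esub> tens V ?BAs) \<cdot>\<^bsub>W\<^esub> (sm_mu (t_src \<phi>) (A, tens V ?BAs) \<cdot>\<^bsub>W\<^esub> (Id W (sm_ob (t_src \<phi>) A) \<boxtimes>\<^bsub>W\<^esub> mu_list (t_src \<phi>) ?BAs))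
  = sm_mu (t_tgt \<phi>) (A, tens V ?BAs) \<cdot>\<^bsub>W\<^esub> ((Id W (sm_ob (t_tgt \<phi>) A) \<boxtimes>\<^bsub>W\<^esub> mu_list (t_tgt \<phi>) ?BAs) \<cdot>\<^bsub>W\<^esub> (t_at \<phi> A \<boxtimes>\<^bsub>W\<^esub> tens_ar W (map (t_at \<phi>) ?BAs)))"
  using m T by (simp add: F.W.comp_head2[OF mt_mu] F.W.interchange IH)
 then show ?case using m T by (simp add: e tt tV)
qed (simp_all add: mt_eta)

lemma U_trans_sel [simp]: "t_src (U_trans \<phi>) = U_fun (t_src \<phi>)" "t_tgt (U_trans \<phi>) = U_fun (t_tgt \<phi>)" by (simp_all add: U_trans_def)

text \<open>Naturality at the underlying arrow is followed by \<open>mu_list_nat\<close>. The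
  components are one-letter operations, so \<open>flat_iso\<close> disappears from their
  simultaneous substitution.\<close>

lemma U_trans_transformation:
 assumes "monoidal_transformation V W \<phi>" shows "operad_transformation (U_ob V) (U_ob W) (U_trans \<phi>)"
proof -
 interpret \<phi>: monoidal_transformation V W \<phi> by fact
 interpret F: univ_functor V W "t_src \<phi>" by (rule univ_functorI) unfold_locales
 interpret G: univ_functor V W "t_tgt \<phi>" by (rule univ_functorI) unfold_locales
 have at: "t_at (U_trans \<phi>) A = Mult [sm_ob (t_src \<phi>) A] (t_at \<phi> A)" if "A \<in> Ob V" for A using that by (simp add: U_trans_def)
 have at_in: "t_at (U_trans \<phi>) A \<in> Ops (U_ob W)" if "A \<in> Ob V" for A using that by (simp add: at F.UW.U_ops_iff)
 show ?thesis proof (intro operad_transformation.intro operad_transformation_axioms.intro)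
  show "operad_morphism (U_ob V) (U_ob W) (t_src (U_trans \<phi>))" "operad_morphism (U_ob V) (U_ob W) (t_tgt (U_trans \<phi>))"
   using F.U_fun_morphism G.U_fun_morphism by simp_all
  show "t_at (U_trans \<phi>) \<in> extensional (Col (U_ob V))" by (simp add: U_trans_def)
 next
  fix i assume "i \<in> Col (U_ob V)"
  then show "t_at (U_trans \<phi>) i \<in> Ops (U_ob W)" "Src (U_ob W) (t_at (U_trans \<phi>) i) = [om_col (t_src (U_trans \<phi>)) i]"
   "Tgt (U_ob W) (t_at (U_trans \<phi>) i) = om_col (t_tgt (U_trans \<phi>)) i" using at_in by (simp_all add: at)
 next
  fix a assume a: "a \<in> Ops (U_ob V)"
  let ?As = "mult_src a" and ?f = "mult_ar a"
  note s = F.UV.U_ops_simps[OF a]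
  let ?B = "Cod V ?f"
  have Fa: "om_op (U_fun (t_src \<phi>)) a = Mult (map (sm_ob (t_src \<phi>)) ?As) (sm_ar (t_src \<phi>) ?f \<cdot>\<^bsub>W\<^esub> mu_list (t_src \<phi>) ?As)"
   by (rule F.U_fun_op[OF a])
  have Ga: "om_op (U_fun (t_tgt \<phi>)) a = Mult (map (sm_ob (t_tgt \<phi>)) ?As) (sm_ar (t_tgt \<phi>) ?f \<cdot>\<^bsub>W\<^esub> mu_list (t_tgt \<phi>) ?As)"
   by (rule G.U_fun_op[OF a])
  have "Mul (U_ob W) (t_at (U_trans \<phi>) ?B) [om_op (U_fun (t_src \<phi>)) a]
   = Mult (map (sm_ob (t_src \<phi>)) ?As) (t_at \<phi> ?B \<cdot>\<^bsub>W\<^esub> (sm_ar (t_src \<phi>) ?f \<cdot>\<^bsub>W\<^esub> mu_list (t_src \<phi>) ?As))"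
   using F.UW.U_Mul_unary[of "map (sm_ob (t_src \<phi>)) ?As" "sm_ar (t_src \<phi>) ?f \<cdot>\<^bsub>W\<^esub> mu_list (t_src \<phi>) ?As" "t_at \<phi> ?B"]
    F.U_fun_op(2)[OF a] s unfolding Fa by (simp add: at)
  also have "t_at \<phi> ?B \<cdot>\<^bsub>W\<^esub> (sm_ar (t_src \<phi>) ?f \<cdot>\<^bsub>W\<^esub> mu_list (t_src \<phi>) ?As) = sm_ar (t_tgt \<phi>) ?f \<cdot>\<^bsub>W\<^esub> (t_at \<phi> (tens V ?As) \<cdot>\<^bsub>W\<^esub> mu_list (t_src \<phi>) ?As)"
   using s by (simp add: \<phi>.F.W.comp_head2[OF \<phi>.at_nat])
  also have "... = sm_ar (t_tgt \<phi>) ?f \<cdot>\<^bsub>W\<^esub> (mu_list (t_tgt \<phi>) ?As \<cdot>\<^bsub>W\<^esub> tens_ar W (map (t_at \<phi>) ?As))"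
   using s by (simp add: \<phi>.mu_list_nat)
  also have "Mult (map (sm_ob (t_src \<phi>)) ?As) ... = Mul (U_ob W) (om_op (U_fun (t_tgt \<phi>)) a) (map (t_at (U_trans \<phi>)) ?As)"
  proof -
   have "map mult_src (map (t_at (U_trans \<phi>)) ?As) = map (%A. [A]) (map (sm_ob (t_src \<phi>)) ?As)"
    "map mult_ar (map (t_at (U_trans \<phi>)) ?As) = map (t_at \<phi>) ?As" using s by (auto simp: at subset_iff)
   moreover have "concat (map (%A. [A]) As) = As" for As :: "'a univ list" by (induction As) auto
   moreover have "set (map (t_at \<phi>) ?As) <= Ar W" using s by auto
   moreover have "map (Dom W) (map (t_at \<phi>) ?As) = map (sm_ob (t_src \<phi>)) ?As" "map (Cod W) (map (t_at \<phi>) ?As) = map (sm_ob (t_tgt \<phi>)) ?As"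
    using s by (auto simp: subset_iff)
   moreover have "flat_iso W (map (%A. [A]) (map (sm_ob (t_src \<phi>)) ?As)) = Id W (tens W (map (sm_ob (t_src \<phi>)) ?As))"
    using s by (intro F.UW.flat_iso_single) auto
   moreover note \<phi>.F.W.tens_ar_simps[of "map (t_at \<phi>) ?As"]
   ultimately show ?thesis using s unfolding Ga by (simp add: U_ob_def del: map_map)
  qed
  finally show "Mul (U_ob W) (t_at (U_trans \<phi>) (Tgt (U_ob V) a)) [om_op (t_src (U_trans \<phi>)) a]
   = Mul (U_ob W) (om_op (t_tgt (U_trans \<phi>)) a) (map (t_at (U_trans \<phi>)) (Src (U_ob V) a))" by simp
 qed
qed

lemma U_fun_id:
 fixes V :: "('u univ, 'u univ) smcat"
 assumes "symmetric_monoidal_category V" shows "U_fun (sm_id V) = om_id (U_ob V)"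
proof -
 interpret univ_functor V V "sm_id V" by (rule univ_functorI[OF sm_id_functor[OF assms]])
 have [simp]: "mu_list (sm_id V) As = Id V (tens V As)" if "set As <= Ob V" for As using that proof (induction As rule: induct_list012)
  case (3 A B As)
  then have "tens V (B # As) \<in> Ob V" by (intro V.tens_in) simp
  then show ?case using 3 by (simp add: sm_id_simps)
 qed (simp_all add: sm_id_simps)
 show ?thesis proof (rule operad_morphism_eqI[OF U_fun_morphism om_id_morphism[OF UV.U_operad]])
  fix a assume a: "a \<in> Ops (U_ob V)"
  have "map (sm_ob (sm_id V)) As = As" if "set As <= Ob V" for As using that by (induction As) (auto simp: sm_id_simps)
  then show "om_op (U_fun (sm_id V)) a = om_op (om_id (U_ob V)) a"
   using a UV.U_ops_simps[OF a] by (simp add: U_fun_op(1) om_id_def sm_id_simps) (auto simp: U_ops)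
 qed (simp_all add: om_id_def sm_id_simps)
qed

text \<open>The content is the formula for the iterated constraints of a composite, whose induction
  step is naturality of the constraint of \<open>G\<close>.\<close>

lemma U_fun_comp:
 fixes V W X :: "('u univ, 'u univ) smcat"
 assumes "symmetric_strong_monoidal_functor V W F" "symmetric_strong_monoidal_functor W X G" shows "U_fun (sm_comp G F) = om_comp (U_fun G) (U_fun F)"
proof -
 interpret F: univ_functor V W F by (rule univ_functorI[OF assms(1)])
 interpret G: univ_functor W X G by (rule univ_functorI[OF assms(2)])
 note GF = sm_comp_functor[OF assms] and S = sm_comp_simps[OF assms]
 interpret GF: univ_functor V X "sm_comp G F" by (rule univ_functorI[OF GF])
 have m: "map (sm_ob (sm_comp G F)) As = map (sm_ob G) (map (sm_ob F) As)" if "set As <= Ob V" for As using that by (induction As) (auto simp: S)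
 have mu: "mu_list (sm_comp G F) As = sm_ar G (mu_list F As) \<cdot>\<^bsub>X\<^esub> mu_list G (map (sm_ob F) As)" if "set As <= Ob V" for As
  using that proof (induction As rule: induct_list012)
  case (3 A B As)
  let ?BAs = "B # As"
  have [simp]: "A \<in> Ob V" and s [simp]: "set ?BAs <= Ob V" using 3 by auto
  have t [simp]: "tens V ?BAs \<in> Ob V" using s by (rule F.V.tens_in)
  have s' [simp]: "set (map (sm_ob F) ?BAs) <= Ob W" using s by auto
  have t' [simp]: "tens W (map (sm_ob F) ?BAs) \<in> Ob W" using s' by (rule F.W.tens_in)
  note m = F.mu_list_simps[OF s] G.mu_list_simps[OF s']
  have e: "mu_list Y (A # C # As) = sm_mu Y (A, tens (sm_dom Y) (C # As)) \<cdot>\<^bsub>sm_cod Y\<^esub> (Id (sm_cod Y) (sm_ob Y A) \<boxtimes>\<^bsub>sm_cod Y\<^esub> mu_list Y (C # As))"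
   for Y :: "('u univ, 'u univ) sm_functor" and A C As by simp
  note [simp del] = mu_list.simps tens.simps list.map
  have IH: "mu_list (sm_comp G F) ?BAs = sm_ar G (mu_list F ?BAs) \<cdot>\<^bsub>X\<^esub> mu_list G (map (sm_ob F) ?BAs)" using 3 by simp
  have eG: "mu_list G (map (sm_ob F) (A # ?BAs)) = sm_mu G (sm_ob F A, tens W (map (sm_ob F) ?BAs)) \<cdot>\<^bsub>X\<^esub> (Id X (sm_ob G (sm_ob F A)) \<boxtimes>\<^bsub>X\<^esub> mu_list G (map (sm_ob F) ?BAs))"
   unfolding list.map e by simp
  have "Id X (sm_ob G (sm_ob F A)) \<boxtimes>\<^bsub>X\<^esub> (sm_ar G (mu_list F ?BAs) \<cdot>\<^bsub>X\<^esub> mu_list G (map (sm_ob F) ?BAs))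
   = (sm_ar G (Id W (sm_ob F A)) \<boxtimes>\<^bsub>X\<^esub> sm_ar G (mu_list F ?BAs)) \<cdot>\<^bsub>X\<^esub> (Id X (sm_ob G (sm_ob F A)) \<boxtimes>\<^bsub>X\<^esub> mu_list G (map (sm_ob F) ?BAs))"
   using m by (simp add: G.W.interchange)
  then show ?case unfolding e IH eG using m by (simp add: S G.W.comp_head2[OF G.mu_nat] del: G.F1_Id)
 qed (simp_all add: S)
 show ?thesis proof (rule operad_morphism_eqI[OF GF.U_fun_morphism om_comp_morphism[OF F.U_fun_morphism G.U_fun_morphism]])
  fix a assume a: "a \<in> Ops (U_ob V)"
  note s = F.UV.U_ops_simps[OF a]
  have s': "set (map (sm_ob F) (mult_src a)) <= Ob W" using s by auto
  show "om_op (U_fun (sm_comp G F)) a = om_op (om_comp (U_fun G) (U_fun F)) a"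
   using a s F.U_fun_op(1,2)[OF a] G.U_fun_op(1)[OF F.U_fun_op(2)[OF a]] G.mu_list_simps[OF s']
   by (simp add: GF.U_fun_op(1) om_comp_def compose_def m mu S del: map_map)
 qed (simp_all add: om_comp_def compose_def S)
qed

lemma U_trans_at:
 assumes "monoidal_transformation V W \<phi>" "A \<in> Ob V" shows "t_at (U_trans \<phi>) A = Mult [sm_ob (t_src \<phi>) A] (t_at \<phi> A)"
proof -
 interpret \<phi>: monoidal_transformation V W \<phi> by fact
 show ?thesis using assms(2) by (simp add: U_trans_def)
qed

lemma U_trans_id:
 fixes V W :: "('u univ, 'u univ) smcat"
 assumes "symmetric_strong_monoidal_functor V W F" shows "U_trans (mt_id F) = ot_id (U_fun F)"
proof -
 interpret F: univ_functor V W F by (rule univ_functorI[OF assms])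
 note i = mt_id_transformation[OF assms]
 show ?thesis by (rule operad_transformation_eqI[OF U_trans_transformation[OF i] ot_id_transformation[OF F.U_fun_morphism]])
   (auto simp: U_trans_at[OF i], auto simp: mt_id_def ot_id_def)
qed

lemma U_trans_vcomp:
 fixes V W :: "('u univ, 'u univ) smcat"
 assumes "monoidal_transformation V W \<phi>" "monoidal_transformation V W \<psi>" "t_src \<psi> = t_tgt \<phi>"
 shows "U_trans (mt_vcomp \<psi> \<phi>) = ot_vcomp (U_trans \<psi>) (U_trans \<phi>)"
proof -
 interpret \<phi>: monoidal_transformation V W \<phi> by fact
 interpret \<psi>: monoidal_transformation V W \<psi> by fact
 interpret UW: univ_smc W by (rule univ_smcI) unfold_locales
 interpret F: univ_functor V W "t_src \<phi>" by (rule univ_functorI) unfold_locales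
 note v = mt_vcomp_transformation[OF assms]
 have s: "t_src (U_trans \<psi>) = t_tgt (U_trans \<phi>)" using assms(3) by simp
 show ?thesis proof (rule operad_transformation_eqI[OF U_trans_transformation[OF v]
   ot_vcomp_transformation[OF U_trans_transformation[OF assms(1)] U_trans_transformation[OF assms(2)] s]])
  fix A assume "A \<in> Col (U_ob V)"
  then have A: "A \<in> Ob V" by simp
  have "Mul (U_ob W) (Mult [Cod W (t_at \<phi> A)] (t_at \<psi> A)) [Mult [sm_ob (t_src \<phi>) A] (t_at \<phi> A)] = Mult [sm_ob (t_src \<phi>) A] (t_at \<psi> A \<cdot>\<^bsub>W\<^esub> t_at \<phi> A)"
   using A assms(3) by (intro UW.U_Mul_unary) (simp_all add: UW.U_ops_iff)
  then show "t_at (U_trans (mt_vcomp \<psi> \<phi>)) A = t_at (ot_vcomp (U_trans \<psi>) (U_trans \<phi>)) A"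
   using A assms(3) unfolding U_trans_at[OF v A] by (simp add: ot_vcomp_def U_trans_at[OF assms(1)] U_trans_at[OF assms(2)] mt_vcomp_def)
 qed (simp_all add: ot_vcomp_def mt_vcomp_def)
qed

lemma U_trans_hcomp:
 fixes V W X :: "('u univ, 'u univ) smcat"
 assumes "monoidal_transformation V W \<phi>" "monoidal_transformation W X \<psi>"
 shows "U_trans (mt_hcomp \<psi> \<phi>) = ot_hcomp (U_trans \<psi>) (U_trans \<phi>)"
proof -
 interpret \<phi>: monoidal_transformation V W \<phi> by fact
 interpret \<psi>: monoidal_transformation W X \<psi> by fact
 interpret F: univ_functor V W "t_src \<phi>" by (rule univ_functorI) unfold_locales
 interpret G: univ_functor V W "t_tgt \<phi>" by (rule univ_functorI) unfold_locales
 interpret H: univ_functor W X "t_src \<psi>" by (rule univ_functorI) unfold_locales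
 note v = mt_hcomp_transformation[OF assms] and S = mt_hcomp_simps[OF assms]
 note fs = \<phi>.F.symmetric_strong_monoidal_functor_axioms \<phi>.G.symmetric_strong_monoidal_functor_axioms
  \<psi>.F.symmetric_strong_monoidal_functor_axioms \<psi>.G.symmetric_strong_monoidal_functor_axioms
 show ?thesis proof (rule operad_transformation_eqI[OF U_trans_transformation[OF v]
   ot_hcomp_transformation[OF U_trans_transformation[OF assms(1)] U_trans_transformation[OF assms(2)]]])
  show "t_src (U_trans (mt_hcomp \<psi> \<phi>)) = t_src (ot_hcomp (U_trans \<psi>) (U_trans \<phi>))"
   "t_tgt (U_trans (mt_hcomp \<psi> \<phi>)) = t_tgt (ot_hcomp (U_trans \<psi>) (U_trans \<phi>))"
   by (simp_all add: S ot_hcomp_def U_fun_comp[OF fs(1,3)] U_fun_comp[OF fs(2,4)])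
  fix A assume "A \<in> Col (U_ob V)"
  then have A: "A \<in> Ob V" by simp
  let ?H = "t_src \<psi>" and ?FA = "sm_ob (t_src \<phi>) A" and ?GA = "sm_ob (t_tgt \<phi>) A"
  have o: "Mult [?FA] (t_at \<phi> A) \<in> Ops (U_ob W)" using A by (simp add: F.UW.U_ops_iff)
  have "om_op (U_fun ?H) (Mult [?FA] (t_at \<phi> A)) = Mult [sm_ob ?H ?FA] (sm_ar ?H (t_at \<phi> A))" using H.U_fun_op(1)[OF o] A by simp
  moreover have "Mul (U_ob X) (Mult [Cod X (sm_ar ?H (t_at \<phi> A))] (t_at \<psi> ?GA)) [Mult [sm_ob ?H ?FA] (sm_ar ?H (t_at \<phi> A))]
   = Mult [sm_ob ?H ?FA] (t_at \<psi> ?GA \<cdot>\<^bsub>X\<^esub> sm_ar ?H (t_at \<phi> A))" using A by (intro H.UW.U_Mul_unary) (simp_all add: H.UW.U_ops_iff)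
  ultimately show "t_at (U_trans (mt_hcomp \<psi> \<phi>)) A = t_at (ot_hcomp (U_trans \<psi>) (U_trans \<phi>)) A" using A unfolding U_trans_at[OF v A]
   by (simp add: ot_hcomp_def U_trans_at[OF assms(1)] U_trans_at[OF assms(2)] S sm_comp_simps[OF fs(1,3)])
 qed
qed

lemma U_simps [simp]: "F_ob U = U_ob" "F_1 U = U_fun" "F_2 U = U_trans" by (simp_all add: U_def)

lemma U_ps: "two_functor SMC_ps Opd U"
proof -
 note [simp] = SMC_ps_hom_simps Opd_hom_simps and [simp del] = hom_cat_simps(1,2)
 have cat: "cat_functor (hom_cat SMC_ps V W) (hom_cat Opd (U_ob V) (U_ob W)) U_fun U_trans"
  if "symmetric_monoidal_category V" "symmetric_monoidal_category W" for V W :: "('u univ, 'u univ) smcat" using that U_trans_vcomp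
  by (intro cat_functor.intro cat_functor_axioms.intro SMC_ps_hom_category Opd_hom_category univ_smc.U_operad univ_smcI)
   (auto simp: U_fun_morphism U_trans_transformation U_trans_id)
 show ?thesis by (intro two_functor.intro two_functor_axioms.intro SMC_ps_two_category Opd_two_category)
   (auto simp: univ_smc.U_operad[OF univ_smcI] cat U_fun_id U_fun_comp U_trans_hcomp)
qed

lemma U_s: "two_functor SMC_s Opd U" by (rule sub_two_category.two_functor_sub[OF SMC_s_sub U_ps])

section \<open>Operations with labelled inputs\<close>

text \<open>The permutation that takes a list with labels \<open>ks\<close> to the list with labels \<open>ls\<close>.\<close>

definition relabel :: "nat list => nat list => nat => nat" where
 "relabel ks ls = list_perm (map (%p. THE t. t < length ks & ks ! t = p) ls)"

lemma sorting_perm_relabel: "sorting_perm ks = relabel ks (sort ks)" by (simp add: sorting_perm_def relabel_def)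

lemma relabel_permutes:
 assumes m: "mset ls = mset ks" and d: "distinct ks" shows "relabel ks ls permutes {..<length ks}" "permute_list (relabel ks ls) ks = ls"
proof -
 let ?t = "%p. THE t. t < length ks & ks ! t = p"
 have t: "?t (ks ! j) = j" if "j < length ks" for j using that d by (auto intro!: the_equality simp: nth_eq_iff_index_eq)
 have s: "set ls = set ks" and len: "length ls = length ks" using m by (auto dest: mset_eq_setD mset_eq_length)
 have "map ?t ks = [0..<length ks]" using t by (intro nth_equalityI) simp_all
 then have "mset (map ?t ls) = mset [0..<length ks]" using m by (metis mset_map)
 then show "relabel ks ls permutes {..<length ks}" unfolding relabel_def by (rule list_perm_permutes)
 have "ks ! ?t p = p" if "p \<in> set ls" for p using that t unfolding s by (auto simp: in_set_conv_nth)
 then show "permute_list (relabel ks ls) ks = ls" unfolding relabel_def using len by (simp add: permute_list_list_perm map_idI)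
qed

text \<open>Replaces computations with values of permutations: on distinct labels a permutation is
  determined by its effect.\<close>

lemma relabel_unique:
 assumes "\<rho> permutes {..<length ks}" "permute_list \<rho> ks = ls" "distinct ks" shows "\<rho> = relabel ks ls" proof (rule ext)
 fix k
 have "mset ls = mset ks" using assms by (metis mset_permute_list)
 note r = relabel_permutes[OF this assms(3)]
 show "\<rho> k = relabel ks ls k" proof (cases "k < length ks")
  case True
  then have "ks ! \<rho> k = ks ! relabel ks ls k" using permute_list_nth[OF assms(1) True] permute_list_nth[OF r(1) True] assms(2) r(2) by simp
  then show ?thesis using True permutes_in_image[OF assms(1), of k] permutes_in_image[OF r(1), of k] assms(3) by (simp add: nth_eq_iff_index_eq)
 qed (use permutes_not_in[OF assms(1)] permutes_not_in[OF r(1)] in simp)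
qed

lemma relabel_refl: "distinct ks ==> relabel ks ks = id" by (intro relabel_unique[symmetric] permutes_id) simp_all

text \<open>Only the positions of labels matter, so an injective renaming leaves the permutation
  unchanged.\<close>

lemma relabel_map:
 assumes "mset ls = mset ks" "distinct (map p ks)" shows "relabel (map p ks) (map p ls) = relabel ks ls" proof (rule relabel_unique[symmetric])
 have d: "distinct ks" using assms(2) by (simp add: distinct_map)
 note r = relabel_permutes[OF assms(1) d]
 show "relabel ks ls permutes {..<length (map p ks)}" using r by simp
 show "permute_list (relabel ks ls) (map p ks) = map p ls" using r by (simp add: permute_list_map)
qed (rule assms(2))

text \<open>Regards the inputs of an operation as carrying the labels \<open>ks\<close> and lists
  them in the order \<open>ls\<close>. Successive reorderings are then tracked by their label
  lists.\<close>

definition reord :: "('i, 'p) operad => nat list => nat list => 'p => 'p" where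
 "reord T ks ls \<alpha> = Act T \<alpha> (relabel ks ls)"

context operad
begin

lemma reord_simps:
 assumes "\<alpha> \<in> Ops T" "Src T \<alpha> = map A ks" "mset ls = mset ks" "distinct ks"
 shows "reord T ks ls \<alpha> \<in> Ops T" "Src T (reord T ks ls \<alpha>) = map A ls" "Tgt T (reord T ks ls \<alpha>) = Tgt T \<alpha>"
 using assms relabel_permutes[OF assms(3,4)] Src_Act[of \<alpha> "relabel ks ls"] by (simp_all add: reord_def arity_def permute_list_map Act_in Tgt_Act)

lemma reord_refl: "[|\<alpha> \<in> Ops T; distinct ks|] ==> reord T ks ks \<alpha> = \<alpha>"
 by (simp add: reord_def relabel_refl Act_id)

lemma reord_reord:
 assumes "\<alpha> \<in> Ops T" "length (Src T \<alpha>) = length ks" "mset ls = mset ks" "mset ms = mset ls" "distinct ks"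
 shows "reord T ls ms (reord T ks ls \<alpha>) = reord T ks ms \<alpha>"
proof -
 have d: "distinct ls" and len: "length ls = length ks" using assms by (auto dest: mset_eq_length mset_eq_imp_distinct_iff)
 note r = relabel_permutes[OF assms(3,5)] relabel_permutes[OF assms(4) d, unfolded len]
 have "relabel ks ls \<circ> relabel ls ms = relabel ks ms" using r assms by (intro relabel_unique permutes_compose) (simp_all add: permute_list_compose)
 then show ?thesis using Act_comp[OF assms(1), of "relabel ks ls" "relabel ls ms"] r assms(2) by (simp add: reord_def arity_def)
qed

text \<open>The two equivariance axioms in terms of labels. Sums of permutations here, and block
  permutations in the next lemma, are recognised by what they do to concatenated labels.\<close>

lemma Mul_reord_inner:
 assumes c: "composable T \<beta> (map \<alpha> rs)" and d: "distinct (concat (map K rs))"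
  and r: "\<And>r. r \<in> set rs ==> mset (L r) = mset (K r) & length (K r) = length (Src T (\<alpha> r))"
 shows "Mul T \<beta> (map (%r. reord T (K r) (L r) (\<alpha> r)) rs) = reord T (concat (map K rs)) (concat (map L rs)) (Mul T \<beta> (map \<alpha> rs))"
proof -
 let ?\<rho>s = "map (%r. relabel (K r) (L r)) rs"
 have \<rho>: "relabel (K r) (L r) permutes {..<length (K r)}" "permute_list (relabel (K r) (L r)) (K r) = L r" if "r \<in> set rs" for r
  using relabel_permutes[of "L r" "K r"] r[OF that] d that by (auto simp: distinct_concat_iff)
 have a: "map (arity T) (map \<alpha> rs) = map length (map K rs)" using r by (auto simp: arity_def)
 have "Mul T \<beta> (map (%r. reord T (K r) (L r) (\<alpha> r)) rs) = Mul T \<beta> (map2 (Act T) (map \<alpha> rs) ?\<rho>s)"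
  unfolding map2_map_map by (simp add: reord_def)
 also have "... = Act T (Mul T \<beta> (map \<alpha> rs)) (sum_perm ?\<rho>s (map (arity T) (map \<alpha> rs)))"
  using r \<rho> by (intro Mul_Act_inner[OF c]) (auto simp: list_all2_map1 list_all2_map2 list_all2_same arity_def)
 also have "sum_perm ?\<rho>s (map (arity T) (map \<alpha> rs)) = relabel (concat (map K rs)) (concat (map L rs))" unfolding a
 proof (rule relabel_unique[OF _ _ d])
  have "sum_perm ?\<rho>s (map length (map K rs)) permutes {..<sum_list (map length (map K rs))}" using \<rho>(1) by (intro sum_perm_permutes) simp
  then show "sum_perm ?\<rho>s (map length (map K rs)) permutes {..<length (concat (map K rs))}" unfolding length_concat .
  have "permute_list (sum_perm ?\<rho>s (map length (map K rs))) (concat (map K rs)) = concat (map2 permute_list ?\<rho>s (map K rs))"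
   using \<rho>(1) by (intro permute_list_sum_perm) simp_all
  also have "map2 permute_list ?\<rho>s (map K rs) = map L rs" unfolding map2_map_map using \<rho>(2) by simp
  finally show "permute_list (sum_perm ?\<rho>s (map length (map K rs))) (concat (map K rs)) = concat (map L rs)" .
 qed
 finally show ?thesis by (simp add: reord_def)
qed

lemma Mul_reord_outer:
 assumes c: "composable T \<beta> (map \<alpha> ks)" and m: "mset ls = mset ks" and d: "distinct ks" "distinct (concat (map K ks))"
  and K: "\<And>k. k \<in> set ks ==> length (K k) = length (Src T (\<alpha> k))"
 shows "Mul T (reord T ks ls \<beta>) (map \<alpha> ls) = reord T (concat (map K ks)) (concat (map K ls)) (Mul T \<beta> (map \<alpha> ks))"
proof -
 note \<sigma> = relabel_permutes[OF m d(1)]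
 have a: "map (arity T) (map \<alpha> ks) = map length (map K ks)" using K by (auto simp: arity_def)
 have "length (Src T \<beta>) = length ks" using c by (metis composable_def length_map)
 then have \<sigma>': "relabel ks ls permutes {..<arity T \<beta>}" using \<sigma> by (simp add: arity_def)
 have "Mul T (reord T ks ls \<beta>) (map \<alpha> ls) = Mul T (Act T \<beta> (relabel ks ls)) (permute_list (relabel ks ls) (map \<alpha> ks))"
  using \<sigma> by (simp add: reord_def permute_list_map)
 also have "... = Act T (Mul T \<beta> (map \<alpha> ks)) (block_perm (relabel ks ls) (map (arity T) (map \<alpha> ks)))"
  by (rule Mul_Act_outer[OF c \<sigma>'])
 also have "block_perm (relabel ks ls) (map (arity T) (map \<alpha> ks)) = relabel (concat (map K ks)) (concat (map K ls))" unfolding a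
 proof (rule relabel_unique[OF _ _ d(2)])
  have "block_perm (relabel ks ls) (map length (map K ks)) permutes {..<sum_list (map length (map K ks))}" using \<sigma>(1) by (intro block_perm_permutes) simp
  then show "block_perm (relabel ks ls) (map length (map K ks)) permutes {..<length (concat (map K ks))}" unfolding length_concat .
  show "permute_list (block_perm (relabel ks ls) (map length (map K ks))) (concat (map K ks)) = concat (map K ls)"
   using permute_list_block_perm[of "relabel ks ls" "map K ks"] \<sigma> by (simp add: permute_list_map)
 qed
 finally show ?thesis by (simp add: reord_def)
qed

end

section \<open>Fibres\<close>

lemma fibre_simps [simp]:
 "set (fibre f k) = {l. l < length f & f ! l = k}" "distinct (fibre f k)" "sorted (fibre f k)" by (auto simp: fibre_def intro: sorted_wrt_filter)

lemma distinct_concat_fibres: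
 assumes "distinct ks" shows "distinct (concat (map (fibre f) ks))" using assms by (induction ks) auto

text \<open>This explains the sorting in the composition of \<open>Com T\<close>: substituting
  operations leaves the inputs in the order of the concatenated fibres, while an arrow needs them in
  the order of its own fibre.\<close>

lemma fibre_comp:
 assumes "set f <= {..<length g}" shows "sort (concat (map (fibre f) (fibre g r))) = fibre (map ((!) g) f) r"
 using assms by (intro sorted_distinct_set_unique) (auto simp: distinct_concat_fibres subset_iff)

lemma mset_fibre_comp:
 assumes "set f <= {..<length g}" shows "mset (fibre (map ((!) g) f) r) = mset (concat (map (fibre f) (fibre g r)))"
 unfolding fibre_comp[OF assms, symmetric] by simp

lemma mset_fibres: "set f <= {..<n} ==> mset (concat (map (fibre f) [0..<n])) = mset [0..<length f]"
proof -
 assume "set f <= {..<n}"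
 then have "set (concat (map (fibre f) [0..<n])) = set [0..<length f]" by (auto simp: subset_iff)
 then show ?thesis by (intro set_eq_iff_mset_eq_distinct[THEN iffD1]) (simp_all add: distinct_concat_fibres)
qed

lemma fibre_eqI: "[|sorted ks; distinct ks; set ks = {l. l < length f & f ! l = k}|] ==> fibre f k = ks"
 by (intro sorted_distinct_set_unique) simp_all

lemma fibre_append:
 assumes "set f <= {..<n}" shows "fibre (f @ map ((+) n) g) k = (if k < n then fibre f k else map ((+) (length f)) (fibre g (k - n)))"
proof (cases "k < n")
 case True
 then show ?thesis using assms by (auto intro!: fibre_eqI simp: nth_append split: if_splits)
next
 case False
 moreover have "l \<in> (+) (length f) ` {l. l < length g & g ! l = k - n}"
  if "l < length f + length g" "\<not> l < length f" "n + g ! (l - length f) = k" for l using that by (intro image_eqI[of _ _ "l - length f"]) auto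
 ultimately show ?thesis using assms by (auto intro!: fibre_eqI simp: nth_append sorted_map distinct_map subset_iff sorted_wrt_map
   intro: sorted_wrt_mono_rel[OF _ fibre_simps(3)] split: if_splits)
qed

section \<open>The symmetric strict monoidal category \<open>Com T\<close>\<close>

definition com_data :: "('u univ, 'u univ) operad => 'u univ list => nat list => 'u univ list => bool" where
 "com_data T is f \<alpha>s \<longleftrightarrow> set is <= Col T & length f = length is & set f <= {..<length \<alpha>s} & set \<alpha>s <= Ops T &
  (\<forall>k < length \<alpha>s. Src T (\<alpha>s ! k) = map ((!) is) (fibre f k))"

text \<open>The \<open>r\<close>-th operation of a composite in \<open>Com T\<close>, with the
  sorting of inputs written as a reordering of labels.\<close>

definition com_op :: "('u univ, 'u univ) operad => nat list => 'u univ list => nat list => 'u univ list => nat => 'u univ" where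
 "com_op T f \<alpha>s g \<beta>s r = reord T (concat (map (fibre f) (fibre g r))) (fibre (map ((!) g) f) r)
  (Mul T (\<beta>s ! r) (map ((!) \<alpha>s) (fibre g r)))"

text \<open>The list \<open>q\<close> is the inverse of the permutation \<open>p\<close>.\<close>

definition perm_data :: "('u univ, 'u univ) operad => 'u univ list => nat list => nat list => 'u univ list => bool" where
 "perm_data T is p q js \<longleftrightarrow> set js <= Col T & length p = length is & length q = length js &
  (\<forall>l < length is. p ! l < length js & q ! (p ! l) = l & is ! l = js ! (p ! l)) &
  (\<forall>k < length js. q ! k < length is & p ! (q ! k) = k)"

lemma Com_Ar: "x \<in> Ar (Com T) \<longleftrightarrow> (\<exists>is f \<alpha>s. x = Mor is f \<alpha>s & com_data T is f \<alpha>s)"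
 by (auto simp: Com_def com_data_def)

lemma Com_simps [simp]:
 "Seq is \<in> Ob (Com T) \<longleftrightarrow> set is <= Col T" "Mor is f \<alpha>s \<in> Ar (Com T) \<longleftrightarrow> com_data T is f \<alpha>s"
 "Dom (Com T) (Mor is f \<alpha>s) = Seq is" "Cod (Com T) (Mor is f \<alpha>s) = Seq (map (Tgt T) \<alpha>s)"
 "Id (Com T) (Seq is) = Mor is [0..<length is] (map (Uni T) is)"
 "Tob (Com T) (Seq is) (Seq js) = Seq (is @ js)" "Unit (Com T) = Seq []"
 "Tar (Com T) (Mor is f \<alpha>s) (Mor js g \<beta>s) = Mor (is @ js) (f @ map ((+) (length \<alpha>s)) g) (\<alpha>s @ \<beta>s)"
 "Braid (Com T) (Seq is) (Seq js) =
  Mor (is @ js) ([length js..<length js + length is] @ [0..<length js]) (map (Uni T) (js @ is))"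
 "Assoc (Com T) (Seq is) (Seq js) (Seq ks) = Id (Com T) (Seq (is @ js @ ks))"
 "Lunit (Com T) (Seq is) = Id (Com T) (Seq is)" "Runit (Com T) (Seq is) = Id (Com T) (Seq is)" by (auto simp: Com_def com_data_def Let_def)

lemma Com_Ob: "A \<in> Ob (Com T) \<longleftrightarrow> (\<exists>is. A = Seq is & set is <= Col T)" by (auto simp: Com_def)

lemma concat_map_concat: "concat (map F (concat (map G xs))) = concat (map (%x. concat (map F (G x))) xs)" by (induction xs) simp_all

locale univ_operad = operad T for T :: "('u univ, 'u univ) operad"
begin

lemma com_data_nth:
 assumes "com_data T is f \<alpha>s"
 shows "length f = length is" "k < length \<alpha>s ==> \<alpha>s ! k \<in> Ops T" "k < length \<alpha>s ==> Src T (\<alpha>s ! k) = map ((!) is) (fibre f k)"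
  "set f <= {..<length \<alpha>s}" "l < length is ==> f ! l < length \<alpha>s" "set is <= Col T" "set \<alpha>s <= Ops T" "set (map (Tgt T) \<alpha>s) <= Col T"
proof -
 show "length f = length is" "k < length \<alpha>s ==> \<alpha>s ! k \<in> Ops T" "k < length \<alpha>s ==> Src T (\<alpha>s ! k) = map ((!) is) (fibre f k)"
  "set f <= {..<length \<alpha>s}" "set is <= Col T" "set \<alpha>s <= Ops T" using assms by (auto simp: com_data_def)
 then show "l < length is ==> f ! l < length \<alpha>s" "set (map (Tgt T) \<alpha>s) <= Col T" by (auto simp: subset_iff)
qed

lemma Com_composable:
 assumes x: "com_data T is f \<alpha>s" and y: "com_data T (map (Tgt T) \<alpha>s) g \<beta>s" and r: "r < length \<beta>s"
 shows "composable T (\<beta>s ! r) (map ((!) \<alpha>s) (fibre g r))"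
  "Src T (Mul T (\<beta>s ! r) (map ((!) \<alpha>s) (fibre g r))) = map ((!) is) (concat (map (fibre f) (fibre g r)))"
  "length (Src T (\<beta>s ! r)) = length (fibre g r)"
proof -
 note x' = com_data_nth[OF x] and y' = com_data_nth[OF y]
 have l: "s < length \<alpha>s" if "s \<in> set (fibre g r)" for s using that y'(1) by simp
 show c: "composable T (\<beta>s ! r) (map ((!) \<alpha>s) (fibre g r))" unfolding composable_def y'(3)[OF r] using y'(2)[OF r] l x'(2) by auto
 have "map (Src T) (map ((!) \<alpha>s) (fibre g r)) = map (%s. map ((!) is) (fibre f s)) (fibre g r)" using l x'(3) by auto
 then show "Src T (Mul T (\<beta>s ! r) (map ((!) \<alpha>s) (fibre g r))) = map ((!) is) (concat (map (fibre f) (fibre g r)))"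
  unfolding Src_Mul[OF c] \<open>map (Src T) _ = _\<close> by (simp add: map_concat comp_def)
 show "length (Src T (\<beta>s ! r)) = length (fibre g r)" by (simp add: y'(3)[OF r])
qed

lemma com_op_simps:
 assumes x: "com_data T is f \<alpha>s" and y: "com_data T (map (Tgt T) \<alpha>s) g \<beta>s" and r: "r < length \<beta>s"
 shows "com_op T f \<alpha>s g \<beta>s r \<in> Ops T" "Src T (com_op T f \<alpha>s g \<beta>s r) = map ((!) is) (fibre (map ((!) g) f) r)"
  "Tgt T (com_op T f \<alpha>s g \<beta>s r) = Tgt T (\<beta>s ! r)"
proof -
 note c = Com_composable[OF x y r]
 have "set f <= {..<length g}" using com_data_nth[OF x] com_data_nth[OF y] by simp
 note R = reord_simps[OF Mul_in[OF c(1)] c(2) mset_fibre_comp[OF this] distinct_concat_fibres[OF fibre_simps(2)]]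
 show "com_op T f \<alpha>s g \<beta>s r \<in> Ops T" "Src T (com_op T f \<alpha>s g \<beta>s r) = map ((!) is) (fibre (map ((!) g) f) r)"
  "Tgt T (com_op T f \<alpha>s g \<beta>s r) = Tgt T (\<beta>s ! r)" using R Tgt_Mul[OF c(1)] by (simp_all add: com_op_def)
qed

lemma Com_Comp:
 assumes x: "com_data T is f \<alpha>s" and y: "com_data T (map (Tgt T) \<alpha>s) g \<beta>s"
 shows "Comp (Com T) (Mor js g \<beta>s) (Mor is f \<alpha>s) = Mor is (map ((!) g) f) (map (com_op T f \<alpha>s g \<beta>s) [0..<length \<beta>s])"
  "com_data T is (map ((!) g) f) (map (com_op T f \<alpha>s g \<beta>s) [0..<length \<beta>s])"
  "map (Tgt T) (map (com_op T f \<alpha>s g \<beta>s) [0..<length \<beta>s]) = map (Tgt T) \<beta>s"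
proof -
 note x' = com_data_nth[OF x] and y' = com_data_nth[OF y] and o = com_op_simps[OF x y]
 have "set f <= {..<length g}" using x' y' by simp
 note F = fibre_comp[OF this]
 show "Comp (Com T) (Mor js g \<beta>s) (Mor is f \<alpha>s) = Mor is (map ((!) g) f) (map (com_op T f \<alpha>s g \<beta>s) [0..<length \<beta>s])"
  by (simp add: Com_def com_op_def reord_def sorting_perm_relabel F)
 have "g ! s < length \<beta>s" if "s \<in> set f" for s using that x'(4) y'(1,5) by auto
 then show "com_data T is (map ((!) g) f) (map (com_op T f \<alpha>s g \<beta>s) [0..<length \<beta>s])" using x' o unfolding com_data_def by auto
 show "map (Tgt T) (map (com_op T f \<alpha>s g \<beta>s) [0..<length \<beta>s]) = map (Tgt T) \<beta>s" using o by (intro nth_equalityI) simp_all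
qed

text \<open>Both sides are one reordering of the same threefold product \<open>?N\<close>, from the
  order \<open>?X\<close> in which substitution leaves its inputs to the fibre of the triple
  composite.\<close>

lemma com_assoc:
 assumes x: "com_data T is f \<alpha>s" and y: "com_data T (map (Tgt T) \<alpha>s) g \<beta>s" and z: "com_data T (map (Tgt T) \<beta>s) h \<gamma>s"
  and r: "r < length \<gamma>s" shows "com_op T f \<alpha>s (map ((!) h) g) (map (com_op T g \<beta>s h \<gamma>s) [0..<length \<gamma>s]) r
  = com_op T (map ((!) g) f) (map (com_op T f \<alpha>s g \<beta>s) [0..<length \<beta>s]) h \<gamma>s r"
proof -
 note x' = com_data_nth[OF x] and y' = com_data_nth[OF y] and z' = com_data_nth[OF z]
 have fg: "set f <= {..<length g}" and gh: "set g <= {..<length h}" using x' y' z' by simp_all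
 then have "g ! s < length h" if "s \<in> set f" for s using that nth_mem by blast
 then have fgh: "set (map ((!) g) f) <= {..<length h}" and fgh': "set f <= {..<length (map ((!) h) g)}" using fg by auto
 have hgf: "map ((!) (map ((!) h) g)) f = map ((!) h) (map ((!) g) f)" using fg by auto
 let ?hg = "fibre (map ((!) h) g) r" and ?G = "concat (map (fibre g) (fibre h r))" and ?hgf = "fibre (map ((!) h) (map ((!) g) f)) r"
 let ?X = "concat (map (fibre f) ?G)"
 have X: "?X = concat (map (%s. concat (map (fibre f) (fibre g s))) (fibre h r))" by (rule concat_map_concat)
 have mG: "mset ?hg = mset ?G" by (rule mset_fibre_comp[OF gh])
 have dG: "distinct ?G" and dX: "distinct ?X" by (simp_all add: distinct_concat_fibres)
 have m1: "mset (concat (map (fibre f) ?hg)) = mset ?X" by (rule mset_concat_map[OF mG])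
 have m2: "mset ?hgf = mset (concat (map (fibre f) ?hg))" using mset_fibre_comp[OF fgh'] unfolding hgf .
 have c1: "composable T (\<gamma>s ! r) (map ((!) \<beta>s) (fibre h r))" by (rule Com_composable[OF y z r])
 let ?M = "Mul T (\<gamma>s ! r) (map ((!) \<beta>s) (fibre h r))"
 have sM: "Src T ?M = map ((!) (map (Tgt T) \<alpha>s)) ?G" by (rule Com_composable[OF y z r])
 have G: "k < length \<alpha>s" if "k \<in> set ?G" for k using that y'(1) by auto
 have c2: "composable T ?M (map ((!) \<alpha>s) ?G)" unfolding composable_def sM using G x'(2) Mul_in[OF c1] by auto
 have h: "s < length \<beta>s" if "s \<in> set (fibre h r)" for s using that z'(1) by simp
 have l2: "list_all2 (composable T) (map ((!) \<beta>s) (fibre h r)) (map (%s. map ((!) \<alpha>s) (fibre g s)) (fibre h r))"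
  using Com_composable(1)[OF x y] h by (simp add: list_all2_map1 list_all2_map2 list_all2_same)
 let ?N = "Mul T ?M (map ((!) \<alpha>s) ?G)"
 have N: "?N = Mul T (\<gamma>s ! r) (map (%s. Mul T (\<beta>s ! s) (map ((!) \<alpha>s) (fibre g s))) (fibre h r))"
  using Mul_assoc[OF c1 l2] unfolding map2_map_map by (simp add: map_concat comp_def)
 have sN: "length (Src T ?N) = length ?X"
 proof -
  have "map (Src T) (map ((!) \<alpha>s) ?G) = map (%s. map ((!) is) (fibre f s)) ?G" using G x'(3) by auto
  then show ?thesis unfolding Src_Mul[OF c2] by (simp only: length_concat map_map comp_def length_map)
 qed
 \<comment> \<open>In this bracketing the inner sorting acts on the operation into which the
   \<open>\<alpha>\<close>s are substituted, so outer equivariance is needed.\<close>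
 have "com_op T f \<alpha>s (map ((!) h) g) (map (com_op T g \<beta>s h \<gamma>s) [0..<length \<gamma>s]) r
  = reord T (concat (map (fibre f) ?hg)) ?hgf (Mul T (reord T ?G ?hg ?M) (map ((!) \<alpha>s) ?hg))" using r unfolding com_op_def hgf by simp
 also have "Mul T (reord T ?G ?hg ?M) (map ((!) \<alpha>s) ?hg) = reord T ?X (concat (map (fibre f) ?hg)) ?N"
  using G x'(3) by (intro Mul_reord_outer[OF c2 mG dG dX]) simp
 also have "reord T (concat (map (fibre f) ?hg)) ?hgf ... = reord T ?X ?hgf ?N" by (rule reord_reord[OF Mul_in[OF c2] sN m1 m2 dX])
 finally have L: "com_op T f \<alpha>s (map ((!) h) g) (map (com_op T g \<beta>s h \<gamma>s) [0..<length \<gamma>s]) r = reord T ?X ?hgf ?N" .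
 let ?L = "%s. fibre (map ((!) g) f) s" and ?K = "%s. concat (map (fibre f) (fibre g s))"
 let ?A = "%s. Mul T (\<beta>s ! s) (map ((!) \<alpha>s) (fibre g s))"
 have c3: "composable T (\<gamma>s ! r) (map ?A (fibre h r))"
 proof -
  have "set (map ?A (fibre h r)) <= Ops T" using h Mul_in[OF Com_composable(1)[OF x y]] by auto
  moreover have "map (Tgt T) (map ?A (fibre h r)) = map (Tgt T) (map ((!) \<beta>s) (fibre h r))" using h Tgt_Mul[OF Com_composable(1)[OF x y]] by auto
  ultimately show ?thesis using c1 unfolding composable_def by metis
 qed
 have o: "map ((!) (map (com_op T f \<alpha>s g \<beta>s) [0..<length \<beta>s])) (fibre h r) = map (%s. reord T (?K s) (?L s) (?A s)) (fibre h r)"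
  using h by (auto simp: com_op_def)
 \<comment> \<open>In this bracketing the operations being substituted have been sorted, so inner
   equivariance is needed.\<close>
 have "com_op T (map ((!) g) f) (map (com_op T f \<alpha>s g \<beta>s) [0..<length \<beta>s]) h \<gamma>s r
  = reord T (concat (map ?L (fibre h r))) ?hgf (Mul T (\<gamma>s ! r) (map (%s. reord T (?K s) (?L s) (?A s)) (fibre h r)))"
  unfolding com_op_def[of T _ _ h] o ..
 also have "Mul T (\<gamma>s ! r) (map (%s. reord T (?K s) (?L s) (?A s)) (fibre h r)) = reord T (concat (map ?K (fibre h r))) (concat (map ?L (fibre h r))) (Mul T (\<gamma>s ! r) (map ?A (fibre h r)))"
  using dX mset_fibre_comp[OF fg] Com_composable(2)[OF x y] h unfolding X by (intro Mul_reord_inner[OF c3]) auto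
 also have "reord T (concat (map ?L (fibre h r))) ?hgf ... = reord T (concat (map ?K (fibre h r))) ?hgf (Mul T (\<gamma>s ! r) (map ?A (fibre h r)))"
 proof (rule reord_reord[OF Mul_in[OF c3]])
  show "length (Src T (Mul T (\<gamma>s ! r) (map ?A (fibre h r)))) = length (concat (map ?K (fibre h r)))" using sN unfolding N X .
  show "mset (concat (map ?L (fibre h r))) = mset (concat (map ?K (fibre h r)))" using mset_fibre_comp[OF fg] by (intro mset_concat_cong) simp
  show "mset ?hgf = mset (concat (map ?L (fibre h r)))" by (rule mset_fibre_comp[OF fgh])
  show "distinct (concat (map ?K (fibre h r)))" using dX unfolding X .
 qed
 finally show ?thesis unfolding L X N ..
qed

section \<open>Permutation arrows of \<open>Com T\<close>\<close>

lemma perm_data_fibre: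
 assumes "perm_data T is p q js" "k < length js" shows "fibre p k = [q ! k]" using assms by (intro fibre_eqI) (auto simp: perm_data_def)

lemma perm_data_com:
 assumes "perm_data T is p q js" shows "com_data T is p (map (Uni T) js)" "map (Tgt T) (map (Uni T) js) = js"
proof -
 have [simp]: "Src T (Uni T (js ! k)) = [js ! k]" if "k < length js" for k using assms that by (intro Src_Uni) (auto simp: perm_data_def)
 have "is ! l \<in> Col T" if "l < length is" for l using assms that nth_mem unfolding perm_data_def by (metis subsetD)
 then have "set p <= {..<length js}" "set is <= Col T" using assms by (auto simp: perm_data_def in_set_conv_nth)
 then show "com_data T is p (map (Uni T) js)" using assms perm_data_fibre[OF assms] by (auto simp: com_data_def perm_data_def subset_iff)
 show "map (Tgt T) (map (Uni T) js) = js" using assms by (auto simp: perm_data_def subset_iff intro!: map_idI)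
qed

text \<open>The permutation has singleton fibres and units as operations, so composing with it
  afterwards only rearranges the list of operations, by the inverse \<open>q\<close>.\<close>

lemma perm_Comp:
 assumes x: "com_data T is f \<alpha>s" and p: "perm_data T (map (Tgt T) \<alpha>s) p q js"
 shows "Comp (Com T) (Mor (map (Tgt T) \<alpha>s) p (map (Uni T) js)) (Mor is f \<alpha>s) = Mor is (map ((!) p) f) (map ((!) \<alpha>s) q)"
proof -
 note x' = com_data_nth[OF x] and y = perm_data_com[OF p]
 have p': "length p = length \<alpha>s" "length q = length js" "\<And>l. l < length \<alpha>s ==> p ! l < length js & q ! (p ! l) = l & Tgt T (\<alpha>s ! l) = js ! (p ! l)"
  "\<And>k. k < length js ==> q ! k < length \<alpha>s & p ! (q ! k) = k" using p by (auto simp: perm_data_def)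
 have "com_op T f \<alpha>s p (map (Uni T) js) r = \<alpha>s ! (q ! r)" if r: "r < length js" for r
 proof -
  have q: "q ! r < length \<alpha>s" "Tgt T (\<alpha>s ! (q ! r)) = js ! r" using p'(3)[of "q ! r"] p'(4)[OF r] by simp_all
  have "set f <= {..<length p}" using x' p' by simp
  from mset_eq_setD[OF mset_fibre_comp[OF this, of r]]
  have "set (fibre (map ((!) p) f) r) = set (fibre f (q ! r))" unfolding perm_data_fibre[OF p r] by (simp del: fibre_simps(1))
  then have "fibre (map ((!) p) f) r = fibre f (q ! r)" by (rule sorted_distinct_set_unique[OF fibre_simps(3,2) fibre_simps(3,2)])
  then show ?thesis using Mul_Uni_left[OF x'(2)[OF q(1)]] r q x'(2)[OF q(1)] by (simp add: com_op_def perm_data_fibre[OF p r] reord_refl)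
 qed
 then show ?thesis unfolding Com_Comp(1)[OF x y(1)] using p' by (auto intro!: nth_equalityI)
qed

text \<open>Substituting units changes no operation. What remains is the sorting of inputs after
  their positions have been pulled back along \<open>q\<close>.\<close>

lemma com_op_perm:
 assumes p: "perm_data T is p q js" and y: "com_data T js g \<beta>s" and r: "r < length \<beta>s"
 shows "com_op T p (map (Uni T) js) g \<beta>s r = reord T (map ((!) q) (fibre g r)) (fibre (map ((!) g) p) r) (\<beta>s ! r)"
  "distinct (map ((!) q) (fibre g r))" "fibre (map ((!) g) p) r = sort (map ((!) q) (fibre g r))"
proof -
 note x = perm_data_com[OF p] and y' = com_data_nth[OF y]
 have p': "length p = length is" "\<And>l. l < length is ==> p ! l < length js" using p by (auto simp: perm_data_def)
 have l: "k < length js" if "k \<in> set (fibre g r)" for k using that y'(1) by simp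
 have m: "map (fibre p) (fibre g r) = map (%k. [q ! k]) (fibre g r)" using l perm_data_fibre[OF p] by auto
 have c: "concat (map (fibre p) (fibre g r)) = map ((!) q) (fibre g r)" unfolding m by (rule concat_map_singleton)
 have "set p <= {..<length g}" using p' y'(1) by (auto simp: in_set_conv_nth)
 from fibre_comp[OF this, of r] show "fibre (map ((!) g) p) r = sort (map ((!) q) (fibre g r))" unfolding c by simp
 have "distinct (concat (map (fibre p) (fibre g r)))" by (rule distinct_concat_fibres) simp
 then show "distinct (map ((!) q) (fibre g r))" unfolding c .
 have "map ((!) (map (Uni T) js)) (fibre g r) = map (Uni T) (Src T (\<beta>s ! r))" using l unfolding y'(3)[OF r] by auto
 then show "com_op T p (map (Uni T) js) g \<beta>s r = reord T (map ((!) q) (fibre g r)) (fibre (map ((!) g) p) r) (\<beta>s ! r)"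
  using y'(2)[OF r] unfolding com_op_def c by (simp add: Mul_Uni_right)
qed

text \<open>If \<open>q\<close> is increasing on every fibre, the inputs of each operation are
  already in order and no symmetric group action remains.\<close>

lemma Comp_perm:
 assumes p: "perm_data T is p q js" and y: "com_data T js g \<beta>s" and s: "\<And>r. r < length \<beta>s ==> sorted (map ((!) q) (fibre g r))"
 shows "Comp (Com T) (Mor js g \<beta>s) (Mor is p (map (Uni T) js)) = Mor is (map ((!) g) p) \<beta>s"
proof -
 note x = perm_data_com[OF p] and y' = com_data_nth[OF y]
 have y2: "com_data T (map (Tgt T) (map (Uni T) js)) g \<beta>s" using y unfolding x(2) .
 have "com_op T p (map (Uni T) js) g \<beta>s r = \<beta>s ! r" if r: "r < length \<beta>s" for r
  using com_op_perm[OF p y r] s[OF r] y'(2)[OF r] by (simp add: sorted_sort_id reord_refl)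
 then show ?thesis unfolding Com_Comp(1)[OF x(1) y2] by (auto intro!: nth_equalityI)
qed

lemma perm_data_Unis:
 "perm_data T is p q js ==> map ((!) (map (Uni T) is)) q = map (Uni T) js" by (intro nth_equalityI) (auto simp: perm_data_def)


section \<open>Tensor product and symmetry of \<open>Com T\<close>\<close>

lemma com_data_Tar:
 assumes x: "com_data T is f \<alpha>s" and x': "com_data T is' f' \<alpha>s'"
 shows "com_data T (is @ is') (f @ map ((+) (length \<alpha>s)) f') (\<alpha>s @ \<alpha>s')"
proof -
 note x1 = com_data_nth[OF x] and x2 = com_data_nth[OF x']
 have "Src T ((\<alpha>s @ \<alpha>s') ! k) = map ((!) (is @ is')) (fibre (f @ map ((+) (length \<alpha>s)) f') k)" if "k < length (\<alpha>s @ \<alpha>s')" for k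
  using that x1 x2 by (auto simp: fibre_append[OF x1(4)] nth_append)
 then show ?thesis using x1 x2 unfolding com_data_def by auto
qed

text \<open>Operations of the first factor see none of the second. Those of the second see their
  labels shifted, to which relabelling permutations are insensitive by
  \<open>relabel_map\<close>.\<close>

lemma com_op_Tar:
 assumes x: "com_data T is f \<alpha>s" and y: "com_data T (map (Tgt T) \<alpha>s) g \<beta>s"
  and x': "com_data T is' f' \<alpha>s'" and y': "com_data T (map (Tgt T) \<alpha>s') g' \<beta>s'" and r: "r < length \<beta>s + length \<beta>s'"
 shows "com_op T (f @ map ((+) (length \<alpha>s)) f') (\<alpha>s @ \<alpha>s') (g @ map ((+) (length \<beta>s)) g') (\<beta>s @ \<beta>s') r
  = (if r < length \<beta>s then com_op T f \<alpha>s g \<beta>s r else com_op T f' \<alpha>s' g' \<beta>s' (r - length \<beta>s))"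
  and "map ((!) (g @ map ((+) (length \<beta>s)) g')) (f @ map ((+) (length \<alpha>s)) f') = map ((!) g) f @ map ((+) (length \<beta>s)) (map ((!) g') f')"
proof -
 note x1 = com_data_nth[OF x] and x2 = com_data_nth[OF x'] and y1 = com_data_nth[OF y] and y2 = com_data_nth[OF y']
 let ?f = "f @ map ((+) (length \<alpha>s)) f'" and ?g = "g @ map ((+) (length \<beta>s)) g'"
 have "?g ! l = g ! l" if "l \<in> set f" for l using that x1(4) y1(1) by (auto simp: nth_append)
 moreover have "?g ! (length \<alpha>s + l) = length \<beta>s + g' ! l" if "l \<in> set f'" for l using that x2(4) y1(1) y2(1) by (auto simp: nth_append)
 ultimately show gf: "map ((!) ?g) ?f = map ((!) g) f @ map ((+) (length \<beta>s)) (map ((!) g') f')" by simp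
 have "g ! l < length \<beta>s" if "l \<in> set f" for l using that x1(4) y1(5) by auto
 then have "set (map ((!) g) f) <= {..<length \<beta>s}" by auto
 note F = fibre_append[OF x1(4)] fibre_append[OF y1(4)] fibre_append[OF this]
 show "com_op T ?f (\<alpha>s @ \<alpha>s') ?g (\<beta>s @ \<beta>s') r = (if r < length \<beta>s then com_op T f \<alpha>s g \<beta>s r else com_op T f' \<alpha>s' g' \<beta>s' (r - length \<beta>s))"
 proof (cases "r < length \<beta>s")
  case True
  have l: "s < length \<alpha>s" if "s \<in> set (fibre g r)" for s using that y1(1) by simp
  have e: "map (fibre ?f) (fibre g r) = map (fibre f) (fibre g r)" "map ((!) (\<alpha>s @ \<alpha>s')) (fibre g r) = map ((!) \<alpha>s) (fibre g r)"
   using l by (auto simp: F(1) nth_append)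
  show ?thesis using True unfolding com_op_def gf F(2,3) by (simp add: nth_append e)
 next
  case False
  let ?r = "r - length \<beta>s"
  have e: "map (fibre ?f) (map ((+) (length g)) (fibre g' ?r)) = map (map ((+) (length f))) (map (fibre f') (fibre g' ?r))"
   "map ((!) (\<alpha>s @ \<alpha>s')) (map ((+) (length g)) (fibre g' ?r)) = map ((!) \<alpha>s') (fibre g' ?r)" using y1(1) by (auto simp: F(1) nth_append)
  have "set f' <= {..<length g'}" using x2(4) y2(1) by simp
  note R = relabel_map[OF mset_fibre_comp[OF this, of ?r], of "(+) (length f)"]
  have "relabel (map ((+) (length f)) (concat (map (fibre f') (fibre g' ?r)))) (map ((+) (length f)) (fibre (map ((!) g') f') ?r))
   = relabel (concat (map (fibre f') (fibre g' ?r))) (fibre (map ((!) g') f') ?r)" by (rule R) (simp add: distinct_map distinct_concat_fibres)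
  then show ?thesis using False unfolding com_op_def gf F(2,3) reord_def by (simp add: nth_append e del: map_map) (simp add: map_concat)
 qed
qed

lemma com_data_Id: "set is <= Col T ==> com_data T is [0..<length is] (map (Uni T) is)"
 using perm_data_com(1)[of "is" "[0..<length is]" "[0..<length is]" "is"] by (simp add: perm_data_def)

lemma Tgt_Unis [simp]: "set is <= Col T ==> map (Tgt T \<circ> Uni T) is = is" by (auto simp: subset_iff intro!: map_idI)

lemma perm_data_Id: "set is <= Col T ==> perm_data T is [0..<length is] [0..<length is] is" by (simp add: perm_data_def)

lemma perm_data_Braid:
 assumes "set is <= Col T" "set js <= Col T"
 shows "perm_data T (is @ js) ([length js..<length js + length is] @ [0..<length js]) ([length is..<length is + length js] @ [0..<length is]) (js @ is)"
 using assms unfolding perm_data_def by (auto simp: nth_append)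

lemma perm_data_append:
 assumes "perm_data T is p q js" "perm_data T is' p' q' js'"
 shows "perm_data T (is @ is') (p @ map ((+) (length js)) p') (q @ map ((+) (length is)) q') (js @ js')"
 using assms unfolding perm_data_def by (auto simp: nth_append)

lemma Com_category: "category (Com T)" proof (rule category.intro)
 fix x assume "x \<in> Ar (Com T)"
 then show "Dom (Com T) x \<in> Ob (Com T)" "Cod (Com T) x \<in> Ob (Com T)" using com_data_nth(6,8) by (auto simp: Com_Ar)
next
 fix A assume "A \<in> Ob (Com T)"
 then show "Id (Com T) A \<in> Hom (Com T) A A" using com_data_Id by (auto simp: Com_Ob Hom_iff)
next
 fix x y A B D assume "x \<in> Hom (Com T) A B" "y \<in> Hom (Com T) B D"
 then show "y \<cdot>\<^bsub>Com T\<^esub> x \<in> Hom (Com T) A D" using Com_Comp by (auto simp: Hom_iff Com_Ar simp del: map_map)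
next
 fix x A B assume x: "x \<in> Hom (Com T) A B"
 then obtain "is" f \<alpha>s where e: "x = Mor is f \<alpha>s" "com_data T is f \<alpha>s" "A = Seq is" "B = Seq (map (Tgt T) \<alpha>s)"
  by (auto simp: Hom_iff Com_Ar)
 note x' = com_data_nth[OF e(2)]
 have "sorted (map ((!) [0..<length is]) (fibre f r))" for r
 proof -
  have "map ((!) [0..<length is]) (fibre f r) = fibre f r" using x'(1) by (intro map_idI) simp
  then show ?thesis by (simp del: fibre_simps(1))
 qed
 moreover have "map ((!) f) [0..<length is] = f" using x'(1) by (intro nth_equalityI) simp_all
 ultimately show "x \<cdot>\<^bsub>Com T\<^esub> Id (Com T) A = x" using Comp_perm[OF perm_data_Id[OF x'(6)] e(2)] unfolding e by simp
 have "map ((!) [0..<length \<alpha>s]) f = f" using x'(4) by (intro map_idI) (auto simp: subset_iff)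
 then show "Id (Com T) B \<cdot>\<^bsub>Com T\<^esub> x = x" using perm_Comp[OF e(2) perm_data_Id[OF x'(8)]] unfolding e by (simp add: map_nth)
next
 fix x y z A B D E assume "x \<in> Hom (Com T) A B" "y \<in> Hom (Com T) B D" "z \<in> Hom (Com T) D E"
 then obtain "is" f \<alpha>s g \<beta>s h \<gamma>s where e: "x = Mor is f \<alpha>s" "y = Mor (map (Tgt T) \<alpha>s) g \<beta>s" "z = Mor (map (Tgt T) \<beta>s) h \<gamma>s"
   and x: "com_data T is f \<alpha>s" and y: "com_data T (map (Tgt T) \<alpha>s) g \<beta>s" and z: "com_data T (map (Tgt T) \<beta>s) h \<gamma>s"
  by (auto simp: Hom_iff Com_Ar)
 note zy = Com_Comp[OF y z] and yx = Com_Comp[OF x y]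
 have f: "map ((!) (map ((!) h) g)) f = map ((!) h) (map ((!) g) f)" using com_data_nth(4)[OF x] com_data_nth(1)[OF y] by auto
 show "z \<cdot>\<^bsub>Com T\<^esub> y \<cdot>\<^bsub>Com T\<^esub> x = z \<cdot>\<^bsub>Com T\<^esub> (y \<cdot>\<^bsub>Com T\<^esub> x)"
  unfolding e zy(1) yx(1) Com_Comp(1)[OF x zy(2)] Com_Comp(1)[OF yx(2) z[folded yx(3)]] f using com_assoc[OF x y z] by simp
qed

lemma Com_Tar_Id: "[|set is <= Col T; set js <= Col T|] ==> Id (Com T) (Seq is) \<boxtimes>\<^bsub>Com T\<^esub> Id (Com T) (Seq js) = Id (Com T) (Seq (is @ js))"
 by (auto simp: map_add_upt upt_add_eq_append[of 0 "length is" "length js", simplified] intro!: nth_equalityI simp: nth_append)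

lemma Com_Tar_Comp:
 assumes x: "com_data T is f \<alpha>s" and y: "com_data T (map (Tgt T) \<alpha>s) g \<beta>s"
  and x': "com_data T is' f' \<alpha>s'" and y': "com_data T (map (Tgt T) \<alpha>s') g' \<beta>s'"
 shows "(Mor js g \<beta>s \<cdot>\<^bsub>Com T\<^esub> Mor is f \<alpha>s) \<boxtimes>\<^bsub>Com T\<^esub> (Mor js' g' \<beta>s' \<cdot>\<^bsub>Com T\<^esub> Mor is' f' \<alpha>s')
  = (Mor js g \<beta>s \<boxtimes>\<^bsub>Com T\<^esub> Mor js' g' \<beta>s') \<cdot>\<^bsub>Com T\<^esub> (Mor is f \<alpha>s \<boxtimes>\<^bsub>Com T\<^esub> Mor is' f' \<alpha>s')"
proof -
 note t = com_data_Tar[OF x x'] com_data_Tar[OF y y']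
 have ops: "map (com_op T (f @ map ((+) (length \<alpha>s)) f') (\<alpha>s @ \<alpha>s') (g @ map ((+) (length \<beta>s)) g') (\<beta>s @ \<beta>s')) [0..<length (\<beta>s @ \<beta>s')]
  = map (com_op T f \<alpha>s g \<beta>s) [0..<length \<beta>s] @ map (com_op T f' \<alpha>s' g' \<beta>s') [0..<length \<beta>s']"
  using com_op_Tar(1)[OF x y x' y'] by (intro nth_equalityI) (simp_all add: nth_append)
 show ?thesis unfolding Com_Comp(1)[OF x y] Com_Comp(1)[OF x' y'] Com_simps Com_Comp(1)[OF t(1) t(2)[folded map_append]] ops com_op_Tar(2)[OF x y x' y', of 0]
  \<comment> \<open>The law for the underlying functions was stated under a bound on
    \<open>r\<close>, so \<open>r = 0\<close> requires a nonempty target. An empty target forces all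
    the functions and lists of operations to be empty.\<close>
  using com_op_Tar(2)[OF x y x' y', of 0] by (cases "\<beta>s @ \<beta>s' = []") (use x y x' y' in \<open>auto simp: com_data_def\<close>)
qed

text \<open>The composite with the symmetry last is computed by \<open>perm_Comp\<close>, the one
  with the symmetry first by \<open>Comp_perm\<close>, and both give the same data.\<close>

lemma Com_Braid_natural:
 assumes x: "com_data T is f \<alpha>s" and x': "com_data T is' f' \<alpha>s'"
 shows "Braid (Com T) (Seq (map (Tgt T) \<alpha>s)) (Seq (map (Tgt T) \<alpha>s')) \<cdot>\<^bsub>Com T\<^esub> (Mor is f \<alpha>s \<boxtimes>\<^bsub>Com T\<^esub> Mor is' f' \<alpha>s')
  = (Mor is' f' \<alpha>s' \<boxtimes>\<^bsub>Com T\<^esub> Mor is f \<alpha>s) \<cdot>\<^bsub>Com T\<^esub> Braid (Com T) (Seq is) (Seq is')"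
proof -
 note x1 = com_data_nth[OF x] and x2 = com_data_nth[OF x']
 note t = com_data_Tar[OF x x'] com_data_Tar[OF x' x]
 let ?p = "[length is'..<length is' + length is] @ [0..<length is']" and ?q = "[length is..<length is + length is'] @ [0..<length is]"
 let ?P = "[length \<alpha>s'..<length \<alpha>s' + length \<alpha>s] @ [0..<length \<alpha>s']" and ?Q = "[length \<alpha>s..<length \<alpha>s + length \<alpha>s'] @ [0..<length \<alpha>s]"
 let ?F = "f @ map ((+) (length \<alpha>s)) f'" and ?G = "f' @ map ((+) (length \<alpha>s')) f"
 have P: "perm_data T (map (Tgt T) (\<alpha>s @ \<alpha>s')) ?P ?Q (map (Tgt T) \<alpha>s' @ map (Tgt T) \<alpha>s)"
  using perm_data_Braid[OF x1(8) x2(8)] by simp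
 note p = perm_data_Braid[OF x1(6) x2(6)]
 \<comment> \<open>A block exchange is increasing on each block, and every fibre of the tensor
   product lies in one block.\<close>
 have s: "sorted (map ((!) ?q) (fibre ?G r))" if "r < length (\<alpha>s' @ \<alpha>s)" for r proof (cases "r < length \<alpha>s'")
  case True
  have "map ((!) ?q) (fibre f' r) = map ((+) (length is)) (fibre f' r)" using x2(1) by (auto simp: nth_append)
  then show ?thesis using True by (simp add: fibre_append[OF x2(4)] sorted_map del: fibre_simps(1)) (rule sorted_wrt_mono_rel[OF _ fibre_simps(3)], simp)
 next
  case False
  have "map ((!) ?q) (map ((+) (length f')) (fibre f (r - length \<alpha>s'))) = fibre f (r - length \<alpha>s')"
   using x2(1) x1(1) by (auto simp: nth_append intro!: map_idI)
  then show ?thesis using False fibre_simps(3) by (simp add: fibre_append[OF x2(4)] del: fibre_simps(1) map_map)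
 qed
 have fs: "map ((!) ?P) ?F = map ((!) ?G) ?p" using x1 x2 by (intro nth_equalityI) (auto simp: nth_append)
 have os: "map ((!) (\<alpha>s @ \<alpha>s')) ?Q = \<alpha>s' @ \<alpha>s" by (intro nth_equalityI) (auto simp: nth_append)
 have "Braid (Com T) (Seq (map (Tgt T) \<alpha>s)) (Seq (map (Tgt T) \<alpha>s')) \<cdot>\<^bsub>Com T\<^esub> (Mor is f \<alpha>s \<boxtimes>\<^bsub>Com T\<^esub> Mor is' f' \<alpha>s')
  = Mor (is @ is') (map ((!) ?P) ?F) (map ((!) (\<alpha>s @ \<alpha>s')) ?Q)" using perm_Comp[OF t(1) P] by simp
 also have "... = (Mor is' f' \<alpha>s' \<boxtimes>\<^bsub>Com T\<^esub> Mor is f \<alpha>s) \<cdot>\<^bsub>Com T\<^esub> Braid (Com T) (Seq is) (Seq is')"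
  using Comp_perm[OF p t(2) s] unfolding fs os by simp
 finally show ?thesis .
qed

text \<open>For composites of permutation arrows, here and in the hexagon, \<open>perm_Comp\<close>
  leaves only equations between lists of values.\<close>

lemma Com_Braid_Braid:
 assumes "set is <= Col T" "set js <= Col T"
 shows "Braid (Com T) (Seq js) (Seq is) \<cdot>\<^bsub>Com T\<^esub> Braid (Com T) (Seq is) (Seq js) = Id (Com T) (Seq (is @ js))"
proof -
 note p = perm_data_Braid[OF assms] and q = perm_data_Braid[OF assms(2,1)]
 note c = perm_data_com[OF p]
 let ?p = "%is js. [length js..<length js + length is] @ [0..<length js]"
 have f: "map ((!) (?p js is)) (?p is js) = [0..<length (is @ js)]" by (intro nth_equalityI) (auto simp: nth_append)
 have o: "map ((!) (map (Uni T) (js @ is))) (?p is js) = map (Uni T) (is @ js)" by (intro nth_equalityI) (auto simp: nth_append)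
 show ?thesis using perm_Comp[OF c(1), of "?p js is" "?p is js" "is @ js"] q unfolding c(2) f o Com_simps(5,9) by simp
qed

lemma Com_hexagon:
 assumes "set is <= Col T" "set js <= Col T" "set ks <= Col T"
 shows "(Id (Com T) (Seq js) \<boxtimes>\<^bsub>Com T\<^esub> Braid (Com T) (Seq is) (Seq ks)) \<cdot>\<^bsub>Com T\<^esub> (Braid (Com T) (Seq is) (Seq js) \<boxtimes>\<^bsub>Com T\<^esub> Id (Com T) (Seq ks))
  = Braid (Com T) (Seq is) (Seq (js @ ks))"
proof -
 note p = perm_data_append[OF perm_data_Braid[OF assms(1,2)] perm_data_Id[OF assms(3)]]
  and q = perm_data_append[OF perm_data_Id[OF assms(2)] perm_data_Braid[OF assms(1,3)]]
 note c = perm_data_com[OF p]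
 have a: "(js @ is) @ ks = js @ is @ ks" by simp
 let ?p = "%is js. [length js..<length js + length is] @ [0..<length js]"
 let ?P = "?p is js @ map ((+) (length (js @ is))) [0..<length ks]" and ?Q = "[0..<length js] @ map ((+) (length js)) (?p is ks)"
  and ?R = "[0..<length js] @ map ((+) (length js)) (?p ks is)"
 have f: "map ((!) ?Q) ?P = ?p is (js @ ks)" by (intro nth_equalityI) (auto simp: nth_append)
 have o: "map ((!) (map (Uni T) ((js @ is) @ ks))) ?R = map (Uni T) ((js @ ks) @ is)" by (intro nth_equalityI) (auto simp: nth_append add.commute)
 have e: "Id (Com T) (Seq js) \<boxtimes>\<^bsub>Com T\<^esub> Braid (Com T) (Seq is) (Seq ks) = Mor (js @ is @ ks) ?Q (map (Uni T) (js @ ks @ is))"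
  "Braid (Com T) (Seq is) (Seq js) \<boxtimes>\<^bsub>Com T\<^esub> Id (Com T) (Seq ks) = Mor ((is @ js) @ ks) ?P (map (Uni T) ((js @ is) @ ks))" by simp_all
 show ?thesis using perm_Comp[OF c(1), of ?Q ?R "(js @ ks) @ is"] q unfolding c(2) e f o by simp
qed

lemma Com_strict: "symmetric_strict_monoidal_category (Com T)"
proof -
 interpret C: category "Com T" by (rule Com_category)
 have Iso: "Id (Com T) (Seq is) \<in> Iso (Com T) (Seq is) (Seq is)" if "set is <= Col T" for "is"
  using that C.Id_simps(1)[of "Seq is"] C.is_iso_Id[of "Seq is"] by (simp add: Iso_iff)
 note [simp del] = Com_simps(5)
 have I: "x \<cdot>\<^bsub>Com T\<^esub> Id (Com T) (Dom (Com T) x) = x" "Id (Com T) (Cod (Com T) x) \<cdot>\<^bsub>Com T\<^esub> x = x" if "x \<in> Ar (Com T)" for x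
  using that by simp_all
 show ?thesis proof (intro symmetric_strict_monoidal_category.intro symmetric_strict_monoidal_category_axioms.intro
   symmetric_monoidal_category.intro symmetric_monoidal_category_axioms.intro Com_category)
  fix f g A B A' B' assume "f \<in> Hom (Com T) A B" "g \<in> Hom (Com T) A' B'"
  then show "f \<boxtimes>\<^bsub>Com T\<^esub> g \<in> Hom (Com T) (A \<otimes>\<^bsub>Com T\<^esub> A') (B \<otimes>\<^bsub>Com T\<^esub> B')"
   using com_data_Tar by (auto simp: Hom_iff Com_Ar)
 next
  fix f g f' g' A B C A' B' C'
  assume "f \<in> Hom (Com T) A B" "g \<in> Hom (Com T) B C" "f' \<in> Hom (Com T) A' B'" "g' \<in> Hom (Com T) B' C'"
  then show "(g \<cdot>\<^bsub>Com T\<^esub> f) \<boxtimes>\<^bsub>Com T\<^esub> (g' \<cdot>\<^bsub>Com T\<^esub> f') = (g \<boxtimes>\<^bsub>Com T\<^esub> g') \<cdot>\<^bsub>Com T\<^esub> (f \<boxtimes>\<^bsub>Com T\<^esub> f')"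
   using Com_Tar_Comp by (auto simp: Hom_iff Com_Ar simp del: Com_simps(8))
 next
  fix A B assume "A \<in> Ob (Com T)" "B \<in> Ob (Com T)"
  then show "Braid (Com T) A B \<in> Hom (Com T) (A \<otimes>\<^bsub>Com T\<^esub> B) (B \<otimes>\<^bsub>Com T\<^esub> A)"
   using perm_data_com[OF perm_data_Braid] by (auto simp: Com_Ob Hom_iff)
 next
  fix f g h A A' B B' C C' assume "f \<in> Hom (Com T) A A'" "g \<in> Hom (Com T) B B'" "h \<in> Hom (Com T) C C'"
  then obtain "is" u \<alpha>s js v \<beta>s ks w \<gamma>s where e: "f = Mor is u \<alpha>s" "g = Mor js v \<beta>s" "h = Mor ks w \<gamma>s"
   "A = Seq is" "A' = Seq (map (Tgt T) \<alpha>s)" "B = Seq js" "B' = Seq (map (Tgt T) \<beta>s)" "C = Seq ks" "C' = Seq (map (Tgt T) \<gamma>s)"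
   and d: "com_data T is u \<alpha>s" "com_data T js v \<beta>s" "com_data T ks w \<gamma>s" by (auto simp: Hom_iff Com_Ar)
  have t: "(f \<boxtimes>\<^bsub>Com T\<^esub> g) \<boxtimes>\<^bsub>Com T\<^esub> h = f \<boxtimes>\<^bsub>Com T\<^esub> (g \<boxtimes>\<^bsub>Com T\<^esub> h)"
   unfolding e by (simp add: comp_def add.assoc)
  have "f \<boxtimes>\<^bsub>Com T\<^esub> (g \<boxtimes>\<^bsub>Com T\<^esub> h) \<in> Ar (Com T)" "Dom (Com T) (f \<boxtimes>\<^bsub>Com T\<^esub> (g \<boxtimes>\<^bsub>Com T\<^esub> h)) = Seq (is @ js @ ks)"
   "Cod (Com T) (f \<boxtimes>\<^bsub>Com T\<^esub> (g \<boxtimes>\<^bsub>Com T\<^esub> h)) = Seq (map (Tgt T) \<alpha>s @ map (Tgt T) \<beta>s @ map (Tgt T) \<gamma>s)"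
   using com_data_Tar[OF d(1) com_data_Tar[OF d(2,3)]] unfolding e by simp_all
  from I[OF this(1), unfolded this(2,3)]
  show "Assoc (Com T) A' B' C' \<cdot>\<^bsub>Com T\<^esub> ((f \<boxtimes>\<^bsub>Com T\<^esub> g) \<boxtimes>\<^bsub>Com T\<^esub> h) = (f \<boxtimes>\<^bsub>Com T\<^esub> (g \<boxtimes>\<^bsub>Com T\<^esub> h)) \<cdot>\<^bsub>Com T\<^esub> Assoc (Com T) A B C"
   unfolding t by (simp add: e(4-9))
 next
  fix f A B assume "f \<in> Hom (Com T) A B"
  then obtain "is" u \<alpha>s where e: "f = Mor is u \<alpha>s" "A = Seq is" "B = Seq (map (Tgt T) \<alpha>s)" and d: "com_data T is u \<alpha>s"
   by (auto simp: Hom_iff Com_Ar)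
  have "Id (Com T) (Unit (Com T)) \<boxtimes>\<^bsub>Com T\<^esub> f = f" "f \<boxtimes>\<^bsub>Com T\<^esub> Id (Com T) (Unit (Com T)) = f"
   unfolding e by (simp_all add: Com_simps(5) map_idI)
  moreover have "f \<in> Ar (Com T)" "Dom (Com T) f = Seq is" "Cod (Com T) f = Seq (map (Tgt T) \<alpha>s)" using d by (simp_all add: e)
  note I[OF this(1), unfolded this(2,3)]
  ultimately show "Lunit (Com T) B \<cdot>\<^bsub>Com T\<^esub> (Id (Com T) \<one>\<^bsub>Com T\<^esub> \<boxtimes>\<^bsub>Com T\<^esub> f) = f \<cdot>\<^bsub>Com T\<^esub> Lunit (Com T) A"
   "Runit (Com T) B \<cdot>\<^bsub>Com T\<^esub> (f \<boxtimes>\<^bsub>Com T\<^esub> Id (Com T) \<one>\<^bsub>Com T\<^esub>) = f \<cdot>\<^bsub>Com T\<^esub> Runit (Com T) A"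
   by (simp_all add: e(2,3))
 next
  fix f g A A' B B' assume "f \<in> Hom (Com T) A A'" "g \<in> Hom (Com T) B B'"
  then show "Braid (Com T) A' B' \<cdot>\<^bsub>Com T\<^esub> (f \<boxtimes>\<^bsub>Com T\<^esub> g) = (g \<boxtimes>\<^bsub>Com T\<^esub> f) \<cdot>\<^bsub>Com T\<^esub> Braid (Com T) A B"
   using Com_Braid_natural by (auto simp: Hom_iff Com_Ar simp del: Com_simps(8,9))
 next
  fix A B C assume "A \<in> Ob (Com T)" "B \<in> Ob (Com T)" "C \<in> Ob (Com T)"
  then obtain "is" js ks where e: "A = Seq is" "B = Seq js" "C = Seq ks" "set is <= Col T" "set js <= Col T" "set ks <= Col T"
   by (auto simp: Com_Ob)
  have b: "Braid (Com T) (Seq is) (Seq (js @ ks)) \<in> Ar (Com T)" "Dom (Com T) (Braid (Com T) (Seq is) (Seq (js @ ks))) = Seq (is @ js @ ks)"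
   "Cod (Com T) (Braid (Com T) (Seq is) (Seq (js @ ks))) = Seq (js @ ks @ is)" using perm_data_com[OF perm_data_Braid, of "is" "js @ ks"] e by simp_all
  have c: "Braid (Com T) (Seq is) (Seq js) \<boxtimes>\<^bsub>Com T\<^esub> Id (Com T) (Seq ks) \<in> Ar (Com T)"
   "Cod (Com T) (Braid (Com T) (Seq is) (Seq js) \<boxtimes>\<^bsub>Com T\<^esub> Id (Com T) (Seq ks)) = Seq (js @ is @ ks)"
   using perm_data_com[OF perm_data_append[OF perm_data_Braid perm_data_Id], of "is" js ks] e by (simp_all add: Com_simps(5))
  have d: "Id (Com T) (Seq js) \<boxtimes>\<^bsub>Com T\<^esub> Braid (Com T) (Seq is) (Seq ks) \<in> Ar (Com T)"
   "Dom (Com T) (Id (Com T) (Seq js) \<boxtimes>\<^bsub>Com T\<^esub> Braid (Com T) (Seq is) (Seq ks)) = Seq (js @ is @ ks)"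
   using perm_data_com[OF perm_data_append[OF perm_data_Id perm_data_Braid], of js "is" ks] e by (simp_all add: Com_simps(5))
  show "Assoc (Com T) B C A \<cdot>\<^bsub>Com T\<^esub> Braid (Com T) A (B \<otimes>\<^bsub>Com T\<^esub> C) \<cdot>\<^bsub>Com T\<^esub> Assoc (Com T) A B C
   = (Id (Com T) B \<boxtimes>\<^bsub>Com T\<^esub> Braid (Com T) A C) \<cdot>\<^bsub>Com T\<^esub> Assoc (Com T) B A C \<cdot>\<^bsub>Com T\<^esub> (Braid (Com T) A B \<boxtimes>\<^bsub>Com T\<^esub> Id (Com T) C)"
   unfolding e Com_simps(6,10) append_assoc using C.Id_simps b c d I(1)[OF b(1)] I(2)[OF b(1)] I(1)[OF d(1)] Com_hexagon[OF e(4-6)] e(4-6) by simp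
 qed (auto simp: Com_Ob Com_Tar_Id Iso Com_Braid_Braid simp del: Com_simps(9))
qed

end

section \<open>Extension of algebras along the unit\<close>

text \<open>
 The image in the strictification of \<open>V\<close> of the arrow \<open>Mor is f \<alpha>s\<close> of \<open>Com T\<close>, under the
 strict functor that extends the morphism \<open>F : T \<rightarrow> U V\<close>.
\<close>

definition lift where
 "lift V F is f \<alpha>s = tensl (str V) (map (%\<alpha>. opar V (om_op F \<alpha>)) \<alpha>s)
  \<cdot>\<^bsub>str V\<^esub> can (str V) (%l. om_col F (is ! l)) [0..<length is] (concat (map (fibre f) [0..<length \<alpha>s]))"

text \<open>The action on \<open>U V\<close> in terms of labels: \<open>can_relabel\<close> renames
  the positions used by \<open>U_Act\<close> to the labels in \<open>ks\<close>.\<close>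

lemma (in univ_smc) opar_reord:
 assumes a: "a \<in> Ops (U_ob V)" "mult_src a = map A ks" and m: "mset ls = mset ks" "distinct ks"
 shows "opar V (reord (U_ob V) ks ls a) = opar V a \<cdot>\<^bsub>str V\<^esub> can (str V) A ls ks"
proof -
 let ?n = "length ks"
 note r = relabel_permutes[OF m]
 have r': "relabel ks ls permutes {..<length (mult_src a)}" using r(1) a(2) by simp
 note L = permuted_labels[OF r' U_ops_simps(1)[OF a(1)]]
 have len: "length (mult_src a) = ?n" by (simp add: a(2))
 let ?ps = "map (relabel ks ls) [0..<?n]"
 have ls: "map ((!) ks) ?ps = ls" "map ((!) ks) [0..<?n] = ks" using r(2) by (simp_all add: permute_list_def map_nth comp_def)
 have A: "A ` set ls <= Ob V" using U_ops_simps(1)[OF a(1)] mset_eq_setD[OF m(1)] unfolding a(2) by simp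
 have "can (str V) ((!) (mult_src a)) ?ps [0..<?n] = can (str V) (A \<circ> (!) ks) ?ps [0..<?n]" proof (rule S.can_cong)
  fix k assume "k \<in> set ?ps"
  then have "k < ?n" using mset_eq_setD[OF L(4)] unfolding len by simp
  then show "mult_src a ! k = (A \<circ> (!) ks) k" by (simp add: a(2))
 qed (use L in \<open>simp_all only: len\<close>)
 also have "... = can (str V) A (map ((!) ks) ?ps) (map ((!) ks) [0..<?n])" proof (rule S.can_relabel[symmetric])
  show "mset [0..<?n] = mset ?ps" using L(1) unfolding len .
  have "(!) ks ` set ?ps = set ls" using arg_cong[OF ls(1), of set] by (simp only: set_map)
  then show "A ` (!) ks ` set ?ps <= Ob V" using A by simp
  show "distinct (map ((!) ks) ?ps)" unfolding ls using m mset_eq_imp_distinct_iff by blast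
 qed
 finally show ?thesis using U_Act(2)[OF a(1) r'] unfolding reord_def len ls by simp
qed

locale univ_lift = F: operad_morphism T "U_ob V" F + univ_smc V
 for T :: "('u univ, 'u univ) operad" and V :: "('u univ, 'u univ) smcat" (structure) and F
begin

sublocale T: univ_operad T by unfold_locales

abbreviation "fop \<equiv> %\<alpha>. opar V (om_op F \<alpha>)"

lemma fop_simps:
 assumes "\<alpha> \<in> Ops T"
 shows "fop \<alpha> \<in> Ar (str V)" "fst (fop \<alpha>) = map (om_col F) (Src T \<alpha>)" "snd (snd (fop \<alpha>)) = [om_col F (Tgt T \<alpha>)]"
 using F.om_op_in[OF assms] F.om_Src[OF assms] F.om_Tgt[OF assms] by simp_all

lemma fop_Mul: "composable T \<beta> as ==> fop (Mul T \<beta> as) = fop \<beta> \<cdot>\<^bsub>str V\<^esub> tensl (str V) (map fop as)"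
 using U_Mul(2)[OF F.composable_map] by (simp add: comp_def)

lemma fop_reord:
 assumes "\<alpha> \<in> Ops T" "Src T \<alpha> = map i ks" "mset ls = mset ks" "distinct ks"
 shows "fop (reord T ks ls \<alpha>) = fop \<alpha> \<cdot>\<^bsub>str V\<^esub> can (str V) (%k. om_col F (i k)) ls ks"
proof -
 have "om_op F (reord T ks ls \<alpha>) = reord (U_ob V) ks ls (om_op F \<alpha>)"
  using assms relabel_permutes(1)[OF assms(3,4)] F.om_Act[of \<alpha>] unfolding reord_def by (simp add: arity_def)
 moreover have "mult_src (om_op F \<alpha>) = map (%k. om_col F (i k)) ks" using F.om_Src[OF assms(1)] assms(2) by (simp add: comp_def)
 ultimately show ?thesis using opar_reord[OF F.om_op_in[OF assms(1)] _ assms(3,4)] by simp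
qed

lemma opar_Uni: "A \<in> Ob V ==> opar V (Mult [A] (Id V A)) = Id (str V) [A]" using U_Uni[of A] by simp

lemma col_in: "i \<in> Col T ==> om_col F i \<in> Ob V" using F.om_col_in[of i] by simp

text \<open>The boundaries of the two factors of \<open>lift\<close>: the canonical arrow groups
  positions by fibres, and the tensor product of operations starts from the grouped word.\<close>

lemma lift_parts:
 assumes x: "com_data T is f \<alpha>s"
 defines "n \<equiv> length \<alpha>s" and "A \<equiv> %l. om_col F (is ! l)"
 shows "mset (concat (map (fibre f) [0..<n])) = mset [0..<length is]" "A ` set [0..<length is] <= Ob V" "distinct [0..<length is]"
  and "set (map fop \<alpha>s) <= Ar (str V)" "tensl (str V) (map fop \<alpha>s) \<in> Ar (str V)"
  and "fst (tensl (str V) (map fop \<alpha>s)) = map A (concat (map (fibre f) [0..<n]))"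
  and "snd (snd (tensl (str V) (map fop \<alpha>s))) = map (om_col F) (map (Tgt T) \<alpha>s)" and "map A [0..<length is] = map (om_col F) is"
  and "l < length is ==> A l \<in> Ob V"
proof -
 note x' = T.com_data_nth[OF x]
 show "mset (concat (map (fibre f) [0..<n])) = mset [0..<length is]" using mset_fibres[OF x'(4)] unfolding n_def x'(1) .
 have "is ! l \<in> Col T" if "l < length is" for l using that x'(6) by auto
 then show A: "A ` set [0..<length is] <= Ob V" "l < length is ==> A l \<in> Ob V" unfolding A_def using col_in by auto
 show "distinct [0..<length is]" by simp
 show s: "set (map fop \<alpha>s) <= Ar (str V)" using fop_simps(1) x'(7) by auto
 then show "tensl (str V) (map fop \<alpha>s) \<in> Ar (str V)" by (rule S.tensl_in)
 have "map (%\<alpha>. fst (fop \<alpha>)) \<alpha>s = map (%k. map A (fibre f k)) [0..<n]"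
  using fop_simps(2)[OF x'(2)] x'(3) unfolding n_def A_def by (intro nth_equalityI) (simp_all del: opar_sel)
 then show "fst (tensl (str V) (map fop \<alpha>s)) = map A (concat (map (fibre f) [0..<n]))" using S.tensl_in(2)[OF s] by (simp add: map_concat comp_def)
 have "map (%\<alpha>. snd (snd (fop \<alpha>))) \<alpha>s = map (%\<alpha>. [om_col F (Tgt T \<alpha>)]) \<alpha>s"
  using fop_simps(3) x'(7) by (intro map_cong) auto
 then show "snd (snd (tensl (str V) (map fop \<alpha>s))) = map (om_col F) (map (Tgt T) \<alpha>s)"
  using S.tensl_in(3)[OF s] by (simp add: comp_def concat_map_singleton)
 show "map A [0..<length is] = map (om_col F) is" unfolding A_def by (intro nth_equalityI) simp_all
qed

lemma lift_simps [simp]: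
 assumes x: "com_data T is f \<alpha>s" shows "lift V F is f \<alpha>s \<in> Ar (str V)" "fst (lift V F is f \<alpha>s) = map (om_col F) is"
  "snd (snd (lift V F is f \<alpha>s)) = map (om_col F) (map (Tgt T) \<alpha>s)"
proof -
 note p = lift_parts[OF x]
 note c = S.can_simps[OF p(1-3)]
 show "lift V F is f \<alpha>s \<in> Ar (str V)" "fst (lift V F is f \<alpha>s) = map (om_col F) is"
  "snd (snd (lift V F is f \<alpha>s)) = map (om_col F) (map (Tgt T) \<alpha>s)" using p c unfolding lift_def by simp_all
qed

text \<open>The operations of a composite contribute outer operations, inner operations and arrows
  that undo the sorting. Tensored together, the last are one canonical arrow, and
  \<open>can_blocks\<close> slides the grouping for \<open>g\<close> past the inner
  operations.\<close>

lemma lift_Comp: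
 assumes x: "com_data T is f \<alpha>s" and y: "com_data T (map (Tgt T) \<alpha>s) g \<beta>s"
 shows "lift V F is (map ((!) g) f) (map (com_op T f \<alpha>s g \<beta>s) [0..<length \<beta>s]) = lift V F (map (Tgt T) \<alpha>s) g \<beta>s \<cdot>\<^bsub>str V\<^esub> lift V F is f \<alpha>s"
proof -
 note x' = T.com_data_nth[OF x] and y' = T.com_data_nth[OF y]
 note px = lift_parts[OF x] and py = lift_parts[OF y]
 let ?A = "%l. om_col F (is ! l)" and ?B = "%l. om_col F (map (Tgt T) \<alpha>s ! l)"
 let ?m = "length is" and ?n = "length \<alpha>s" and ?rs = "[0..<length \<beta>s]"
 let ?L = "fibre (map ((!) g) f)" and ?M = "%r. concat (map (fibre f) (fibre g r))"
 let ?b = "%r. fop (\<beta>s ! r)" and ?t = "%r. tensl (str V) (map (%s. fop (\<alpha>s ! s)) (fibre g r))" and ?c = "%r. can (str V) ?A (?L r) (?M r)"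
 let ?G = "concat (map (fibre g) ?rs)"
 have lg: "length g = ?n" using y'(1) by simp
 have fg: "set f <= {..<length g}" using x' lg by simp
 note z = T.Com_Comp(2)[OF x y]
 note pz = lift_parts[OF z]
 have c: "composable T (\<beta>s ! r) (map ((!) \<alpha>s) (fibre g r))" "Src T (Mul T (\<beta>s ! r) (map ((!) \<alpha>s) (fibre g r))) = map ((!) is) (?M r)"
  if "r < length \<beta>s" for r using T.Com_composable[OF x y that] by auto
 have mL: "mset (?L r) = mset (?M r)" for r by (rule mset_fibre_comp[OF fg])
 have dM: "distinct (?M r)" for r by (simp add: distinct_concat_fibres)
 have AL: "?A ` set (?L r) <= Ob V" for r using px(9) x'(1) by auto
 have AM: "?A ` set (?M r) <= Ob V" for r using AL[of r] mset_eq_setD[OF mL[of r]] by simp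
 have s: "s < ?n" if "s \<in> set (fibre g r)" for s r using that lg by simp
 have as: "fop (\<alpha>s ! s) \<in> Ar (str V)" "fst (fop (\<alpha>s ! s)) = map ?A (fibre f s)" "snd (snd (fop (\<alpha>s ! s))) = [?B s]" if "s < ?n" for s
  using fop_simps[OF x'(2)[OF that]] x'(3)[OF that] that by (simp_all del: opar_sel)
 have t: "?t r \<in> Ar (str V)" "fst (?t r) = map ?A (?M r)" "snd (snd (?t r)) = map ?B (fibre g r)" for r
 proof -
  have S: "set (map (%s. fop (\<alpha>s ! s)) (fibre g r)) <= Ar (str V)" using as(1) s by auto
  have "map fst (map (%s. fop (\<alpha>s ! s)) (fibre g r)) = map (%s. map ?A (fibre f s)) (fibre g r)"
   "map (%x. snd (snd x)) (map (%s. fop (\<alpha>s ! s)) (fibre g r)) = map (%s. [?B s]) (fibre g r)"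
   using as(2,3) s by (simp_all del: opar_sel fibre_simps(1))
  then show "?t r \<in> Ar (str V)" "fst (?t r) = map ?A (?M r)" "snd (snd (?t r)) = map ?B (fibre g r)"
   using S.tensl_in[OF S] unfolding str_simps by (simp_all only: map_concat map_map comp_def concat_map_singleton)
 qed
 have b: "?b r \<in> Ar (str V)" "fst (?b r) = map ?B (fibre g r)" if "r < length \<beta>s" for r
  using fop_simps[OF y'(2)[OF that]] y'(3)[OF that] s by (simp_all del: opar_sel fibre_simps(1))
 \<comment> \<open>One factor for each layer; the canonical arrow \<open>?c r\<close> returns from
   the sorted fibre to the concatenated fibres.\<close>
 have ops: "fop (com_op T f \<alpha>s g \<beta>s r) = (?b r \<cdot>\<^bsub>str V\<^esub> ?t r) \<cdot>\<^bsub>str V\<^esub> ?c r" if r: "r < length \<beta>s" for r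
  using fop_reord[OF F.S.Mul_in[OF c(1)[OF r]] c(2)[OF r] mL dM] fop_Mul[OF c(1)[OF r]] unfolding com_op_def by (simp add: comp_def)
 have "map fop (map (com_op T f \<alpha>s g \<beta>s) ?rs) = map (%r. (?b r \<cdot>\<^bsub>str V\<^esub> ?t r) \<cdot>\<^bsub>str V\<^esub> ?c r) ?rs"
  using ops by simp
 also have "tensl (str V) ... = tensl (str V) (map (%r. ?b r \<cdot>\<^bsub>str V\<^esub> ?t r) ?rs) \<cdot>\<^bsub>str V\<^esub> tensl (str V) (map ?c ?rs)"
 proof (rule S.tensl_comp)
  fix r assume "r \<in> set ?rs"
  then have r: "r < length \<beta>s" by simp
  have "mset (?M r) = mset (?L r)" using mL[of r] by simp
  note cs = S.can_simps[OF this AL fibre_simps(2)]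
  show "?c r \<in> Ar (str V) & ?b r \<cdot>\<^bsub>str V\<^esub> ?t r \<in> Ar (str V) & Dom (str V) (?b r \<cdot>\<^bsub>str V\<^esub> ?t r) = Cod (str V) (?c r)"
   using cs b[OF r] t[of r] by (simp del: opar_sel)
 qed
 also have "tensl (str V) (map (%r. ?b r \<cdot>\<^bsub>str V\<^esub> ?t r) ?rs) = tensl (str V) (map ?b ?rs) \<cdot>\<^bsub>str V\<^esub> tensl (str V) (map ?t ?rs)"
  using b t by (intro S.tensl_comp) (simp del: opar_sel)
 also have "tensl (str V) (map ?c ?rs) = can (str V) ?A (concat (map ?L ?rs)) (concat (map ?M ?rs))"
  using mL AL by (intro S.can_tensl) (simp_all add: distinct_concat_fibres)
 also have "tensl (str V) (map ?t ?rs) = tensl (str V) (map (%s. fop (\<alpha>s ! s)) ?G)"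
 proof -
  have "\<forall>xs \<in> set (map (%r. map (%s. fop (\<alpha>s ! s)) (fibre g r)) ?rs). set xs <= Ar (str V)" using as(1) s by auto
  from S.tensl_concat[OF this] show ?thesis by (simp add: map_concat comp_def)
 qed
 also have "map ?b ?rs = map fop \<beta>s" by (intro nth_equalityI) simp_all
 finally have T: "tensl (str V) (map fop (map (com_op T f \<alpha>s g \<beta>s) ?rs))
  = (tensl (str V) (map fop \<beta>s) \<cdot>\<^bsub>str V\<^esub> tensl (str V) (map (%s. fop (\<alpha>s ! s)) ?G)) \<cdot>\<^bsub>str V\<^esub> can (str V) ?A (concat (map ?L ?rs)) (concat (map ?M ?rs))" .
 have M: "concat (map ?M ?rs) = concat (map (fibre f) ?G)" by (rule concat_map_concat[symmetric])
 have mG: "mset ?G = mset [0..<?n]" using mset_fibres[OF y'(4)] unfolding lg .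
 have mLs: "mset (concat (map ?L ?rs)) = mset [0..<?m]" using pz(1) by simp
 have mMs: "mset (concat (map (fibre f) ?G)) = mset [0..<?m]" unfolding mset_concat_map[OF mG] by (rule px(1))
 have single: "concat (map (%k. [k]) ks) = ks" for ks :: "nat list" by (induction ks) auto
 \<comment> \<open>The blocks are the fibres of \<open>f\<close> at the sources of the inner
   operations and single positions at their targets.\<close>
 have blocks: "can (str V) ?B [0..<?n] ?G \<cdot>\<^bsub>str V\<^esub> tensl (str V) (map (%s. fop (\<alpha>s ! s)) [0..<?n])
  = tensl (str V) (map (%s. fop (\<alpha>s ! s)) ?G) \<cdot>\<^bsub>str V\<^esub> can (str V) ?A (concat (map (fibre f) [0..<?n])) (concat (map (fibre f) ?G))"
  using S.can_blocks[where B' = "%k. [k]" and A' = ?B and A = ?A and B = "fibre f" and ks = "[0..<?n]" and ls = ?G and f = "%s. fop (\<alpha>s ! s)"] as mG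
  unfolding single by (simp add: distinct_concat_fibres del: opar_sel)
 have an: "map (%s. fop (\<alpha>s ! s)) [0..<?n] = map fop \<alpha>s" by (intro nth_equalityI) simp_all
 have G: "tensl (str V) (map (%s. fop (\<alpha>s ! s)) ?G) \<in> Ar (str V)" "fst (tensl (str V) (map (%s. fop (\<alpha>s ! s)) ?G)) = map ?A (concat (map (fibre f) ?G))"
  "snd (snd (tensl (str V) (map (%s. fop (\<alpha>s ! s)) ?G))) = map ?B ?G"
 proof -
  have S: "set (map (%s. fop (\<alpha>s ! s)) ?G) <= Ar (str V)" using as(1) s by auto
  have "map fst (map (%s. fop (\<alpha>s ! s)) ?G) = map (%s. map ?A (fibre f s)) ?G"
   "map (%x. snd (snd x)) (map (%s. fop (\<alpha>s ! s)) ?G) = map (%s. [?B s]) ?G" using as(2,3) lg by (auto simp del: opar_sel)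
  then show "tensl (str V) (map (%s. fop (\<alpha>s ! s)) ?G) \<in> Ar (str V)" "fst (tensl (str V) (map (%s. fop (\<alpha>s ! s)) ?G)) = map ?A (concat (map (fibre f) ?G))"
   "snd (snd (tensl (str V) (map (%s. fop (\<alpha>s ! s)) ?G))) = map ?B ?G"
   using S.tensl_in[OF S] unfolding str_simps by (simp_all only: map_concat[of _ "map (fibre f) _"] map_map comp_def concat_map_singleton)
 qed
 let ?TB = "tensl (str V) (map fop \<beta>s)" and ?TA = "tensl (str V) (map fop \<alpha>s)" and ?TG = "tensl (str V) (map (%s. fop (\<alpha>s ! s)) ?G)"
 let ?cL = "can (str V) ?A [0..<?m] (concat (map ?L ?rs))" and ?cLM = "can (str V) ?A (concat (map ?L ?rs)) (concat (map (fibre f) ?G))"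
 let ?cM = "can (str V) ?A [0..<?m] (concat (map (fibre f) ?G))" and ?cA = "can (str V) ?A [0..<?m] (concat (map (fibre f) [0..<?n]))"
 let ?cAM = "can (str V) ?A (concat (map (fibre f) [0..<?n])) (concat (map (fibre f) ?G))" and ?cG = "can (str V) ?B [0..<?n] ?G"
 note cL = S.can_simps[OF mLs px(2,3)] and cM = S.can_simps[OF mMs px(2,3)] and cA = S.can_simps[OF px(1-3)]
 have cLM: "?cLM \<cdot>\<^bsub>str V\<^esub> ?cL = ?cM" by (rule S.can_comp[OF mLs mMs px(2,3)])
 have cAM: "?cAM \<cdot>\<^bsub>str V\<^esub> ?cA = ?cM" by (rule S.can_comp[OF px(1) mMs px(2,3)])
 have setA: "?A ` set ks <= Ob V" if "mset ks = mset [0..<?m]" for ks using px(2) mset_eq_setD[OF that] by simp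
 have dist: "distinct ks" if "mset ks = mset [0..<?m]" for ks using mset_eq_imp_distinct_iff[OF that] by simp
 note cLMs = S.can_simps[OF trans[OF mMs mLs[symmetric]] setA[OF mLs] dist[OF mLs]]
  and cAMs = S.can_simps[OF trans[OF mMs px(1)[symmetric]] setA[OF px(1)] dist[OF px(1)]]
 have "map ?B [0..<?n] = map (om_col F) (map (Tgt T) \<alpha>s)" by (intro nth_equalityI) simp_all
 note py' = py(1-3)[unfolded length_map]
 note cG = S.can_simps[OF py'] 
 \<comment> \<open>The passage through the sorted fibres cancels by \<open>can_comp\<close>. The
   resulting arrow is split at the grouping by \<open>f\<close>, which makes room for the
   slide.\<close>
 have "lift V F is (map ((!) g) f) (map (com_op T f \<alpha>s g \<beta>s) ?rs) = ((?TB \<cdot>\<^bsub>str V\<^esub> ?TG) \<cdot>\<^bsub>str V\<^esub> ?cLM) \<cdot>\<^bsub>str V\<^esub> ?cL"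
  unfolding lift_def T M by simp
 also have "... = (?TB \<cdot>\<^bsub>str V\<^esub> ?TG) \<cdot>\<^bsub>str V\<^esub> (?cLM \<cdot>\<^bsub>str V\<^esub> ?cL)"
  using py(5,6) G cL cLMs by (intro S.Comp_assoc') simp_all
 also have "... = ?TB \<cdot>\<^bsub>str V\<^esub> (?TG \<cdot>\<^bsub>str V\<^esub> ?cM)"
  unfolding cLM using py(5,6) G cM by (intro S.Comp_assoc') simp_all
 also have "?TG \<cdot>\<^bsub>str V\<^esub> ?cM = (?TG \<cdot>\<^bsub>str V\<^esub> ?cAM) \<cdot>\<^bsub>str V\<^esub> ?cA"
  unfolding cAM[symmetric] using G cAMs cA by (intro S.Comp_assoc'[symmetric]) simp_all
 also have "?TG \<cdot>\<^bsub>str V\<^esub> ?cAM = ?cG \<cdot>\<^bsub>str V\<^esub> ?TA" using blocks unfolding an by simp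
 also have "(?cG \<cdot>\<^bsub>str V\<^esub> ?TA) \<cdot>\<^bsub>str V\<^esub> ?cA = ?cG \<cdot>\<^bsub>str V\<^esub> (?TA \<cdot>\<^bsub>str V\<^esub> ?cA)"
  using px(5-7) cG cA \<open>map ?B [0..<?n] = _\<close> by (intro S.Comp_assoc') simp_all
 also have "?TB \<cdot>\<^bsub>str V\<^esub> ... = (?TB \<cdot>\<^bsub>str V\<^esub> ?cG) \<cdot>\<^bsub>str V\<^esub> (?TA \<cdot>\<^bsub>str V\<^esub> ?cA)"
  using py(5,6) px(5-7) cG cA \<open>map ?B [0..<?n] = _\<close> by (intro S.Comp_assoc'[symmetric]) simp_all
 finally show ?thesis unfolding lift_def length_map .
qed

text \<open>The canonical arrows of both factors are expressed by positions in the concatenated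
  word, the second after a shift, and joined by \<open>can_Tar\<close>; interchange does the
  rest.\<close>

lemma lift_Tar:
 assumes x: "com_data T is f \<alpha>s" and x': "com_data T is' f' \<alpha>s'"
 shows "lift V F (is @ is') (f @ map ((+) (length \<alpha>s)) f') (\<alpha>s @ \<alpha>s') = lift V F is f \<alpha>s \<boxtimes>\<^bsub>str V\<^esub> lift V F is' f' \<alpha>s'"
proof -
 note p = lift_parts[OF x] and p' = lift_parts[OF x'] and q = lift_parts[OF T.com_data_Tar[OF x x']]
 note n = T.com_data_nth[OF x] and n' = T.com_data_nth[OF x']
 let ?A = "%l. om_col F (is ! l)" and ?A' = "%l. om_col F (is' ! l)" and ?B = "%l. om_col F ((is @ is') ! l)"
 let ?ks = "concat (map (fibre f) [0..<length \<alpha>s])" and ?ks' = "concat (map (fibre f') [0..<length \<alpha>s'])"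
 let ?m = "length is" and ?m' = "length is'"
 have m: "set ks = {0..<k}" if "mset ks = mset [0..<k]" for ks k using mset_eq_setD[OF that] by simp
 have c: "can (str V) ?A [0..<?m] ?ks = can (str V) ?B [0..<?m] ?ks" using p(1-3) by (intro S.can_cong) (simp_all add: nth_append)
 have BB: "?B ` set [0..<?m] <= Ob V" "?B ` set (map ((+) ?m) [0..<?m']) <= Ob V" using q(9) by (auto simp del: nth_append)
 have c': "can (str V) ?A' [0..<?m'] ?ks' = can (str V) ?B (map ((+) ?m) [0..<?m']) (map ((+) ?m) ?ks')"
 proof -
  have "can (str V) ?B (map ((+) ?m) [0..<?m']) (map ((+) ?m) ?ks') = can (str V) (?B \<circ> (+) ?m) [0..<?m'] ?ks'"
   using p'(1-3) BB(2) by (intro S.can_relabel) (simp_all add: image_image distinct_map)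
  also have "... = can (str V) ?A' [0..<?m'] ?ks'" using p'(1-3) by (intro S.can_cong) (simp_all add: image_comp comp_def)
  finally show ?thesis by simp
 qed
 have k: "concat (map (fibre (f @ map ((+) (length \<alpha>s)) f')) [0..<length (\<alpha>s @ \<alpha>s')]) = ?ks @ map ((+) ?m) ?ks'"
 proof -
  have "[0..<length (\<alpha>s @ \<alpha>s')] = [0..<length \<alpha>s] @ map ((+) (length \<alpha>s)) [0..<length \<alpha>s']"
   by (intro nth_equalityI) (auto simp: nth_append)
  moreover have "map (fibre (f @ map ((+) (length \<alpha>s)) f')) [0..<length \<alpha>s] = map (fibre f) [0..<length \<alpha>s]"
   by (simp add: fibre_append[OF n(4)])
  moreover have "map (fibre (f @ map ((+) (length \<alpha>s)) f')) (map ((+) (length \<alpha>s)) [0..<length \<alpha>s']) = map (map ((+) ?m)) (map (fibre f') [0..<length \<alpha>s'])"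
   by (simp add: fibre_append[OF n(4)] n(1))
  ultimately show ?thesis by (simp only: map_append concat_append map_concat)
 qed
 have u: "[0..<length (is @ is')] = [0..<?m] @ map ((+) ?m) [0..<?m']" by (intro nth_equalityI) (auto simp: nth_append)
 have cc: "can (str V) ?B ([0..<?m] @ map ((+) ?m) [0..<?m']) (?ks @ map ((+) ?m) ?ks')
  = can (str V) ?B [0..<?m] ?ks \<boxtimes>\<^bsub>str V\<^esub> can (str V) ?B (map ((+) ?m) [0..<?m']) (map ((+) ?m) ?ks')" proof (rule S.can_Tar[symmetric])
  show "distinct ([0..<?m] @ map ((+) ?m) [0..<?m'])" unfolding u[symmetric] by simp
  show "mset ?ks = mset [0..<?m]" by (rule p(1))
  show "mset (map ((+) ?m) ?ks') = mset (map ((+) ?m) [0..<?m'])" unfolding mset_map p'(1) ..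
 qed (use BB in simp_all)
 show ?thesis unfolding lift_def k u cc c[symmetric] c'[symmetric] map_append S.tensl_append[OF p(4) p'(4)]
  using p(5,6) p'(5,6) S.can_simps[OF p(1-3)] S.can_simps[OF p'(1-3)] by (intro S.interchange) simp_all
qed

text \<open>The operations are units, so their tensor product is an identity, and the concatenated
  singleton fibres of \<open>p\<close> form its inverse \<open>q\<close>.\<close>

lemma lift_perm:
 assumes p: "perm_data T is p q js" shows "lift V F is p (map (Uni T) js) = can (str V) (%l. om_col F (is ! l)) [0..<length is] q"
proof -
 note P = lift_parts[OF T.perm_data_com(1)[OF p]]
 have mf: "map (fibre p) [0..<length js] = map (%k. [q ! k]) [0..<length js]" using T.perm_data_fibre[OF p] by simp
 have "concat (map (fibre p) [0..<length (map (Uni T) js)]) = map ((!) q) [0..<length js]" by (simp only: length_map mf concat_map_singleton)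
 also have "... = q" using p by (metis map_nth perm_data_def)
 finally have q: "concat (map (fibre p) [0..<length (map (Uni T) js)]) = q" .
 have js: "set js <= Col T" using p by (simp add: perm_data_def)
 then have "tensl (str V) (map fop (map (Uni T) js)) = Id (str V) (map (om_col F) js)" proof (induction js)
  case (Cons j js)
  then have "om_col F j \<in> Ob V" "set (map (om_col F) js) <= Ob V" using col_in by auto
  then show ?case using Cons S.Tar_Id[of "[om_col F j]" "map (om_col F) js"] by (simp add: opar_Uni)
 qed simp
 moreover have "map (om_col F) js = map (%l. om_col F (is ! l)) q" using p by (intro nth_equalityI) (auto simp: perm_data_def)
 ultimately show ?thesis using S.can_simps[OF P(1-3)] unfolding lift_def q by simp
qed

lemma lift_Id:
 assumes "set is <= Col T" shows "lift V F is [0..<length is] (map (Uni T) is) = Id (str V) (map (om_col F) is)"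
 using lift_perm[OF T.perm_data_Id[OF assms]] lift_parts(2,8)[OF T.com_data_Id[OF assms]] by simp

lemma lift_Braid:
 assumes "set is <= Col T" "set js <= Col T"
 shows "lift V F (is @ js) ([length js..<length js + length is] @ [0..<length js]) (map (Uni T) (js @ is)) = Braid (str V) (map (om_col F) is) (map (om_col F) js)"
proof -
 let ?B = "%l. om_col F ((is @ js) ! l)" and ?ks = "[0..<length is]" and ?ls = "[length is..<length is + length js]"
 note P = lift_parts[OF T.perm_data_com(1)[OF T.perm_data_Braid[OF assms]]]
 have m: "map ?B ?ks = map (om_col F) is" "map ?B ?ls = map (om_col F) js" by (intro nth_equalityI; simp add: nth_append)+
 have u: "[0..<length (is @ js)] = ?ks @ ?ls" by (intro nth_equalityI) (auto simp: nth_append)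
 have "Braid (str V) (map ?B ?ks) (map ?B ?ls) = can (str V) ?B (?ks @ ?ls) (?ls @ ?ks)" using P(2,3) unfolding u by (intro S.can_Braid) auto
 then show ?thesis unfolding lift_perm[OF T.perm_data_Braid[OF assms]] m u by simp
qed

end

section \<open>The unit \<open>T \<rightarrow> U (Com T)\<close>\<close>

context symmetric_strict_monoidal_category
begin

lemma tens_append: "[|set As <= Ob V; set Bs <= Ob V|] ==> tens V (As @ Bs) = tens V As \<otimes> tens V Bs"
proof (induction As)
 case (Cons A As)
 then show ?case by (cases "As = []"; cases "Bs = []") (simp_all add: tens_Cons strict_assoc strict_runit)
qed (simp add: strict_lunit)

text \<open>For strict \<open>V\<close> the coherence collapses, so tensor products of arrows in
  \<open>str V\<close> are those of \<open>V\<close>. For \<open>Com T\<close> this allows arrows of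
  the strictification to be computed explicitly.\<close>

lemma app_iso_strict: "[|set As <= Ob V; set Bs <= Ob V|] ==> app_iso V As Bs = Id V (tens V (As @ Bs))"
proof (induction As rule: induct_list012)
 case (2 A)
 then show ?case by (cases Bs) (simp_all add: Runit_strict)
next
 case (3 A A' As)
 show ?case proof (cases Bs)
  case Nil
  then show ?thesis using 3(3) tens_in[of "A # A' # As"] by (simp add: Runit_strict)
 next
  case (Cons B Bs')
  have t: "tens V (A' # As) \<in> Ob V" "tens V Bs \<in> Ob V" "A \<in> Ob V" using 3(3,4) by (auto intro!: tens_in)
  have e: "tens V ((A' # As) @ Bs) = tens V (A' # As) \<otimes> tens V Bs" using 3(3,4) by (intro tens_append) auto
  have "app_iso V (A # A' # As) Bs = (Id V A \<boxtimes> app_iso V (A' # As) Bs) \<cdot> Assoc V A (tens V (A' # As)) (tens V Bs)" by (simp add: Cons)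
  also have "... = Id V (A \<otimes> tens V ((A' # As) @ Bs))"
   using 3(2)[unfolded e] 3(3,4) t unfolding e by (simp add: Assoc_strict Tar_Id del: tens.simps)
  finally show ?thesis by (simp del: app_iso.simps)
 qed
qed (simp add: Lunit_strict)

lemma mid_Tar_strict:
 assumes "x \<in> Ar (str V)" "y \<in> Ar (str V)" shows "mid (x \<boxtimes>\<^bsub>str V\<^esub> y) = mid x \<boxtimes> mid y"
 using assms by (simp add: mid_str str_Ar app_iso_strict tens_append)

lemma mid_Braid_strict:
 assumes "A \<in> Ob V" "B \<in> Ob V" shows "mid (Braid (str V) [A] [B]) = Braid V A B" using assms by (simp add: mid_str)

end

text \<open>The monotone function with consecutive fibres of sizes \<open>ns\<close>; it underlies a
  tensor product of corollas.\<close>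

fun block_fun :: "nat list => nat list" where
 "block_fun [] = []"
| "block_fun (n # ns) = replicate n 0 @ map ((+) (Suc 0)) (block_fun ns)"

lemma block_fun_simps:
 "set (block_fun ns) <= {..<length ns}" "length (block_fun ns) = sum_list ns" by (induction ns) auto

lemma fibre_replicate: "fibre (replicate n 0) 0 = [0..<n]" by (rule fibre_eqI) auto

lemma fibre_block_fun: "k < length ns ==> fibre (block_fun ns) k = block ns k" proof (induction ns arbitrary: k)
 case (Cons n ns)
 have "set (replicate n 0) <= {..<Suc 0}" by auto
 note F = fibre_append[OF this, of "block_fun ns" k]
 show ?case proof (cases k)
  case 0
  then show ?thesis unfolding block_fun.simps F by (simp add: fibre_replicate block_def map_idI)
 next
  case (Suc j)
  then show ?thesis using Cons unfolding block_fun.simps F by (simp add: block_def comp_def add.assoc)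
 qed
qed simp

definition corolla :: "('u univ, 'u univ) operad => 'u univ => 'u univ" where
 "corolla T \<alpha> = Mor (Src T \<alpha>) (replicate (length (Src T \<alpha>)) 0) [\<alpha>]"

definition com_unit :: "('u univ, 'u univ) operad => ('u univ, 'u univ) operad_morphism" where
 "com_unit T = \<lparr>om_dom = T, om_cod = U_ob (Com T), om_col = (\<lambda>i \<in> Col T. Seq [i]),
  om_op = (\<lambda>\<alpha> \<in> Ops T. Mult (map (%i. Seq [i]) (Src T \<alpha>)) (corolla T \<alpha>))\<rparr>"

abbreviation letters :: "'u univ list => 'u univ list" where
 "letters is \<equiv> map (%i. Seq [i]) is"

locale com_operad = univ_operad T for T :: "('u univ, 'u univ) operad"
begin

sublocale C: symmetric_strict_monoidal_category "Com T" by (rule Com_strict)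
sublocale C: univ_smc "Com T" by unfold_locales

lemma letters_in [simp]: "set is <= Col T ==> set (letters is) <= Ob (Com T)" by auto

lemma tens_letters [simp]: "tens (Com T) (letters is) = Seq is" by (induction "is" rule: induct_list012) simp_all

lemma str_com_data: "x \<in> Ar (str (Com T)) ==> mid x = Mor is f \<alpha>s ==> com_data T is f \<alpha>s" by (simp add: str_Ar)

lemma corolla_data: "\<alpha> \<in> Ops T ==> com_data T (Src T \<alpha>) (replicate (length (Src T \<alpha>)) 0) [\<alpha>]"
 using Src_in[of \<alpha>] by (auto simp: com_data_def fibre_replicate map_nth)

lemma com_unit_op:
 assumes "\<alpha> \<in> Ops T"
 shows "om_op (com_unit T) \<alpha> = Mult (letters (Src T \<alpha>)) (corolla T \<alpha>)" "om_op (com_unit T) \<alpha> \<in> Ops (U_ob (Com T))"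
  "opar (Com T) (om_op (com_unit T) \<alpha>) = (letters (Src T \<alpha>), corolla T \<alpha>, [Seq [Tgt T \<alpha>]])"
 using assms corolla_data[OF assms] letters_in[OF Src_in[OF assms]] by (simp_all add: com_unit_def C.U_ops_iff corolla_def opar_def)

lemma tensl_corollas:
 "set \<alpha>s <= Ops T ==> tensl (str (Com T)) (map (%\<alpha>. opar (Com T) (om_op (com_unit T) \<alpha>)) \<alpha>s)
  = (letters (concat (map (Src T) \<alpha>s)), Mor (concat (map (Src T) \<alpha>s)) (block_fun (map (arity T) \<alpha>s)) \<alpha>s, letters (map (Tgt T) \<alpha>s))"
proof (induction \<alpha>s)
 case Nil
 show ?case by (intro prod_eqI) simp_all
next
 case (Cons \<alpha> \<alpha>s)
 let ?o = "%\<alpha>. opar (Com T) (om_op (com_unit T) \<alpha>)"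
 have a: "\<alpha> \<in> Ops T" and as: "set \<alpha>s <= Ops T" using Cons by auto
 have "set (map ?o \<alpha>s) <= Ar (str (Com T))" using as com_unit_op(2) C.opar_in by auto
 note m = C.mid_Tar_strict[OF C.opar_in[OF com_unit_op(2)[OF a]] C.S.tensl_in(1)[OF this]]
 show ?case using m unfolding list.map tensl_simps Cons.IH[OF as] com_unit_op(3)[OF a] by (intro prod_eqI) (simp_all add: corolla_def arity_def)
qed

text \<open>Each symmetry in \<open>Com T\<close> carries units as operations, and the underlying
  function follows every label to a position with the same label. When labels are distinct this
  determines the function.\<close>

lemma parr_Com:
 assumes "parr (str (Com T)) (%k. Seq [I k]) ks ls x" "I ` set ks <= Col T"
 shows "\<exists>p. mid x = Mor (map I ks) p (map (Uni T) (map I ls)) & length p = length ks &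
  (\<forall>l < length ks. p ! l < length ls & ls ! (p ! l) = ks ! l)" using assms proof (induction rule: parr.induct)
 case parr_refl
 have m: "map (%k. Seq [I k]) ks = letters (map I ks)" by simp
 show ?case unfolding m by (intro exI[of _ "[0..<length ks]"]) (simp del: map_map)
next
 case (parr_step xs a b ys x)
 let ?A = "%k. Seq [I k]" and ?ls = "xs @ a # b # ys" and ?ls' = "xs @ b # a # ys"
 have mm: "mset ?ls = mset ks" by (rule parr_mset[OF parr_step.hyps])
 from parr_step obtain p where p: "mid x = Mor (map I ks) p (map (Uni T) (map I ?ls))" "length p = length ks"
  "\<And>l. l < length ks ==> p ! l < length ?ls & ?ls ! (p ! l) = ks ! l" by blast
 have A: "?A ` set ks <= Ob (Com T)" using parr_step.prems by auto
 note X = C.S.parr_simps[OF parr_step.hyps A]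
 have I: "I ` set ?ls <= Col T" using parr_step.prems unfolding mset_eq_setD[OF mm] .
 then have i: "I a \<in> Col T" "I b \<in> Col T" "set (map I xs) <= Col T" "set (map I ys) <= Col T" by auto
 have o: "Seq [I a] \<in> Ob (Com T)" "Seq [I b] \<in> Ob (Com T)" "set (map ?A xs) <= Ob (Com T)" "set (map ?A ys) <= Ob (Com T)" using i by auto
 let ?y = "Id (str (Com T)) (map ?A xs) \<boxtimes>\<^bsub>str (Com T)\<^esub> (Braid (str (Com T)) [?A a] [?A b] \<boxtimes>\<^bsub>str (Com T)\<^esub> Id (str (Com T)) (map ?A ys))"
 let ?P = "[0..<length xs] @ map ((+) (length xs)) ([Suc 0, 0] @ map ((+) (Suc (Suc 0))) [0..<length ys])"
 have in': "Id (str (Com T)) (map ?A xs) \<in> Ar (str (Com T))" "Braid (str (Com T)) [?A a] [?A b] \<in> Ar (str (Com T))" "Id (str (Com T)) (map ?A ys) \<in> Ar (str (Com T))"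
  using o C.S.Id_simps by auto
 have t: "tens (Com T) (map ?A zs) = Seq (map I zs)" for zs using tens_letters[of "map I zs"] by (simp add: comp_def)
 have y: "mid ?y = Mor (map I ?ls) ?P (map (Uni T) (map I ?ls'))"
  using C.mid_Tar_strict[OF in'(1) C.str_Ar_simps(1)[OF in'(2,3)]] C.mid_Tar_strict[OF in'(2,3)] C.mid_Braid_strict[OF o(1,2)] by (simp add: t)
 have pd: "perm_data T (map I ?ls) ?P ?P (map I ?ls')"
  using perm_data_append[OF perm_data_Id[OF i(3)] perm_data_append[OF perm_data_Braid[of "[I a]" "[I b]"] perm_data_Id[OF i(4)]]] i by simp
 have c: "com_data T (map I ks) p (map (Uni T) (map I ?ls))" using str_com_data[OF X(1) p(1)] .
 have tg: "map (Tgt T) (map (Uni T) (map I ?ls)) = map I ?ls" using i by (simp add: subset_iff)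
 have "mid (?y \<cdot>\<^bsub>str (Com T)\<^esub> x) = Mor (map I ks) (map ((!) ?P) p) (map (Uni T) (map I ?ls'))"
  using perm_Comp[OF c, unfolded tg, OF pd] perm_data_Unis[OF pd] unfolding str_simps y p(1) by simp
 moreover have "?P ! j < length ?ls' & ?ls' ! (?P ! j) = ?ls ! j" if "j < length ?ls" for j
 proof -
  consider "j < length xs" | "j = length xs" | "j = Suc (length xs)" | "Suc (Suc (length xs)) \<le> j" by linarith
  then show ?thesis
  proof cases
   case 4
   then obtain t where t: "j = Suc (Suc (length xs)) + t" using le_Suc_ex by blast
   then have "t < length ys" using that by simp
   then show ?thesis unfolding t by (simp add: nth_append)
  qed (simp_all add: nth_append)
 qed
 ultimately show ?case using p(2,3) by (intro exI[of _ "map ((!) ?P) p"]) simp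
qed

lemma can_Com:
 assumes "mset ls = mset ks" "I ` set ks <= Col T" "distinct ks"
 obtains p where "mid (can (str (Com T)) (%k. Seq [I k]) ks ls) = Mor (map I ks) p (map (Uni T) (map I ls))"
  "length p = length ks" "\<And>l. l < length ks ==> p ! l < length ls & ls ! (p ! l) = ks ! l"
proof -
 have "(%k. Seq [I k]) ` set ks <= Ob (Com T)" using assms(2) by auto
 from parr_Com[OF C.S.can_parr[OF assms(1) this assms(3)] assms(2)] show thesis using that by blast
qed

text \<open>Substituting corollas into a corolla meets the inputs in increasing order, so the
  sorting in the composition of \<open>Com T\<close> is trivial.\<close>

lemma com_unit_Mul:
 assumes c: "composable T \<beta> \<alpha>s"
 shows "om_op (com_unit T) (Mul T \<beta> \<alpha>s) = Mul (U_ob (Com T)) (om_op (com_unit T) \<beta>) (map (om_op (com_unit T)) \<alpha>s)"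
proof -
 let ?\<eta> = "om_op (com_unit T)"
 have b: "\<beta> \<in> Ops T" and as: "set \<alpha>s <= Ops T" and tg: "Src T \<beta> = map (Tgt T) \<alpha>s" using c by (auto simp: composable_def)
 note m = Mul_in[OF c]
 have tgs: "map (Tgt (U_ob (Com T))) (map ?\<eta> \<alpha>s) = letters (Src T \<beta>)" unfolding tg using com_unit_op(1) as by (auto simp: corolla_def)
 have c': "composable (U_ob (Com T)) (?\<eta> \<beta>) (map ?\<eta> \<alpha>s)"
  unfolding composable_def tgs using com_unit_op(1,2)[OF b] com_unit_op(2) as by auto
 let ?ns = "map (arity T) \<alpha>s" and ?k = "length (Src T \<beta>)"
 have k: "?k = length \<alpha>s" by (simp add: tg)
 have sl: "sum_list ?ns = length (Src T (Mul T \<beta> \<alpha>s))" unfolding Src_Mul[OF c] length_concat map_map comp_def by (simp add: arity_def[abs_def])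
 have "set (map (%\<alpha>. opar (Com T) (?\<eta> \<alpha>)) \<alpha>s) <= Ar (str (Com T))" using as com_unit_op(2) C.opar_in by auto
 from C.S.tensl_in(1)[OF this] have x: "com_data T (concat (map (Src T) \<alpha>s)) (block_fun ?ns) \<alpha>s"
  unfolding tensl_corollas[OF as] by (simp add: str_Ar)
 have "corolla T \<beta> \<cdot>\<^bsub>Com T\<^esub> Mor (concat (map (Src T) \<alpha>s)) (block_fun ?ns) \<alpha>s = corolla T (Mul T \<beta> \<alpha>s)"
 proof -
  let ?g = "replicate ?k 0"
  have fb: "concat (map (fibre (block_fun ?ns)) (fibre ?g 0)) = [0..<sum_list ?ns]"
  proof -
   have "map (fibre (block_fun ?ns)) [0..<?k] = map (block ?ns) [0..<length ?ns]" by (simp add: fibre_block_fun k)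
   then show ?thesis unfolding fibre_replicate by (simp only: concat_blocks)
  qed
  have "set (block_fun ?ns) <= {..<length ?g}" using block_fun_simps(1)[of ?ns] k by simp
  from fibre_comp[OF this, of 0] have f0: "fibre (map ((!) ?g) (block_fun ?ns)) 0 = [0..<sum_list ?ns]" unfolding fb by (simp add: sorted_sort_id)
  have "map ((!) ?g) (block_fun ?ns) = replicate (sum_list ?ns) 0" using block_fun_simps[of ?ns] k by (intro nth_equalityI) (auto simp: subset_iff)
  moreover have "com_op T (block_fun ?ns) \<alpha>s ?g [\<beta>] 0 = Mul T \<beta> \<alpha>s"
   using m unfolding com_op_def fb f0 by (simp add: fibre_replicate k map_nth reord_refl)
  ultimately show ?thesis
   using Com_Comp(1)[OF x corolla_data[OF b, unfolded tg], of "Src T \<beta>"] unfolding corolla_def by (simp add: Src_Mul[OF c] sl[unfolded Src_Mul[OF c]] tg)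
 qed
 then have "opar (Com T) (?\<eta> (Mul T \<beta> \<alpha>s)) = opar (Com T) (Mul (U_ob (Com T)) (?\<eta> \<beta>) (map ?\<eta> \<alpha>s))"
  unfolding C.U_Mul(2)[OF c'] com_unit_op(3)[OF m] com_unit_op(3)[OF b] map_map comp_def tensl_corollas[OF as]
  by (intro prod_eqI) (simp_all add: Src_Mul[OF c] Tgt_Mul[OF c])
 then show ?thesis by (rule C.U_eqI[OF com_unit_op(2)[OF m] C.U_Mul(1)[OF c']])
qed

text \<open>Precomposing a corolla with the permutation arrow of \<open>\<rho>\<close> pulls its
  positions back along the inverse; putting them in order again is the action of
  \<open>\<rho>\<close>.\<close>

lemma com_unit_Act:
 assumes a: "\<alpha> \<in> Ops T" and \<rho>: "\<rho> permutes {..<arity T \<alpha>}"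
 shows "om_op (com_unit T) (Act T \<alpha> \<rho>) = Act (U_ob (Com T)) (om_op (com_unit T) \<alpha>) \<rho>"
proof -
 let ?\<eta> = "om_op (com_unit T)" and ?is = "Src T \<alpha>"
 let ?n = "length ?is" and ?p = "map \<rho> [0..<length ?is]" and ?q = "map (inv \<rho>) [0..<length ?is]"
 have \<rho>n: "\<rho> permutes {..<?n}" using \<rho> by (simp add: arity_def)
 note m = Act_in[OF a \<rho>]
 have src: "mult_src (?\<eta> \<alpha>) = letters ?is" using com_unit_op(1)[OF a] by simp
 have \<rho>': "\<rho> permutes {..<length (mult_src (?\<eta> \<alpha>))}" using \<rho>n by (simp add: src)
 have L: "mset [0..<?n] = mset ?p" "distinct ?p" using mset_map_permutes[OF \<rho>n] mset_eq_imp_distinct_iff[OF mset_map_permutes[OF \<rho>n]] by simp_all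
 have sp: "set ?p = {0..<?n}" using mset_eq_setD[OF L(1)] by simp
 have col: "?is ! k \<in> Col T" if "k < ?n" for k using Src_in[OF a] nth_mem[OF that] by blast
 have inj: "(!) ?is ` set ?p <= Col T" unfolding sp using col by auto
 obtain p where p: "mid (can (str (Com T)) (%k. Seq [?is ! k]) ?p [0..<?n]) = Mor (map ((!) ?is) ?p) p (map (Uni T) (map ((!) ?is) [0..<?n]))"
  "length p = length ?p" "\<And>l. l < length ?p ==> p ! l < length [0..<?n] & [0..<?n] ! (p ! l) = ?p ! l"
  using can_Com[OF L(1) inj L(2)] by blast
 \<comment> \<open>The target labels are the positions themselves, so the labelling property of
   \<open>p\<close> states its values.\<close>
 have "p = ?p" using p(2,3) by (intro nth_equalityI) force+
 have pl: "map ((!) ?is) ?p = permute_list \<rho> ?is" by (simp add: permute_list_def)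
 have can: "can (str (Com T)) ((!) (letters ?is)) ?p [0..<?n] = can (str (Com T)) (%k. Seq [?is ! k]) ?p [0..<?n]"
 proof (rule C.S.can_cong[OF _ L(1) _ L(2)])
  fix k assume "k \<in> set ?p"
  then show "letters ?is ! k = Seq [?is ! k]" unfolding sp by simp
 next
  show "(!) (letters ?is) ` set ?p <= Ob (Com T)" unfolding sp using col by auto
 qed
 have "(%k. Seq [?is ! k]) ` set ?p <= Ob (Com T)" unfolding sp using col by auto
 from C.S.can_simps(2)[OF L(1) this L(2)]
 have fc: "fst (can (str (Com T)) (%k. Seq [?is ! k]) ?p [0..<?n]) = letters (permute_list \<rho> ?is)" unfolding pl[symmetric] by (simp add: comp_def)
 have pd: "perm_data T (permute_list \<rho> ?is) ?p ?q ?is"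
  using Src_in[OF a] permutes_inverses[OF \<rho>n] permutes_in_image[OF \<rho>n] permutes_in_image[OF permutes_inv[OF \<rho>n]]
  by (simp add: perm_data_def permute_list_nth[OF \<rho>n])
 have pr: "\<rho> = relabel ?q [0..<?n]" proof (rule relabel_unique)
  show "\<rho> permutes {..<length ?q}" using \<rho>n by simp
  show "permute_list \<rho> ?q = [0..<?n]"
   using permutes_in_image[OF \<rho>n] permutes_inverses[OF \<rho>n] by (intro nth_equalityI) (simp_all add: permute_list_def)
  show "distinct ?q" using mset_eq_imp_distinct_iff[OF mset_map_permutes[OF permutes_inv[OF \<rho>n]]] by simp
 qed
 note y = corolla_data[OF a]
 note x = perm_data_com[OF pd]
 have y': "com_data T (map (Tgt T) (map (Uni T) ?is)) (replicate ?n 0) [\<alpha>]" using y unfolding x(2) .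
 have f: "map ((!) (replicate ?n 0)) ?p = replicate ?n (0::nat)" using permutes_in_image[OF \<rho>n] by (intro nth_equalityI) simp_all
 have "map ((!) ?q) [0..<?n] = ?q" by (intro nth_equalityI) simp_all
 then have "com_op T ?p (map (Uni T) ?is) (replicate ?n 0) [\<alpha>] 0 = Act T \<alpha> \<rho>"
  using com_op_perm(1)[OF pd y, of 0] unfolding f fibre_replicate reord_def pr[symmetric] by (simp only:) (simp add: pr[symmetric])
 then have "corolla T \<alpha> \<cdot>\<^bsub>Com T\<^esub> Mor (permute_list \<rho> ?is) ?p (map (Uni T) ?is) = corolla T (Act T \<alpha> \<rho>)"
  using Com_Comp(1)[OF x(1) y', of ?is] unfolding corolla_def f Src_Act[OF a \<rho>] by simp
 then have "opar (Com T) (?\<eta> (Act T \<alpha> \<rho>)) = opar (Com T) (Act (U_ob (Com T)) (?\<eta> \<alpha>) \<rho>)"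
  using p(1) fc C.U_Act_sel(1)[OF com_unit_op(2)[OF a] \<rho>'] unfolding C.U_Act(2)[OF com_unit_op(2)[OF a] \<rho>'] com_unit_op(3)[OF m] com_unit_op(3)[OF a] src length_map can \<open>p = ?p\<close> pl map_nth
  by (intro prod_eqI) (simp_all add: Src_Act[OF a \<rho>] Tgt_Act[OF a \<rho>] permute_list_map[OF \<rho>n])
 then show ?thesis by (rule C.U_eqI[OF com_unit_op(2)[OF m] C.U_Act(1)[OF com_unit_op(2)[OF a] \<rho>']])
qed

lemma com_unit_morphism: "operad_morphism T (U_ob (Com T)) (com_unit T)"
proof (intro operad_morphism.intro operad_morphism_axioms.intro operad_axioms C.U_operad)
 fix i assume i: "i \<in> Col T"
 then show "om_col (com_unit T) i \<in> Col (U_ob (Com T))" by (simp add: com_unit_def)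
 show "om_op (com_unit T) (Uni T i) = Uni (U_ob (Com T)) (om_col (com_unit T) i)" using i com_unit_op(1)[of "Uni T i"] by (simp add: corolla_def com_unit_def)
next
 fix \<alpha> assume a: "\<alpha> \<in> Ops T"
 show "om_op (com_unit T) \<alpha> \<in> Ops (U_ob (Com T))" by (rule com_unit_op[OF a])
 show "Src (U_ob (Com T)) (om_op (com_unit T) \<alpha>) = map (om_col (com_unit T)) (Src T \<alpha>)"
  "Tgt (U_ob (Com T)) (om_op (com_unit T) \<alpha>) = om_col (com_unit T) (Tgt T \<alpha>)"
  using com_unit_op(1)[OF a] Src_in[OF a] Tgt_in[OF a] by (auto simp: com_unit_def corolla_def subset_iff)
qed (simp_all add: com_unit_Mul com_unit_Act, simp_all add: com_unit_def)

sublocale \<eta>: univ_lift T "Com T" "com_unit T" by (intro univ_lift.intro com_unit_morphism) unfold_locales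

text \<open>The extension of the unit is the identity. This is the factorisation of an arrow of
  \<open>Com T\<close> into a permutation and a tensor product of corollas: \<open>q\<close> lists
  the positions grouped by fibres, and \<open>p\<close> is its inverse.\<close>

lemma lift_unit:
 assumes x: "com_data T is f \<alpha>s" shows "lift (Com T) (com_unit T) is f \<alpha>s = (letters is, Mor is f \<alpha>s, letters (map (Tgt T) \<alpha>s))"
proof -
 let ?m = "length is" and ?n = "length \<alpha>s" and ?ns = "map (arity T) \<alpha>s"
 define q where "q = concat (map (fibre f) [0..<?n])"
 note x' = com_data_nth[OF x] and P = \<eta>.lift_parts(1-3,5)[OF x, folded q_def]
 have isC: "is ! l \<in> Col T" if "l < ?m" for l using subsetD[OF x'(6) nth_mem[OF that]] .
 then have col: "om_col (com_unit T) (is ! l) = Seq [is ! l]" if "l < ?m" for l using that by (simp add: com_unit_def)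
 have I: "(!) is ` set [0..<?m] <= Col T" using isC by auto
 obtain p where p: "mid (can (str (Com T)) (%l. Seq [is ! l]) [0..<?m] q) = Mor (map ((!) is) [0..<?m]) p (map (Uni T) (map ((!) is) q))"
  and p0: "length p = length [0..<?m]" "\<And>l. l < length [0..<?m] ==> p ! l < length q & q ! (p ! l) = [0..<?m] ! l"
  using can_Com[OF P(1) I P(3)] by blast
 have can: "can (str (Com T)) (%l. om_col (com_unit T) (is ! l)) [0..<?m] q = can (str (Com T)) (%l. Seq [is ! l]) [0..<?m] q"
  using col by (intro C.S.can_cong[OF _ P(1-3)]) simp
 have len: "length q = ?m" "distinct q" and setq: "set q = {0..<?m}"
  using mset_eq_length[OF P(1)] mset_eq_imp_distinct_iff[OF P(1)] mset_eq_setD[OF P(1)] by simp_all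
 have pl: "length p = ?m" using p0(1) by simp
 have pq: "p ! l < ?m" "q ! (p ! l) = l" if "l < ?m" for l using p0(2)[of l] that len(1) by simp_all
 have qm: "q ! k < ?m" if "k < ?m" for k
 proof -
  have "q ! k \<in> set q" using that len(1) by simp
  then show ?thesis unfolding setq by simp
 qed
 have qp: "p ! (q ! k) = k" if "k < ?m" for k using pq[OF qm[OF that]] that len by (simp add: nth_eq_iff_index_eq)
 define js where "js = map ((!) is) q"
 have js: "set js <= Col T" "length js = ?m" "\<And>k. k < ?m ==> js ! k = is ! (q ! k)"
  using I len(1) unfolding js_def set_map setq by simp_all
 have pd: "perm_data T is p q js" using js pl len(1) pq qm qp by (simp add: perm_data_def)
 have "map (Src T) \<alpha>s = map (map ((!) is)) (map (fibre f) [0..<?n])" using x'(3) by (intro nth_equalityI) simp_all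
 then have src: "concat (map (Src T) \<alpha>s) = js" by (simp only: map_concat js_def q_def)
 have ns: "?ns = map length (map (fibre f) [0..<?n])" using x'(3) by (intro nth_equalityI) (simp_all add: arity_def)
 \<comment> \<open>Pulled back along \<open>q\<close>, the \<open>r\<close>-th block is the fibre
   over \<open>r\<close> in increasing order, so composing with the permutation requires no
   sorting.\<close>
 have bl: "map ((!) q) (fibre (block_fun ?ns) r) = fibre f r" if r: "r < ?n" for r
 proof -
  have "map ((!) q) (block ?ns r) = fibre f r"
   unfolding block_def ns q_def using nth_concat_offset[of r "map (fibre f) [0..<?n]"] r by (intro nth_equalityI) simp_all
  then show ?thesis using r fibre_block_fun[of r ?ns] by simp
 qed
 have as: "set \<alpha>s <= Ops T" by (rule x'(7))
 have y: "com_data T js (block_fun ?ns) \<alpha>s" using P(4) unfolding tensl_corollas[OF as] src by (simp add: str_Ar)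
 have lb: "length (block_fun ?ns) = ?m" using com_data_nth(1)[OF y] js(2) by simp
 have "map ((!) (block_fun ?ns)) p = f" proof (rule nth_equalityI)
  fix l assume "l < length (map ((!) (block_fun ?ns)) p)"
  then have l: "l < ?m" using pl by simp
  let ?k = "block_fun ?ns ! (p ! l)"
  have r: "?k < ?n" using com_data_nth(5)[OF y, of "p ! l"] pq(1)[OF l] js(2) by simp
  have "p ! l \<in> set (fibre (block_fun ?ns) ?k)" using pq(1)[OF l] lb by simp
  then have "q ! (p ! l) \<in> set (map ((!) q) (fibre (block_fun ?ns) ?k))" unfolding set_map by (rule imageI)
  then have "l \<in> set (fibre f ?k)" unfolding bl[OF r] pq(2)[OF l] .
  then show "map ((!) (block_fun ?ns)) p ! l = f ! l" using l pl by simp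
 qed (use pl x'(1) in simp)
 moreover have "sorted (map ((!) q) (fibre (block_fun ?ns) r))" if "r < ?n" for r unfolding bl[OF that] by (rule fibre_simps)
 ultimately have c: "Mor js (block_fun ?ns) \<alpha>s \<cdot>\<^bsub>Com T\<^esub> Mor is p (map (Uni T) js) = Mor is f \<alpha>s"
  using Comp_perm[OF pd y] by (simp only:)
 have "mid (lift (Com T) (com_unit T) is f \<alpha>s) = Mor is f \<alpha>s"
  unfolding lift_def q_def[symmetric] can tensl_corollas[OF as] src str_simps p js_def[symmetric] map_nth fst_conv snd_conv by (rule c)
 moreover have cl: "map (om_col (com_unit T)) ks = letters ks" if "set ks <= Col T" for ks using that by (simp add: com_unit_def subset_iff)
 ultimately show ?thesis by (intro prod_eqI) (simp_all only: fst_conv snd_conv \<eta>.lift_simps(2,3)[OF x] cl[OF x'(6)] cl[OF x'(8)])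
qed

end

section \<open>The universal property of \<open>Com T\<close>\<close>

text \<open>The strict functor \<open>lift\<close> followed by the multiplication of words from
  \<open>str V\<close> to \<open>V\<close>; the constraint \<open>app_iso\<close> is that of the
  second functor.\<close>

definition com_ext ::
 "('u univ, 'u univ) smcat => ('u univ, 'u univ) operad => ('u univ, 'u univ) operad_morphism => ('u univ, 'u univ) sm_functor" where
 "com_ext V T F = \<lparr>sm_dom = Com T, sm_cod = V,
  sm_ob = (\<lambda>A \<in> Ob (Com T). tens V (map (om_col F) (seq A))),
  sm_ar = (\<lambda>x \<in> Ar (Com T). mid (lift V F (mor_dom x) (mor_fun x) (mor_ops x))),
  sm_mu = (\<lambda>(A, B) \<in> Ob (Com T) \<times> Ob (Com T). app_iso V (map (om_col F) (seq A)) (map (om_col F) (seq B))),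
  sm_eta = Id V \<one>\<^bsub>V\<^esub>\<rparr>"

context univ_lift
begin

lemma com_ext_sel [simp]:
 "sm_dom (com_ext V T F) = Com T" "sm_cod (com_ext V T F) = V" "sm_eta (com_ext V T F) = Id V \<one>"
 "set is <= Col T ==> sm_ob (com_ext V T F) (Seq is) = tens V (map (om_col F) is)"
 "com_data T is f \<alpha>s ==> sm_ar (com_ext V T F) (Mor is f \<alpha>s) = mid (lift V F is f \<alpha>s)"
 "[|set is <= Col T; set js <= Col T|] ==> sm_mu (com_ext V T F) (Seq is, Seq js) = app_iso V (map (om_col F) is) (map (om_col F) js)"
 by (simp_all add: com_ext_def)

lemma cols_in: "set is <= Col T ==> set (map (om_col F) is) <= Ob V" using col_in by auto

lemma mid_lift:
 assumes "com_data T is f \<alpha>s" shows "mid (lift V F is f \<alpha>s) \<in> Ar V" "Dom V (mid (lift V F is f \<alpha>s)) = tens V (map (om_col F) is)"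
  "Cod V (mid (lift V F is f \<alpha>s)) = tens V (map (om_col F) (map (Tgt T) \<alpha>s))" using lift_simps[OF assms] unfolding str_Ar by simp_all

text \<open>Functoriality comes from the laws of \<open>lift\<close>. Naturality and symmetry of the
  constraint are \<open>lift_Tar\<close> and \<open>lift_Braid\<close> read through the squares for
  \<open>str V\<close>, and its associativity is \<open>app_iso_assoc\<close>.\<close>

lemma com_ext_functor: "symmetric_strong_monoidal_functor (Com T) V (com_ext V T F)"
proof -
 interpret C: symmetric_strict_monoidal_category "Com T" by (rule T.Com_strict)
 let ?E = "com_ext V T F"
 note [simp del] = list.map
 have Id: "sm_ar ?E (Id (Com T) (Seq is)) = Id V (tens V (map (om_col F) is))" if "set is <= Col T" for "is"
  using lift_Id[OF that] T.com_data_Id[OF that] by simp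
 show ?thesis proof (intro symmetric_strong_monoidal_functor.intro symmetric_strong_monoidal_functor_axioms.intro
   cat_functor.intro cat_functor_axioms.intro C.symmetric_monoidal_category_axioms symmetric_monoidal_category_axioms
   C.category_axioms category_axioms)
  fix A assume "A \<in> Ob (Com T)"
  then show "sm_ob ?E A \<in> Ob V" using tens_in[OF cols_in] by (auto simp: Com_Ob)
 next
  fix x A B assume "x \<in> Hom (Com T) A B"
  then show "sm_ar ?E x \<in> Hom V (sm_ob ?E A) (sm_ob ?E B)" using mid_lift T.com_data_nth(6,8) by (auto simp: Hom_iff Com_Ar simp del: map_map)
 next
  fix A assume "A \<in> Ob (Com T)"
  then show "sm_ar ?E (Id (Com T) A) = Id V (sm_ob ?E A)" using Id by (auto simp: Com_Ob simp del: Com_simps(5))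
 next
  fix x y A B D assume "x \<in> Hom (Com T) A B" "y \<in> Hom (Com T) B D"
  then show "sm_ar ?E (y \<cdot>\<^bsub>Com T\<^esub> x) = sm_ar ?E y \<cdot> sm_ar ?E x"
   using lift_Comp T.Com_Comp(1,2) by (auto simp: Hom_iff Com_Ar simp del: map_map)
 next
  show "sm_ob ?E \<in> extensional (Ob (Com T))" "sm_ar ?E \<in> extensional (Ar (Com T))" "sm_mu ?E \<in> extensional (Ob (Com T) \<times> Ob (Com T))"
   by (simp_all add: com_ext_def)
 next
  fix A B assume "A \<in> Ob (Com T)" "B \<in> Ob (Com T)"
  then obtain "is" js where e: "A = Seq is" "B = Seq js" "set is <= Col T" "set js <= Col T" by (auto simp: Com_Ob)
  show "sm_mu ?E (A, B) \<in> Iso V (sm_ob ?E A \<otimes> sm_ob ?E B) (sm_ob ?E (A \<otimes>\<^bsub>Com T\<^esub> B))"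
   using e app_iso_simps[OF cols_in cols_in, of "is" js] by (simp add: Iso_iff)
  have b: "com_data T (is @ js) ([length js..<length js + length is] @ [0..<length js]) (map (Uni T) (js @ is))"
   using T.perm_data_com(1)[OF T.perm_data_Braid[OF e(3,4)]] .
  show "sm_ar ?E (Braid (Com T) A B) \<cdot> sm_mu ?E (A, B) = sm_mu ?E (B, A) \<cdot> Braid V (sm_ob ?E A) (sm_ob ?E B)"
   unfolding e(1,2) Com_simps(9) com_ext_sel(5)[OF b] lift_Braid[OF e(3,4)] using e mid_Braid[OF cols_in cols_in, of "is" js] by simp
 next
  show "sm_eta ?E \<in> Iso V \<one> (sm_ob ?E \<one>\<^bsub>Com T\<^esub>)" by (simp add: Iso_iff list.map)
 next
  fix x y A A' B B' assume "x \<in> Hom (Com T) A A'" "y \<in> Hom (Com T) B B'"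
  then obtain "is" f \<alpha>s js g \<beta>s where e: "x = Mor is f \<alpha>s" "A = Seq is" "A' = Seq (map (Tgt T) \<alpha>s)" "y = Mor js g \<beta>s" "B = Seq js" "B' = Seq (map (Tgt T) \<beta>s)"
   and x: "com_data T is f \<alpha>s" and y: "com_data T js g \<beta>s" by (auto simp: Hom_iff Com_Ar)
  show "sm_mu ?E (A', B') \<cdot> (sm_ar ?E x \<boxtimes> sm_ar ?E y) = sm_ar ?E (x \<boxtimes>\<^bsub>Com T\<^esub> y) \<cdot> sm_mu ?E (A, B)"
   using mid_Tar[OF lift_simps(1)[OF x] lift_simps(1)[OF y]] T.com_data_nth(6,8)[OF x] T.com_data_nth(6,8)[OF y] x y
   unfolding e Com_simps(8) com_ext_sel(5)[OF T.com_data_Tar[OF x y]] lift_Tar[OF x y] lift_simps(2,3)[OF x] lift_simps(2,3)[OF y] by (simp del: map_map)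
 next
  fix A B D assume "A \<in> Ob (Com T)" "B \<in> Ob (Com T)" "D \<in> Ob (Com T)"
  then obtain "is" js ks where e: "A = Seq is" "B = Seq js" "D = Seq ks" and i: "set is <= Col T" "set js <= Col T" "set ks <= Col T" by (auto simp: Com_Ob)
  note c = cols_in[OF i(1)] cols_in[OF i(2)] cols_in[OF i(3)]
  have ijk: "set (is @ js @ ks) <= Col T" using i by simp
  note a = app_iso_assoc[OF c] app_iso_simps[OF c(1,2)] app_iso_simps[OF c(2,3)] tens_in[OF c(1)] tens_in[OF c(2)] tens_in[OF c(3)]
   app_iso_simps[of "map (om_col F) is @ map (om_col F) js" "map (om_col F) ks"] app_iso_simps[of "map (om_col F) is" "map (om_col F) js @ map (om_col F) ks"]
  show "sm_ar ?E (Assoc (Com T) A B D) \<cdot> sm_mu ?E (A \<otimes>\<^bsub>Com T\<^esub> B, D) \<cdot> (sm_mu ?E (A, B) \<boxtimes> Id V (sm_ob ?E D))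
   = sm_mu ?E (A, B \<otimes>\<^bsub>Com T\<^esub> D) \<cdot> (Id V (sm_ob ?E A) \<boxtimes> sm_mu ?E (B, D)) \<cdot> Assoc V (sm_ob ?E A) (sm_ob ?E B) (sm_ob ?E D)"
   unfolding e Com_simps(10) Id[OF ijk] using i c a by (simp add: map_append)
 next
  fix A assume "A \<in> Ob (Com T)"
  then obtain "is" where e: "A = Seq is" and i: "set is <= Col T" by (auto simp: Com_Ob)
  note c = cols_in[OF i] and t = tens_in[OF cols_in[OF i]]
  show "sm_ar ?E (Lunit (Com T) A) \<cdot> sm_mu ?E (\<one>\<^bsub>Com T\<^esub>, A) \<cdot> (sm_eta ?E \<boxtimes> Id V (sm_ob ?E A)) = Lunit V (sm_ob ?E A)"
   "sm_ar ?E (Runit (Com T) A) \<cdot> sm_mu ?E (A, \<one>\<^bsub>Com T\<^esub>) \<cdot> (Id V (sm_ob ?E A) \<boxtimes> sm_eta ?E) = Runit V (sm_ob ?E A)"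
   unfolding e Com_simps(11,12) Id[OF i] using i t by (simp_all add: list.map(1) app_iso_Nil_right)
 qed simp_all
qed

lemma com_ext_strict:
 assumes "symmetric_strict_monoidal_category V" shows "symmetric_strict_monoidal_functor (Com T) V (com_ext V T F)"
proof -
 interpret V: symmetric_strict_monoidal_category V by fact
 show ?thesis using V.tens_append[OF cols_in cols_in] V.app_iso_strict[OF cols_in cols_in]
  by (intro symmetric_strict_monoidal_functor.intro com_ext_functor symmetric_strict_monoidal_functor_axioms.intro) (auto simp: Com_Ob)
qed

text \<open>With products bracketed to the right, attaching one letter to a nonempty word has an
  identity as constraint, so the iterated constraints on letters vanish.\<close>

lemma mu_list_com_ext:
 "set is <= Col T ==> mu_list (com_ext V T F) (letters is) = Id V (tens V (map (om_col F) is))"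
proof (induction "is" rule: induct_list012)
 case (3 i j js)
 have t: "tens (Com T) (letters (j # js)) = Seq (j # js)"
 proof -
  interpret com_operad T by unfold_locales
  show ?thesis by (rule tens_letters)
 qed
 have c: "om_col F i \<in> Ob V" "tens V (map (om_col F) (j # js)) \<in> Ob V" using 3 cols_in[of "j # js"] col_in tens_in by auto
 have "sm_mu (com_ext V T F) (Seq [i], Seq (j # js)) = app_iso V [om_col F i] (map (om_col F) (j # js))" using com_ext_sel(6)[of "[i]" "j # js"] 3 by simp
 also have "... = Id V (om_col F i \<otimes> tens V (map (om_col F) (j # js)))" by simp
 finally show ?case using 3 c t Tar_Id[of "om_col F i"] by simp
qed simp_all

text \<open>An equality even for \<open>V\<close> that is not strict: a one-letter word is sent to
  its letter, constraints on letters are identities, and the lift of a corolla is its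
  operation.\<close>

lemma com_ext_unit: "om_comp (U_fun (com_ext V T F)) (com_unit T) = F"
proof -
 interpret TC: com_operad T by unfold_locales
 note h = com_ext_functor
 interpret h: univ_functor "Com T" V "com_ext V T F" by (rule univ_functorI[OF h])
 show ?thesis proof (rule operad_morphism_eqI[OF om_comp_morphism[OF TC.com_unit_morphism h.U_fun_morphism] F.operad_morphism_axioms])
  fix i assume "i \<in> Col T"
  then show "om_col (om_comp (U_fun (com_ext V T F)) (com_unit T)) i = om_col F i" by (simp add: om_comp_def compose_def com_unit_def)
 next
  fix \<alpha> assume a: "\<alpha> \<in> Ops T"
  note d = TC.corolla_data[OF a]
  have s: "set (Src T \<alpha>) <= Col T" by (rule F.S.Src_in[OF a])
  have co: "(%l. om_col F (Src T \<alpha> ! l)) ` set [0..<length (Src T \<alpha>)] <= Ob V" using lift_parts(2)[OF d] .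
  have "lift V F (Src T \<alpha>) (replicate (length (Src T \<alpha>)) 0) [\<alpha>] = fop \<alpha> \<cdot>\<^bsub>str V\<^esub> Id (str V) (map (om_col F) (Src T \<alpha>))"
   using fop_simps[OF a] S.can_refl[OF co] lift_parts(8)[OF d] unfolding lift_def by (simp add: fibre_replicate del: opar_sel)
  also have "... = fop \<alpha>" using fop_simps[OF a] by (intro S.Comp_Id') simp_all
  finally have l: "lift V F (Src T \<alpha>) (replicate (length (Src T \<alpha>)) 0) [\<alpha>] = fop \<alpha>" .
  note o = U_ops_simps[OF F.om_op_in[OF a]]
  have "map (sm_ob (com_ext V T F)) (letters (Src T \<alpha>)) = map (om_col F) (Src T \<alpha>)" using s by (auto simp: subset_iff)
  then have "om_op (U_fun (com_ext V T F)) (om_op (com_unit T) \<alpha>) = Mult (mult_src (om_op F \<alpha>)) (mult_ar (om_op F \<alpha>))"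
   using h.U_fun_op(1)[OF TC.com_unit_op(2)[OF a]] F.om_Src[OF a] o d l mu_list_com_ext[OF s] by (simp add: TC.com_unit_op(1)[OF a] corolla_def del: map_map)
  then show "om_op (om_comp (U_fun (com_ext V T F)) (com_unit T)) \<alpha> = om_op F \<alpha>"
   using a F.om_op_in[OF a] by (auto simp: om_comp_def compose_def com_unit_def U_ops)
 qed
qed

end

section \<open>Strong monoidal functors out of \<open>Com T\<close>\<close>

locale com_functor = com_operad T + h: univ_functor "Com T" V h
 for T :: "('u univ, 'u univ) operad" and V and h
begin

abbreviation "restr \<equiv> om_comp (U_fun h) (com_unit T)"

lemma restr_morphism: "operad_morphism T (U_ob V) restr" by (rule om_comp_morphism[OF com_unit_morphism h.U_fun_morphism])

sublocale R: univ_lift T V restr by (intro univ_lift.intro restr_morphism) unfold_locales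

lemma restr_col: "i \<in> Col T ==> om_col restr i = sm_ob h (Seq [i])" by (simp add: om_comp_def compose_def com_unit_def)

lemma restr_cols: "set is <= Col T ==> map (om_col restr) is = map (sm_ob h) (letters is)" using restr_col by (simp add: subset_iff)

text \<open>By \<open>lift_unit\<close> every arrow is built from a canonical arrow and images of
  operations under the unit, and \<open>str_ar\<close> respects this construction. So
  \<open>h\<close>, once conjugated by its constraints, depends only on its restriction.\<close>

lemma str_ar_lift:
 assumes x: "com_data T is f \<alpha>s" shows "h.str_ar (letters is, Mor is f \<alpha>s, letters (map (Tgt T) \<alpha>s)) = lift V restr is f \<alpha>s"
proof -
 note P = \<eta>.lift_parts[OF x] and Q = R.lift_parts[OF x] and x' = com_data_nth[OF x]
 let ?q = "concat (map (fibre f) [0..<length \<alpha>s])"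
 have isC: "is ! l \<in> Col T" if "l < length is" for l using subsetD[OF x'(6) nth_mem[OF that]] .
 have t: "map h.str_ar (map (%\<alpha>. opar (Com T) (om_op (com_unit T) \<alpha>)) \<alpha>s) = map (%\<alpha>. opar V (om_op restr \<alpha>)) \<alpha>s"
  using h.U_fun_op(3)[OF com_unit_op(2)] x'(7) by (auto simp: om_comp_def compose_def com_unit_def)
 have "can (str V) (sm_ob h \<circ> (%l. om_col (com_unit T) (is ! l))) [0..<length is] ?q = can (str V) (%l. om_col restr (is ! l)) [0..<length is] ?q"
 proof (rule h.UW.S.can_cong[symmetric, OF _ Q(1-3)])
  fix l assume "l \<in> set [0..<length is]"
  then show "om_col restr (is ! l) = (sm_ob h \<circ> (%l. om_col (com_unit T) (is ! l))) l"
   using isC[of l] restr_col[of "is ! l"] by (simp add: com_unit_def[THEN arg_cong[where f = om_col]])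
 qed
 note c = h.str_ar_can[OF P(1-3)] this
 show ?thesis unfolding lift_unit[OF x, symmetric] lift_def h.str_ar_tensl[OF P(4), unfolded t, symmetric] c(2)[symmetric] c(1)[symmetric]
  using P(5,6) C.S.can_simps[OF P(1-3)] by (intro h.str_ar_Comp) simp_all
qed

lemma mid_lift_restr:
 assumes x: "com_data T is f \<alpha>s"
 shows "mid (lift V restr is f \<alpha>s) = Inv V (mu_list h (letters (map (Tgt T) \<alpha>s))) \<cdot>\<^bsub>V\<^esub> (sm_ar h (Mor is f \<alpha>s) \<cdot>\<^bsub>V\<^esub> mu_list h (letters is))"
 unfolding str_ar_lift[OF x, symmetric] by simp

end

lemma mu_list_strict:
 assumes "symmetric_strict_monoidal_functor V W F" "set As <= Ob V" shows "mu_list F As = Id W (sm_ob F (tens V As))" using assms(2)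
proof (induction As rule: induct_list012)
 interpret F: symmetric_strict_monoidal_functor V W F by fact
 {
  case 1
  show ?case by (simp add: F.strict_eta F.strict_Unit)
 next
  case (2 A)
  then show ?case by (simp add: F.sm_cod)
 next
  case (3 A B As)
  have t: "tens V (B # As) \<in> Ob V" "A \<in> Ob V" using 3 by (auto intro!: F.V.tens_in)
  note s = F.sm_dom F.sm_cod F.strict_mu[OF t(2,1)] F.strict_Tob[OF t(2,1)] F.F0_in[OF t(1)] F.F0_in[OF t(2)] F.W.Tar_Id
  have "mu_list F (A # B # As) = sm_mu F (A, tens V (B # As)) \<cdot>\<^bsub>W\<^esub> (Id W (sm_ob F A) \<boxtimes>\<^bsub>W\<^esub> mu_list F (B # As))"
   by (simp add: F.sm_dom F.sm_cod del: tens.simps)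
  also have "... = Id W (sm_ob F (tens V (A # B # As)))" using 3 unfolding tens.simps(3) by (simp add: s del: tens.simps mu_list.simps)
  finally show ?case .
 }
qed

text \<open>For strict functors the conjugating isomorphisms are identities, so the restriction
  recovers the functor itself.\<close>

lemma com_functor_determined:
 fixes h h' :: "('u univ, 'u univ) sm_functor"
 assumes T: "operad T" and h: "symmetric_strict_monoidal_functor (Com T) V h" "symmetric_strict_monoidal_functor (Com T) V h'"
  and eq: "om_comp (U_fun h) (com_unit T) = om_comp (U_fun h') (com_unit T)" shows "h = h'"
proof -
 interpret T: com_operad T using T by (simp add: com_operad_def univ_operad_def)
 have fact: "sm_ob k (Seq is) = tens V (map (om_col (om_comp (U_fun k) (com_unit T))) is) & mu_list k (letters is) = Id V (sm_ob k (Seq is))"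
  if k: "symmetric_strict_monoidal_functor (Com T) V k" and i: "set is <= Col T" for k "is"
 proof -
  interpret k: symmetric_strict_monoidal_functor "Com T" V k by (rule k)
  interpret k: com_functor T V k by unfold_locales
  note m = mu_list_strict[OF k T.letters_in[OF i], unfolded T.tens_letters]
  have "sm_ob k (Seq is) \<in> Ob V" using i by (intro k.F0_in) simp
  then show ?thesis using m k.mu_list_simps(2)[OF T.letters_in[OF i]] unfolding k.restr_cols[OF i] by (simp del: map_map)
 qed
 have ar: "sm_ar k (Mor is f \<alpha>s) = mid (lift V (om_comp (U_fun k) (com_unit T)) is f \<alpha>s)"
  if k: "symmetric_strict_monoidal_functor (Com T) V k" and x: "com_data T is f \<alpha>s" for k "is" f \<alpha>s
 proof -
  interpret k: symmetric_strict_monoidal_functor "Com T" V k by (rule k)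
  interpret k: com_functor T V k by unfold_locales
  note i = T.com_data_nth(6,8)[OF x]
  have "Mor is f \<alpha>s \<in> Ar (Com T)" using x by simp
  note s = k.F1_simps[OF this]
  have "sm_ob k (Seq is) \<in> Ob V" "sm_ob k (Seq (map (Tgt T) \<alpha>s)) \<in> Ob V" using i by (intro k.F0_in; simp)+
  then show ?thesis unfolding k.mid_lift_restr[OF x] fact[OF k i(1), THEN conjunct2] fact[OF k i(2), THEN conjunct2] using s by simp
 qed
 interpret h: symmetric_strict_monoidal_functor "Com T" V h by (rule h)
 interpret h': symmetric_strict_monoidal_functor "Com T" V h' by (rule h)
 have ob: "sm_ob h A = sm_ob h' A" if "A \<in> Ob (Com T)" for A using that fact[OF h(1)] fact[OF h(2)] eq by (auto simp: Com_Ob)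
 show ?thesis proof (rule sm_functor_eqI[OF h.symmetric_strong_monoidal_functor_axioms h'.symmetric_strong_monoidal_functor_axioms])
  fix x assume "x \<in> Ar (Com T)"
  then show "sm_ar h x = sm_ar h' x" using ar[OF h(1)] ar[OF h(2)] eq by (auto simp: Com_Ar)
 qed (simp_all add: ob h.strict_mu h'.strict_mu h.strict_eta h'.strict_eta)
qed

section \<open>Transformations between functors out of \<open>Com T\<close>\<close>

lemma (in univ_smc) mid_hat:
 assumes "\<And>i. i \<in> set is ==> p i \<in> Ops (U_ob V) & mult_src (p i) = [s i] & Cod V (mult_ar (p i)) = t i"
 shows "tensl (str V) (map (%i. opar V (p i)) is) \<in> Ar (str V)" "fst (tensl (str V) (map (%i. opar V (p i)) is)) = map s is"
  "snd (snd (tensl (str V) (map (%i. opar V (p i)) is))) = map t is"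
proof -
 have S: "set (map (%i. opar V (p i)) is) <= Ar (str V)" using assms by auto
 have "map fst (map (%i. opar V (p i)) is) = map (%i. [s i]) is" "map (%x. snd (snd x)) (map (%i. opar V (p i)) is) = map (%i. [t i]) is"
  using assms by auto
 then show "tensl (str V) (map (%i. opar V (p i)) is) \<in> Ar (str V)" "fst (tensl (str V) (map (%i. opar V (p i)) is)) = map s is"
  "snd (snd (tensl (str V) (map (%i. opar V (p i)) is))) = map t is" using S.tensl_in[OF S] unfolding str_simps by (simp_all only: concat_map_singleton)
qed

locale univ_transformation = \<phi>: operad_transformation T "U_ob V" \<phi> + univ_smc V
 for T :: "('u univ, 'u univ) operad" and V :: "('u univ, 'u univ) smcat" (structure) and \<phi>
begin

sublocale F: univ_lift T V "t_src \<phi>" by unfold_locales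
sublocale G: univ_lift T V "t_tgt \<phi>" by unfold_locales

abbreviation "at \<equiv> %i. opar V (t_at \<phi> i)"

text \<open>The component at a word as seen in the strictification; compatibility with tensor
  products forces it to be the product of the components at the letters.\<close>

definition hat where "hat is = tensl (str V) (map at is)"

lemma at_op:
 assumes "i \<in> Col T"
 shows "t_at \<phi> i \<in> Ops (U_ob V)" "mult_src (t_at \<phi> i) = [om_col (t_src \<phi>) i]" "Cod V (mult_ar (t_at \<phi> i)) = om_col (t_tgt \<phi>) i"
 using \<phi>.t_at_in[OF assms] \<phi>.Src_t_at[OF assms] \<phi>.Tgt_t_at[OF assms] by simp_all

lemma hat_simps:
 assumes "set is <= Col T"
 shows "hat is \<in> Ar (str V)" "fst (hat is) = map (om_col (t_src \<phi>)) is" "snd (snd (hat is)) = map (om_col (t_tgt \<phi>)) is"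
proof -
 have P: "\<And>i. i \<in> set is ==> t_at \<phi> i \<in> Ops (U_ob V) & mult_src (t_at \<phi> i) = [om_col (t_src \<phi>) i] & Cod V (mult_ar (t_at \<phi> i)) = om_col (t_tgt \<phi>) i"
  using assms at_op by blast
 show "hat is \<in> Ar (str V)" unfolding hat_def by (rule mid_hat(1), erule P)
 show "fst (hat is) = map (om_col (t_src \<phi>)) is" unfolding hat_def by (rule mid_hat(2), erule P)
 show "snd (snd (hat is)) = map (om_col (t_tgt \<phi>)) is" unfolding hat_def by (rule mid_hat(3), erule P)
qed

lemma hat_append:
 assumes "set is <= Col T" "set js <= Col T" shows "hat (is @ js) = hat is \<boxtimes>\<^bsub>str V\<^esub> hat js"
 using assms at_op(1) unfolding hat_def map_append by (intro S.tensl_append) auto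

lemma hat_single: "i \<in> Col T ==> hat [i] = at i" using at_op(1) by (simp add: hat_def)

lemma at_natural:
 assumes a: "\<alpha> \<in> Ops T"
 shows "at (Tgt T \<alpha>) \<cdot>\<^bsub>str V\<^esub> F.fop \<alpha> = G.fop \<alpha> \<cdot>\<^bsub>str V\<^esub> hat (Src T \<alpha>)"
proof -
 note t = at_op[OF \<phi>.F.S.Tgt_in[OF a]] and s = \<phi>.F.S.Src_in[OF a]
 have c1: "composable (U_ob V) (t_at \<phi> (Tgt T \<alpha>)) [om_op (t_src \<phi>) \<alpha>]"
  using t \<phi>.F.om_op_in[OF a] \<phi>.F.om_Tgt[OF a] by (simp add: composable_def)
 have c2: "composable (U_ob V) (om_op (t_tgt \<phi>) \<alpha>) (map (t_at \<phi>) (Src T \<alpha>))"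
  using at_op s \<phi>.G.om_op_in[OF a] \<phi>.G.om_Src[OF a] by (auto simp: composable_def subset_iff)
 show ?thesis using \<phi>.t_at_natural[OF a] U_Mul(2)[OF c1] U_Mul(2)[OF c2] F.fop_simps(1)[OF a] by (simp add: hat_def comp_def)
qed

text \<open>Naturality at all arrows of \<open>Com T\<close> splits into naturality at operations,
  given by \<open>at_natural\<close>, and naturality along permutations, given by
  \<open>can_blocks\<close>.\<close>

lemma hat_lift:
 assumes x: "com_data T is f \<alpha>s"
 shows "hat (map (Tgt T) \<alpha>s) \<cdot>\<^bsub>str V\<^esub> lift V (t_src \<phi>) is f \<alpha>s = lift V (t_tgt \<phi>) is f \<alpha>s \<cdot>\<^bsub>str V\<^esub> hat is"
proof -
 note x' = F.T.com_data_nth[OF x] and P = F.lift_parts[OF x] and Q = G.lift_parts[OF x]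
 let ?A = "%l. om_col (t_src \<phi>) (is ! l)" and ?B = "%l. om_col (t_tgt \<phi>) (is ! l)" and ?m = "length is"
 define q where "q = concat (map (fibre f) [0..<length \<alpha>s])"
 note P = P[folded q_def] and Q = Q[folded q_def]
 note cA = S.can_simps[OF P(1-3)] and cB = S.can_simps[OF Q(1-3)]
 have col: "is ! l \<in> Col T" if "l < ?m" for l using subsetD[OF x'(6) nth_mem[OF that]] .
 have setq: "set q = {0..<?m}" using mset_eq_setD[OF P(1)] by simp
 have src: "concat (map (Src T) \<alpha>s) = map ((!) is) q"
 proof -
  have "map (Src T) \<alpha>s = map (map ((!) is)) (map (fibre f) [0..<length \<alpha>s])" using x'(3) by (intro nth_equalityI) simp_all
  then show ?thesis by (simp only: map_concat q_def)
 qed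
 let ?TF = "tensl (str V) (map F.fop \<alpha>s)" and ?TG = "tensl (str V) (map G.fop \<alpha>s)"
 have tF: "?TF \<in> Ar (str V)" "fst ?TF = map ?A q" "snd (snd ?TF) = map (om_col (t_src \<phi>)) (map (Tgt T) \<alpha>s)" using P(5-7) .
 have tG: "?TG \<in> Ar (str V)" "fst ?TG = map ?B q" using Q(5,6) .
 note h = hat_simps[OF x'(8)] and hi = hat_simps[OF x'(6)]
 have "set (map ((!) is) q) <= Col T" unfolding set_map setq using col by auto
 note hq = hat_simps[OF this]
 \<comment> \<open>The naturality squares of the single operations, tensored together by
   interchange.\<close>
 have n1: "hat (map (Tgt T) \<alpha>s) \<cdot>\<^bsub>str V\<^esub> ?TF = ?TG \<cdot>\<^bsub>str V\<^esub> hat (map ((!) is) q)"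
 proof -
  have as: "\<alpha> \<in> Ops T" if "\<alpha> \<in> set \<alpha>s" for \<alpha> using that x'(7) by auto
  have "hat (map (Tgt T) \<alpha>s) \<cdot>\<^bsub>str V\<^esub> ?TF = tensl (str V) (map (%\<alpha>. at (Tgt T \<alpha>) \<cdot>\<^bsub>str V\<^esub> F.fop \<alpha>) \<alpha>s)"
   unfolding hat_def map_map comp_def using as F.fop_simps at_op(1,2)[OF \<phi>.F.S.Tgt_in] by (intro S.tensl_comp[symmetric]) (simp del: \<phi>.F.om_Tgt)
  also have "... = tensl (str V) (map (%\<alpha>. G.fop \<alpha> \<cdot>\<^bsub>str V\<^esub> hat (Src T \<alpha>)) \<alpha>s)"
   using as at_natural by (intro arg_cong[where f = "tensl (str V)"] map_cong) auto
  also have "... = ?TG \<cdot>\<^bsub>str V\<^esub> tensl (str V) (map (%\<alpha>. hat (Src T \<alpha>)) \<alpha>s)"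
   using as G.fop_simps hat_simps[OF \<phi>.F.S.Src_in] by (intro S.tensl_comp) (simp del: opar_sel)
  also have "tensl (str V) (map (%\<alpha>. hat (Src T \<alpha>)) \<alpha>s) = hat (concat (map (Src T) \<alpha>s))"
  proof -
   have "at i \<in> Ar (str V)" if "i \<in> Col T" for i using at_op(1)[OF that] by simp
   then have "at ` set (Src T \<alpha>) <= Ar (str V)" if "\<alpha> \<in> set \<alpha>s" for \<alpha>
    using subsetD[OF \<phi>.F.S.Src_in[OF as[OF that]]] by blast
   then have "\<forall>xs \<in> set (map (%\<alpha>. map at (Src T \<alpha>)) \<alpha>s). set xs <= Ar (str V)" by simp
   from S.tensl_concat[OF this] show ?thesis by (simp add: hat_def[abs_def] map_concat comp_def)
  qed
  finally show ?thesis unfolding src .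
 qed
 have single: "concat (map (%k. [k]) ks) = ks" for ks :: "nat list" by (induction ks) auto
 have at_l: "at (is ! l) \<in> Ar (str V) & fst (at (is ! l)) = map ?A [l] & snd (snd (at (is ! l))) = map ?B [l]" if "l < ?m" for l
  using at_op[OF col[OF that]] by simp
 have "distinct q" using mset_eq_imp_distinct_iff[OF P(1)] by simp
 \<comment> \<open>Components are unary, so on both sides every block is a single position.\<close>
 then have n2: "can (str V) ?B [0..<?m] q \<cdot>\<^bsub>str V\<^esub> tensl (str V) (map (%l. at (is ! l)) [0..<?m])
  = tensl (str V) (map (%l. at (is ! l)) q) \<cdot>\<^bsub>str V\<^esub> can (str V) ?A [0..<?m] q"
  using S.can_blocks[where B = "%k. [k]" and B' = "%k. [k]" and A = ?A and A' = ?B and ks = "[0..<?m]" and ls = q and f = "%l. at (is ! l)"] P(1) at_l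
  unfolding single by (simp del: opar_sel)
 have "map (%l. at (is ! l)) [0..<?m] = map at is" by (intro nth_equalityI) simp_all
 then have n3: "can (str V) ?B [0..<?m] q \<cdot>\<^bsub>str V\<^esub> hat is = hat (map ((!) is) q) \<cdot>\<^bsub>str V\<^esub> can (str V) ?A [0..<?m] q"
  using n2 unfolding hat_def by (simp add: comp_def)
 have "hat (map (Tgt T) \<alpha>s) \<cdot>\<^bsub>str V\<^esub> (?TF \<cdot>\<^bsub>str V\<^esub> can (str V) ?A [0..<?m] q) = (hat (map (Tgt T) \<alpha>s) \<cdot>\<^bsub>str V\<^esub> ?TF) \<cdot>\<^bsub>str V\<^esub> can (str V) ?A [0..<?m] q"
  using h tF cA by (intro S.Comp_assoc'[symmetric]) simp_all
 also have "... = ?TG \<cdot>\<^bsub>str V\<^esub> (hat (map ((!) is) q) \<cdot>\<^bsub>str V\<^esub> can (str V) ?A [0..<?m] q)"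
  unfolding n1 using hq tG cA by (intro S.Comp_assoc') (simp_all add: comp_def)
 also have "... = (?TG \<cdot>\<^bsub>str V\<^esub> can (str V) ?B [0..<?m] q) \<cdot>\<^bsub>str V\<^esub> hat is"
  unfolding n3[symmetric] using hi tG cB Q(8) by (intro S.Comp_assoc'[symmetric]) simp_all
 finally show ?thesis unfolding lift_def q_def .
qed

end

lemma U_trans_unit_at:
 assumes T: "operad T" and \<chi>: "monoidal_transformation (Com T) V \<chi>" and i: "i \<in> Col T"
 shows "t_at (ot_hcomp (U_trans \<chi>) (ot_id (com_unit T))) i = Mult [sm_ob (t_src \<chi>) (Seq [i])] (t_at \<chi> (Seq [i]))"
proof -
 interpret T: com_operad T using T by (simp add: com_operad_def univ_operad_def)
 interpret \<chi>: monoidal_transformation "Com T" V \<chi> by (rule \<chi>)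
 interpret h: com_functor T V "t_src \<chi>" by unfold_locales
 have I: "Seq [i] \<in> Ob (Com T)" using i by simp
 have u: "Mult [Seq [i]] (Id (Com T) (Seq [i])) \<in> Ops (U_ob (Com T))" using I T.C.U_Uni by (simp del: Com_simps(5))
 have s: "om_op (U_fun (t_src \<chi>)) (Mult [Seq [i]] (Id (Com T) (Seq [i]))) = Mult [sm_ob (t_src \<chi>) (Seq [i])] (Id V (sm_ob (t_src \<chi>) (Seq [i])))"
  using h.h.U_fun_op(1)[OF u] I \<chi>.F.F0_in[OF I] by (simp del: Com_simps(5))
 have o: "Mult [sm_ob (t_src \<chi>) (Seq [i])] (Id V (sm_ob (t_src \<chi>) (Seq [i]))) \<in> Ops (U_ob V)" using h.h.UW.U_Uni[OF \<chi>.F.F0_in[OF I]] by simp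
 have "t_at (ot_hcomp (U_trans \<chi>) (ot_id (com_unit T))) i = Mul (U_ob V) (Mult [sm_ob (t_src \<chi>) (Seq [i])] (t_at \<chi> (Seq [i]))) [om_op (U_fun (t_src \<chi>)) (Mult [Seq [i]] (Id (Com T) (Seq [i])))]"
  using i I U_trans_at[OF \<chi> I] by (simp add: ot_hcomp_def ot_id_def com_unit_def del: Com_simps(5))
 also have "... = Mult [sm_ob (t_src \<chi>) (Seq [i])] (t_at \<chi> (Seq [i]) \<cdot>\<^bsub>V\<^esub> Id V (sm_ob (t_src \<chi>) (Seq [i])))"
  unfolding s using h.h.UW.U_Mul_unary[OF o, of "t_at \<chi> (Seq [i])"] I \<chi>.F.F0_in[OF I] by simp
 finally show ?thesis using I by simp
qed

text \<open>Compatibility with the iterated constraints determines the component at a word by those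
  at its letters, since the constraints are invertible.\<close>

lemma com_transformation_unique:
 assumes T: "operad T" and \<chi>: "monoidal_transformation (Com T) V \<chi>" "monoidal_transformation (Com T) V \<chi>'"
  and st: "t_src \<chi> = t_src \<chi>'" "t_tgt \<chi> = t_tgt \<chi>'"
  and eq: "ot_hcomp (U_trans \<chi>) (ot_id (com_unit T)) = ot_hcomp (U_trans \<chi>') (ot_id (com_unit T))" shows "\<chi> = \<chi>'"
proof (rule monoidal_transformation_eqI[OF \<chi> st])
 fix A assume "A \<in> Ob (Com T)"
 then obtain "is" where A: "A = Seq is" "set is <= Col T" by (auto simp: Com_Ob)
 interpret T: com_operad T using T by (simp add: com_operad_def univ_operad_def)
 interpret x: monoidal_transformation "Com T" V \<chi> by (rule \<chi>)
 interpret y: monoidal_transformation "Com T" V \<chi>' by (rule \<chi>)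
 let ?h = "t_src \<chi>" and ?S = "letters is"
 have i: "t_at \<chi> (Seq [i]) = t_at \<chi>' (Seq [i])" if "i \<in> Col T" for i
  using U_trans_unit_at[OF T \<chi>(1) that] U_trans_unit_at[OF T \<chi>(2) that] eq by simp
 have S: "set ?S <= Ob (Com T)" using A(2) by (rule T.letters_in)
 have ms: "map (t_at \<chi>) ?S = map (t_at \<chi>') ?S" using i A(2) by auto
 have e: "t_at \<chi> (Seq is) \<cdot>\<^bsub>V\<^esub> mu_list ?h ?S = t_at \<chi>' (Seq is) \<cdot>\<^bsub>V\<^esub> mu_list ?h ?S"
  using x.mu_list_nat[OF S] y.mu_list_nat[OF S] unfolding ms st T.tens_letters by simp
 have O: "Seq is \<in> Ob (Com T)" using A(2) by simp
 note m = x.F.mu_list_simps[OF S, unfolded T.tens_letters]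
 show "t_at \<chi> A = t_at \<chi>' A"
  unfolding A(1) by (rule x.F.W.iso_cancel_right[of "mu_list ?h ?S", OF _ _ _ _ _ e]) (use m x.at_simps[OF O] y.at_simps[OF O] st in simp_all)
qed

text \<open>The operad transformation gives a transformation of the conjugated functors; undoing the
  conjugation by the iterated constraints of \<open>h\<close> and \<open>h'\<close> gives the
  required one.\<close>

lemma com_transformation_exists:
 assumes T: "operad T" and h: "symmetric_strong_monoidal_functor (Com T) V h" "symmetric_strong_monoidal_functor (Com T) V h'"
  and \<phi>: "operad_transformation T (U_ob V) \<phi>" "t_src \<phi> = om_comp (U_fun h) (com_unit T)" "t_tgt \<phi> = om_comp (U_fun h') (com_unit T)"
 shows "\<exists>\<chi>. monoidal_transformation (Com T) V \<chi> & t_src \<chi> = h & t_tgt \<chi> = h' & ot_hcomp (U_trans \<chi>) (ot_id (com_unit T)) = \<phi>"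
proof -
 interpret T: com_operad T using T by (simp add: com_operad_def univ_operad_def)
 interpret h: symmetric_strong_monoidal_functor "Com T" V h by (rule h)
 interpret h': symmetric_strong_monoidal_functor "Com T" V h' by (rule h)
 interpret h: com_functor T V h by unfold_locales
 interpret h': com_functor T V h' by unfold_locales
 interpret op: operad_transformation T "U_ob V" \<phi> by (rule \<phi>)
 interpret \<phi>: univ_transformation T V \<phi> by unfold_locales
 define m where "m is = mu_list h (letters is)" for "is"
 define m' where "m' is = mu_list h' (letters is)" for "is"
 define k where "k is = mid (\<phi>.hat is)" for "is"
 \<comment> \<open>The formula is forced by \<open>mu_list_nat\<close>: a component commutes with
   the iterated constraints \<open>m\<close> of \<open>h\<close> and \<open>m'\<close> of
   \<open>h'\<close>.\<close>
 define \<chi> where "\<chi> = \<lparr>t_src = h, t_tgt = h', t_at = (\<lambda>A \<in> Ob (Com T). m' (seq A) \<cdot>\<^bsub>V\<^esub> (k (seq A) \<cdot>\<^bsub>V\<^esub> Inv V (m (seq A))))\<rparr>"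
 have ob [simp]: "sm_ob h (Seq is) \<in> Ob V" "sm_ob h' (Seq is) \<in> Ob V" if "set is <= Col T" for "is"
  using that by (intro h.F0_in h'.F0_in; simp)+
 let ?s = "%is. tens V (map (sm_ob h) (letters is))" and ?t = "%is. tens V (map (sm_ob h') (letters is))"
 have m [simp]: "m is \<in> Ar V" "Dom V (m is) = ?s is" "Cod V (m is) = sm_ob h (Seq is)" "is_iso V (m is)"
  and m' [simp]: "m' is \<in> Ar V" "Dom V (m' is) = ?t is" "Cod V (m' is) = sm_ob h' (Seq is)" "is_iso V (m' is)" if "set is <= Col T" for "is"
  using h.mu_list_simps[OF T.letters_in[OF that]] h'.mu_list_simps[OF T.letters_in[OF that]] unfolding m_def m'_def T.tens_letters by simp_all
 have k [simp]: "k is \<in> Ar V" "Dom V (k is) = ?s is" "Cod V (k is) = ?t is" if "set is <= Col T" for "is"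
  using \<phi>.hat_simps[OF that] unfolding k_def str_Ar \<phi>(2,3) h.restr_cols[OF that] h'.restr_cols[OF that] by simp_all
 note [simp del] = map_map list.map
 have at: "t_at \<chi> (Seq is) = m' is \<cdot>\<^bsub>V\<^esub> (k is \<cdot>\<^bsub>V\<^esub> Inv V (m is))" if "set is <= Col T" for "is" using that by (simp add: \<chi>_def)
 have st: "t_src \<chi> = h" "t_tgt \<chi> = h'" by (simp_all add: \<chi>_def)
 have \<chi>: "monoidal_transformation (Com T) V \<chi>" proof (intro monoidal_transformation.intro monoidal_transformation_axioms.intro; (unfold st)?)
  show "symmetric_strong_monoidal_functor (Com T) V h" "symmetric_strong_monoidal_functor (Com T) V h'" by (rule h)+
  show "t_at \<chi> \<in> extensional (Ob (Com T))" by (simp add: \<chi>_def)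
 next
  fix A assume "A \<in> Ob (Com T)"
  then show "t_at \<chi> A \<in> Hom V (sm_ob h A) (sm_ob h' A)" by (auto simp: Com_Ob at Hom_iff)
 next
  fix x A B assume "x \<in> Hom (Com T) A B"
  then obtain "is" f \<alpha>s where e: "x = Mor is f \<alpha>s" "A = Seq is" "B = Seq (map (Tgt T) \<alpha>s)" and x: "com_data T is f \<alpha>s"
   by (auto simp: Hom_iff Com_Ar)
  let ?js = "map (Tgt T) \<alpha>s"
  have i [simp]: "set is <= Col T" "set ?js <= Col T" using T.com_data_nth(6,8)[OF x] .
  have [simp]: "Tgt T ` set \<alpha>s <= Col T" using i(2) by simp
  have "Mor is f \<alpha>s \<in> Ar (Com T)" using x by simp
  note [simp] = h.F1_simps[OF this, unfolded Com_simps] h'.F1_simps[OF this, unfolded Com_simps]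
  let ?x = "sm_ar h (Mor is f \<alpha>s)" and ?y = "sm_ar h' (Mor is f \<alpha>s)"
  \<comment> \<open>This is \<open>hat_lift\<close> with both lifts rewritten, by
    \<open>mid_lift_restr\<close>, as conjugates of the arrows of \<open>h\<close> and
    \<open>h'\<close>.\<close>
  have N: "k ?js \<cdot>\<^bsub>V\<^esub> (Inv V (m ?js) \<cdot>\<^bsub>V\<^esub> (?x \<cdot>\<^bsub>V\<^esub> m is)) = (Inv V (m' ?js) \<cdot>\<^bsub>V\<^esub> (?y \<cdot>\<^bsub>V\<^esub> m' is)) \<cdot>\<^bsub>V\<^esub> k is"
   using arg_cong[OF \<phi>.hat_lift[OF x], of mid]
   unfolding \<phi>(2,3) str_simps h.mid_lift_restr[OF x] h'.mid_lift_restr[OF x] m_def[symmetric] m'_def[symmetric] k_def[symmetric] .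
  have "(m' ?js \<cdot>\<^bsub>V\<^esub> (k ?js \<cdot>\<^bsub>V\<^esub> Inv V (m ?js))) \<cdot>\<^bsub>V\<^esub> ?x = m' ?js \<cdot>\<^bsub>V\<^esub> ((k ?js \<cdot>\<^bsub>V\<^esub> (Inv V (m ?js) \<cdot>\<^bsub>V\<^esub> (?x \<cdot>\<^bsub>V\<^esub> m is))) \<cdot>\<^bsub>V\<^esub> Inv V (m is))"
   by simp
  also have "... = ?y \<cdot>\<^bsub>V\<^esub> (m' is \<cdot>\<^bsub>V\<^esub> (k is \<cdot>\<^bsub>V\<^esub> Inv V (m is)))" unfolding N by simp
  finally show "t_at \<chi> B \<cdot>\<^bsub>V\<^esub> sm_ar h x = sm_ar h' x \<cdot>\<^bsub>V\<^esub> t_at \<chi> A" by (simp add: e at)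
 next
  fix A B assume "A \<in> Ob (Com T)" "B \<in> Ob (Com T)"
  then obtain "is" js where e: "A = Seq is" "B = Seq js" and i [simp]: "set is <= Col T" "set js <= Col T" by (auto simp: Com_Ob)
  have ij [simp]: "set (is @ js) <= Col T" by simp
  have O: "Seq is \<in> Ob (Com T)" "Seq js \<in> Ob (Com T)" "Seq (is @ js) \<in> Ob (Com T)" by simp_all
  note S = T.letters_in[OF i(1)] T.letters_in[OF i(2)]
  have app: "app_iso (Com T) (letters is) (letters js) = Id (Com T) (Seq (is @ js))"
   using T.C.app_iso_strict[OF S] T.tens_letters[of "is @ js"] by (simp add: map_append del: Com_simps(5))
  let ?a = "app_iso V (map (sm_ob h) (letters is)) (map (sm_ob h) (letters js))" and ?b = "app_iso V (map (sm_ob h') (letters is)) (map (sm_ob h') (letters js))"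
  note Sh = h.map_ob_in[OF S(1)] h.map_ob_in[OF S(2)] h'.map_ob_in[OF S(1)] h'.map_ob_in[OF S(2)]
  have Sh': "set (map (sm_ob h) (letters is)) <= Ob V" "set (map (sm_ob h) (letters js)) <= Ob V"
   "set (map (sm_ob h') (letters is)) <= Ob V" "set (map (sm_ob h') (letters js)) <= Ob V" using Sh by simp_all
  note [simp] = h.W.app_iso_simps[OF Sh'(1,2)] h.W.app_iso_simps[OF Sh'(3,4)] h.W.tens_in[OF Sh'(1)] h.W.tens_in[OF Sh'(2)] h.W.tens_in[OF Sh'(3)] h.W.tens_in[OF Sh'(4)]
  note [simp] = h.sm_simps(1-4)[OF O(1,2), unfolded Com_simps] h'.sm_simps(1-4)[OF O(1,2), unfolded Com_simps]
  let ?mu = "sm_mu h (Seq is, Seq js)" and ?mu' = "sm_mu h' (Seq is, Seq js)"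
  \<comment> \<open>Three splittings over a concatenation, for the constraints of \<open>h\<close>,
    those of \<open>h'\<close> and the word component \<open>k\<close>. Pasted together they give
    compatibility with \<open>sm_mu\<close>.\<close>
  have 1: "Inv V (m (is @ js)) \<cdot>\<^bsub>V\<^esub> ?mu = ?a \<cdot>\<^bsub>V\<^esub> (Inv V (m is) \<boxtimes>\<^bsub>V\<^esub> Inv V (m js))"
   using h.Inv_mu_list_append[OF S] h.F1_Id[OF O(3)] unfolding app T.tens_letters m_def map_append by (simp del: Com_simps(5))
  have 2: "m' (is @ js) \<cdot>\<^bsub>V\<^esub> ?b = ?mu' \<cdot>\<^bsub>V\<^esub> (m' is \<boxtimes>\<^bsub>V\<^esub> m' js)"
   using h'.mu_list_append[OF S] h'.F1_Id[OF O(3)] m'(1-3)[OF i(1)] m'(1-3)[OF i(2)] unfolding app T.tens_letters m'_def map_append by (simp del: Com_simps(5))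
  have 3: "k (is @ js) \<cdot>\<^bsub>V\<^esub> ?a = ?b \<cdot>\<^bsub>V\<^esub> (k is \<boxtimes>\<^bsub>V\<^esub> k js)"
   using h.W.mid_Tar[OF \<phi>.hat_simps(1)[OF i(1)] \<phi>.hat_simps(1)[OF i(2)]]
   unfolding k_def \<phi>.hat_append[OF i] \<phi>.hat_simps(2,3)[OF i(1)] \<phi>.hat_simps(2,3)[OF i(2)] \<phi>(2,3) h.restr_cols[OF i(1)] h.restr_cols[OF i(2)] h'.restr_cols[OF i(1)] h'.restr_cols[OF i(2)] .
  have d: "?s (is @ js) = tens V (map (sm_ob h) (letters is) @ map (sm_ob h) (letters js))" "?t (is @ js) = tens V (map (sm_ob h') (letters is) @ map (sm_ob h') (letters js))"
   by (simp_all add: map_append)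
  have "(m' (is @ js) \<cdot>\<^bsub>V\<^esub> (k (is @ js) \<cdot>\<^bsub>V\<^esub> Inv V (m (is @ js)))) \<cdot>\<^bsub>V\<^esub> ?mu = m' (is @ js) \<cdot>\<^bsub>V\<^esub> (k (is @ js) \<cdot>\<^bsub>V\<^esub> (Inv V (m (is @ js)) \<cdot>\<^bsub>V\<^esub> ?mu))"
   by simp
  also have "... = m' (is @ js) \<cdot>\<^bsub>V\<^esub> ((k (is @ js) \<cdot>\<^bsub>V\<^esub> ?a) \<cdot>\<^bsub>V\<^esub> (Inv V (m is) \<boxtimes>\<^bsub>V\<^esub> Inv V (m js)))"
   unfolding 1 by (simp add: d)
  also have "... = (m' (is @ js) \<cdot>\<^bsub>V\<^esub> ?b) \<cdot>\<^bsub>V\<^esub> ((k is \<boxtimes>\<^bsub>V\<^esub> k js) \<cdot>\<^bsub>V\<^esub> (Inv V (m is) \<boxtimes>\<^bsub>V\<^esub> Inv V (m js)))"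
   unfolding 3 by (simp add: d)
  also have "... = ?mu' \<cdot>\<^bsub>V\<^esub> ((m' is \<cdot>\<^bsub>V\<^esub> (k is \<cdot>\<^bsub>V\<^esub> Inv V (m is))) \<boxtimes>\<^bsub>V\<^esub> (m' js \<cdot>\<^bsub>V\<^esub> (k js \<cdot>\<^bsub>V\<^esub> Inv V (m js))))"
   unfolding 2 by (simp add: h.W.interchange)
  finally show "t_at \<chi> (A \<otimes>\<^bsub>Com T\<^esub> B) \<cdot>\<^bsub>V\<^esub> sm_mu h (A, B) = sm_mu h' (A, B) \<cdot>\<^bsub>V\<^esub> (t_at \<chi> A \<boxtimes>\<^bsub>V\<^esub> t_at \<chi> B)"
   by (simp add: e at)
 next
  have "k [] = Id V \<one>\<^bsub>V\<^esub>" by (simp add: k_def \<phi>.hat_def list.map)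
  then show "t_at \<chi> \<one>\<^bsub>Com T\<^esub> \<cdot>\<^bsub>V\<^esub> sm_eta h = sm_eta h'"
   using at[of "[]"] h.sm_simps(5-8) h'.sm_simps(5-8) by (simp add: m_def m'_def list.map)
 qed
 have "ot_hcomp (U_trans \<chi>) (ot_id (com_unit T)) = \<phi>"
 proof (rule operad_transformation_eqI[OF ot_hcomp_transformation[OF ot_id_transformation[OF T.com_unit_morphism] U_trans_transformation[OF \<chi>]] \<phi>(1)])
  fix i assume i: "i \<in> Col T"
  \<comment> \<open>On one letter the iterated constraints are identities, so the conjugation
    disappears.\<close>
  have "t_at \<chi> (Seq [i]) = mult_ar (t_at \<phi> i)" using at[of "[i]"] i ob[of "[i]"] k[of "[i]"] \<phi>.hat_single[OF i]
   by (simp add: m_def m'_def k_def list.map h.sm_cod h'.sm_cod)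
  moreover have "t_at \<phi> i = Mult (mult_src (t_at \<phi> i)) (mult_ar (t_at \<phi> i))" using \<phi>.at_op(1)[OF i] by (auto simp: U_ops)
  ultimately show "t_at (ot_hcomp (U_trans \<chi>) (ot_id (com_unit T))) i = t_at \<phi> i"
   using \<phi>.at_op(2)[OF i] unfolding U_trans_unit_at[OF T \<chi> i] st \<phi>(2) h.restr_col[OF i] by simp
 qed (simp_all add: ot_hcomp_def ot_id_def st \<phi>)
 then show ?thesis using \<chi> st by blast
qed

section \<open>The two universal properties of the unit, and the adjunctions\<close>

lemma (in two_functor) precomp_functor:
 assumes "k \<in> Cell1 B" "cod1 B k = F_ob F L" "L \<in> Obj A" "Y \<in> Obj A"
 shows "cat_functor (hom_cat A L Y) (hom_cat B (dom1 B k) (F_ob F Y)) (%h. F_1 F h \<odot>\<^bsub>B\<^esub> k) (%\<chi>. F_2 F \<chi> \<star>\<^bsub>B\<^esub> id2 B k)"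
 using assms B.interchange'[of "id2 B k" _ "id2 B k"] by (intro cat_functor.intro cat_functor_axioms.intro A.hom_category B.hom_category) (auto simp: Hom_iff)

text \<open>Surjectivity on objects is witnessed by \<open>com_ext\<close>; fullness and
  faithfulness are the existence and uniqueness of transformations with given restriction.\<close>

lemma universal_ps:
 assumes T: "operad T" and V: "symmetric_monoidal_category V" shows "equivalence_of_categories (hom_cat SMC_ps (Com T) V) (hom_cat Opd T (F_ob U V))
  (%h. F_1 U h \<odot>\<^bsub>Opd\<^esub> com_unit T) (%\<chi>. F_2 U \<chi> \<star>\<^bsub>Opd\<^esub> id2 Opd (com_unit T))"
proof -
 interpret T: com_operad T using T by (simp add: com_operad_def univ_operad_def)
 interpret U: two_functor SMC_ps Opd U by (rule U_ps)
 have u: "om_dom (com_unit T) = T" "om_cod (com_unit T) = U_ob (Com T)" by (simp_all add: com_unit_def)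
 show ?thesis proof (rule equivalence_of_categoriesI)
  show "cat_functor (hom_cat SMC_ps (Com T) V) (hom_cat Opd T (F_ob U V))
   (%h. F_1 U h \<odot>\<^bsub>Opd\<^esub> com_unit T) (%\<chi>. F_2 U \<chi> \<star>\<^bsub>Opd\<^esub> id2 Opd (com_unit T))"
   using U.precomp_functor[of "com_unit T" "Com T" V] T.com_unit_morphism V T.C.symmetric_monoidal_category_axioms by (simp add: u)
 next
  fix F assume "F \<in> Ob (hom_cat Opd T (F_ob U V))"
  then have F: "operad_morphism T (U_ob V) F" unfolding Opd_hom_simps by simp
  then interpret univ_lift T V F by (simp add: univ_lift_def univ_smcI V)
  show "\<exists>h \<in> Ob (hom_cat SMC_ps (Com T) V). F_1 U h \<odot>\<^bsub>Opd\<^esub> com_unit T = F"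
   unfolding SMC_ps_hom_simps Bex_def using com_ext_functor com_ext_unit by (intro exI[of _ "com_ext V T F"]) simp
 next
  fix h h' \<phi> assume "h \<in> Ob (hom_cat SMC_ps (Com T) V)" "h' \<in> Ob (hom_cat SMC_ps (Com T) V)"
   "\<phi> \<in> Hom (hom_cat Opd T (F_ob U V)) (F_1 U h \<odot>\<^bsub>Opd\<^esub> com_unit T) (F_1 U h' \<odot>\<^bsub>Opd\<^esub> com_unit T)"
  then have h: "symmetric_strong_monoidal_functor (Com T) V h" "symmetric_strong_monoidal_functor (Com T) V h'"
   and \<phi>: "operad_transformation T (U_ob V) \<phi>" "t_src \<phi> = om_comp (U_fun h) (com_unit T)" "t_tgt \<phi> = om_comp (U_fun h') (com_unit T)"
   unfolding Opd_hom_simps SMC_ps_hom_simps by simp_all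
  show "\<exists>!\<chi>. \<chi> \<in> Hom (hom_cat SMC_ps (Com T) V) h h' & F_2 U \<chi> \<star>\<^bsub>Opd\<^esub> id2 Opd (com_unit T) = \<phi>"
   unfolding SMC_ps_hom_simps using com_transformation_exists[OF T h \<phi>] com_transformation_unique[OF T] by (simp, metis)
 qed
qed

text \<open>For strict \<open>V\<close> the extension \<open>com_ext\<close> is itself strict, and
  restriction is injective by \<open>com_functor_determined\<close>. Two-cells between strict
  functors are those of the strong case, so the argument for full faithfulness is the same.\<close>

lemma universal_s:
 assumes T: "operad T" and V: "symmetric_strict_monoidal_category V" shows "isomorphism_of_categories (hom_cat SMC_s (Com T) V) (hom_cat Opd T (F_ob U V))
  (%h. F_1 U h \<odot>\<^bsub>Opd\<^esub> com_unit T) (%\<chi>. F_2 U \<chi> \<star>\<^bsub>Opd\<^esub> id2 Opd (com_unit T))"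
proof -
 interpret T: com_operad T using T by (simp add: com_operad_def univ_operad_def)
 interpret V: symmetric_strict_monoidal_category V by (rule V)
 interpret U: two_functor SMC_s Opd U by (rule U_s)
 have u: "om_dom (com_unit T) = T" "om_cod (com_unit T) = U_ob (Com T)" by (simp_all add: com_unit_def)
 have s: "sm_dom h = Com T & sm_cod h = V" if "symmetric_strict_monoidal_functor (Com T) V h" for h :: "('a univ, 'a univ) sm_functor"
 proof -
  interpret symmetric_strict_monoidal_functor "Com T" V h by (rule that)
  show ?thesis by (simp add: sm_dom sm_cod)
 qed
 have ob: "h \<in> Ob (hom_cat SMC_s (Com T) V) \<longleftrightarrow> symmetric_strict_monoidal_functor (Com T) V h" for h
  using s[of h] T.C.symmetric_strict_monoidal_category_axioms V by auto
 have hom: "\<chi> \<in> Hom (hom_cat SMC_s (Com T) V) h h' \<longleftrightarrow> monoidal_transformation (Com T) V \<chi> & t_src \<chi> = h & t_tgt \<chi> = h'"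
  if "symmetric_strict_monoidal_functor (Com T) V h" "symmetric_strict_monoidal_functor (Com T) V h'" for \<chi> h h'
  using s[OF that(1)] s[OF that(2)] that T.C.symmetric_strict_monoidal_category_axioms V by (auto simp: Hom_iff)
 show ?thesis proof (rule isomorphism_of_categoriesI)
  show "cat_functor (hom_cat SMC_s (Com T) V) (hom_cat Opd T (F_ob U V))
   (%h. F_1 U h \<odot>\<^bsub>Opd\<^esub> com_unit T) (%\<chi>. F_2 U \<chi> \<star>\<^bsub>Opd\<^esub> id2 Opd (com_unit T))"
   using U.precomp_functor[of "com_unit T" "Com T" V] T.com_unit_morphism V T.C.symmetric_strict_monoidal_category_axioms by (simp add: u)
 next
  fix F assume "F \<in> Ob (hom_cat Opd T (F_ob U V))"
  then have F: "operad_morphism T (U_ob V) F" unfolding Opd_hom_simps by simp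
  then interpret univ_lift T V F by (simp add: univ_lift_def univ_smcI V.symmetric_monoidal_category_axioms)
  show "\<exists>h \<in> Ob (hom_cat SMC_s (Com T) V). F_1 U h \<odot>\<^bsub>Opd\<^esub> com_unit T = F"
   unfolding ob Bex_def using com_ext_strict[OF V] com_ext_unit by (intro exI[of _ "com_ext V T F"]) simp
 next
  fix h h' assume "h \<in> Ob (hom_cat SMC_s (Com T) V)" "h' \<in> Ob (hom_cat SMC_s (Com T) V)" "F_1 U h \<odot>\<^bsub>Opd\<^esub> com_unit T = F_1 U h' \<odot>\<^bsub>Opd\<^esub> com_unit T"
  then show "h = h'" unfolding ob using com_functor_determined[OF T] by simp
 next
  fix h h' \<phi> assume h0: "h \<in> Ob (hom_cat SMC_s (Com T) V)" "h' \<in> Ob (hom_cat SMC_s (Com T) V)"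
   and "\<phi> \<in> Hom (hom_cat Opd T (F_ob U V)) (F_1 U h \<odot>\<^bsub>Opd\<^esub> com_unit T) (F_1 U h' \<odot>\<^bsub>Opd\<^esub> com_unit T)"
  then have \<phi>: "operad_transformation T (U_ob V) \<phi>" "t_src \<phi> = om_comp (U_fun h) (com_unit T)" "t_tgt \<phi> = om_comp (U_fun h') (com_unit T)"
   unfolding Opd_hom_simps by simp_all
  note hs = h0[unfolded ob]
  note h = hs[THEN symmetric_strict_monoidal_functor.axioms(1)]
  show "\<exists>!\<chi>. \<chi> \<in> Hom (hom_cat SMC_s (Com T) V) h h' & F_2 U \<chi> \<star>\<^bsub>Opd\<^esub> id2 Opd (com_unit T) = \<phi>"
   unfolding hom[OF hs] using com_transformation_exists[OF T h \<phi>] com_transformation_unique[OF T] by (simp, metis)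
 qed
qed

lemma Com_universal_arrows: "universal_arrows Opd SMC_s U Com com_unit" proof (intro universal_arrows.intro universal_arrows_axioms.intro U_s)
 fix T :: "('a univ, 'a univ) operad" assume "T \<in> Obj Opd"
 then have T: "operad T" by simp
 interpret T: com_operad T using T by (simp add: com_operad_def univ_operad_def)
 show "Com T \<in> Obj SMC_s" using T.C.symmetric_strict_monoidal_category_axioms by simp
 show "com_unit T \<in> Ob (hom_cat Opd T (F_ob U (Com T)))" unfolding Opd_hom_simps using T.com_unit_morphism by simp
 fix V :: "('a univ, 'a univ) smcat" assume "V \<in> Obj SMC_s"
 then show "isomorphism_of_categories (hom_cat SMC_s (Com T) V) (hom_cat Opd T (F_ob U V))
  (%h. F_1 U h \<odot>\<^bsub>Opd\<^esub> com_unit T) (%\<chi>. F_2 U \<chi> \<star>\<^bsub>Opd\<^esub> id2 Opd (com_unit T))"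
  using universal_s[OF T] by simp
qed

theorem corollary6p4p7:
  shows "object_part_of_left_2_adjoint
           (Opd :: (('u univ, 'u univ) operad, ('u univ, 'u univ) operad_morphism,
                    ('u univ, 'u univ) operad_transformation) twocat)
           SMC_s U Com
       \<and> object_part_of_left_biadjoint
           (Opd :: (('u univ, 'u univ) operad, ('u univ, 'u univ) operad_morphism,
                    ('u univ, 'u univ) operad_transformation) twocat)
           SMC_ps U Com"
proof -
  interpret universal_arrows Opd SMC_s U Com com_unit by (rule Com_universal_arrows)
  have 1: "object_part_of_left_2_adjoint Opd SMC_s U Com"
    unfolding object_part_of_left_2_adjoint_def
    by (rule exI, rule exI, rule exI, rule conjI, rule two_adjunction) simp
  have sub: "Obj SMC_s \<subseteq> Obj SMC_ps" "Cell1 SMC_s \<subseteq> Cell1 SMC_ps" "Cell2 SMC_s \<subseteq> Cell2 SMC_ps"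
    using sub_two_category.sub[OF SMC_s_sub] sub_two_category.full[OF SMC_s_sub] by auto
  \<comment> \<open>The strict 2-category lies in \<open>SMC_ps\<close> with the same operations,
    and there the units have the weaker universal property.\<close>
  note b = biadjunction[OF U_ps sub sub_two_category.ops[OF SMC_s_sub, symmetric] universal_ps]
  have "object_part_of_left_biadjoint Opd SMC_ps U Com"
    unfolding object_part_of_left_biadjoint_def
  proof (rule exI, rule exI, rule exI, rule conjI, rule b(1))
    show "\<forall>X \<in> Obj Opd. F_ob (two_functor.extend left_adjoint (pseudofunctor.fields
      (\<lambda>g f. id2 SMC_ps (ext1 (g \<odot>\<^bsub>Opd\<^esub> f))) (\<lambda>X. id2 SMC_ps (ext1 (id1 Opd X))))) X = Com X"
      by (simp add: two_functor.defs)
  qed simp_all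
  with 1 show ?thesis by blast
qed

end
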